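(* For every constant $K>0$ there is a constant $C_K>0$ depending only on $K$ such that the following holds. Let $X=Z_0+\sum_{i=1}^n Z_i$ be a $d\times d$ self-adjoint random matrix as in the context, with associated Gaussian model $G$, and suppose that $\bar R(X)(\log d)^{\frac53}\le K\sigma(X)$. Then for every $z\in\mathbb{C}$ with $\mathrm{Im}\,z>0$, $$\big\|\mathbf{E}[(z\mathbf{1}-X)^{-1}]-\mathbf{E}[(z\mathbf{1}-G)^{-1}]\big\|\le C_K\,\frac{\sigma_*(X)+\bar R(X)^{\frac1{10}}\sigma(X)^{\frac9{10}}}{(\mathrm{Im}\,z)^2},$$ and for every $\varphi\in W^{3,1}(\mathbb{R})$, $$\big\|\mathbf{E}[\varphi(X)]-\mathbf{E}[\varphi(G)]\big\|\le C_K\big(\sigma_*(X)+\bar R(X)^{\frac1{10}}\sigma(X)^{\frac9{10}}\big)\|\varphi\|_{W^{3,1}(\mathbb{R})}.$$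
   Context: Model: $d\ge 2$, $n\in\mathbb{N}$; $Z_0$ is a deterministic self-adjoint $d\times d$ complex matrix; $Z_1,\dots,Z_n$ are independent self-adjoint $d\times d$ random matrices with complex entries (with finite second moments, not necessarily bounded) and $\mathbf{E}[Z_i]=0$; $X:=Z_0+\sum_{i=1}^n Z_i$. $\mathrm{Cov}(X)$ is the $d^2\times d^2$ matrix $\mathrm{Cov}(X)_{ij,kl}=\mathbf{E}[(X-\mathbf{E}X)_{ij}\overline{(X-\mathbf{E}X)_{kl}}]$. The Gaussian model $G$ is the $d\times d$ self-adjoint random matrix such that $\{\mathrm{Re}\,G_{ij},\mathrm{Im}\,G_{ij}\}_{i,j}$ are jointly Gaussian, $\mathbf{E}[G]=\mathbf{E}[X]$ and $\mathrm{Cov}(G)=\mathrm{Cov}(X)$. Notation: $\|\cdot\|$ is the operator norm of a matrix (Euclidean norm of a vector), $\mathbf{1}$ the identity matrix; $\sigma(X):=\|\mathbf{E}[(X-\mathbf{E}X)^2]\|^{1/2}$; $\sigma_*(X):=\sup_{\|v\|=\|w\|=1}\mathbf{E}[|\langle v,(X-\mathbf{E}X)w\rangle|^2]^{1/2}$; $\bar R(X):=\mathbf{E}[\max_{1\le i\le n}\|Z_i\|^2]^{1/2}$. $W^{k,1}(\mathbb{R})$ is the Sobolev space of functions $f:\mathbb{R}\to\mathbb{C}$ with $\|f\|_{W^{k,1}(\mathbb{R})}:=\sum_{i=0}^k\int_{-\infty}^\infty|f^{(i)}(x)|\,dx<\infty$. $\varphi(X)$ is defined by functional calculus. *)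

theory Defs
  imports
    "HOL-Probability.Probability"
    "Jordan_Normal_Form.Gauss_Jordan_Elimination"
    "Jordan_Normal_Form.Schur_Decomposition"
begin

section \<open>Matrices\<close>

definition self_adjoint :: "nat \<Rightarrow> complex mat \<Rightarrow> bool" where
  "self_adjoint d A \<longleftrightarrow> A \<in> carrier_mat d d \<and> mat_adjoint A = A"

definition euclid_norm :: "complex Matrix.vec \<Rightarrow> real" where
  "euclid_norm v = sqrt (Re (v \<bullet>c v))"

definition unit_vecs :: "nat \<Rightarrow> complex Matrix.vec set" where
  "unit_vecs d = {v \<in> carrier_vec d. euclid_norm v = 1}"

definition op_norm :: "complex mat \<Rightarrow> real" where
  "op_norm A = (SUP v\<in>unit_vecs (dim_col A). euclid_norm (A *\<^sub>v v))"

definition resolvent :: "nat \<Rightarrow> complex \<Rightarrow> complex mat \<Rightarrow> complex mat" where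
  "resolvent d z A = the (mat_inverse (z \<cdot>\<^sub>m 1\<^sub>m d - A))"

text \<open>Functional calculus for a self-adjoint \<open>A\<close>: if \<open>A = U diag(l) U*\<close> with \<open>U\<close> unitary and
  \<open>l\<close> real, then \<open>\<phi>(A) = U diag(\<phi> \<circ> l) U*\<close>, which does not depend on the diagonalization.\<close>

definition fun_calc :: "nat \<Rightarrow> (real \<Rightarrow> complex) \<Rightarrow> complex mat \<Rightarrow> complex mat" where
  "fun_calc d \<phi> A = (THE B. \<exists>U l. U \<in> carrier_mat d d
      \<and> U * mat_adjoint U = 1\<^sub>m d \<and> mat_adjoint U * U = 1\<^sub>m d
      \<and> A = U * mat_diag d (\<lambda>i. complex_of_real (l i)) * mat_adjoint U
      \<and> B = U * mat_diag d (\<lambda>i. \<phi> (l i)) * mat_adjoint U)"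

section \<open>Random matrices\<close>

text \<open>The Borel sigma-algebra on \<open>d \<times> d\<close> matrices, generated by the entries.\<close>

definition mat_borel :: "nat \<Rightarrow> complex mat measure" where
  "mat_borel d = vimage_algebra (carrier_mat d d)
     (\<lambda>A. \<lambda>ij\<in>{..<d} \<times> {..<d}. A $$ ij) (Pi\<^sub>M ({..<d} \<times> {..<d}) (\<lambda>_. borel))"

definition mat_expectation :: "nat \<Rightarrow> 'a measure \<Rightarrow> ('a \<Rightarrow> complex mat) \<Rightarrow> complex mat" where
  "mat_expectation d M X = Matrix.mat d d (\<lambda>jk. \<integral>\<omega>. X \<omega> $$ jk \<partial>M)"

definition centered :: "nat \<Rightarrow> 'a measure \<Rightarrow> ('a \<Rightarrow> complex mat) \<Rightarrow> 'a \<Rightarrow> complex mat" where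
  "centered d M X \<omega> = X \<omega> - mat_expectation d M X"

definition mat_cov ::
    "nat \<Rightarrow> 'a measure \<Rightarrow> ('a \<Rightarrow> complex mat) \<Rightarrow> nat \<times> nat \<Rightarrow> nat \<times> nat \<Rightarrow> complex" where
  "mat_cov d M X ij kl = (\<integral>\<omega>. centered d M X \<omega> $$ ij * cnj (centered d M X \<omega> $$ kl) \<partial>M)"

definition sigma_std :: "nat \<Rightarrow> 'a measure \<Rightarrow> ('a \<Rightarrow> complex mat) \<Rightarrow> real" where
  "sigma_std d M X =
     sqrt (op_norm (mat_expectation d M (\<lambda>\<omega>. centered d M X \<omega> * centered d M X \<omega>)))"

definition sigma_star :: "nat \<Rightarrow> 'a measure \<Rightarrow> ('a \<Rightarrow> complex mat) \<Rightarrow> real" where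
  "sigma_star d M X = (SUP (v, w)\<in>unit_vecs d \<times> unit_vecs d.
     sqrt (\<integral>\<omega>. (cmod ((centered d M X \<omega> *\<^sub>v w) \<bullet>c v))\<^sup>2 \<partial>M))"

text \<open>Inserting \<open>0\<close> only matters for \<open>n = 0\<close>, where the maximum would be over the empty set.\<close>

definition R_bar :: "nat \<Rightarrow> 'a measure \<Rightarrow> (nat \<Rightarrow> 'a \<Rightarrow> complex mat) \<Rightarrow> real" where
  "R_bar n M Z = sqrt (\<integral>\<omega>. (Max (insert 0 ((\<lambda>i. op_norm (Z i \<omega>)) ` {1..n})))\<^sup>2 \<partial>M)"

definition summand_model ::
    "nat \<Rightarrow> nat \<Rightarrow> 'a measure \<Rightarrow> complex mat \<Rightarrow> (nat \<Rightarrow> 'a \<Rightarrow> complex mat) \<Rightarrow> bool" where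
  "summand_model d n M Z0 Z \<longleftrightarrow>
     prob_space M \<and> self_adjoint d Z0
     \<and> prob_space.indep_vars M (\<lambda>_. mat_borel d) Z {1..n}
     \<and> (\<forall>i\<in>{1..n}. (\<forall>\<omega>\<in>space M. self_adjoint d (Z i \<omega>))
          \<and> (\<forall>j<d. \<forall>k<d. integrable M (\<lambda>\<omega>. (cmod (Z i \<omega> $$ (j, k)))\<^sup>2))
          \<and> mat_expectation d M (Z i) = 0\<^sub>m d d)"

definition rand_sum ::
    "nat \<Rightarrow> nat \<Rightarrow> complex mat \<Rightarrow> (nat \<Rightarrow> 'a \<Rightarrow> complex mat) \<Rightarrow> 'a \<Rightarrow> complex mat" where
  "rand_sum d n Z0 Z \<omega> = Matrix.mat d d (\<lambda>jk. Z0 $$ jk + (\<Sum>i=1..n. Z i \<omega> $$ jk))"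

text \<open>Possibly degenerate real Gaussians: \<open>normal_density\<close> only covers positive variance.\<close>

definition gaussian_rv :: "'b measure \<Rightarrow> ('b \<Rightarrow> real) \<Rightarrow> bool" where
  "gaussian_rv N Y \<longleftrightarrow> Y \<in> borel_measurable N \<and>
     ((\<exists>\<mu> s. 0 < s \<and> distributed N lborel Y (\<lambda>x. ennreal (normal_density \<mu> s x)))
      \<or> (\<exists>\<mu>. AE \<omega> in N. Y \<omega> = \<mu>))"

text \<open>Joint Gaussianity of the real and imaginary parts of the entries: every real linear
  combination of them is Gaussian.\<close>

definition jointly_gaussian_entries :: "nat \<Rightarrow> 'b measure \<Rightarrow> ('b \<Rightarrow> complex mat) \<Rightarrow> bool" where
  "jointly_gaussian_entries d N G \<longleftrightarrow> (\<forall>a b :: nat \<Rightarrow> nat \<Rightarrow> real.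
     gaussian_rv N (\<lambda>\<omega>. \<Sum>j<d. \<Sum>k<d. a j k * Re (G \<omega> $$ (j, k)) + b j k * Im (G \<omega> $$ (j, k))))"

text \<open>\<open>G\<close> may live on a probability space of its own, since only its law matters.\<close>

definition gaussian_model ::
    "nat \<Rightarrow> 'a measure \<Rightarrow> ('a \<Rightarrow> complex mat) \<Rightarrow> 'b measure \<Rightarrow> ('b \<Rightarrow> complex mat) \<Rightarrow> bool" where
  "gaussian_model d M X N G \<longleftrightarrow>
     prob_space N \<and> G \<in> N \<rightarrow>\<^sub>M mat_borel d \<and> (\<forall>\<omega>\<in>space N. self_adjoint d (G \<omega>))
     \<and> jointly_gaussian_entries d N G
     \<and> mat_expectation d N G = mat_expectation d M X
     \<and> (\<forall>i<d. \<forall>j<d. \<forall>k<d. \<forall>l<d. mat_cov d N G (i, j) (k, l) = mat_cov d M X (i, j) (k, l))"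

section \<open>Sobolev spaces\<close>

definition test_function :: "(real \<Rightarrow> real) \<Rightarrow> bool" where
  "test_function \<psi> \<longleftrightarrow> (\<forall>k. (deriv ^^ k) \<psi> differentiable_on UNIV) \<and> (\<exists>R. \<forall>x. \<bar>x\<bar> > R \<longrightarrow> \<psi> x = 0)"

definition is_weak_deriv :: "nat \<Rightarrow> (real \<Rightarrow> complex) \<Rightarrow> (real \<Rightarrow> complex) \<Rightarrow> bool" where
  "is_weak_deriv k f g \<longleftrightarrow> integrable lborel g \<and> (\<forall>\<psi>. test_function \<psi> \<longrightarrow>
     (\<integral>x. complex_of_real ((deriv ^^ k) \<psi> x) * f x \<partial>lborel)
       = (-1) ^ k * (\<integral>x. complex_of_real (\<psi> x) * g x \<partial>lborel))"

definition sobolev_W1 :: "nat \<Rightarrow> (real \<Rightarrow> complex) set" where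
  "sobolev_W1 k = {f. integrable lborel f \<and> (\<forall>i\<le>k. \<exists>g. is_weak_deriv i f g)}"

text \<open>Weak derivatives are unique almost everywhere, so the choice does not affect the norm.\<close>

definition sobolev_norm :: "nat \<Rightarrow> (real \<Rightarrow> complex) \<Rightarrow> real" where
  "sobolev_norm k f = (\<Sum>i\<le>k. \<integral>x. cmod ((SOME g. is_weak_deriv i f g) x) \<partial>lborel)"

section \<open>The bounds with a given constant\<close>

text \<open>\<open>universality_bounds TYPE('a) TYPE('b) K C\<close> says that both bounds hold with the constant \<open>C\<close>
  for all dimensions, numbers of summands and models, with \<open>Z\<^sub>1, \<dots>, Z\<^sub>n\<close> defined on a probability
  space over the type \<open>'a\<close> and \<open>G\<close> on one over \<open>'b\<close>. The elements of the Sobolev space are classes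
  of functions modulo null sets; \<open>\<phi>(X)\<close> refers to the continuous representative.\<close>

definition universality_bounds :: "'a itself \<Rightarrow> 'b itself \<Rightarrow> real \<Rightarrow> real \<Rightarrow> bool" where
  "universality_bounds TA TB K C \<longleftrightarrow>
    (\<forall>d n (M :: 'a measure) Z0 Z (N :: 'b measure) G.
      let X = rand_sum d n Z0 Z;
          \<epsilon> = sigma_star d M X + R_bar n M Z powr (1/10) * sigma_std d M X powr (9/10)
      in 2 \<le> d \<longrightarrow> summand_model d n M Z0 Z \<longrightarrow> gaussian_model d M X N G \<longrightarrow>
         R_bar n M Z * ln (real d) powr (5/3) \<le> K * sigma_std d M X \<longrightarrow>
           (\<forall>z. 0 < Im z \<longrightarrow>
              op_norm (mat_expectation d M (\<lambda>\<omega>. resolvent d z (X \<omega>))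
                       - mat_expectation d N (\<lambda>\<omega>. resolvent d z (G \<omega>)))
                \<le> C * (\<epsilon> / (Im z)\<^sup>2))
         \<and> (\<forall>\<phi>\<in>sobolev_W1 3. continuous_on UNIV \<phi> \<longrightarrow>
              op_norm (mat_expectation d M (\<lambda>\<omega>. fun_calc d \<phi> (X \<omega>))
                       - mat_expectation d N (\<lambda>\<omega>. fun_calc d \<phi> (G \<omega>)))
                \<le> C * \<epsilon> * sobolev_norm 3 \<phi>))"

end

theory Submission
  imports
    Defs
    "HOL-Complex_Analysis.Complex_Analysis"
    "HOL-Real_Asymp.Real_Asymp"
begin

text \<open>Write \<open>Y = X - Z\<^sub>0\<close>, \<open>W = G - Z\<^sub>0\<close>, \<open>y = Im z\<close>, \<open>R\<close> for the mean square of the largest summand, and interpolate by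
  \<open>X\<^sub>\<theta> = Z\<^sub>0 + sin \<theta> Y + cos \<theta> W\<close> on the product of the two sample spaces. The derivative in \<open>\<theta>\<close> of
  \<open>E \<langle>(z - X\<^sub>\<theta>)\<inverse> w, v\<rangle>\<close> consists of a term linear in \<open>Y\<close> and one linear in \<open>W\<close>. Gaussian integration by parts turns the
  second into an expression that only involves the covariance. For the first, expanding in each summand \<open>Z\<^sub>i\<close> gives the same
  expression, as the covariances agree, up to an error that is at most a constant times \<open>R \<sigma>\<^sup>2 / y\<^sup>4 + R\<^sup>2 / y\<^sup>3\<close> if
  \<open>2 R \<le> y\<close>: the factor \<open>\<parallel>Z\<^sub>i\<parallel>\<close> of the error term is bounded by \<open>2 R\<close> except on a set where \<open>Z\<^sub>i\<close> is essentially the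
  largest summand, and there the second moments of all summands add up to at most \<open>2 R\<^sup>2\<close>. Together with the trivial bounds
  \<open>2 / y\<close> and \<open>2 \<sigma> / y\<^sup>2\<close> this yields \<open>96 R\<^bsup>1/10\<^esup> \<sigma>\<^bsup>9/10\<^esup> / y\<^sup>2\<close>.

  A function \<open>\<phi>\<close> of \<open>X\<close> is the limit of its Poisson integrals, so that \<open>E \<phi>(X) - E \<phi>(G)\<close> is a limit of integrals of \<open>\<phi>\<close> against
  a holomorphic function of size \<open>y\<^bsup>-2\<^esup>\<close> along horizontal lines. Three derivatives of this function in the vertical direction
  can be moved to \<open>\<phi>\<close>, and integrating \<open>y\<^bsup>-2\<^esup>\<close> three times down from the line \<open>Im = 1\<close> leaves a bounded quantity.\<close>

section \<open>Uniqueness of joint characteristic functions\<close>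

text \<open>The remainder is therefore kept as one operator norm times the norms of
  \<open>Z i\<close> applied to two resolvent vectors. If these vectors are independent of
  \<open>Z i\<close>, the mean squares add up to at most \<sigma>^2 / y^2; this is why resolvents
  without \<open>Z i\<close> and independent copies of \<open>Z i\<close> appear. With \<theta> as
  an angle, the two second-order contributions are 2 sin \<theta> cos \<theta> times the same
  number, with opposite signs. The scale \<tau> = R^(1/10) \<sigma>^(9/10) separates the bounds: 2 /
  y settles y \<le> 2 \<tau>, 2 \<sigma> / y^2 settles \<sigma> \<le> R, and otherwise 2 R \<le> y
  and R \<sigma>^2 \<le> \<tau>^3. Joint Gaussianity is given by linear combinations, possibly
  degenerate, so in general there is no density to integrate by parts with. The formula comes from
  the rotation invariance of two independent copies, which rests on the uniqueness of joint
  characteristic functions.\<close>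

lemma weighted_char_uniqueness:
  fixes X1 :: "'a \<Rightarrow> real" and X2 :: "'b \<Rightarrow> real" and w1 :: "'a \<Rightarrow> real" and w2 :: "'b \<Rightarrow> real"
  assumes "finite_measure M1" "finite_measure M2"
    and [measurable]: "X1 \<in> borel_measurable M1" "X2 \<in> borel_measurable M2"
    and i: "integrable M1 w1" "integrable M2 w2"
    and nn: "\<And>x. 0 \<le> w1 x" "\<And>x. 0 \<le> w2 x"
    and eq: "\<And>s. (\<integral>x. w1 x * iexp (s * X1 x) \<partial>M1) = (\<integral>x. w2 x * iexp (s * X2 x) \<partial>M2)"
    and B: "B \<in> sets borel"
  shows "(\<integral>x. w1 x * indicator B (X1 x) \<partial>M1) = (\<integral>x. w2 x * indicator B (X2 x) \<partial>M2)"
proof -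
  interpret M1: finite_measure M1 by fact
  interpret M2: finite_measure M2 by fact
  have [measurable]: "w1 \<in> borel_measurable M1" "w2 \<in> borel_measurable M2" using i by auto
  have [measurable]: "B \<in> sets borel" by fact
  define c where "c = (\<integral>x. w1 x \<partial>M1)"
  have c2: "c = (\<integral>x. w2 x \<partial>M2)"
    using eq[of 0] unfolding c_def by (simp add: complex_eq_iff)
  have c0: "0 \<le> c" unfolding c_def using nn by simp
  show ?thesis
  proof (cases "c = 0")
    case True
    have "AE x in M1. w1 x = 0" using True i nn by (simp add: c_def integral_nonneg_eq_0_iff_AE)
    then have 1: "(\<integral>x. w1 x * indicator B (X1 x) \<partial>M1) = 0" by (intro integral_eq_zero_AE) auto
    have "AE x in M2. w2 x = 0" using True i nn by (simp add: c2 integral_nonneg_eq_0_iff_AE)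
    then have 2: "(\<integral>x. w2 x * indicator B (X2 x) \<partial>M2) = 0" by (intro integral_eq_zero_AE) auto
    show ?thesis using 1 2 by simp
  next
    case False
    with c0 have c: "c > 0" by simp
    \<comment> \<open>Reweighting by \<open>w / c\<close> turns the weighted integrals into
      expectations under a probability measure, so that \<open>eq\<close> becomes the equality of
      two characteristic functions and Levy's theorem applies.\<close>
    have gen: "real_distribution (distr (density M (\<lambda>x. ennreal (w x / c))) borel X)
        \<and> (\<forall>t. char (distr (density M (\<lambda>x. ennreal (w x / c))) borel X) t = (\<integral>x. w x * iexp (t * X x) \<partial>M) / c)
        \<and> measure (distr (density M (\<lambda>x. ennreal (w x / c))) borel X) B = (\<integral>x. w x * indicator B (X x) \<partial>M) / c"
      if [measurable]: "X \<in> borel_measurable M" and iw: "integrable M w" and nw: "\<And>x. 0 \<le> w x"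
        and cw: "c = (\<integral>x. w x \<partial>M)" for M :: "'c measure" and w X
    proof -
      let ?D = "density M (\<lambda>x. ennreal (w x / c))"
      have [measurable]: "w \<in> borel_measurable M" using iw by auto
      have p: "prob_space ?D"
      proof
        have "emeasure ?D (space ?D) = (\<integral>\<^sup>+x. ennreal (w x / c) \<partial>M)"
          by (auto simp: emeasure_density intro!: nn_integral_cong)
        also have "\<dots> = ennreal (\<integral>x. w x / c \<partial>M)" using iw nw c by (intro nn_integral_eq_integral) auto
        also have "\<dots> = 1" using cw c by simp
        finally show "emeasure ?D (space ?D) = 1" .
      qed
      interpret D: prob_space ?D by fact
      have 1: "real_distribution (distr ?D borel X)"
        by (intro D.real_distribution_distr) auto
      have 2: "char (distr ?D borel X) t = (\<integral>x. w x * iexp (t * X x) \<partial>M) / c" for t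
      proof -
        have "char (distr ?D borel X) t = (\<integral>x. iexp (t * X x) \<partial>?D)"
          unfolding char_def by (subst integral_distr) auto
        also have "\<dots> = (\<integral>x. (w x / c) *\<^sub>R iexp (t * X x) \<partial>M)"
          using nw c by (subst integral_density) auto
        also have "\<dots> = (\<integral>x. w x * iexp (t * X x) / c \<partial>M)"
          by (intro Bochner_Integration.integral_cong) (auto simp: scaleR_conv_of_real)
        finally show ?thesis by simp
      qed
      have "measure (distr ?D borel X) B = (\<integral>x. indicator B (X x) \<partial>?D)"
      proof -
        interpret DD: real_distribution "distr ?D borel X" by fact
        have "measure (distr ?D borel X) B = (\<integral>x. indicator B x \<partial>distr ?D borel X)" by simp
        also have "\<dots> = (\<integral>x. indicator B (X x) \<partial>?D)" by (subst integral_distr) auto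
        finally show ?thesis .
      qed
      also have "\<dots> = (\<integral>x. (w x / c) * indicator B (X x) \<partial>M)"
        using nw c by (subst integral_density) auto
      also have "\<dots> = (\<integral>x. w x * indicator B (X x) / c \<partial>M)" by simp
      finally show ?thesis using 1 2 by simp
    qed
    note g1 = gen[OF assms(3) i(1) nn(1) c_def] and g2 = gen[OF assms(4) i(2) nn(2) c2]
    have "distr (density M1 (\<lambda>x. ennreal (w1 x / c))) borel X1 = distr (density M2 (\<lambda>x. ennreal (w2 x / c))) borel X2"
      using g1 g2 eq by (intro Levy_uniqueness) auto
    then show ?thesis using g1 g2 c by simp
  qed
qed

text \<open>Induction over the coordinates, where the indicator of the coordinate just treated is
  absorbed into the weight; this is why weights are carried along. To continue, the transforms of
  the remaining coordinates have to agree under the new weight. The one-variable result takes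
  nonnegative weights, so it is applied with \<open>1 + cos\<close> and \<open>1 + sin\<close> of
  the remaining linear form, and the constant is subtracted afterwards.\<close>

lemma joint_char_uniqueness_aux:
  fixes X1 :: "'i \<Rightarrow> 'a \<Rightarrow> real" and X2 :: "'i \<Rightarrow> 'b \<Rightarrow> real"
  assumes M: "finite_measure M1" "finite_measure M2"
    and fin: "finite J"
    and m1: "\<And>j. j \<in> J \<Longrightarrow> X1 j \<in> borel_measurable M1"
    and m2: "\<And>j. j \<in> J \<Longrightarrow> X2 j \<in> borel_measurable M2"
    and i: "integrable M1 w1" "integrable M2 w2"
    and nn: "\<And>x. 0 \<le> (w1 x :: real)" "\<And>x. 0 \<le> (w2 x :: real)"
    and eq: "\<And>a. (\<integral>x. w1 x * iexp (\<Sum>j\<in>J. a j * X1 j x) \<partial>M1) = (\<integral>x. w2 x * iexp (\<Sum>j\<in>J. a j * X2 j x) \<partial>M2)"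
    and B: "\<And>j. j \<in> J \<Longrightarrow> B j \<in> sets borel"
  shows "(\<integral>x. w1 x * (\<Prod>j\<in>J. indicator (B j) (X1 j x)) \<partial>M1) = (\<integral>x. w2 x * (\<Prod>j\<in>J. indicator (B j) (X2 j x)) \<partial>M2)"
  using fin m1 m2 i nn eq B
proof (induction J arbitrary: w1 w2 rule: finite_induct)
  case empty
  then show ?case by (simp add: complex_eq_iff)
next
  case (insert j J)
  interpret M1: finite_measure M1 by fact
  interpret M2: finite_measure M2 by fact
  have [measurable]: "w1 \<in> borel_measurable M1" "w2 \<in> borel_measurable M2" using insert.prems(3,4) by auto
  have m1[measurable]: "X1 j \<in> borel_measurable M1" "\<And>k. k \<in> J \<Longrightarrow> X1 k \<in> borel_measurable M1" using insert.prems by auto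
  have m2[measurable]: "X2 j \<in> borel_measurable M2" "\<And>k. k \<in> J \<Longrightarrow> X2 k \<in> borel_measurable M2" using insert.prems by auto
  have B[measurable]: "B j \<in> sets borel" using insert.prems by auto
  note i = insert.prems(3,4) and nn = insert.prems(5,6)
  \<comment> \<open>The frequency vector is s at the coordinate split off and a elsewhere.\<close>
  have key: "(\<integral>x. w1 x * iexp (s * X1 j x + (\<Sum>k\<in>J. a k * X1 k x)) \<partial>M1) = (\<integral>x. w2 x * iexp (s * X2 j x + (\<Sum>k\<in>J. a k * X2 k x)) \<partial>M2)" for s a
  proof -
    have "(\<Sum>k\<in>insert j J. (a(j := s)) k * Y k) = s * Y j + (\<Sum>k\<in>J. a k * Y k)" for Y :: "'i \<Rightarrow> real"
      using insert.hyps by (auto intro!: sum.cong)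
    note e = this
    show ?thesis
      using insert.prems(7)[of "a(j := s)"] unfolding e[of "\<lambda>k. X1 k _"] e[of "\<lambda>k. X2 k _"] .
  qed
  have wi: "integrable M1 (\<lambda>x. w1 x * f x)" if [measurable]: "f \<in> borel_measurable M1" and f: "\<And>x. \<bar>f x\<bar> \<le> 2" for f
    by (rule Bochner_Integration.integrable_bound[of _ "\<lambda>x. 2 * w1 x"])
       (use i nn f in \<open>auto simp: abs_mult intro!: mult_right_mono AE_I2 simp: mult.commute[of "w1 _"]\<close>)
  have wi2: "integrable M2 (\<lambda>x. w2 x * f x)" if [measurable]: "f \<in> borel_measurable M2" and f: "\<And>x. \<bar>f x\<bar> \<le> 2" for f
    by (rule Bochner_Integration.integrable_bound[of _ "\<lambda>x. 2 * w2 x"])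
       (use i nn f in \<open>auto simp: abs_mult intro!: mult_right_mono AE_I2 simp: mult.commute[of "w2 _"]\<close>)
  have wc: "integrable M1 (\<lambda>x. w1 x * iexp (f x))" if [measurable]: "f \<in> borel_measurable M1" for f
    by (rule Bochner_Integration.integrable_bound[OF i(1)]) (auto simp: norm_mult nn)
  have wc2: "integrable M2 (\<lambda>x. w2 x * iexp (f x))" if [measurable]: "f \<in> borel_measurable M2" for f
    by (rule Bochner_Integration.integrable_bound[OF i(2)]) (auto simp: norm_mult nn)
  define T1 where "T1 a x = (\<Sum>k\<in>J. a k * X1 k x)" for a x
  define T2 where "T2 a x = (\<Sum>k\<in>J. a k * X2 k x)" for a x
  have [measurable]: "T1 a \<in> borel_measurable M1" "T2 a \<in> borel_measurable M2" for a
    unfolding T1_def T2_def by auto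
  have T_neg: "- T1 a x = T1 (\<lambda>k. - a k) x" "- T2 a y = T2 (\<lambda>k. - a k) y" for a x y
    by (simp_all add: T1_def T2_def sum_negf)
  have key': "(\<integral>x. w1 x * iexp (s * X1 j x + T1 a x) \<partial>M1) = (\<integral>x. w2 x * iexp (s * X2 j x + T2 a x) \<partial>M2)" for s a
    using key by (simp add: T1_def T2_def)
  have key0: "(\<integral>x. w1 x * iexp (s * X1 j x) \<partial>M1) = (\<integral>x. w2 x * iexp (s * X2 j x) \<partial>M2)" for s
    using key[of s "\<lambda>_. 0"] by simp
  let ?I1 = "\<lambda>x. indicator (B j) (X1 j x) :: real" and ?I2 = "\<lambda>x. indicator (B j) (X2 j x) :: real"
  have P0: "(\<integral>x. w1 x * ?I1 x \<partial>M1) = (\<integral>x. w2 x * ?I2 x \<partial>M2)"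
    by (rule weighted_char_uniqueness[OF M m1(1) m2(1) i nn key0 B])
  \<comment> \<open>By Euler's formulas the trigonometric weights are combinations of exponentials
    with the linear form shifted by t, -t or 0, whose integrals are compared by
    \<open>key\<close>.\<close>
  have csplit: "of_real (1 + cos t) * iexp u = iexp u + (iexp (u + t) + iexp (u + - t)) / 2"
               "of_real (1 + sin t) * iexp u = iexp u + (iexp (u + t) - iexp (u + - t)) / (2 * \<i>)" for t u :: real
    by (simp_all add: exp_add exp_diff exp_minus exp_minus_inverse cos_of_real[symmetric] sin_of_real[symmetric] cos_exp_eq sin_exp_eq field_simps del: cos_of_real sin_of_real exp_minus)
  have trig: "0 \<le> 1 + cos t" "0 \<le> 1 + sin t" "\<bar>1 + cos t\<bar> \<le> 2" "\<bar>1 + sin t\<bar> \<le> 2" for t :: real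
    using cos_ge_minus_one[of t] cos_le_one[of t] sin_ge_minus_one[of t] sin_le_one[of t] by linarith+
  have Pc: "(\<integral>x. w1 x * (1 + cos (T1 a x)) * ?I1 x \<partial>M1) = (\<integral>x. w2 x * (1 + cos (T2 a x)) * ?I2 x \<partial>M2)" for a
  proof (rule weighted_char_uniqueness[OF M m1(1) m2(1) wi wi2 _ _ _ B])
    show "0 \<le> w1 x * (1 + cos (T1 a x))" "0 \<le> w2 y * (1 + cos (T2 a y))" for x y
      by (intro mult_nonneg_nonneg nn trig)+
    show "\<bar>1 + cos (T1 a x)\<bar> \<le> 2" "\<bar>1 + cos (T2 a y)\<bar> \<le> 2" for x y
      by (rule trig)+
    fix s
    have "(\<integral>x. of_real (w1 x * (1 + cos (T1 a x))) * iexp (s * X1 j x) \<partial>M1)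
       = (\<integral>x. w1 x * iexp (s * X1 j x) + (w1 x * iexp (s * X1 j x + T1 a x) + w1 x * iexp (s * X1 j x + - T1 a x)) / 2 \<partial>M1)"
      by (rule Bochner_Integration.integral_cong[OF refl], subst of_real_mult, subst mult.assoc, subst csplit) (simp only: distrib_left times_divide_eq_right right_diff_distrib)
    also have "\<dots> = (\<integral>x. w1 x * iexp (s * X1 j x) \<partial>M1) + ((\<integral>x. w1 x * iexp (s * X1 j x + T1 a x) \<partial>M1) + (\<integral>x. w1 x * iexp (s * X1 j x + - T1 a x) \<partial>M1)) / 2"
      by (subst Bochner_Integration.integral_add, (intro wc Bochner_Integration.integrable_add integrable_divide_zero impI; measurable), (intro wc Bochner_Integration.integrable_add integrable_divide_zero impI; measurable), subst integral_divide_zero, subst Bochner_Integration.integral_add, (intro wc; measurable)+, rule refl)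
    also have "\<dots> = (\<integral>x. w2 x * iexp (s * X2 j x) \<partial>M2) + ((\<integral>x. w2 x * iexp (s * X2 j x + T2 a x) \<partial>M2) + (\<integral>x. w2 x * iexp (s * X2 j x + - T2 a x) \<partial>M2)) / 2"
      unfolding T_neg key' key0 ..
    also have "\<dots> = (\<integral>x. w2 x * iexp (s * X2 j x) + (w2 x * iexp (s * X2 j x + T2 a x) + w2 x * iexp (s * X2 j x + - T2 a x)) / 2 \<partial>M2)"
      by (subst Bochner_Integration.integral_add, (intro wc2 Bochner_Integration.integrable_add integrable_divide_zero impI; measurable), (intro wc2 Bochner_Integration.integrable_add integrable_divide_zero impI; measurable), subst integral_divide_zero, subst Bochner_Integration.integral_add, (intro wc2; measurable)+, rule refl)
    also have "\<dots> = (\<integral>x. of_real (w2 x * (1 + cos (T2 a x))) * iexp (s * X2 j x) \<partial>M2)"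
      by (rule Bochner_Integration.integral_cong[OF refl], subst of_real_mult, subst mult.assoc, subst csplit) (simp only: distrib_left times_divide_eq_right right_diff_distrib)
    finally show "(\<integral>x. of_real (w1 x * (1 + cos (T1 a x))) * iexp (s * X1 j x) \<partial>M1) = (\<integral>x. of_real (w2 x * (1 + cos (T2 a x))) * iexp (s * X2 j x) \<partial>M2)" .
  qed measurable
  have Ps: "(\<integral>x. w1 x * (1 + sin (T1 a x)) * ?I1 x \<partial>M1) = (\<integral>x. w2 x * (1 + sin (T2 a x)) * ?I2 x \<partial>M2)" for a
  proof (rule weighted_char_uniqueness[OF M m1(1) m2(1) wi wi2 _ _ _ B])
    show "0 \<le> w1 x * (1 + sin (T1 a x))" "0 \<le> w2 y * (1 + sin (T2 a y))" for x y
      by (intro mult_nonneg_nonneg nn trig)+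
    show "\<bar>1 + sin (T1 a x)\<bar> \<le> 2" "\<bar>1 + sin (T2 a y)\<bar> \<le> 2" for x y
      by (rule trig)+
    fix s
    have "(\<integral>x. of_real (w1 x * (1 + sin (T1 a x))) * iexp (s * X1 j x) \<partial>M1)
       = (\<integral>x. w1 x * iexp (s * X1 j x) + (w1 x * iexp (s * X1 j x + T1 a x) - w1 x * iexp (s * X1 j x + - T1 a x)) / (2 * \<i>) \<partial>M1)"
      by (rule Bochner_Integration.integral_cong[OF refl], subst of_real_mult, subst mult.assoc, subst csplit) (simp only: distrib_left times_divide_eq_right right_diff_distrib)
    also have "\<dots> = (\<integral>x. w1 x * iexp (s * X1 j x) \<partial>M1) + ((\<integral>x. w1 x * iexp (s * X1 j x + T1 a x) \<partial>M1) - (\<integral>x. w1 x * iexp (s * X1 j x + - T1 a x) \<partial>M1)) / (2 * \<i>)"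
      by (subst Bochner_Integration.integral_add, (intro wc Bochner_Integration.integrable_diff integrable_divide_zero impI; measurable), (intro wc Bochner_Integration.integrable_diff integrable_divide_zero impI; measurable), subst integral_divide_zero, subst Bochner_Integration.integral_diff, (intro wc; measurable)+, rule refl)
    also have "\<dots> = (\<integral>x. w2 x * iexp (s * X2 j x) \<partial>M2) + ((\<integral>x. w2 x * iexp (s * X2 j x + T2 a x) \<partial>M2) - (\<integral>x. w2 x * iexp (s * X2 j x + - T2 a x) \<partial>M2)) / (2 * \<i>)"
      unfolding T_neg key' key0 ..
    also have "\<dots> = (\<integral>x. w2 x * iexp (s * X2 j x) + (w2 x * iexp (s * X2 j x + T2 a x) - w2 x * iexp (s * X2 j x + - T2 a x)) / (2 * \<i>) \<partial>M2)"
      by (subst Bochner_Integration.integral_add, (intro wc2 Bochner_Integration.integrable_diff integrable_divide_zero impI; measurable), (intro wc2 Bochner_Integration.integrable_diff integrable_divide_zero impI; measurable), subst integral_divide_zero, subst Bochner_Integration.integral_diff, (intro wc2; measurable)+, rule refl)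
    also have "\<dots> = (\<integral>x. of_real (w2 x * (1 + sin (T2 a x))) * iexp (s * X2 j x) \<partial>M2)"
      by (rule Bochner_Integration.integral_cong[OF refl], subst of_real_mult, subst mult.assoc, subst csplit) (simp only: distrib_left times_divide_eq_right right_diff_distrib)
    finally show "(\<integral>x. of_real (w1 x * (1 + sin (T1 a x))) * iexp (s * X1 j x) \<partial>M1) = (\<integral>x. of_real (w2 x * (1 + sin (T2 a x))) * iexp (s * X2 j x) \<partial>M2)" .
  qed measurable
  have ind: "integrable M1 (\<lambda>x. w1 x * (f x * ?I1 x))" if "f \<in> borel_measurable M1" "\<And>x. \<bar>f x\<bar> \<le> 1" for f
    using that by (intro wi) (auto simp: indicator_def intro: order.trans[OF that(2)])
  have ind2: "integrable M2 (\<lambda>x. w2 x * (f x * ?I2 x))" if "f \<in> borel_measurable M2" "\<And>x. \<bar>f x\<bar> \<le> 1" for f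
    using that by (intro wi2) (auto simp: indicator_def intro: order.trans[OF that(2)])
  have ind1: "integrable M1 (\<lambda>x. w1 x * ?I1 x)" "integrable M2 (\<lambda>x. w2 x * ?I2 x)"
    using ind[of "\<lambda>_. 1"] ind2[of "\<lambda>_. 1"] by auto
  \<comment> \<open>The contribution \<open>P0\<close> of the constant in \<open>1 + cos\<close> is
    removed again.\<close>
  have Pc': "(\<integral>x. w1 x * (cos (T1 a x) * ?I1 x) \<partial>M1) = (\<integral>x. w2 x * (cos (T2 a x) * ?I2 x) \<partial>M2)" for a
  proof -
    have "(\<integral>x. w1 x * (1 + cos (T1 a x)) * ?I1 x \<partial>M1) = (\<integral>x. w1 x * ?I1 x \<partial>M1) + (\<integral>x. w1 x * (cos (T1 a x) * ?I1 x) \<partial>M1)"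
      by (subst Bochner_Integration.integral_add[symmetric]) (auto intro!: ind ind1 Bochner_Integration.integral_cong simp: algebra_simps)
    moreover have "(\<integral>x. w2 x * (1 + cos (T2 a x)) * ?I2 x \<partial>M2) = (\<integral>x. w2 x * ?I2 x \<partial>M2) + (\<integral>x. w2 x * (cos (T2 a x) * ?I2 x) \<partial>M2)"
      by (subst Bochner_Integration.integral_add[symmetric]) (auto intro!: ind2 ind1 Bochner_Integration.integral_cong simp: algebra_simps)
    ultimately show ?thesis using Pc[of a] P0 by simp
  qed
  have Ps': "(\<integral>x. w1 x * (sin (T1 a x) * ?I1 x) \<partial>M1) = (\<integral>x. w2 x * (sin (T2 a x) * ?I2 x) \<partial>M2)" for a
  proof -
    have "(\<integral>x. w1 x * (1 + sin (T1 a x)) * ?I1 x \<partial>M1) = (\<integral>x. w1 x * ?I1 x \<partial>M1) + (\<integral>x. w1 x * (sin (T1 a x) * ?I1 x) \<partial>M1)"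
      by (subst Bochner_Integration.integral_add[symmetric]) (auto intro!: ind ind1 Bochner_Integration.integral_cong simp: algebra_simps)
    moreover have "(\<integral>x. w2 x * (1 + sin (T2 a x)) * ?I2 x \<partial>M2) = (\<integral>x. w2 x * ?I2 x \<partial>M2) + (\<integral>x. w2 x * (sin (T2 a x) * ?I2 x) \<partial>M2)"
      by (subst Bochner_Integration.integral_add[symmetric]) (auto intro!: ind2 ind1 Bochner_Integration.integral_cong simp: algebra_simps)
    ultimately show ?thesis using Ps[of a] P0 by simp
  qed
  have fin: "(\<integral>x. of_real (w1 x * ?I1 x) * iexp (T1 a x) \<partial>M1) = (\<integral>x. of_real (w2 x * ?I2 x) * iexp (T2 a x) \<partial>M2)" for a
  proof -
    have e: "of_real (w * I) * iexp t = of_real (w * (cos t * I)) + \<i> * of_real (w * (sin t * I))" for w I t :: real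
      by (simp add: cis_conv_exp[symmetric] complex_eq_iff)
    have "(\<integral>x. of_real (w1 x * ?I1 x) * iexp (T1 a x) \<partial>M1) = of_real (\<integral>x. w1 x * (cos (T1 a x) * ?I1 x) \<partial>M1) + \<i> * of_real (\<integral>x. w1 x * (sin (T1 a x) * ?I1 x) \<partial>M1)"
      unfolding e integral_complex_of_real[symmetric] integral_mult_right_zero[symmetric]
      by (rule Bochner_Integration.integral_add; intro integrable_mult_right integrable_of_real ind; simp)
    moreover have "(\<integral>x. of_real (w2 x * ?I2 x) * iexp (T2 a x) \<partial>M2) = of_real (\<integral>x. w2 x * (cos (T2 a x) * ?I2 x) \<partial>M2) + \<i> * of_real (\<integral>x. w2 x * (sin (T2 a x) * ?I2 x) \<partial>M2)"
      unfolding e integral_complex_of_real[symmetric] integral_mult_right_zero[symmetric]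
      by (rule Bochner_Integration.integral_add; intro integrable_mult_right integrable_of_real ind2; simp)
    ultimately show ?thesis by (simp add: Pc' Ps')
  qed
  \<comment> \<open>The induction hypothesis is used with the old weight times the indicator of
    \<open>B j\<close>.\<close>
  have "(\<integral>x. (w1 x * ?I1 x) * (\<Prod>k\<in>J. indicator (B k) (X1 k x)) \<partial>M1) = (\<integral>x. (w2 x * ?I2 x) * (\<Prod>k\<in>J. indicator (B k) (X2 k x)) \<partial>M2)"
    by (rule insert.IH) (use fin m1 m2 ind1 nn insert.prems(8) in \<open>auto simp: T1_def T2_def\<close>)
  then show ?case using insert.hyps by (simp add: mult.assoc)
qed

text \<open>Measures on a finite product are determined by their values on boxes, and the value on a
  box is the integral of a product of indicators, to which the previous lemma applies with weight
  1.\<close>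

lemma joint_char_uniqueness:
  fixes X1 :: "'i \<Rightarrow> 'a \<Rightarrow> real" and X2 :: "'i \<Rightarrow> 'b \<Rightarrow> real"
  assumes P: "prob_space M1" "prob_space M2"
    and fin: "finite J"
    and m1: "\<And>j. j \<in> J \<Longrightarrow> X1 j \<in> borel_measurable M1"
    and m2: "\<And>j. j \<in> J \<Longrightarrow> X2 j \<in> borel_measurable M2"
    and eq: "\<And>a. (\<integral>x. iexp (\<Sum>j\<in>J. a j * X1 j x) \<partial>M1) = (\<integral>x. iexp (\<Sum>j\<in>J. a j * X2 j x) \<partial>M2)"
  shows "distr M1 (Pi\<^sub>M J (\<lambda>_. borel)) (\<lambda>x. \<lambda>j\<in>J. X1 j x) = distr M2 (Pi\<^sub>M J (\<lambda>_. borel)) (\<lambda>x. \<lambda>j\<in>J. X2 j x)"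
proof -
  interpret M1: prob_space M1 by fact
  interpret M2: prob_space M2 by fact
  have fm: "finite_measure M1" "finite_measure M2" by unfold_locales
  have [measurable]: "(\<lambda>x. \<lambda>j\<in>J. X1 j x) \<in> M1 \<rightarrow>\<^sub>M Pi\<^sub>M J (\<lambda>_. borel)" "(\<lambda>x. \<lambda>j\<in>J. X2 j x) \<in> M2 \<rightarrow>\<^sub>M Pi\<^sub>M J (\<lambda>_. borel)"
    using m1 m2 by (auto intro!: measurable_restrict)
  have *: "emeasure (distr M (Pi\<^sub>M J (\<lambda>_. borel)) (\<lambda>x. \<lambda>j\<in>J. X j x)) (Pi\<^sub>E J A) = ennreal (\<integral>x. 1 * (\<Prod>j\<in>J. indicator (A j) (X j x)) \<partial>M)"
    if "prob_space M" and X: "\<And>j. j \<in> J \<Longrightarrow> X j \<in> borel_measurable M" and A: "\<And>j. j \<in> J \<Longrightarrow> A j \<in> sets borel"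
    for M :: "'c measure" and X A
  proof -
    interpret M: prob_space M by fact
    have [measurable]: "(\<lambda>x. \<lambda>j\<in>J. X j x) \<in> M \<rightarrow>\<^sub>M Pi\<^sub>M J (\<lambda>_. borel)"
      using X by (auto intro!: measurable_restrict)
    have S[measurable]: "Pi\<^sub>E J A \<in> sets (Pi\<^sub>M J (\<lambda>_. borel))" using A fin by (auto intro!: sets_PiM_I_finite)
    let ?S = "(\<lambda>x. \<lambda>j\<in>J. X j x) -` Pi\<^sub>E J A \<inter> space M"
    have "emeasure (distr M (Pi\<^sub>M J (\<lambda>_. borel)) (\<lambda>x. \<lambda>j\<in>J. X j x)) (Pi\<^sub>E J A) = emeasure M ?S"
      by (subst emeasure_distr) auto
    also have "\<dots> = ennreal (\<integral>x. indicator ?S x \<partial>M)" by (simp add: M.emeasure_eq_measure)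
    also have "(\<integral>x. indicator ?S x \<partial>M) = (\<integral>x. (1::real) * (\<Prod>j\<in>J. indicator (A j) (X j x)) \<partial>M)"
    proof (intro Bochner_Integration.integral_cong refl)
      fix x assume x: "x \<in> space M"
      show "indicator ?S x = (1::real) * (\<Prod>j\<in>J. indicator (A j) (X j x))"
      proof (cases "\<forall>j\<in>J. X j x \<in> A j")
        case True
        then have "(\<Prod>j\<in>J. indicator (A j) (X j x) :: real) = 1" by (intro prod.neutral) auto
        with True x show ?thesis by auto
      next
        case False
        then have "(\<Prod>j\<in>J. indicator (A j) (X j x) :: real) = 0" using fin by (auto simp: prod_zero_iff indicator_def)
        moreover have "x \<notin> ?S" using False by auto
        ultimately show ?thesis by simp
      qed
    qed
    finally show ?thesis .
  qed
  show ?thesis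
  proof (rule measure_eqI_PiM_finite[OF fin, of _ "\<lambda>_. borel"])
    fix A assume A: "\<And>i. i \<in> J \<Longrightarrow> A i \<in> sets (borel :: real measure)"
    have "(\<integral>x. (1::real) * (\<Prod>j\<in>J. indicator (A j) (X1 j x)) \<partial>M1) = (\<integral>x. 1 * (\<Prod>j\<in>J. indicator (A j) (X2 j x)) \<partial>M2)"
      by (rule joint_char_uniqueness_aux) (use fm fin m1 m2 eq A in auto)
    moreover have "emeasure (distr M1 (Pi\<^sub>M J (\<lambda>_. borel)) (\<lambda>x. \<lambda>j\<in>J. X1 j x)) (Pi\<^sub>E J A) = ennreal (\<integral>x. 1 * (\<Prod>j\<in>J. indicator (A j) (X1 j x)) \<partial>M1)"
      by (rule *) (use P m1 A in auto)
    moreover have "emeasure (distr M2 (Pi\<^sub>M J (\<lambda>_. borel)) (\<lambda>x. \<lambda>j\<in>J. X2 j x)) (Pi\<^sub>E J A) = ennreal (\<integral>x. 1 * (\<Prod>j\<in>J. indicator (A j) (X2 j x)) \<partial>M2)"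
      by (rule *) (use P m2 A in auto)
    ultimately show "emeasure (distr M1 (Pi\<^sub>M J (\<lambda>_. borel)) (\<lambda>x. \<lambda>j\<in>J. X1 j x)) (Pi\<^sub>E J A) = emeasure (distr M2 (Pi\<^sub>M J (\<lambda>_. borel)) (\<lambda>x. \<lambda>j\<in>J. X2 j x)) (Pi\<^sub>E J A)"
      by simp
  next
    show "range (\<lambda>n::nat. Pi\<^sub>E J (\<lambda>_. UNIV)) \<subseteq> prod_algebra J (\<lambda>_. borel)"
      by (auto simp: prod_algebra_eq_finite[OF fin])
    show "(\<Union>n::nat. Pi\<^sub>E J (\<lambda>_. UNIV)) = space (Pi\<^sub>M J (\<lambda>_. borel))" by (simp add: space_PiM)
    show "emeasure (distr M1 (Pi\<^sub>M J (\<lambda>_. borel)) (\<lambda>x. \<lambda>j\<in>J. X1 j x)) (Pi\<^sub>E J (\<lambda>_. UNIV)) \<noteq> \<infinity>"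
      using *[of M1 X1 "\<lambda>_. UNIV"] P m1 by simp
  qed auto
qed

section \<open>Weak derivatives and functions on the half-plane\<close>

subsection \<open>Smooth functions\<close>

definition smooth :: "(real \<Rightarrow> real) \<Rightarrow> bool" where
  "smooth f \<longleftrightarrow> (\<forall>k. (deriv ^^ k) f differentiable_on UNIV)"

text \<open>Formulas for derivatives of arbitrary order are avoided by exhibiting a family closed
  under differentiation: sums of products, rescalings, polynomial multiples of
  \<open>exp (- (1 / x))\<close>, and later the parts of a holomorphic function along a
  line.\<close>

lemma smooth_coinduct:
  assumes "P f" and "\<And>f. P f \<Longrightarrow> \<exists>f'. P f' \<and> (\<forall>x. (f has_real_derivative f' x) (at x))"
  shows "smooth f"
proof -
  have d: "P (deriv f) \<and> f differentiable_on UNIV" if Pf: "P f" for f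
  proof -
    obtain f' where f': "P f'" "\<And>x. (f has_real_derivative f' x) (at x)" using assms(2)[OF Pf] by auto
    then have "deriv f = f'" by (auto intro!: DERIV_imp_deriv)
    with f' show ?thesis by (auto simp: differentiable_on_def real_differentiable_def)
  qed
  have "P ((deriv ^^ k) f)" for k by (induction k) (use assms(1) d in auto)
  with d show ?thesis by (auto simp: smooth_def)
qed

lemma smooth_deriv: "smooth f \<Longrightarrow> smooth (deriv f)"
  unfolding smooth_def by (metis funpow_Suc_right comp_apply)

lemma smooth_has_deriv: "smooth f \<Longrightarrow> (f has_real_derivative deriv f x) (at x)"
  unfolding smooth_def
  by (drule spec[of _ 0]) (auto simp: differentiable_on_def real_differentiable_def DERIV_deriv_iff_real_differentiable)

lemma smooth_higher_deriv: "smooth f \<Longrightarrow> smooth ((deriv ^^ k) f)"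
  by (induction k) (auto intro: smooth_deriv)

lemma smooth_continuous: "smooth f \<Longrightarrow> continuous_on A f"
  using smooth_has_deriv by (metis DERIV_isCont continuous_at_imp_continuous_on)

text \<open>Single products are not closed under differentiation; by the Leibniz rule, finite sums
  of them are.\<close>

inductive sum_of_prods :: "(real \<Rightarrow> real) \<Rightarrow> bool" where
  "smooth f \<Longrightarrow> smooth g \<Longrightarrow> sum_of_prods (\<lambda>x. f x * g x)"
| "sum_of_prods f \<Longrightarrow> sum_of_prods g \<Longrightarrow> sum_of_prods (\<lambda>x. f x + g x)"

lemma smooth_mult:
  assumes "smooth f" "smooth g"
  shows "smooth (\<lambda>x. f x * g x)"
proof (rule smooth_coinduct[of sum_of_prods])
  show "sum_of_prods (\<lambda>x. f x * g x)" by (intro sum_of_prods.intros assms)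
  fix h assume "sum_of_prods h"
  then show "\<exists>h'. sum_of_prods h' \<and> (\<forall>x. (h has_real_derivative h' x) (at x))"
  proof induction
    case (1 f g)
    have "sum_of_prods (\<lambda>x. deriv f x * g x + f x * deriv g x)"
      using 1 by (intro sum_of_prods.intros smooth_deriv)
    moreover have "((\<lambda>x. f x * g x) has_real_derivative (deriv f x * g x + f x * deriv g x)) (at x)" for x
      using smooth_has_deriv[OF 1(1), of x] smooth_has_deriv[OF 1(2), of x]
      by (auto intro!: derivative_eq_intros)
    ultimately show ?case by blast
  next
    case (2 f g)
    then obtain f' g' where "sum_of_prods f'" "sum_of_prods g'" "\<forall>x. (f has_real_derivative f' x) (at x)" "\<forall>x. (g has_real_derivative g' x) (at x)"
      by blast
    then show ?case by (intro exI[of _ "\<lambda>x. f' x + g' x"]) (auto intro!: sum_of_prods.intros derivative_eq_intros)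
  qed
qed

lemma smooth_affine:
  assumes "smooth f"
  shows "smooth (\<lambda>x. c * f (a * x + b))"
proof (rule smooth_coinduct[of "\<lambda>h. \<exists>c f. smooth f \<and> h = (\<lambda>x. c * f (a * x + b))"])
  show "\<exists>c' f'. smooth f' \<and> (\<lambda>x. c * f (a * x + b)) = (\<lambda>x. c' * f' (a * x + b))" using assms by blast
  fix h assume "\<exists>c f. smooth f \<and> h = (\<lambda>x. c * f (a * x + b))"
  then obtain c f where h: "smooth f" "h = (\<lambda>x. c * f (a * x + b))" by blast
  have "(h has_real_derivative (c * a) * deriv f (a * x + b)) (at x)" for x
    unfolding h(2)
    by (rule derivative_eq_intros DERIV_chain'[OF _ smooth_has_deriv[OF h(1)]] refl | simp)+
  then show "\<exists>h'. (\<exists>c f. smooth f \<and> h' = (\<lambda>x. c * f (a * x + b))) \<and> (\<forall>x. (h has_real_derivative h' x) (at x))"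
    using smooth_deriv[OF h(1)] by (intro exI[of _ "\<lambda>x. (c * a) * deriv f (a * x + b)"]) blast
qed

lemma higher_deriv_scaled:
  assumes "smooth f"
  shows "(deriv ^^ k) (\<lambda>x. f (a * x)) = (\<lambda>x. a ^ k * (deriv ^^ k) f (a * x))"
proof (induction k)
  case (Suc k)
  have "((\<lambda>x. a ^ k * (deriv ^^ k) f (a * x)) has_real_derivative a ^ Suc k * (deriv ^^ Suc k) f (a * x)) (at x)" for x
    by (rule derivative_eq_intros DERIV_chain'[OF _ smooth_has_deriv[OF smooth_higher_deriv[OF assms]]] refl | simp)+
  then show ?case using Suc by (auto intro!: DERIV_imp_deriv)
qed auto

text \<open>The functions \<open>poly p (1 / x) * exp (- (1 / x))\<close>, extended by 0, form a
  family closed under differentiation, also at the origin, since the exponential beats every power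
  of 1 / x.\<close>

lemma smooth_exp_neg_inverse: "smooth (\<lambda>x. if x > 0 then exp (- (1 / x)) else 0)"
proof (rule smooth_coinduct[of "\<lambda>h. \<exists>p. h = (\<lambda>x. if x > 0 then poly p (1 / x) * exp (- (1 / x)) else 0)"])
  show "\<exists>p. (\<lambda>x::real. if x > 0 then exp (- (1 / x)) else 0) = (\<lambda>x. if x > 0 then poly p (1 / x) * exp (- (1 / x)) else 0)"
    by (rule exI[of _ 1]) auto
  fix h :: "real \<Rightarrow> real" assume "\<exists>p. h = (\<lambda>x. if x > 0 then poly p (1 / x) * exp (- (1 / x)) else 0)"
  then obtain p where h: "h = (\<lambda>x. if x > 0 then poly p (1 / x) * exp (- (1 / x)) else 0)" by blast
  \<comment> \<open>With u = 1 / x and u' = - u^2, the derivative of p(u) exp(-u) in x is u^2 (p(u)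
    - p'(u)) exp(-u).\<close>
  define q where "q = [:0, 0, 1:] * (p - pderiv p)"
  define h' where "h' = (\<lambda>x::real. if x > 0 then poly q (1 / x) * exp (- (1 / x)) else 0)"
  have lim0: "((\<lambda>u. poly r u * exp (- u)) \<longlongrightarrow> 0) at_top" for r :: "real poly"
  proof (induction r)
    case 0 then show ?case by simp
  next
    case (pCons c r)
    have *: "((\<lambda>u::real. u ^ 1 * exp (- u)) \<longlongrightarrow> 0) at_top" by real_asymp
    show ?case
    proof -
      have m: "((\<lambda>u. u ^ k * exp (- u)) \<longlongrightarrow> (0::real)) at_top" for k
        using tendsto_power_div_exp_0[of k] by (simp add: exp_minus field_simps)
      have "((\<lambda>u. \<Sum>i\<le>degree (pCons c r). coeff (pCons c r) i * (u ^ i * exp (- u))) \<longlongrightarrow> (\<Sum>i\<le>degree (pCons c r). coeff (pCons c r) i * 0)) at_top"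
        by (intro tendsto_sum tendsto_mult tendsto_const m)
      then show ?thesis by (simp add: poly_altdef sum_distrib_right mult.assoc)
    qed
  qed
  have "(h has_real_derivative h' x) (at x)" for x
  proof -
    consider "x > 0" | "x < 0" | "x = 0" by linarith
    then show ?thesis
    proof cases
      case 1
      have "((\<lambda>x. poly p (1 / x) * exp (- (1 / x))) has_real_derivative (poly (pderiv p) (1 / x) * (- (1 / x\<^sup>2)) * exp (- (1 / x)) + poly p (1 / x) * (exp (- (1 / x)) * (1 / x\<^sup>2)))) (at x)"
        using 1 by (auto intro!: derivative_eq_intros DERIV_chain'[OF _ poly_DERIV] simp: power2_eq_square field_simps)
      also have "(poly (pderiv p) (1 / x) * (- (1 / x\<^sup>2)) * exp (- (1 / x)) + poly p (1 / x) * (exp (- (1 / x)) * (1 / x\<^sup>2))) = h' x"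
        using 1 by (simp add: h'_def q_def power2_eq_square field_simps)
      finally have *: "((\<lambda>x. poly p (1 / x) * exp (- (1 / x))) has_real_derivative h' x) (at x)" .
      show ?thesis
        by (rule has_field_derivative_transform_within_open[OF *, of "{0<..}"]) (use 1 in \<open>auto simp: h\<close>)
    next
      case 2
      have *: "((\<lambda>x. 0) has_real_derivative h' x) (at x)" using 2 by (simp add: h'_def)
      show ?thesis
        by (rule has_field_derivative_transform_within_open[OF *, of "{..<0}"]) (use 2 in \<open>auto simp: h\<close>)
    next
      case 3
      have r: "((\<lambda>x. h x / x) \<longlongrightarrow> 0) (at_right 0)"
      proof -
        \<comment> \<open>\<open>pCons 0 p\<close> is u p(u): the division by x in the difference
          quotient is absorbed into the polynomial.\<close>
        have "((\<lambda>x. poly (pCons 0 p) (inverse x) * exp (- inverse x)) \<longlongrightarrow> (0::real)) (at_right 0)"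
          by (rule filterlim_compose[OF lim0 filterlim_inverse_at_top_right])
        then show ?thesis
          by (rule Lim_transform_eventually) (auto simp: eventually_at_filter h field_simps)
      qed
      have l: "((\<lambda>x. h x / x) \<longlongrightarrow> 0) (at_left 0)"
        by (rule Lim_transform_eventually[OF tendsto_const]) (auto simp: eventually_at_filter h)
      have "((\<lambda>x. h x / x) \<longlongrightarrow> 0) (at 0)" using l r by (simp add: filterlim_split_at)
      then show ?thesis using 3 by (simp add: has_field_derivative_iff h h'_def)
    qed
  qed
  then show "\<exists>h'. (\<exists>p. h' = (\<lambda>x. if x > 0 then poly p (1 / x) * exp (- (1 / x)) else 0)) \<and> (\<forall>x. (h has_real_derivative h' x) (at x))"
    by (intro exI[of _ h']) (auto simp: h'_def)
qed

lemma smooth_cutoff_exists: "\<exists>g. smooth g \<and> g 0 = 1 \<and> (\<forall>x. \<bar>x\<bar> \<ge> 1 \<longrightarrow> g x = 0)"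
proof -
  let ?b = "\<lambda>x::real. if x > 0 then exp (- (1 / x)) else 0"
  \<comment> \<open>One factor vanishes for x \<ge> 1, the other for x \<le> -1. Each bump equals
    exp (-1) at 0, which \<open>exp 2\<close> compensates.\<close>
  have "smooth (\<lambda>x. (exp 2 * ?b (-1 * x + 1)) * (1 * ?b (1 * x + 1)))"
    by (intro smooth_mult smooth_affine smooth_exp_neg_inverse)
  moreover have "exp (2::real) * exp (- 1) * exp (- 1) = 1" by (simp flip: exp_add)
  ultimately show ?thesis
    by (intro exI[of _ "\<lambda>x. (exp 2 * ?b (-1 * x + 1)) * (1 * ?b (1 * x + 1))"]) (auto simp: mult.assoc abs_if split: if_splits)
qed

text \<open>The inequality becomes strict because vanishing is inherited by derivatives on an open
  set.\<close>

lemma higher_deriv_zero_outside: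
  assumes "smooth f" "\<And>x. \<bar>x\<bar> \<ge> 1 \<Longrightarrow> f x = 0"
  shows "\<bar>x\<bar> > 1 \<Longrightarrow> (deriv ^^ k) f x = 0"
proof (induction k arbitrary: x)
  case (Suc k)
  have o: "open {x::real. \<bar>x\<bar> > 1}" by (intro open_Collect_less continuous_intros)
  have "((deriv ^^ k) f has_real_derivative 0) (at x)"
    by (rule has_field_derivative_transform_within_open[OF DERIV_const[of 0] o]) (use Suc in auto)
  then show ?case by (simp add: DERIV_imp_deriv)
qed (use assms in auto)

lemma higher_deriv_bounded:
  assumes "smooth f" "\<And>x. \<bar>x\<bar> \<ge> 1 \<Longrightarrow> f x = 0"
  shows "\<exists>C\<ge>0. \<forall>x. \<bar>(deriv ^^ k) f x\<bar> \<le> C"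
proof -
  have "compact ((deriv ^^ k) f ` {-1..1})"
    by (intro compact_continuous_image smooth_continuous smooth_higher_deriv assms) auto
  then obtain C where C: "\<And>x. x \<in> {-1..1} \<Longrightarrow> \<bar>(deriv ^^ k) f x\<bar> \<le> C"
    by (force dest!: compact_imp_bounded simp: bounded_iff)
  have "\<bar>(deriv ^^ k) f x\<bar> \<le> max 0 C" for x
  proof (cases "\<bar>x\<bar> > 1")
    case True then show ?thesis using higher_deriv_zero_outside[OF assms] by simp
  next
    case False
    then have "x \<in> {-1..1}" by auto
    from C[OF this] show ?thesis by (simp add: le_max_iff_disj)
  qed
  then show ?thesis by (intro exI[of _ "max 0 C"]) auto
qed

lemma deriv_mult_smooth:
  assumes "smooth f" "smooth g"
  shows "deriv (\<lambda>x. f x * g x) = (\<lambda>x. deriv f x * g x + f x * deriv g x)"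
  by (rule ext, rule DERIV_imp_deriv)
     (auto intro!: derivative_eq_intros smooth_has_deriv[OF assms(1)] smooth_has_deriv[OF assms(2)])

lemma deriv3_mult_smooth:
  assumes "smooth f" "smooth g"
  shows "(deriv ^^ 3) (\<lambda>x. f x * g x) = (\<lambda>x. (deriv ^^ 3) f x * g x + 3 * ((deriv ^^ 2) f x * deriv g x)
    + 3 * (deriv f x * (deriv ^^ 2) g x) + f x * (deriv ^^ 3) g x)"
proof -
  note s = smooth_higher_deriv[OF assms(1)] smooth_higher_deriv[OF assms(2)]
  note d = smooth_has_deriv[OF s(1)] smooth_has_deriv[OF s(2)]
  note d0 = d(1)[of 0] d(2)[of 0] d(1)[of "Suc 0"] d(2)[of "Suc 0"] d(1)[of "Suc (Suc 0)"] d(2)[of "Suc (Suc 0)"]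
  note d0' = d0[simplified]
  have "deriv (\<lambda>x. deriv f x * g x + f x * deriv g x) = (\<lambda>x. deriv (deriv f) x * g x + 2 * (deriv f x * deriv g x) + f x * deriv (deriv g) x)"
    by (rule ext, rule DERIV_imp_deriv) (auto intro!: derivative_eq_intros d0')
  moreover have "deriv (\<lambda>x. deriv (deriv f) x * g x + 2 * (deriv f x * deriv g x) + f x * deriv (deriv g) x) =
    (\<lambda>x. deriv (deriv (deriv f)) x * g x + 3 * (deriv (deriv f) x * deriv g x) + 3 * (deriv f x * deriv (deriv g) x) + f x * deriv (deriv (deriv g)) x)"
    by (rule ext, rule DERIV_imp_deriv) (auto intro!: derivative_eq_intros d0')
  ultimately show ?thesis
    by (simp add: numeral_eq_Suc deriv_mult_smooth[OF assms])
qed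

lemma test_function_if_smooth: "smooth f \<Longrightarrow> (\<And>x. \<bar>x\<bar> > R \<Longrightarrow> f x = 0) \<Longrightarrow> test_function f"
  by (auto simp: test_function_def smooth_def)

subsection \<open>Testing weak derivatives against bounded smooth functions\<close>

lemma smooth_measurable [measurable_dest]: "smooth f \<Longrightarrow> f \<in> borel_measurable borel"
  by (auto intro: borel_measurable_continuous_onI smooth_continuous)

text \<open>Weak derivatives are tested against compactly supported functions, whereas the functions
  needed later, holomorphic functions along horizontal lines, are merely bounded. The cutoff at
  scale n + 1 reduces to compact support, and dominated convergence removes it. The hypothesis
  \<open>lim\<close> isolates the Leibniz computation, which depends on the order k.\<close>

lemma weak_deriv_limit:
  fixes f g :: "real \<Rightarrow> complex"
  assumes f: "integrable lborel f" and w: "is_weak_deriv k f g" and s: "smooth e"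
    and lim: "\<And>e'. smooth e' \<Longrightarrow> e' 0 = 1 \<Longrightarrow> (\<And>x. \<bar>x\<bar> \<ge> 1 \<Longrightarrow> e' x = 0) \<Longrightarrow>
      (\<exists>C. \<forall>n x. \<bar>(deriv ^^ k) (\<lambda>x. e' (x / real (Suc n)) * e x) x\<bar> \<le> C) \<and>
      (\<forall>x. (\<lambda>n. (deriv ^^ k) (\<lambda>x. e' (x / real (Suc n)) * e x) x) \<longlonglongrightarrow> (deriv ^^ k) e x)"
    and b: "\<And>x. \<bar>e x\<bar> \<le> C0"
  shows "(\<integral>x. complex_of_real ((deriv ^^ k) e x) * f x \<partial>lborel) = (-1) ^ k * (\<integral>x. complex_of_real (e x) * g x \<partial>lborel)"
proof -
  obtain c where c: "smooth c" "c 0 = 1" "\<And>x. \<bar>x\<bar> \<ge> 1 \<Longrightarrow> c x = 0" using smooth_cutoff_exists by blast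
  have g: "integrable lborel g" using w by (simp add: is_weak_deriv_def)
  have [measurable]: "f \<in> borel_measurable borel" "g \<in> borel_measurable borel" using f g by auto
  define h where "h n = (\<lambda>x. c (x / real (Suc n)) * e x)" for n
  have sm: "smooth (h n)" for n
    using smooth_mult[OF smooth_affine[OF c(1), of 1 "1 / real (Suc n)" 0] s] by (simp add: h_def)
  have te: "test_function (h n)" for n
  proof (rule test_function_if_smooth[OF sm])
    fix x assume "real (Suc n) < \<bar>x\<bar>"
    then have "\<bar>x / real (Suc n)\<bar> \<ge> 1" by (simp add: abs_divide le_divide_eq)
    then show "h n x = 0" by (simp add: h_def c(3))
  qed
  from lim[OF c] obtain C where C: "\<And>n x. \<bar>(deriv ^^ k) (h n) x\<bar> \<le> C"
    and l: "\<And>x. (\<lambda>n. (deriv ^^ k) (h n) x) \<longlonglongrightarrow> (deriv ^^ k) e x" unfolding h_def by blast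
  note [measurable] = smooth_measurable[OF smooth_higher_deriv[OF sm]] smooth_measurable[OF smooth_higher_deriv[OF s]]
    smooth_measurable[OF sm] smooth_measurable[OF s]
  obtain C1 where C1: "\<And>x. \<bar>c x\<bar> \<le> C1" using higher_deriv_bounded[OF c(1,3), of 0] by auto
  have l0: "(\<lambda>n. h n x) \<longlonglongrightarrow> e x" for x
  proof -
    have "(\<lambda>n. c (x / real (Suc n))) \<longlonglongrightarrow> c 0"
      by (rule isCont_tendsto_compose[OF DERIV_isCont[OF smooth_has_deriv[OF c(1)]] LIMSEQ_Suc[OF lim_const_over_n]])
    then show ?thesis unfolding h_def using tendsto_mult[OF _ tendsto_const[of "e x"]] c(2) by fastforce
  qed
  have "(\<lambda>n. \<integral>x. complex_of_real ((deriv ^^ k) (h n) x) * f x \<partial>lborel) \<longlonglongrightarrow> (\<integral>x. complex_of_real ((deriv ^^ k) e x) * f x \<partial>lborel)"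
  proof (rule integral_dominated_convergence)
    show "integrable lborel (\<lambda>x. C * norm (f x))" using f by simp
    show "AE x in lborel. (\<lambda>n. complex_of_real ((deriv ^^ k) (h n) x) * f x) \<longlonglongrightarrow> complex_of_real ((deriv ^^ k) e x) * f x"
      by (intro AE_I2 tendsto_mult tendsto_of_real l tendsto_const)
    show "AE x in lborel. norm (complex_of_real ((deriv ^^ k) (h n) x) * f x) \<le> C * norm (f x)" for n
      by (intro AE_I2) (auto simp: norm_mult C mult_right_mono)
  qed measurable
  moreover have "(\<lambda>n. (-1) ^ k * (\<integral>x. complex_of_real (h n x) * g x \<partial>lborel)) \<longlonglongrightarrow> (-1) ^ k * (\<integral>x. complex_of_real (e x) * g x \<partial>lborel)"
  proof (intro tendsto_mult tendsto_const, rule integral_dominated_convergence)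
    show "integrable lborel (\<lambda>x. (C1 * C0) * norm (g x))" using g by simp
    show "AE x in lborel. (\<lambda>n. complex_of_real (h n x) * g x) \<longlonglongrightarrow> complex_of_real (e x) * g x"
      by (intro AE_I2 tendsto_mult tendsto_of_real l0 tendsto_const)
    show "AE x in lborel. norm (complex_of_real (h n x) * g x) \<le> (C1 * C0) * norm (g x)" for n
      by (intro AE_I2) (auto simp: norm_mult h_def abs_mult intro!: mult_right_mono mult_mono C1 b order.trans[OF abs_ge_zero C1])
  qed measurable
  moreover have "(\<integral>x. complex_of_real ((deriv ^^ k) (h n) x) * f x \<partial>lborel) = (-1) ^ k * (\<integral>x. complex_of_real (h n x) * g x \<partial>lborel)" for n
    using w te[of n] by (simp add: is_weak_deriv_def)
  ultimately show ?thesis by (simp add: LIMSEQ_unique)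
qed

text \<open>A weak derivative of order 0 is another representative of \<open>f\<close>. It is kept
  apart from \<open>f\<close> because \<open>sobolev_norm\<close> integrates a chosen weak
  derivative also in order 0.\<close>

lemma weak_deriv0_smooth:
  assumes "integrable lborel f" "is_weak_deriv 0 f g" "smooth e" and b: "\<And>x. \<bar>e x\<bar> \<le> C0"
  shows "(\<integral>x. complex_of_real (e x) * f x \<partial>lborel) = (\<integral>x. complex_of_real (e x) * g x \<partial>lborel)"
proof -
  have "(\<integral>x. complex_of_real ((deriv ^^ 0) e x) * f x \<partial>lborel) = (-1) ^ 0 * (\<integral>x. complex_of_real (e x) * g x \<partial>lborel)"
  proof (rule weak_deriv_limit[OF assms(1-3) _ b], intro conjI allI)
    fix c :: "real \<Rightarrow> real" assume c: "smooth c" "c 0 = 1" "\<And>x. \<bar>x\<bar> \<ge> 1 \<Longrightarrow> c x = 0"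
    obtain C1 where C1: "\<And>x. \<bar>c x\<bar> \<le> C1" using higher_deriv_bounded[OF c(1,3), of 0] by auto
    show "\<exists>C. \<forall>n x. \<bar>(deriv ^^ 0) (\<lambda>x. c (x / real (Suc n)) * e x) x\<bar> \<le> C"
      by (intro exI[of _ "C1 * C0"]) (auto simp: abs_mult intro!: mult_mono C1 b order.trans[OF abs_ge_zero C1])
    fix x
    have "(\<lambda>n. c (x / real (Suc n))) \<longlonglongrightarrow> c 0"
      by (rule isCont_tendsto_compose[OF DERIV_isCont[OF smooth_has_deriv[OF c(1)]] LIMSEQ_Suc[OF lim_const_over_n]])
    then show "(\<lambda>n. (deriv ^^ 0) (\<lambda>x. c (x / real (Suc n)) * e x) x) \<longlonglongrightarrow> (deriv ^^ 0) e x"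
      using tendsto_mult[OF _ tendsto_const[of "e x"]] c(2) by fastforce
  qed
  then show ?thesis by simp
qed

text \<open>Each derivative falling on the cutoff brings a factor 1 / (n + 1), so only the term with
  all three derivatives on \<open>e\<close> survives in the limit.\<close>

lemma weak_deriv3_smooth:
  assumes "integrable lborel f" "is_weak_deriv 3 f g" and s: "smooth e" and b: "\<And>k x. k \<le> 3 \<Longrightarrow> \<bar>(deriv ^^ k) e x\<bar> \<le> C0"
  shows "(\<integral>x. complex_of_real ((deriv ^^ 3) e x) * f x \<partial>lborel) = - (\<integral>x. complex_of_real (e x) * g x \<partial>lborel)"
proof -
  have b0: "\<bar>e x\<bar> \<le> C0" for x using b[of 0 x] by simp
  have C0: "C0 \<ge> 0" using order.trans[OF abs_ge_zero b0] .
  have "(\<integral>x. complex_of_real ((deriv ^^ 3) e x) * f x \<partial>lborel) = (-1) ^ 3 * (\<integral>x. complex_of_real (e x) * g x \<partial>lborel)"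
  proof (rule weak_deriv_limit[OF assms(1-3) _ b0], intro conjI)
    fix c :: "real \<Rightarrow> real" assume c: "smooth c" "c 0 = 1" "\<And>x. \<bar>x\<bar> \<ge> 1 \<Longrightarrow> c x = 0"
    have "\<forall>k. \<exists>C\<ge>0. \<forall>x. \<bar>(deriv ^^ k) c x\<bar> \<le> C" using higher_deriv_bounded[OF c(1,3)] by blast
    then obtain D where D: "\<And>k x. \<bar>(deriv ^^ k) c x\<bar> \<le> D k" "\<And>k. D k \<ge> 0" by metis
    define r where "r n = 1 / real (Suc n)" for n
    have r: "0 \<le> r n" "r n \<le> 1" for n by (auto simp: r_def)
    have r0: "r \<longlonglongrightarrow> 0" unfolding r_def by (rule LIMSEQ_Suc[OF lim_1_over_n])
    have sc: "smooth (\<lambda>x. c (r n * x))" for n using smooth_affine[OF c(1), of 1 "r n" 0] by simp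
    have e3: "(deriv ^^ 3) (\<lambda>x. c (x / real (Suc n)) * e x) = (\<lambda>x. r n ^ 3 * (deriv ^^ 3) c (r n * x) * e x
      + 3 * (r n ^ 2 * (deriv ^^ 2) c (r n * x) * (deriv ^^ 1) e x) + 3 * (r n ^ 1 * (deriv ^^ 1) c (r n * x) * (deriv ^^ 2) e x)
      + c (r n * x) * (deriv ^^ 3) e x)" for n
      using deriv3_mult_smooth[OF sc s, of n] higher_deriv_scaled[OF c(1), of 3 "r n"] higher_deriv_scaled[OF c(1), of 2 "r n"]
        higher_deriv_scaled[OF c(1), of 1 "r n"]
      by (simp add: r_def)
    have bd: "\<bar>r n ^ j * (deriv ^^ j) c y * (deriv ^^ i) e x\<bar> \<le> D j * C0" if "i \<le> 3" for n j i x y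
    proof -
      have "\<bar>r n ^ j * (deriv ^^ j) c y * (deriv ^^ i) e x\<bar> \<le> (1 * D j) * C0"
        unfolding abs_mult using r[of n] D(2)[of j] b[OF that, of x] by (intro mult_mono D) (auto intro!: power_le_one)
      then show ?thesis by simp
    qed
    show "\<exists>C. \<forall>n x. \<bar>(deriv ^^ 3) (\<lambda>x. c (x / real (Suc n)) * e x) x\<bar> \<le> C"
    proof (intro exI allI)
      fix n x
      show "\<bar>(deriv ^^ 3) (\<lambda>x. c (x / real (Suc n)) * e x) x\<bar> \<le> D 3 * C0 + 3 * (D 2 * C0) + 3 * (D 1 * C0) + D 0 * C0"
        unfolding e3 using bd[of 0 n 3 "r n * x" x] bd[of 1 n 2 "r n * x" x] bd[of 2 n 1 "r n * x" x] bd[of 3 n 0 "r n * x" x] by simp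
    qed
    show "\<forall>x. (\<lambda>n. (deriv ^^ 3) (\<lambda>x. c (x / real (Suc n)) * e x) x) \<longlonglongrightarrow> (deriv ^^ 3) e x"
    proof
      fix x
      have rx: "(\<lambda>n. r n * x) \<longlonglongrightarrow> 0" using tendsto_mult[OF r0 tendsto_const[of x]] by simp
      have cc: "(\<lambda>n. (deriv ^^ j) c (r n * x)) \<longlonglongrightarrow> (deriv ^^ j) c 0" for j
        by (rule isCont_tendsto_compose[OF _ rx]) (use smooth_has_deriv[OF smooth_higher_deriv[OF c(1)]] in \<open>blast intro: DERIV_isCont\<close>)
      have "(\<lambda>n. r n ^ 3 * (deriv ^^ 3) c (r n * x) * e x
      + 3 * (r n ^ 2 * (deriv ^^ 2) c (r n * x) * (deriv ^^ 1) e x) + 3 * (r n ^ 1 * (deriv ^^ 1) c (r n * x) * (deriv ^^ 2) e x)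
      + (deriv ^^ 0) c (r n * x) * (deriv ^^ 3) e x) \<longlonglongrightarrow> 0 ^ 3 * (deriv ^^ 3) c 0 * e x
      + 3 * (0 ^ 2 * (deriv ^^ 2) c 0 * (deriv ^^ 1) e x) + 3 * (0 ^ 1 * (deriv ^^ 1) c 0 * (deriv ^^ 2) e x)
      + (deriv ^^ 0) c 0 * (deriv ^^ 3) e x"
        by (intro tendsto_intros r0 cc)
      then show "(\<lambda>n. (deriv ^^ 3) (\<lambda>x. c (x / real (Suc n)) * e x) x) \<longlonglongrightarrow> (deriv ^^ 3) e x"
        unfolding e3 by (simp add: c(2))
    qed
  qed
  then show ?thesis by simp
qed

subsection \<open>Integrals of holomorphic functions along horizontal lines\<close>

text \<open>Taylor and resolvent expansions come with quadratic remainders, and these survive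
  integration; differentiation under an integral is carried out through this criterion.\<close>

lemma has_vector_derivative_quadratic:
  fixes F :: "real \<Rightarrow> 'a :: real_normed_vector"
  assumes "\<delta> > 0" and q: "\<And>t. \<bar>t - s\<bar> \<le> \<delta> \<Longrightarrow> norm (F t - F s - (t - s) *\<^sub>R D) \<le> K * (t - s)\<^sup>2"
  shows "(F has_vector_derivative D) (at s)"
  unfolding has_vector_derivative_def has_derivative_at2
proof (intro conjI)
  show "bounded_linear (\<lambda>x. x *\<^sub>R D)" by (rule bounded_linear_scaleR_left)
  show "((\<lambda>t. (1 / norm (t - s)) *\<^sub>R (F t - (F s + (t - s) *\<^sub>R D))) \<longlongrightarrow> 0) (at s)"
  proof (rule tendsto_norm_zero_cancel, rule tendsto_sandwich[of "\<lambda>_. 0" _ _ "\<lambda>t. \<bar>K\<bar> * \<bar>t - s\<bar>"])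
    show "((\<lambda>t. \<bar>K\<bar> * \<bar>t - s\<bar>) \<longlongrightarrow> 0) (at s)" by (auto intro!: tendsto_eq_intros)
    have "\<forall>\<^sub>F t in at s. \<bar>t - s\<bar> < \<delta> \<and> t \<noteq> s" using assms(1)
      by (auto simp: eventually_at dist_real_def)
    then show "\<forall>\<^sub>F t in at s. norm ((1 / norm (t - s)) *\<^sub>R (F t - (F s + (t - s) *\<^sub>R D))) \<le> \<bar>K\<bar> * \<bar>t - s\<bar>"
    proof eventually_elim
      case (elim t)
      have "norm (F t - (F s + (t - s) *\<^sub>R D)) \<le> K * (t - s)\<^sup>2" using q[of t] elim by (simp add: algebra_simps)
      also have "\<dots> \<le> \<bar>K\<bar> * (t - s)\<^sup>2" by (intro mult_right_mono) auto
      finally have le: "norm (F t - (F s + (t - s) *\<^sub>R D)) \<le> \<bar>K\<bar> * \<bar>t - s\<bar> * \<bar>t - s\<bar>"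
        by (simp add: power2_eq_square abs_mult_self_eq mult.assoc)
      have "norm ((1 / norm (t - s)) *\<^sub>R (F t - (F s + (t - s) *\<^sub>R D))) = norm (F t - (F s + (t - s) *\<^sub>R D)) / \<bar>t - s\<bar>"
        by simp
      also have "\<dots> \<le> \<bar>K\<bar> * \<bar>t - s\<bar>" using le elim by (subst pos_divide_le_eq) auto
      finally show ?case .
    qed
  qed auto
qed

text \<open>Captures what is used of a resolvent form, or of a difference of two. Height 2 leaves
  room: integrals run along lines of height at most 1, varying the height leads up to 4/3, and discs
  of radius \<open>Im z / 2\<close> around points of height at most 4/3 stay below 2.\<close>

locale halfplane_function =
  fixes h :: "complex \<Rightarrow> complex" and B :: real
  assumes hol: "h holomorphic_on {z. 0 < Im z}"
    and bound: "\<And>z. 0 < Im z \<Longrightarrow> Im z \<le> 2 \<Longrightarrow> cmod (h z) \<le> B / (Im z)\<^sup>2"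
begin

lemma open_uhp: "open {z. 0 < Im z}"
  by (simp add: open_halfspace_Im_gt)

lemma convex_strip: "convex {z. a \<le> Im z \<and> Im z \<le> b}"
proof -
  have "{z. a \<le> Im z \<and> Im z \<le> b} = {z. Im z \<ge> a} \<inter> {z. Im z \<le> b}" by auto
  then show ?thesis by (simp add: convex_Int convex_halfspace_Im_ge convex_halfspace_Im_le)
qed

abbreviation "H k \<equiv> (deriv ^^ k) h"

lemma H_hol: "H k holomorphic_on {z. 0 < Im z}"
  by (intro holomorphic_higher_deriv hol open_uhp)

lemma H_deriv: "0 < Im z \<Longrightarrow> (H k has_field_derivative H (Suc k) z) (at z)"
  using holomorphic_derivI[OF H_hol open_uhp, of z k] by simp

lemma B_nonneg: "B \<ge> 0"
  using order.trans[OF norm_ge_zero bound[of \<i>]] by simp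

text \<open>Cauchy's inequality on the disc of radius \<open>Im z / 2\<close>, on which imaginary
  parts are at least half of \<open>Im z\<close>; hence the factor 4.\<close>

lemma H_bound: assumes "0 < Im z" "Im z \<le> 4/3" shows "cmod (H k z) \<le> fact k * (4 * B / (Im z)\<^sup>2) / (Im z / 2) ^ k"
proof (rule Cauchy_inequality)
  have sub: "cball z (Im z / 2) \<subseteq> {z. 0 < Im z}"
  proof
    fix w assume "w \<in> cball z (Im z / 2)"
    then have "\<bar>Im z - Im w\<bar> \<le> Im z / 2" using abs_Im_le_cmod[of "z - w"] by (simp add: dist_norm)
    then have "Im z / 2 \<le> Im w" by (simp only: abs_diff_le_iff) linarith
    then show "w \<in> {z. 0 < Im z}" using assms by auto
  qed
  then show "h holomorphic_on ball z (Im z / 2)" using hol holomorphic_on_subset ball_subset_cball by blast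
  show "continuous_on (cball z (Im z / 2)) h" using sub hol holomorphic_on_imp_continuous_on holomorphic_on_subset by blast
  show "0 < Im z / 2" using assms by simp
  fix w assume "norm (z - w) = Im z / 2"
  then have "\<bar>Im z - Im w\<bar> \<le> Im z / 2" using abs_Im_le_cmod[of "z - w"] by simp
  then have w: "Im z / 2 \<le> Im w" "Im w \<le> 2" using assms by (simp_all only: abs_diff_le_iff) linarith+
  have "cmod (h w) \<le> B / (Im w)\<^sup>2" using bound w assms by auto
  also have "\<dots> \<le> B / (Im z / 2)\<^sup>2" using w assms B_nonneg by (intro divide_left_mono power_mono mult_pos_pos) auto
  finally show "cmod (h w) \<le> 4 * B / (Im z)\<^sup>2" by (simp add: power_divide mult.commute)
qed

lemma H_bound_unif: "0 < y \<Longrightarrow> y \<le> Im z \<Longrightarrow> Im z \<le> 4/3 \<Longrightarrow> cmod (H k z) \<le> fact k * (4 * B / y\<^sup>2) / (y / 2) ^ k"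
proof -
  assume y: "0 < y" "y \<le> Im z" "Im z \<le> 4/3"
  have "cmod (H k z) \<le> fact k * (4 * B / (Im z)\<^sup>2) / (Im z / 2) ^ k" using y by (intro H_bound) auto
  also have "\<dots> \<le> fact k * (4 * B / y\<^sup>2) / (y / 2) ^ k"
  proof (rule frac_le)
    show "fact k * (4 * B / (Im z)\<^sup>2) \<le> fact k * (4 * B / y\<^sup>2)"
      using y B_nonneg by (intro mult_left_mono divide_left_mono power_mono mult_pos_pos) auto
    show "(y / 2) ^ k \<le> (Im z / 2) ^ k" using y by (intro power_mono) auto
  qed (use y B_nonneg in auto)
  finally show ?thesis .
qed

lemma H_line_measurable [measurable]: "0 < y \<Longrightarrow> (\<lambda>x. H k (Complex x y)) \<in> borel_measurable borel"
proof -
  assume "0 < y"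
  have "continuous_on UNIV (\<lambda>x. Complex x y)" unfolding Complex_eq by (intro continuous_intros)
  then have "continuous_on UNIV (\<lambda>x. H k (Complex x y))"
    by (rule continuous_on_compose2[OF holomorphic_on_imp_continuous_on[OF H_hol]]) (use \<open>0 < y\<close> in auto)
  then show ?thesis by (rule borel_measurable_continuous_onI)
qed

definition L :: "(real \<Rightarrow> complex) \<Rightarrow> nat \<Rightarrow> real \<Rightarrow> complex" where
  "L f k y = (\<integral>x. f x * H k (Complex x y) \<partial>lborel)"

lemma L_integrable:
  assumes f: "integrable lborel f" and y: "0 < y" "y \<le> 4/3"
  shows "integrable lborel (\<lambda>x. f x * H k (Complex x y))"
proof (rule Bochner_Integration.integrable_bound)
  define C where "C = fact k * (4 * B / y\<^sup>2) / (y / 2) ^ k"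
  show "integrable lborel (\<lambda>x. C * norm (f x))" using f by simp
  have [measurable]: "f \<in> borel_measurable borel" using f by auto
  show "(\<lambda>x. f x * H k (Complex x y)) \<in> borel_measurable lborel" using y(1) by measurable
  have "norm (f x * H k (Complex x y)) \<le> C * norm (f x)" for x
    unfolding norm_mult using H_bound_unif[of y "Complex x y" k] y
    by (subst mult.commute) (intro mult_right_mono, auto simp: C_def)
  then show "AE x in lborel. norm (f x * H k (Complex x y)) \<le> norm (C * norm (f x))"
    by (intro AE_I2) (metis abs_ge_self order.trans real_norm_def)
qed

lemma L_bound:
  assumes "integrable lborel f" "0 < y" "y \<le> 4/3" and K: "\<And>x. cmod (H k (Complex x y)) \<le> K"
  shows "cmod (L f k y) \<le> K * (\<integral>x. norm (f x) \<partial>lborel)"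
proof -
  have "cmod (L f k y) \<le> (\<integral>x. K * norm (f x) \<partial>lborel)"
    unfolding L_def using assms(1) by (intro Bochner_Integration.integral_norm_bound_integral L_integrable assms(1-3)) (auto simp: norm_mult mult.commute[of K] intro!: mult_left_mono K)
  then show ?thesis by simp
qed

text \<open>Differentiating a holomorphic function in the vertical direction gives
  \<open>\<i>\<close> times its complex derivative. The Taylor remainder is bounded uniformly in x
  and can be integrated against \<open>f\<close>.\<close>

lemma L_deriv:
  assumes f: "integrable lborel f" and y: "0 < y" "y \<le> 1"
  shows "(L f k has_vector_derivative \<i> * L f (Suc k) y) (at y)"
proof (rule has_vector_derivative_quadratic)
  \<comment> \<open>A change of height by y / 3 stays above y / 2 and, as y \<le> 1, below
    4/3.\<close>
  show "y / 3 > 0" using y by simp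
  define K where "K = fact (Suc (Suc k)) * (4 * B / (y/2)\<^sup>2) / (y/2 / 2) ^ (Suc (Suc k))"
  fix t assume t: "\<bar>t - y\<bar> \<le> y / 3"
  then have t': "y / 2 \<le> t" "t \<le> 4/3" "0 < t" using y by (simp_all only: abs_diff_le_iff) linarith+
  have pt: "cmod (H k (Complex x t) - H k (Complex x y) - of_real (t - y) * (\<i> * H (Suc k) (Complex x y))) \<le> K * (t - y)\<^sup>2" for x
  proof -
    let ?S = "{z. y / 2 \<le> Im z \<and> Im z \<le> 4/3}"
    have ty: "cmod (H (k + 0) (Complex x t) - (\<Sum>i\<le>1. H (k + i) (Complex x y) * (Complex x t - Complex x y) ^ i / fact i))
       \<le> K * cmod (Complex x t - Complex x y) ^ Suc 1 / fact 1"
    proof (rule complex_Taylor[OF convex_strip[of "y/2" "4/3"], of 1 "\<lambda>i. H (k + i)"])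
      show "(H (k + i) has_field_derivative H (k + Suc i) z) (at z within ?S)" if "z \<in> ?S" for i z
        using H_deriv[of z "k + i"] that y by (auto intro: DERIV_subset)
      show "cmod (H (k + Suc 1) z) \<le> K" if "z \<in> ?S" for z
        unfolding K_def using H_bound_unif[of "y/2" z "k + Suc 1"] that y by simp
    qed (use t' y in auto)
    have c: "Complex x t - Complex x y = \<i> * of_real (t - y)" by (simp add: complex_eq_iff)
    have n: "cmod (Complex x t - Complex x y) = \<bar>t - y\<bar>" unfolding c norm_mult norm_of_real by simp
    have s: "(\<Sum>i\<le>1. H (k + i) (Complex x y) * (Complex x t - Complex x y) ^ i / fact i)
       = H k (Complex x y) + H (Suc k) (Complex x y) * (\<i> * of_real (t - y))" unfolding c by simp
    have fr_sum: "K * \<bar>t - y\<bar> ^ Suc 1 / fact 1 = K * (t - y)\<^sup>2" by (simp add: power2_eq_square flip: abs_mult)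
    have e: "H k (Complex x t) - H k (Complex x y) - of_real (t - y) * (\<i> * H (Suc k) (Complex x y))
      = H (k + 0) (Complex x t) - (H k (Complex x y) + H (Suc k) (Complex x y) * (\<i> * of_real (t - y)))" by (simp add: algebra_simps)
    show ?thesis unfolding e using ty unfolding s n fr_sum .
  qed
  have "L f k t - L f k y - (t - y) *\<^sub>R (\<i> * L f (Suc k) y)
     = (\<integral>x. f x * H k (Complex x t) \<partial>lborel) - (\<integral>x. f x * H k (Complex x y) \<partial>lborel) - (\<integral>x. (of_real (t - y) * \<i>) * (f x * H (Suc k) (Complex x y)) \<partial>lborel)"
    unfolding L_def by (simp add: scaleR_conv_of_real)
  also have "\<dots> = (\<integral>x. f x * H k (Complex x t) - f x * H k (Complex x y) - (of_real (t - y) * \<i>) * (f x * H (Suc k) (Complex x y)) \<partial>lborel)"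
  proof -
    have i1: "integrable lborel (\<lambda>x. f x * H k (Complex x t))" by (rule L_integrable[OF f t'(3,2)])
    have i2: "integrable lborel (\<lambda>x. f x * H k (Complex x y))" by (rule L_integrable[OF f y(1)]) (use y in simp)
    have i3: "integrable lborel (\<lambda>x. (of_real (t - y) * \<i>) * (f x * H (Suc k) (Complex x y)))"
      by (rule integrable_mult_right, rule L_integrable[OF f y(1)]) (use y in simp)
    note i = i1 i2 i3
    show ?thesis
      by (simp only: Bochner_Integration.integral_diff[OF Bochner_Integration.integrable_diff[OF i(1,2)] i(3)] Bochner_Integration.integral_diff[OF i(1,2)])
  qed
  also have "\<dots> = (\<integral>x. f x * (H k (Complex x t) - H k (Complex x y) - of_real (t - y) * (\<i> * H (Suc k) (Complex x y))) \<partial>lborel)"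
    by (intro Bochner_Integration.integral_cong) (auto simp: algebra_simps)
  finally have eq: "L f k t - L f k y - (t - y) *\<^sub>R (\<i> * L f (Suc k) y) = \<dots>" .
  have "norm (\<integral>x. f x * (H k (Complex x t) - H k (Complex x y) - of_real (t - y) * (\<i> * H (Suc k) (Complex x y))) \<partial>lborel)
     \<le> (\<integral>x. (K * (t - y)\<^sup>2) * norm (f x) \<partial>lborel)"
  proof (rule Bochner_Integration.integral_norm_bound_integral)
    have e: "f x * (H k (Complex x t) - H k (Complex x y) - of_real (t - y) * (\<i> * H (Suc k) (Complex x y)))
      = f x * H k (Complex x t) - f x * H k (Complex x y) - (of_real (t - y) * \<i>) * (f x * H (Suc k) (Complex x y))" for x
      by (simp add: algebra_simps)
    show "integrable lborel (\<lambda>x. f x * (H k (Complex x t) - H k (Complex x y) - of_real (t - y) * (\<i> * H (Suc k) (Complex x y))))"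
      unfolding e using f y t' by (intro Bochner_Integration.integrable_diff L_integrable integrable_mult_right) auto
    show "integrable lborel (\<lambda>x. (K * (t - y)\<^sup>2) * norm (f x))" using f by simp
    show "norm (f x * (H k (Complex x t) - H k (Complex x y) - of_real (t - y) * (\<i> * H (Suc k) (Complex x y)))) \<le> (K * (t - y)\<^sup>2) * norm (f x)" for x
      unfolding norm_mult by (subst mult.commute) (intro mult_right_mono pt norm_ge_zero)
  qed
  then show "norm (L f k t - L f k y - (t - y) *\<^sub>R (\<i> * L f (Suc k) y)) \<le> (K * (\<integral>x. norm (f x) \<partial>lborel)) * (t - y)\<^sup>2"
    unfolding eq by (simp add: mult_ac)
qed

text \<open>Test functions are real, so real and imaginary parts are treated separately. Along a
  horizontal line the real derivative is the complex one, hence the family of all \<open>H k\<close>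
  is closed under differentiation.\<close>

lemma line_smooth: assumes "0 < y"
  shows "smooth (\<lambda>x. Re (H k (Complex x y)))" "smooth (\<lambda>x. Im (H k (Complex x y)))"
    "(deriv ^^ j) (\<lambda>x. Re (H k (Complex x y))) = (\<lambda>x. Re (H (j + k) (Complex x y)))"
    "(deriv ^^ j) (\<lambda>x. Im (H k (Complex x y))) = (\<lambda>x. Im (H (j + k) (Complex x y)))"
proof -
  have d: "((\<lambda>x. H k (Complex x y)) has_vector_derivative H (Suc k) (Complex x y)) (at x)" for k x
  proof -
    have "((\<lambda>x. of_real x + \<i> * of_real y) has_vector_derivative 1) (at x)" by (auto intro!: derivative_eq_intros)
    then have *: "((\<lambda>x. Complex x y) has_vector_derivative 1) (at x)" by (simp add: Complex_eq)
    show ?thesis using field_vector_diff_chain_at[OF * H_deriv[of "Complex x y" k]] assms by (simp add: o_def)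
  qed
  have dr: "((\<lambda>x. Re (H k (Complex x y))) has_real_derivative Re (H (Suc k) (Complex x y))) (at x)"
   and di: "((\<lambda>x. Im (H k (Complex x y))) has_real_derivative Im (H (Suc k) (Complex x y))) (at x)" for k x
    using bounded_linear.has_vector_derivative[OF bounded_linear_Re d] bounded_linear.has_vector_derivative[OF bounded_linear_Im d]
    by (simp_all add: has_real_derivative_iff_has_vector_derivative)
  show "smooth (\<lambda>x. Re (H k (Complex x y)))"
    by (rule smooth_coinduct[of "\<lambda>f. \<exists>k. f = (\<lambda>x. Re (H k (Complex x y)))"]) (use dr in blast)+
  show "smooth (\<lambda>x. Im (H k (Complex x y)))"
    by (rule smooth_coinduct[of "\<lambda>f. \<exists>k. f = (\<lambda>x. Im (H k (Complex x y)))"]) (use di in blast)+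
  show "(deriv ^^ j) (\<lambda>x. Re (H k (Complex x y))) = (\<lambda>x. Re (H (j + k) (Complex x y)))"
    by (induction j) (auto intro!: DERIV_imp_deriv dr[simplified])
  show "(deriv ^^ j) (\<lambda>x. Im (H k (Complex x y))) = (\<lambda>x. Im (H (j + k) (Complex x y)))"
    by (induction j) (auto intro!: DERIV_imp_deriv di[simplified])
qed

lemma L_split:
  assumes "integrable lborel f" "0 < y" "y \<le> 4/3"
  shows "L f k y = (\<integral>x. of_real (Re (H k (Complex x y))) * f x \<partial>lborel) + \<i> * (\<integral>x. of_real (Im (H k (Complex x y))) * f x \<partial>lborel)"
proof -
  have [measurable]: "f \<in> borel_measurable borel" using assms(1) by auto
  have e: "f x * H k (Complex x y) = of_real (Re (H k (Complex x y))) * f x + \<i> * (of_real (Im (H k (Complex x y))) * f x)" for x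
    by (subst complex_eq[of "H k (Complex x y)"]) (simp only: algebra_simps)
  have "integrable lborel (\<lambda>x. of_real (Re (H k (Complex x y))) * f x)" "integrable lborel (\<lambda>x. of_real (Im (H k (Complex x y))) * f x)"
    by (rule Bochner_Integration.integrable_bound[OF L_integrable[OF assms, of k]];
        use assms in \<open>auto simp: norm_mult mult.commute abs_Re_le_cmod abs_Im_le_cmod intro!: mult_left_mono\<close>)+
  then show ?thesis unfolding L_def e by simp
qed

lemma L_weak0:
  assumes f: "integrable lborel f" and w: "is_weak_deriv 0 f g" and y: "0 < y" "y \<le> 1"
  shows "L f k y = L g k y"
proof -
  have g: "integrable lborel g" using w by (simp add: is_weak_deriv_def)
  define C where "C = fact k * (4 * B / y\<^sup>2) / (y / 2) ^ k"
  have "\<bar>Re (H k (Complex x y))\<bar> \<le> C" "\<bar>Im (H k (Complex x y))\<bar> \<le> C" for x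
    using H_bound[of "Complex x y" k] y abs_Re_le_cmod[of "H k (Complex x y)"] abs_Im_le_cmod[of "H k (Complex x y)"] unfolding C_def by auto
  note wd = weak_deriv0_smooth[OF f w line_smooth(1)[OF y(1)] this(1)] weak_deriv0_smooth[OF f w line_smooth(2)[OF y(1)] this(2)]
  show ?thesis using L_split[OF f y(1)] L_split[OF g y(1)] y wd by simp
qed

text \<open>Along the line the complex derivatives of \<open>h\<close> are real derivatives in x, so
  all three can be moved to \<open>f\<close>, with the sign \<open>(-1) ^ 3\<close>.\<close>

lemma L_weak3:
  assumes f: "integrable lborel f" and w: "is_weak_deriv 3 f g" and y: "0 < y" "y \<le> 1"
  shows "L f 3 y = - L g 0 y"
proof -
  have g: "integrable lborel g" using w by (simp add: is_weak_deriv_def)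
  define C where "C k = fact k * (4 * B / y\<^sup>2) / (y / 2) ^ k" for k :: nat
  have C: "\<bar>Re (H k (Complex x y))\<bar> \<le> Max (C ` {..3})" "\<bar>Im (H k (Complex x y))\<bar> \<le> Max (C ` {..3})" if "k \<le> 3" for x k
  proof -
    have "C k \<le> Max (C ` {..3})" using that by (intro Max_ge) auto
    then show "\<bar>Re (H k (Complex x y))\<bar> \<le> Max (C ` {..3})" "\<bar>Im (H k (Complex x y))\<bar> \<le> Max (C ` {..3})"
      using H_bound[of "Complex x y" k] y abs_Re_le_cmod[of "H k (Complex x y)"] abs_Im_le_cmod[of "H k (Complex x y)"] unfolding C_def by auto
  qed
  have wd: "(\<integral>x. complex_of_real ((deriv ^^ 3) (\<lambda>x. Re (H 0 (Complex x y))) x) * f x \<partial>lborel) = - (\<integral>x. complex_of_real (Re (H 0 (Complex x y))) * g x \<partial>lborel)"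
    "(\<integral>x. complex_of_real ((deriv ^^ 3) (\<lambda>x. Im (H 0 (Complex x y))) x) * f x \<partial>lborel) = - (\<integral>x. complex_of_real (Im (H 0 (Complex x y))) * g x \<partial>lborel)"
    by (rule weak_deriv3_smooth[OF f w line_smooth(1)[OF y(1)], where ?C0.0 = "Max (C ` {..3})"]; unfold line_smooth[OF y(1)]; use C in simp)
       (rule weak_deriv3_smooth[OF f w line_smooth(2)[OF y(1)], where ?C0.0 = "Max (C ` {..3})"]; unfold line_smooth[OF y(1)]; use C in simp)
  show ?thesis using L_split[OF f y(1), of 3] L_split[OF g y(1), of 0] y wd unfolding line_smooth[OF y(1)] by simp
qed

text \<open>The descent from height 1 to height y, with \<open>p\<close> a primitive of the
  bound.\<close>

lemma integrate_derivative_bound: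
  fixes F :: "real \<Rightarrow> complex"
  assumes F: "\<And>t. 0 < t \<Longrightarrow> t \<le> 1 \<Longrightarrow> (F has_vector_derivative F' t) (at t)"
    and P: "\<And>t. 0 < t \<Longrightarrow> t \<le> 1 \<Longrightarrow> (p has_vector_derivative p' t) (at t)"
    and b: "\<And>t. 0 < t \<Longrightarrow> t \<le> 1 \<Longrightarrow> cmod (F' t) \<le> p' t" and y: "0 < y" "y \<le> 1"
  shows "cmod (F y) \<le> cmod (F 1) + p 1 - p y"
proof (cases "y = 1")
  case False
  have c: "continuous_on {y..1} F" "continuous_on {y..1} p"
    using y by (auto intro!: continuous_at_imp_continuous_on has_vector_derivative_continuous[OF F] has_vector_derivative_continuous[OF P])
  have "norm (F 1 - F y) \<le> p 1 - p y"
    by (rule differentiable_bound_general[OF _ c F P b]) (use False y in auto)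
  then show ?thesis using norm_triangle_sub[of "F y" "F 1"] by (simp add: norm_minus_commute)
qed auto

text \<open>At height 1, Cauchy's inequality bounds the integrals with derivatives of order 0, 1 and
  2 by 4 a, 8 a and 32 a, which add up to the constant 44; the singular part with b comes from the
  third order alone. Stopping after two integrations would leave a logarithm of the height, hence
  three derivatives.\<close>

theorem line_integral_bound:
  assumes f: "integrable lborel f" and w0: "is_weak_deriv 0 f g0" and w3: "is_weak_deriv 3 f g3" and y: "0 < y" "y \<le> 1"
  shows "cmod (\<integral>x. f x * h (Complex x y) \<partial>lborel) \<le> 44 * B * ((\<integral>x. norm (g0 x) \<partial>lborel) + (\<integral>x. norm (g3 x) \<partial>lborel))"
proof -
  define a where "a = B * (\<integral>x. norm (g0 x) \<partial>lborel)"
  define b where "b = B * (\<integral>x. norm (g3 x) \<partial>lborel)"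
  have g: "integrable lborel g0" "integrable lborel g3" using w0 w3 by (simp_all add: is_weak_deriv_def)
  have ab: "a \<ge> 0" "b \<ge> 0" unfolding a_def b_def using B_nonneg by auto
  have one: "cmod (L f k 1) \<le> fact k * (4 * 2 ^ k) * a" for k
  proof -
    have "cmod (L g0 k 1) \<le> (fact k * (4 * B / 1\<^sup>2) / (1 / 2) ^ k) * (\<integral>x. norm (g0 x) \<partial>lborel)"
      by (rule L_bound[OF g(1)]) (use H_bound_unif[of 1] in auto)
    then show ?thesis using L_weak0[OF f w0, of 1 k] by (simp add: a_def field_simps)
  qed
  have three: "cmod (L f 3 t) \<le> b / t\<^sup>2" if "0 < t" "t \<le> 1" for t
  proof -
    have "cmod (L g3 0 t) \<le> (B / t\<^sup>2) * (\<integral>x. norm (g3 x) \<partial>lborel)"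
      by (rule L_bound[OF g(2)]) (use that bound[of "Complex _ t"] in auto)
    then show ?thesis using L_weak3[OF f w3 that] by (simp add: b_def)
  qed
  have two: "cmod (L f 2 t) \<le> 32 * a + b / t" if "0 < t" "t \<le> 1" for t
  proof -
    have "cmod (L f 2 t) \<le> cmod (L f 2 1) + (- b / 1) - (- b / t)"
    proof (rule integrate_derivative_bound[OF L_deriv[OF f] _ _ that, where p = "\<lambda>t. - b / t" and p' = "\<lambda>t. b / t\<^sup>2"])
      fix t :: real assume t: "0 < t" "t \<le> 1"
      show "((\<lambda>t. - b / t) has_vector_derivative b / t\<^sup>2) (at t)"
        unfolding has_real_derivative_iff_has_vector_derivative[symmetric]
        using t by (auto intro!: derivative_eq_intros simp: power2_eq_square)
      show "cmod (\<i> * L f (Suc 2) t) \<le> b / t\<^sup>2" using three[OF t] by (simp add: norm_mult numeral_3_eq_3 numeral_2_eq_2)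
    qed
    then show ?thesis using one[of 2] ab by (simp add: fact_2)
  qed
  have oneb: "cmod (L f 1 t) \<le> 40 * a - b * ln t" if "0 < t" "t \<le> 1" for t
  proof -
    have "cmod (L f 1 t) \<le> cmod (L f 1 1) + (32 * a * 1 + b * ln 1) - (32 * a * t + b * ln t)"
    proof (rule integrate_derivative_bound[OF L_deriv[OF f] _ _ that, where p = "\<lambda>t. 32 * a * t + b * ln t" and p' = "\<lambda>t. 32 * a + b / t"])
      fix t :: real assume t: "0 < t" "t \<le> 1"
      show "((\<lambda>t. 32 * a * t + b * ln t) has_vector_derivative 32 * a + b / t) (at t)"
        unfolding has_real_derivative_iff_has_vector_derivative[symmetric]
        using t by (auto intro!: derivative_eq_intros)
      show "cmod (\<i> * L f (Suc 1) t) \<le> 32 * a + b / t" using two[OF t] by (simp add: norm_mult numeral_2_eq_2)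
    qed
    moreover have "0 \<le> a * t" using ab that by simp
    ultimately show ?thesis using one[of 1] by simp
  qed
  have "cmod (L f 0 y) \<le> cmod (L f 0 1) + (40 * a * 1 - b * (1 * ln 1 - 1)) - (40 * a * y - b * (y * ln y - y))"
  proof (rule integrate_derivative_bound[OF L_deriv[OF f] _ _ y, where p = "\<lambda>t. 40 * a * t - b * (t * ln t - t)" and p' = "\<lambda>t. 40 * a - b * ln t"])
    fix t :: real assume t: "0 < t" "t \<le> 1"
    show "((\<lambda>t. 40 * a * t - b * (t * ln t - t)) has_vector_derivative 40 * a - b * ln t) (at t)"
      unfolding has_real_derivative_iff_has_vector_derivative[symmetric]
      using t by (auto intro!: derivative_eq_intros simp: field_simps)
    show "cmod (\<i> * L f (Suc 0) t) \<le> 40 * a - b * ln t" using oneb[OF t] by (simp add: norm_mult)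
  qed
  moreover have "y * ln y \<le> 0" using y by (intro mult_nonneg_nonpos) auto
  then have "y * ln y - y \<le> 0" using y by linarith
  then have "b * (y * ln y - y) \<le> 0" using ab by (intro mult_nonneg_nonpos)
  moreover have "0 \<le> a * y" using ab y by simp
  ultimately have "cmod (L f 0 y) \<le> 44 * a + b" using one[of 0] by simp
  also have "\<dots> \<le> 44 * (a + b)" using ab by simp
  finally show ?thesis by (simp add: L_def a_def b_def algebra_simps)
qed

end

subsection \<open>The Poisson kernel\<close>

lemma inverse_1_plus_square_integral:
  "integrable lborel (\<lambda>u::real. inverse (1 + u\<^sup>2))" "(\<integral>u. inverse (1 + u\<^sup>2) \<partial>lborel) = pi"
  using integrable_inverse_1_plus_square LBINT_inverse_1_plus_square
  by (simp_all add: set_integrable_def interval_lebesgue_integral_def set_lebesgue_integral_def einterval_def)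

text \<open>Boundedness of \<open>f\<close> is not among the hypotheses, so \<open>f\<close> is cut
  at distance 1 from l. Near l it is bounded, and after the substitution x = l + Y u the kernel
  becomes the fixed function 1 / (1 + u^2); farther away the kernel is at most Y, and integrability
  of \<open>f\<close> suffices.\<close>

lemma poisson_limit:
  fixes f :: "real \<Rightarrow> complex"
  assumes cont: "continuous_on UNIV f" and int: "integrable lborel f"
    and Y: "\<And>n. Y n > 0" "Y \<longlonglongrightarrow> 0"
  shows "(\<lambda>n. \<integral>x. f x * of_real (Y n / ((x - l)\<^sup>2 + (Y n)\<^sup>2)) \<partial>lborel) \<longlonglongrightarrow> pi * f l"
proof -
  have [measurable]: "f \<in> borel_measurable borel" using int by auto
  let ?I = "{l - 1..l + 1}"
  let ?P = "\<lambda>n x. Y n / ((x - l)\<^sup>2 + (Y n)\<^sup>2)"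
  have "compact (f ` ?I)" by (intro compact_continuous_image continuous_on_subset[OF cont]) auto
  then obtain K where K: "\<And>x. x \<in> ?I \<Longrightarrow> cmod (f x) \<le> K" by (force dest!: compact_imp_bounded simp: bounded_iff)
  have K0: "K \<ge> 0" using order.trans[OF norm_ge_zero K[of l]] by simp
  have Ppos: "0 < (x - l)\<^sup>2 + (Y n)\<^sup>2" for x n using Y(1)[of n] by (simp add: add_nonneg_pos)
  have Ple: "?P n x \<le> 1 / Y n" for x n
  proof -
    have "Y n / ((x - l)\<^sup>2 + (Y n)\<^sup>2) \<le> Y n / (Y n)\<^sup>2" using Y(1)[of n] by (intro divide_left_mono mult_pos_pos Ppos) auto
    then show ?thesis using Y(1)[of n] by (simp add: power2_eq_square)
  qed
  have ip: "integrable lborel (\<lambda>x. g x * of_real (?P n x))" if g: "integrable lborel g" for n and g :: "real \<Rightarrow> complex"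
  proof (rule Bochner_Integration.integrable_bound)
    show "integrable lborel (\<lambda>x. (1 / Y n) * norm (g x))" using g by simp
    have [measurable]: "g \<in> borel_measurable borel" using g by auto
    show "(\<lambda>x. g x * of_real (?P n x)) \<in> borel_measurable lborel" by measurable
    have "norm (g x * of_real (?P n x)) \<le> (1 / Y n) * norm (g x)" for x
    proof -
      have "0 \<le> ?P n x" using Y(1)[of n] Ppos[of x n] by simp
      then show ?thesis unfolding norm_mult norm_of_real using Ple[of n x] by (subst mult.commute) (intro mult_right_mono, auto)
    qed
    then show "AE x in lborel. norm (g x * of_real (?P n x)) \<le> norm ((1 / Y n) * norm (g x))"
      by (intro AE_I2) (metis abs_ge_self order.trans real_norm_def)
  qed
  define g where "g = (\<lambda>x. f x * indicator ?I x)"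
  define r where "r = (\<lambda>x. f x * indicator (- ?I) x)"
  have gi: "integrable lborel g" and ri: "integrable lborel r" unfolding g_def r_def
    by (rule Bochner_Integration.integrable_bound[OF int]; auto simp: norm_mult indicator_def)+
  have [measurable]: "g \<in> borel_measurable borel" using gi by auto
  have gK: "cmod (g x) \<le> K" for x using K[of x] K0 by (auto simp: g_def indicator_def)
  have eq: "(\<integral>x. f x * of_real (?P n x) \<partial>lborel) = (\<integral>u. g (l + Y n * u) * of_real (inverse (1 + u\<^sup>2)) \<partial>lborel) + (\<integral>x. r x * of_real (?P n x) \<partial>lborel)" for n
  proof -
    have "(\<integral>x. f x * of_real (?P n x) \<partial>lborel) = (\<integral>x. g x * of_real (?P n x) + r x * of_real (?P n x) \<partial>lborel)"
      by (intro Bochner_Integration.integral_cong) (auto simp: g_def r_def indicator_def)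
    also have "\<dots> = (\<integral>x. g x * of_real (?P n x) \<partial>lborel) + (\<integral>x. r x * of_real (?P n x) \<partial>lborel)"
      by (intro Bochner_Integration.integral_add ip gi ri)
    also have "(\<integral>x. g x * of_real (?P n x) \<partial>lborel) = \<bar>Y n\<bar> *\<^sub>R (\<integral>u. g (l + Y n * u) * of_real (?P n (l + Y n * u)) \<partial>lborel)"
      using Y(1)[of n] by (subst lborel_integral_real_affine[of "Y n" _ l]) auto
    also have "\<dots> = (\<integral>u. \<bar>Y n\<bar> *\<^sub>R (g (l + Y n * u) * of_real (?P n (l + Y n * u))) \<partial>lborel)" by simp
    also have "\<dots> = (\<integral>u. g (l + Y n * u) * of_real (inverse (1 + u\<^sup>2)) \<partial>lborel)"
    proof (intro Bochner_Integration.integral_cong refl)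
      fix u
      have "(Y n * u)\<^sup>2 + (Y n)\<^sup>2 = (Y n)\<^sup>2 * (1 + u\<^sup>2)" by (simp add: algebra_simps power_mult_distrib)
      then have "Y n * ?P n (l + Y n * u) = inverse (1 + u\<^sup>2)" using Y(1)[of n] by (simp add: power2_eq_square inverse_eq_divide)
      then have "of_real (Y n) * complex_of_real (?P n (l + Y n * u)) = of_real (inverse (1 + u\<^sup>2))" by (simp only: of_real_mult[symmetric])
      then show "\<bar>Y n\<bar> *\<^sub>R (g (l + Y n * u) * of_real (?P n (l + Y n * u))) = g (l + Y n * u) * of_real (inverse (1 + u\<^sup>2))"
        using Y(1)[of n] by (simp add: scaleR_conv_of_real mult.left_commute del: of_real_divide of_real_inverse)
    qed
    finally show ?thesis .
  qed
  have "(\<lambda>n. \<integral>u. g (l + Y n * u) * of_real (inverse (1 + u\<^sup>2)) \<partial>lborel) \<longlonglongrightarrow> (\<integral>u. f l * of_real (inverse (1 + u\<^sup>2)) \<partial>lborel)"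
  proof (rule integral_dominated_convergence)
    show "integrable lborel (\<lambda>u::real. K * inverse (1 + u\<^sup>2))" by (intro integrable_mult_right inverse_1_plus_square_integral)
    show "AE u in lborel. norm (g (l + Y n * u) * of_real (inverse (1 + u\<^sup>2))) \<le> K * inverse (1 + u\<^sup>2)" for n
    proof (intro AE_I2)
      fix u :: real
      have "0 \<le> inverse (1 + u\<^sup>2)" by simp
      then show "norm (g (l + Y n * u) * of_real (inverse (1 + u\<^sup>2))) \<le> K * inverse (1 + u\<^sup>2)"
        unfolding norm_mult norm_of_real by (simp only: abs_of_nonneg) (intro mult_right_mono gK)
    qed
    show "AE u in lborel. (\<lambda>n. g (l + Y n * u) * of_real (inverse (1 + u\<^sup>2))) \<longlonglongrightarrow> f l * of_real (inverse (1 + u\<^sup>2))"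
    proof (intro AE_I2 tendsto_mult tendsto_const)
      fix u
      have lim: "(\<lambda>n. l + Y n * u) \<longlonglongrightarrow> l" using Y(2) by (auto intro!: tendsto_eq_intros)
      have "isCont f l" using cont by (simp add: continuous_on_eq_continuous_at)
      then have "(\<lambda>n. f (l + Y n * u)) \<longlonglongrightarrow> f l" by (rule isCont_tendsto_compose[OF _ lim])
      moreover have "\<forall>\<^sub>F n in sequentially. f (l + Y n * u) = g (l + Y n * u)"
        using tendstoD[OF lim, of 1] by (auto elim!: eventually_mono simp: g_def dist_real_def indicator_def abs_less_iff)
      ultimately show "(\<lambda>n. g (l + Y n * u)) \<longlonglongrightarrow> f l" by (rule Lim_transform_eventually)
    qed
  qed measurable
  also have "(\<integral>u. f l * of_real (inverse (1 + u\<^sup>2)) \<partial>lborel) = f l * of_real (\<integral>u. inverse (1 + u\<^sup>2) \<partial>lborel)"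
    by (simp only: integral_mult_right_zero integral_complex_of_real)
  also have "\<dots> = pi * f l" by (simp only: inverse_1_plus_square_integral(2) mult.commute)
  finally have l1: "(\<lambda>n. \<integral>u. g (l + Y n * u) * of_real (inverse (1 + u\<^sup>2)) \<partial>lborel) \<longlonglongrightarrow> pi * f l" .
  have "(\<lambda>n. \<integral>x. r x * of_real (?P n x) \<partial>lborel) \<longlonglongrightarrow> 0"
  proof (rule Lim_null_comparison)
    show "(\<lambda>n. Y n * (\<integral>x. norm (f x) \<partial>lborel)) \<longlonglongrightarrow> 0" using tendsto_mult[OF Y(2) tendsto_const] by simp
    have "norm (\<integral>x. r x * of_real (?P n x) \<partial>lborel) \<le> (\<integral>x. Y n * norm (f x) \<partial>lborel)" for n
    proof (rule Bochner_Integration.integral_norm_bound_integral[OF ip[OF ri]])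
      show "integrable lborel (\<lambda>x. Y n * norm (f x))" using int by simp
      fix x
      show "norm (r x * of_real (?P n x)) \<le> Y n * norm (f x)"
      proof (cases "x \<in> ?I")
        case False
        then have "1 \<le> \<bar>x - l\<bar>" by auto
        then have "1 \<le> (x - l)\<^sup>2" using one_le_power[of "\<bar>x - l\<bar>" 2] by simp
        then have S1: "1 \<le> (x - l)\<^sup>2 + (Y n)\<^sup>2" using zero_le_power2[of "Y n"] by linarith
        have "?P n x \<le> Y n / 1" by (rule divide_left_mono[OF S1]) (use Y(1)[of n] in linarith, use Ppos[of x n] in \<open>simp only: mult_1_right\<close>)
        moreover have "0 \<le> ?P n x" using Y(1)[of n] Ppos[of x n] by simp
        moreover have "norm (r x) = norm (f x)" using False by (simp add: r_def)
        ultimately show ?thesis unfolding norm_mult norm_of_real by (subst mult.commute) (intro mult_mono, auto)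
      qed (use Y(1)[of n] in \<open>auto simp: r_def\<close>)
    qed
    then show "\<forall>\<^sub>F n in sequentially. norm (\<integral>x. r x * of_real (?P n x) \<partial>lborel) \<le> Y n * (\<integral>x. norm (f x) \<partial>lborel)" by simp
  qed
  from tendsto_add[OF l1 this] show ?thesis unfolding eq by simp
qed

section \<open>Linear algebra in coordinates\<close>

text \<open>Vectors are represented by functions of which only the first \<open>d\<close> values matter; in contrast to
  carrier-based vectors they form a type, so that linearity needs no side conditions.\<close>

locale dim =
  fixes d :: nat
begin

definition ip :: "(nat \<Rightarrow> complex) \<Rightarrow> (nat \<Rightarrow> complex) \<Rightarrow> complex" where
  "ip x y = (\<Sum>i<d. x i * cnj (y i))"

definition nv :: "(nat \<Rightarrow> complex) \<Rightarrow> real" where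
  "nv x = L2_set (\<lambda>i. cmod (x i)) {..<d}"

text \<open>Components beyond the dimension are 0, so that linearity and composition hold as
  equalities of functions.\<close>

definition ap :: "complex mat \<Rightarrow> (nat \<Rightarrow> complex) \<Rightarrow> nat \<Rightarrow> complex" where
  "ap A x = (\<lambda>i. if i < d then \<Sum>j<d. A $$ (i, j) * x j else 0)"

text \<open>An entrywise bound for the operator norm, evidently measurable; it dominates integrands
  where the size of the bound does not matter.\<close>

definition fr :: "complex mat \<Rightarrow> real" where
  "fr A = (\<Sum>i<d. \<Sum>j<d. cmod (A $$ (i, j)))"

lemma ip_add_left: "ip (\<lambda>i. x i + y i) z = ip x z + ip y z"
  by (simp add: ip_def sum.distrib algebra_simps)
lemma ip_diff_left: "ip (\<lambda>i. x i - y i) z = ip x z - ip y z"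
  by (simp add: ip_def sum_subtractf algebra_simps)
lemma ip_mult_left: "ip (\<lambda>i. c * x i) z = c * ip x z"
  by (simp add: ip_def sum_distrib_left algebra_simps)
lemma ip_add_right: "ip z (\<lambda>i. x i + y i) = ip z x + ip z y"
  by (simp add: ip_def sum.distrib algebra_simps)
lemma ip_diff_right: "ip z (\<lambda>i. x i - y i) = ip z x - ip z y"
  by (simp add: ip_def sum_subtractf algebra_simps)
lemma ip_mult_right: "ip z (\<lambda>i. c * x i) = cnj c * ip z x"
  by (simp add: ip_def sum_distrib_left algebra_simps)

lemmas ip_simps = ip_add_left ip_diff_left ip_mult_left ip_add_right ip_diff_right ip_mult_right

lemma ip_cnj: "cnj (ip x y) = ip y x"
  by (simp add: ip_def mult.commute)

lemma ip_self: "ip x x = of_real ((nv x)\<^sup>2)"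
  by (simp add: ip_def nv_def L2_set_def sum_nonneg complex_norm_square[symmetric])

lemma nv_nonneg [simp]: "0 \<le> nv x" by (simp add: nv_def)

lemma nv_add: "nv (\<lambda>i. x i + y i) \<le> nv x + nv y"
proof -
  have "nv (\<lambda>i. x i + y i) \<le> L2_set (\<lambda>i. cmod (x i) + cmod (y i)) {..<d}"
    unfolding nv_def by (intro L2_set_mono norm_triangle_ineq) auto
  also have "\<dots> \<le> nv x + nv y" unfolding nv_def by (rule L2_set_triangle_ineq)
  finally show ?thesis .
qed

lemma nv_mult: "nv (\<lambda>i. c * x i) = cmod c * nv x"
  by (simp add: nv_def norm_mult L2_set_right_distrib)

lemma nv_diff: "nv (\<lambda>i. x i - y i) \<le> nv x + nv y"
  using nv_add[of x "\<lambda>i. - 1 * y i"] by (simp only: nv_mult) (simp add: norm_divide)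

lemma ip_cong: "(\<And>i. i < d \<Longrightarrow> x i = x' i) \<Longrightarrow> (\<And>i. i < d \<Longrightarrow> y i = y' i) \<Longrightarrow> ip x y = ip x' y'"
  by (simp add: ip_def)
lemma nv_cong: "(\<And>i. i < d \<Longrightarrow> x i = x' i) \<Longrightarrow> nv x = nv x'"
  by (simp add: nv_def L2_set_def)
lemma ap_cong: "(\<And>i. i < d \<Longrightarrow> x i = x' i) \<Longrightarrow> ap A x = ap A x'"
  by (simp add: ap_def fun_eq_iff)

lemma cauchy_schwarz: "cmod (ip x y) \<le> nv x * nv y"
proof -
  have "cmod (ip x y) \<le> (\<Sum>i<d. cmod (x i) * cmod (y i))"
    unfolding ip_def by (rule order.trans[OF norm_sum]) (simp add: norm_mult)
  also have "\<dots> \<le> nv x * nv y" unfolding nv_def by (rule order.trans[OF _ L2_set_mult_ineq]) simp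
  finally show ?thesis .
qed

lemma nv_eqI: "(nv x)\<^sup>2 = Re (ip x x)" by (simp add: ip_self)

lemma nv_le_if_ip_le:
  assumes "0 \<le> K" "\<And>y. cmod (ip x y) \<le> K * nv y" shows "nv x \<le> K"
proof (cases "nv x = 0")
  case False
  have "nv x * nv x \<le> K * nv x" using assms(2)[of x] by (simp add: ip_self power2_eq_square norm_mult)
  then show ?thesis using False nv_nonneg[of x] by (simp add: mult_le_cancel_right)
qed (use assms in auto)

lemma component_le_nv: "i < d \<Longrightarrow> cmod (x i) \<le> nv x"
  unfolding nv_def by (rule member_le_L2_set) auto

lemma nv_zero_iff: "nv x = 0 \<longleftrightarrow> (\<forall>i<d. x i = 0)"
  by (auto simp: nv_def L2_set_eq_0_iff)

lemma nv_const_zero [simp]: "nv (\<lambda>i. 0) = 0" by (simp add: nv_zero_iff)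

lemma ap_add: "ap A (\<lambda>i. x i + y i) = (\<lambda>i. ap A x i + ap A y i)"
  by (auto simp: ap_def sum.distrib algebra_simps)
lemma ap_diff: "ap A (\<lambda>i. x i - y i) = (\<lambda>i. ap A x i - ap A y i)"
  by (auto simp: ap_def sum_subtractf algebra_simps)
lemma ap_mult: "ap A (\<lambda>i. c * x i) = (\<lambda>i. c * ap A x i)"
  by (auto simp: ap_def sum_distrib_left algebra_simps)
lemmas ap_simps = ap_add ap_diff ap_mult

lemma ap_out: "\<not> i < d \<Longrightarrow> ap A x i = 0" by (simp add: ap_def)

lemma ap_lincomb: "(\<And>i j. i < d \<Longrightarrow> j < d \<Longrightarrow> C $$ (i, j) = A $$ (i, j) + c * B $$ (i, j)) \<Longrightarrow> ap C x = (\<lambda>i. ap A x i + c * ap B x i)"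
  by (auto simp: ap_def sum.distrib sum_distrib_left algebra_simps)

lemma nv_ap_fr: "nv (ap A x) \<le> fr A * nv x"
proof -
  have "nv (ap A x) \<le> (\<Sum>i<d. cmod (ap A x i))" unfolding nv_def by (rule L2_set_le_sum) auto
  also have "\<dots> \<le> (\<Sum>i<d. (\<Sum>j<d. cmod (A $$ (i, j))) * nv x)"
  proof (rule sum_mono)
    fix i assume "i \<in> {..<d}"
    then have "cmod (ap A x i) \<le> (\<Sum>j<d. cmod (A $$ (i, j)) * cmod (x j))"
      by (auto simp: ap_def norm_mult intro!: order.trans[OF norm_sum])
    also have "\<dots> \<le> (\<Sum>j<d. cmod (A $$ (i, j)) * nv x)" by (intro sum_mono mult_left_mono component_le_nv) auto
    finally show "cmod (ap A x i) \<le> (\<Sum>j<d. cmod (A $$ (i, j))) * nv x" by (simp add: sum_distrib_right)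
  qed
  also have "\<dots> = fr A * nv x" by (simp add: fr_def sum_distrib_right)
  finally show ?thesis .
qed

lemma fr_nonneg [simp]: "0 \<le> fr A" by (simp add: fr_def sum_nonneg)

subsection \<open>Relation to carrier-based vectors\<close>

lemma euclid_norm_eq: "v \<in> carrier_vec d \<Longrightarrow> euclid_norm v = nv (\<lambda>i. v $ i)"
  by (simp add: euclid_norm_def nv_def L2_set_def scalar_prod_def complex_norm_square[symmetric] lessThan_atLeast0 del: of_real_power flip: of_real_sum)

lemma cscalar_prod_eq: "v \<in> carrier_vec d \<Longrightarrow> w \<in> carrier_vec d \<Longrightarrow> v \<bullet>c w = ip (\<lambda>i. v $ i) (\<lambda>i. w $ i)"
  by (simp add: ip_def scalar_prod_def lessThan_atLeast0)

lemma mult_mat_vec_eq: "A \<in> carrier_mat d d \<Longrightarrow> v \<in> carrier_vec d \<Longrightarrow> i < d \<Longrightarrow> (A *\<^sub>v v) $ i = ap A (\<lambda>i. v $ i) i"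
  by (simp add: ap_def scalar_prod_def lessThan_atLeast0)

lemma euclid_norm_mult: "A \<in> carrier_mat d d \<Longrightarrow> v \<in> carrier_vec d \<Longrightarrow> euclid_norm (A *\<^sub>v v) = nv (ap A (\<lambda>i. v $ i))"
  by (subst euclid_norm_eq) (auto intro!: nv_cong simp: mult_mat_vec_eq simp del: index_mult_mat_vec)

lemma unit_vecs_vec: "nv x = 1 \<Longrightarrow> vec d x \<in> unit_vecs d"
  by (simp add: unit_vecs_def euclid_norm_eq nv_cong[of "\<lambda>i. vec d x $ i" x])

lemma unit_vecs_nv: "v \<in> unit_vecs d \<Longrightarrow> nv (\<lambda>i. v $ i) = 1"
  by (auto simp: unit_vecs_def euclid_norm_eq)

lemma nv_delta: "k < d \<Longrightarrow> nv (\<lambda>i. if i = k then 1 else 0) = 1"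
  by (simp add: nv_def L2_set_def if_distrib[of cmod] if_distrib[of "\<lambda>x. x\<^sup>2"] cong: if_cong)

lemma unit_vecs_nonempty: "0 < d \<Longrightarrow> unit_vecs d \<noteq> {}"
  using unit_vecs_vec[OF nv_delta[of 0]] by auto

lemma op_norm_bdd: "A \<in> carrier_mat d d \<Longrightarrow> bdd_above ((\<lambda>v. euclid_norm (A *\<^sub>v v)) ` unit_vecs d)"
proof (intro bdd_aboveI[of _ "fr A"], elim imageE)
  fix v r assume A: "A \<in> carrier_mat d d" and v: "v \<in> unit_vecs d" and r: "r = euclid_norm (A *\<^sub>v v)"
  then have "v \<in> carrier_vec d" by (simp add: unit_vecs_def)
  with A v show "r \<le> fr A" using nv_ap_fr[of A "\<lambda>i. v $ i"] by (simp add: r euclid_norm_mult unit_vecs_nv)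
qed

lemma nv_ap_unit_le_op_norm:
  assumes "A \<in> carrier_mat d d" "nv x = 1" shows "nv (ap A x) \<le> op_norm A"
proof -
  have "nv (ap A x) = euclid_norm (A *\<^sub>v vec d x)" using assms by (subst euclid_norm_mult) (auto intro!: arg_cong[where f=nv] ap_cong)
  also have "\<dots> \<le> op_norm A" unfolding op_norm_def using assms op_norm_bdd[of A] unit_vecs_vec[of x] by (intro cSUP_upper) auto
  finally show ?thesis .
qed

lemma op_norm_nonneg: "0 < d \<Longrightarrow> A \<in> carrier_mat d d \<Longrightarrow> 0 \<le> op_norm A"
  using nv_ap_unit_le_op_norm[of A, OF _ nv_delta[of 0]] nv_nonneg order.trans by blast

lemma op_norm_bound:
  assumes d: "0 < d" and A: "A \<in> carrier_mat d d" shows "nv (ap A x) \<le> op_norm A * nv x"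
proof (cases "nv x = 0")
  case True
  then have "ap A x = ap A (\<lambda>i. 0 * 0)" by (intro ap_cong) (auto simp: nv_zero_iff)
  then have "nv (ap A x) = 0" by (simp only: ap_mult) simp
  then show ?thesis using op_norm_nonneg[OF d A] by simp
next
  case False
  then have "nv (\<lambda>i. of_real (1 / nv x) * x i) = 1" by (simp only: nv_mult) (simp add: norm_divide)
  from nv_ap_unit_le_op_norm[OF A this] have "nv (ap A x) / nv x \<le> op_norm A"
    by (simp only: ap_mult nv_mult) (simp add: norm_divide)
  then show ?thesis using False nv_nonneg[of x] by (simp add: field_simps)
qed

lemma op_norm_le:
  assumes d: "0 < d" and A: "A \<in> carrier_mat d d" and K: "\<And>x. nv x = 1 \<Longrightarrow> nv (ap A x) \<le> K"
  shows "op_norm A \<le> K"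
proof -
  have "dim_col A = d" using A by auto
  show ?thesis unfolding op_norm_def \<open>dim_col A = d\<close>
  proof (rule cSUP_least[OF unit_vecs_nonempty[OF d]])
    fix v assume "v \<in> unit_vecs d"
    then show "euclid_norm (A *\<^sub>v v) \<le> K"
      using K[OF unit_vecs_nv] A by (simp add: euclid_norm_mult unit_vecs_def)
  qed
qed

text \<open>Reduces operator norms to scalar forms, which commute with expectations.\<close>

lemma op_norm_le_ip:
  assumes d: "0 < d" and A: "A \<in> carrier_mat d d" and K: "0 \<le> K"
    and b: "\<And>x y. nv x = 1 \<Longrightarrow> nv y = 1 \<Longrightarrow> cmod (ip (ap A x) y) \<le> K"
  shows "op_norm A \<le> K"
proof (rule op_norm_le[OF d A], rule nv_le_if_ip_le[OF K])
  fix x y assume x: "nv x = 1"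
  show "cmod (ip (ap A x) y) \<le> K * nv y"
  proof (cases "nv y = 0")
    case True
    then show ?thesis using cauchy_schwarz[of "ap A x" y] by simp
  next
    case False
    then have "nv (\<lambda>i. of_real (1 / nv y) * y i) = 1" by (simp only: nv_mult) (simp add: norm_divide)
    from b[OF x this] have "cmod (ip (ap A x) y) / nv y \<le> K"
      by (simp only: ip_mult_right norm_mult) (simp add: norm_divide)
    then show ?thesis using False nv_nonneg[of y] by (simp add: field_simps)
  qed
qed

lemma op_norm_le_fr: "0 < d \<Longrightarrow> A \<in> carrier_mat d d \<Longrightarrow> op_norm A \<le> fr A"
  using nv_ap_fr by (intro op_norm_le) (auto, metis mult.right_neutral)

lemma op_norm_ip: "0 < d \<Longrightarrow> A \<in> carrier_mat d d \<Longrightarrow> cmod (ip (ap A x) y) \<le> op_norm A * nv x * nv y"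
  by (rule order.trans[OF cauchy_schwarz]) (intro mult_right_mono op_norm_bound, auto)

subsection \<open>Self-adjoint matrices and resolvents\<close>

lemma mat_adjoint_index: "A \<in> carrier_mat d d \<Longrightarrow> i < d \<Longrightarrow> j < d \<Longrightarrow> mat_adjoint A $$ (i, j) = cnj (A $$ (j, i))"
  by (auto simp: mat_adjoint_def mat_of_rows_def)

lemma mat_adjoint_carrier: "A \<in> carrier_mat d d \<Longrightarrow> mat_adjoint A \<in> carrier_mat d d"
  by (auto simp: mat_adjoint_def mat_of_rows_def)

lemma self_adjoint_iff: "self_adjoint d A \<longleftrightarrow> A \<in> carrier_mat d d \<and> (\<forall>i<d. \<forall>j<d. A $$ (i, j) = cnj (A $$ (j, i)))"
proof (cases "A \<in> carrier_mat d d")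
  case True
  then have "mat_adjoint A = A \<longleftrightarrow> (\<forall>i<d. \<forall>j<d. mat_adjoint A $$ (i, j) = A $$ (i, j))"
    using mat_adjoint_carrier[OF True] by (auto intro!: eq_matI)
  also have "\<dots> \<longleftrightarrow> (\<forall>i<d. \<forall>j<d. A $$ (i, j) = cnj (A $$ (j, i)))"
    using mat_adjoint_index[OF True] by metis
  finally show ?thesis using True by (simp only: self_adjoint_def)
qed (simp add: self_adjoint_def)

lemma self_adjoint_entry: "self_adjoint d A \<Longrightarrow> i < d \<Longrightarrow> j < d \<Longrightarrow> cnj (A $$ (i, j)) = A $$ (j, i)"
  unfolding self_adjoint_iff by (metis complex_cnj_cnj)

lemma self_adjoint_carrier: "self_adjoint d A \<Longrightarrow> A \<in> carrier_mat d d" by (simp add: self_adjoint_def)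

lemma self_adjoint_ip: assumes "self_adjoint d A" shows "ip (ap A x) y = ip x (ap A y)"
proof -
  have "ip (ap A x) y = (\<Sum>i<d. \<Sum>j<d. A $$ (i, j) * x j * cnj (y i))"
    by (simp add: ip_def ap_def sum_distrib_right)
  also have "\<dots> = (\<Sum>j<d. \<Sum>i<d. A $$ (i, j) * x j * cnj (y i))" by (rule sum.swap)
  also have "\<dots> = (\<Sum>j<d. \<Sum>i<d. x j * cnj (A $$ (j, i) * y i))"
    by (intro sum.cong refl) (simp add: self_adjoint_entry[OF assms])
  also have "\<dots> = ip x (ap A y)" by (simp add: ip_def ap_def sum_distrib_left)
  finally show ?thesis .
qed

lemma self_adjoint_ip_real: "self_adjoint d A \<Longrightarrow> Im (ip (ap A x) x) = 0"
  using ip_cnj[of "ap A x" x] self_adjoint_ip[of A x x] by (simp add: complex_eq_iff)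

text \<open>Since the form of a self-adjoint matrix is real, pairing (z - A) x with x has imaginary
  part \<open>Im z\<close> times the squared norm of x; Cauchy-Schwarz finishes.\<close>

lemma shifted_lower_bound:
  assumes "self_adjoint d A" shows "\<bar>Im z\<bar> * nv x \<le> nv (\<lambda>i. z * x i - ap A x i)"
proof (cases "nv x = 0")
  case False
  have "ip (\<lambda>i. z * x i - ap A x i) x = z * of_real ((nv x)\<^sup>2) - ip (ap A x) x"
    by (simp only: ip_simps ip_self)
  then have "Im (ip (\<lambda>i. z * x i - ap A x i) x) = Im z * (nv x)\<^sup>2" using self_adjoint_ip_real[OF assms] by simp
  then have "\<bar>Im z\<bar> * (nv x)\<^sup>2 \<le> cmod (ip (\<lambda>i. z * x i - ap A x i) x)"
    using abs_Im_le_cmod[of "ip (\<lambda>i. z * x i - ap A x i) x"] by (simp add: abs_mult)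
  also have "\<dots> \<le> nv (\<lambda>i. z * x i - ap A x i) * nv x" by (rule cauchy_schwarz)
  finally have "(\<bar>Im z\<bar> * nv x) * nv x \<le> nv (\<lambda>i. z * x i - ap A x i) * nv x" by (simp add: power2_eq_square mult.assoc)
  then show ?thesis using False nv_nonneg[of x] by (simp add: mult_le_cancel_right)
qed simp

lemma ap_shifted: "A \<in> carrier_mat d d \<Longrightarrow> i < d \<Longrightarrow> ap (z \<cdot>\<^sub>m 1\<^sub>m d - A) x i = z * x i - ap A x i"
proof -
  assume A: "A \<in> carrier_mat d d" and i: "i < d"
  have "ap (z \<cdot>\<^sub>m 1\<^sub>m d - A) x i = (\<Sum>j<d. ((if i = j then z else 0) - A $$ (i, j)) * x j)"
    using A i by (auto simp: ap_def intro!: sum.cong)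
  also have "\<dots> = (\<Sum>j<d. (if i = j then z * x j else 0) - A $$ (i, j) * x j)" by (intro sum.cong) (auto simp: algebra_simps)
  also have "\<dots> = z * x i - ap A x i" using i by (simp add: sum_subtractf ap_def)
  finally show ?thesis .
qed

lemma shifted_det_nonzero:
  assumes A: "self_adjoint d A" and z: "Im z \<noteq> 0" shows "det (z \<cdot>\<^sub>m 1\<^sub>m d - A) \<noteq> 0"
proof
  have c: "z \<cdot>\<^sub>m 1\<^sub>m d - A \<in> carrier_mat d d" using A by (auto simp: self_adjoint_def)
  assume "det (z \<cdot>\<^sub>m 1\<^sub>m d - A) = 0"
  then obtain v where v: "v \<in> carrier_vec d" "v \<noteq> 0\<^sub>v d" "(z \<cdot>\<^sub>m 1\<^sub>m d - A) *\<^sub>v v = 0\<^sub>v d"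
    using det_0_iff_vec_prod_zero[OF c] by auto
  have "nv (\<lambda>i. z * v $ i - ap A (\<lambda>i. v $ i) i) = nv (\<lambda>i. 0)"
  proof (rule nv_cong)
    fix i assume i: "i < d"
    have "0 = ap (z \<cdot>\<^sub>m 1\<^sub>m d - A) (\<lambda>i. v $ i) i" using mult_mat_vec_eq[OF c v(1) i] v(3) i by simp
    then show "z * v $ i - ap A (\<lambda>i. v $ i) i = 0" using ap_shifted[OF self_adjoint_carrier[OF A] i] by simp
  qed
  then have "\<bar>Im z\<bar> * nv (\<lambda>i. v $ i) \<le> 0" using shifted_lower_bound[OF A, of z "\<lambda>i. v $ i"] by (simp only: nv_const_zero)
  with z have "nv (\<lambda>i. v $ i) \<le> 0" by (simp add: mult_le_0_iff)
  then have "nv (\<lambda>i. v $ i) = 0" by (rule antisym) simp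
  with v show False by (auto simp: nv_zero_iff)
qed

lemma resolvent_inverse:
  assumes A: "A \<in> carrier_mat d d" and z: "det (z \<cdot>\<^sub>m 1\<^sub>m d - A) \<noteq> 0"
  shows "resolvent d z A \<in> carrier_mat d d" "(z \<cdot>\<^sub>m 1\<^sub>m d - A) * resolvent d z A = 1\<^sub>m d" "resolvent d z A * (z \<cdot>\<^sub>m 1\<^sub>m d - A) = 1\<^sub>m d"
proof -
  have c: "z \<cdot>\<^sub>m 1\<^sub>m d - A \<in> carrier_mat d d" using A by auto
  have "mat_inverse (z \<cdot>\<^sub>m 1\<^sub>m d - A) \<noteq> None" using mat_inverse(1)[OF c, where b = "()"] det_non_zero_imp_unit[OF c z, where b = "()"] by blast
  then obtain B where B: "mat_inverse (z \<cdot>\<^sub>m 1\<^sub>m d - A) = Some B" by auto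
  then have r: "resolvent d z A = B" by (simp add: resolvent_def)
  show "resolvent d z A \<in> carrier_mat d d" "(z \<cdot>\<^sub>m 1\<^sub>m d - A) * resolvent d z A = 1\<^sub>m d" "resolvent d z A * (z \<cdot>\<^sub>m 1\<^sub>m d - A) = 1\<^sub>m d"
    using mat_inverse(2)[OF c B] by (auto simp: r)
qed

text \<open>Cramer's rule. Its purpose is measurability: it shows the entries of the resolvent as
  quotients of determinants in the entries of \<open>A\<close>.\<close>

lemma resolvent_adj:
  assumes A: "A \<in> carrier_mat d d" and z: "det (z \<cdot>\<^sub>m 1\<^sub>m d - A) \<noteq> 0" and ij: "i < d" "j < d"
  shows "resolvent d z A $$ (i, j) = cofactor (z \<cdot>\<^sub>m 1\<^sub>m d - A) j i / det (z \<cdot>\<^sub>m 1\<^sub>m d - A)"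
proof -
  let ?C = "z \<cdot>\<^sub>m 1\<^sub>m d - A" and ?R = "resolvent d z A"
  have c: "?C \<in> carrier_mat d d" using A by auto
  note R = resolvent_inverse[OF A z]
  have "?R * (?C * adj_mat ?C) = ?R * (det ?C \<cdot>\<^sub>m 1\<^sub>m d)" by (simp add: adj_mat(2)[OF c])
  also have "\<dots> = det ?C \<cdot>\<^sub>m ?R" by (subst mult_smult_distrib[OF R(1) one_carrier_mat], subst right_mult_one_mat[OF R(1)], rule refl)
  also have "?R * (?C * adj_mat ?C) = ?R * ?C * adj_mat ?C" by (rule assoc_mult_mat[OF R(1) c adj_mat(1)[OF c], symmetric])
  also have "\<dots> = adj_mat ?C" unfolding R(3) by (rule left_mult_one_mat[OF adj_mat(1)[OF c]])
  finally have "adj_mat ?C $$ (i, j) = det ?C * ?R $$ (i, j)" using R(1) ij by simp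
  moreover have "dim_row A = d" "dim_col A = d" using A by auto
  ultimately show ?thesis using z ij by (simp add: adj_mat_def nonzero_eq_divide_eq mult.commute)
qed

lemma ap_mult_mat: "A \<in> carrier_mat d d \<Longrightarrow> B \<in> carrier_mat d d \<Longrightarrow> ap (A * B) x = ap A (ap B x)"
proof
  fix i assume A: "A \<in> carrier_mat d d" and B: "B \<in> carrier_mat d d"
  show "ap (A * B) x i = ap A (ap B x) i"
  proof (cases "i < d")
    case True
    have "ap (A * B) x i = (\<Sum>j<d. \<Sum>k<d. A $$ (i, k) * B $$ (k, j) * x j)"
      using A B True by (auto simp: ap_def scalar_prod_def lessThan_atLeast0 sum_distrib_right intro!: sum.cong)
    also have "\<dots> = (\<Sum>k<d. \<Sum>j<d. A $$ (i, k) * B $$ (k, j) * x j)" by (rule sum.swap)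
    also have "\<dots> = ap A (ap B x) i" using True by (simp add: ap_def sum_distrib_left mult.assoc)
    finally show ?thesis .
  qed (simp add: ap_out)
qed

lemma ap_one: "i < d \<Longrightarrow> ap (1\<^sub>m d) x i = x i"
proof -
  assume i: "i < d"
  then have "ap (1\<^sub>m d) x i = (\<Sum>j<d. if i = j then x j else 0)"
    unfolding ap_def by (simp add: if_distrib[of "\<lambda>c. c * _"] cong: if_cong)
  then show ?thesis using i by simp
qed

definition rs :: "complex \<Rightarrow> complex mat \<Rightarrow> (nat \<Rightarrow> complex) \<Rightarrow> nat \<Rightarrow> complex" where
  "rs z A = ap (resolvent d z A)"

lemma rs_lin: "rs z A (\<lambda>i. x i + y i) = (\<lambda>i. rs z A x i + rs z A y i)"
  "rs z A (\<lambda>i. x i - y i) = (\<lambda>i. rs z A x i - rs z A y i)" "rs z A (\<lambda>i. c * x i) = (\<lambda>i. c * rs z A x i)"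
  by (simp_all add: rs_def ap_simps)

context
  fixes A and z
  assumes A: "self_adjoint d A" and z: "Im z \<noteq> 0"
begin

lemma resolvent_carrier: "resolvent d z A \<in> carrier_mat d d"
  using resolvent_inverse[OF self_adjoint_carrier[OF A] shifted_det_nonzero[OF A z]] by simp

lemma rs_right: "i < d \<Longrightarrow> z * rs z A x i - ap A (rs z A x) i = x i"
proof -
  assume i: "i < d"
  note Ac = self_adjoint_carrier[OF A]
  have c: "z \<cdot>\<^sub>m 1\<^sub>m d - A \<in> carrier_mat d d" using Ac by auto
  note R = resolvent_inverse[OF Ac shifted_det_nonzero[OF A z]]
  have "z * rs z A x i - ap A (rs z A x) i = ap (z \<cdot>\<^sub>m 1\<^sub>m d - A) (rs z A x) i" using ap_shifted[OF Ac i] by simp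
  also have "\<dots> = ap (1\<^sub>m d) x i" unfolding rs_def using ap_mult_mat[OF c R(1), symmetric] by (simp only: R(2))
  finally show ?thesis using i by (simp add: ap_one)
qed

lemma rs_left: "i < d \<Longrightarrow> rs z A (\<lambda>i. z * x i - ap A x i) i = x i"
proof -
  assume i: "i < d"
  note Ac = self_adjoint_carrier[OF A]
  have c: "z \<cdot>\<^sub>m 1\<^sub>m d - A \<in> carrier_mat d d" using Ac by auto
  note R = resolvent_inverse[OF Ac shifted_det_nonzero[OF A z]]
  have "rs z A (\<lambda>i. z * x i - ap A x i) i = ap (resolvent d z A) (ap (z \<cdot>\<^sub>m 1\<^sub>m d - A) x) i"
    unfolding rs_def by (rule fun_cong[OF ap_cong]) (simp add: ap_shifted[OF Ac])
  also have "\<dots> = ap (1\<^sub>m d) x i" using ap_mult_mat[OF R(1) c, symmetric] by (simp only: R(3))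
  finally show ?thesis using i by (simp add: ap_one)
qed

lemma rs_bound: "nv (rs z A x) \<le> nv x / \<bar>Im z\<bar>"
proof -
  have "\<bar>Im z\<bar> * nv (rs z A x) \<le> nv (\<lambda>i. z * rs z A x i - ap A (rs z A x) i)" by (rule shifted_lower_bound[OF A])
  also have "\<dots> = nv x" by (rule nv_cong) (rule rs_right)
  finally show ?thesis using z by (simp add: field_simps)
qed

end

lemma rs_adjoint:
  assumes A: "self_adjoint d A" and z: "Im z \<noteq> 0" shows "ip (rs z A x) y = ip x (rs (cnj z) A y)"
proof -
  have z': "Im (cnj z) \<noteq> 0" using z by simp
  have "ip (rs z A x) y = ip (rs z A x) (\<lambda>i. cnj z * rs (cnj z) A y i - ap A (rs (cnj z) A y) i)"
    by (rule ip_cong) (auto simp: rs_right[OF A z'])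
  also have "\<dots> = ip (\<lambda>i. z * rs z A x i - ap A (rs z A x) i) (rs (cnj z) A y)"
    by (simp add: ip_simps self_adjoint_ip[OF A])
  also have "\<dots> = ip x (rs (cnj z) A y)" by (rule ip_cong) (auto simp: rs_right[OF A z])
  finally show ?thesis .
qed

text \<open>With y the resolvent of \<open>B\<close> applied to x one has x = (z - A) y + c C y; now
  apply the resolvent of \<open>A\<close>. The scalar c is separated from the direction
  \<open>C\<close> because steps of varying length are taken in a given direction.\<close>

lemma resolvent_identity:
  assumes A: "self_adjoint d A" and B: "self_adjoint d B" and z: "Im z \<noteq> 0"
    and C: "\<And>i j. i < d \<Longrightarrow> j < d \<Longrightarrow> A $$ (i, j) = B $$ (i, j) + c * C $$ (i, j)"
  shows "rs z A x = (\<lambda>i. rs z B x i + c * rs z A (ap C (rs z B x)) i)"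
proof
  fix i
  show "rs z A x i = rs z B x i + c * rs z A (ap C (rs z B x)) i"
  proof (cases "i < d")
    case True
    let ?y = "rs z B x"
    have "rs z A x = rs z A (\<lambda>i. (z * ?y i - ap A ?y i) + c * ap C ?y i)"
      unfolding rs_def[of z A]
    proof (rule ap_cong)
      fix i assume "i < d"
      then show "x i = z * ?y i - ap A ?y i + c * ap C ?y i"
        using rs_right[OF B z, of i x] ap_lincomb[OF C] by simp
    qed
    then show ?thesis using rs_left[OF A z True, of ?y] by (simp add: rs_lin)
  qed (simp add: rs_def ap_out)
qed

lemma resolvent_identity_shift:
  assumes A: "self_adjoint d A" and z: "Im z \<noteq> 0" "Im w \<noteq> 0"
  shows "rs z A x = (\<lambda>i. rs w A x i + (w - z) * rs z A (rs w A x) i)"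
proof
  fix i
  show "rs z A x i = rs w A x i + (w - z) * rs z A (rs w A x) i"
  proof (cases "i < d")
    case True
    let ?y = "rs w A x"
    have "rs z A x = rs z A (\<lambda>i. (z * ?y i - ap A ?y i) + (w - z) * ?y i)"
      unfolding rs_def[of z A]
    proof (rule ap_cong)
      fix i assume "i < d"
      then show "x i = z * ?y i - ap A ?y i + (w - z) * ?y i"
        using rs_right[OF A z(2), of i x] by (simp add: algebra_simps)
    qed
    then show ?thesis using rs_left[OF A z(1) True, of ?y] by (simp add: rs_lin)
  qed (simp add: rs_def ap_out)
qed

end

lemma mat_diag_dims [simp]: "dim_row (mat_diag n f) = n" "dim_col (mat_diag n f) = n"
  by (simp_all add: mat_diag_def)

context dim
begin

subsection \<open>The spectral theorem\<close>

lemma trace_similar: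
  assumes "P \<in> carrier_mat d d" "B \<in> carrier_mat d d" "Q \<in> carrier_mat d d" "Q * P = 1\<^sub>m d"
  shows "(\<Sum>i<d. (P * B * Q) $$ (i, i)) = (\<Sum>i<d. (B :: complex mat) $$ (i, i))"
proof -
  have tr: "(\<Sum>i<d. (X * Y) $$ (i, i)) = (\<Sum>i<d. (Y * X) $$ (i, i))" if "X \<in> carrier_mat d d" "Y \<in> carrier_mat d d" for X Y :: "complex mat"
  proof -
    have "(\<Sum>i<d. (X * Y) $$ (i, i)) = (\<Sum>i<d. \<Sum>j<d. X $$ (i, j) * Y $$ (j, i))"
      using that by (auto simp: scalar_prod_def lessThan_atLeast0 intro!: sum.cong)
    also have "\<dots> = (\<Sum>j<d. \<Sum>i<d. X $$ (i, j) * Y $$ (j, i))" by (rule sum.swap)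
    also have "\<dots> = (\<Sum>i<d. (Y * X) $$ (i, i))"
      using that by (auto simp: scalar_prod_def lessThan_atLeast0 mult.commute intro!: sum.cong)
    finally show ?thesis .
  qed
  have "(\<Sum>i<d. (P * B * Q) $$ (i, i)) = (\<Sum>i<d. (Q * (P * B)) $$ (i, i))" using assms by (intro tr) auto
  also have "Q * (P * B) = Q * P * B" using assms by (intro assoc_mult_mat[symmetric]) auto
  also have "\<dots> = B" using assms by simp
  finally show ?thesis .
qed

text \<open>Adding \<open>\<i>\<close> times the projection to the span of \<open>e\<^sub>0, \<dots>, e\<^sub>k\<^sub>-\<^sub>1\<close> moves the eigenvalues on this span to the line
  \<open>Im = 1\<close>; by comparing traces, some eigenvalue is not on this line, and its eigenvectors are orthogonal to the span.\<close>

lemma orthogonal_eigenvector: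
  fixes e :: "nat \<Rightarrow> nat \<Rightarrow> complex"
  assumes A: "self_adjoint d A" and k: "k < d"
    and orth: "\<And>m n. m < k \<Longrightarrow> n < k \<Longrightarrow> ip (e m) (e n) = (if m = n then 1 else 0)"
    and eig: "\<And>m i. m < k \<Longrightarrow> i < d \<Longrightarrow> ap A (e m) i = of_real (l m) * e m i"
  shows "\<exists>x r. nv x = 1 \<and> (\<forall>m<k. ip x (e m) = 0) \<and> (\<forall>i<d. ap A x i = of_real r * x i)"
proof -
  note Ac = self_adjoint_carrier[OF A]
  define Q where "Q x = (\<lambda>i. \<Sum>m<k. ip x (e m) * e m i)" for x
  define C where "C = Matrix.mat d d (\<lambda>(i, j). A $$ (i, j) + \<i> * (\<Sum>m<k. e m i * cnj (e m j)))"
  have C: "C \<in> carrier_mat d d" by (simp add: C_def)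
  have apC: "ap C x i = ap A x i + \<i> * Q x i" if "i < d" for x i
  proof -
    have "ap C x i = (\<Sum>j<d. A $$ (i, j) * x j + \<i> * (\<Sum>m<k. e m i * cnj (e m j) * x j))"
      using that by (auto simp: ap_def C_def sum_distrib_right sum_distrib_left algebra_simps intro!: sum.cong)
    also have "\<dots> = ap A x i + \<i> * (\<Sum>j<d. \<Sum>m<k. e m i * cnj (e m j) * x j)"
      using that by (simp add: ap_def sum.distrib sum_distrib_left)
    also have "(\<Sum>j<d. \<Sum>m<k. e m i * cnj (e m j) * x j) = (\<Sum>m<k. \<Sum>j<d. e m i * cnj (e m j) * x j)" by (rule sum.swap)
    also have "\<dots> = Q x i" by (simp add: Q_def ip_def sum_distrib_left sum_distrib_right mult_ac)
    finally show ?thesis .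
  qed
  obtain es where es: "char_poly C = (\<Prod>a\<leftarrow>es. [:- a, 1:])" "length es = d" using char_poly_factorized[OF C] by auto
  \<comment> \<open>A triangular form has the eigenvalues on its diagonal and the same trace, so the
    eigenvalues of \<open>C\<close> sum to the trace of \<open>C\<close>.\<close>
  obtain B P R where sd: "schur_decomposition C es = (B, P, R)" by (cases "schur_decomposition C es") auto
  from schur_decomposition[OF C es(1) sd] have sim: "similar_mat_wit C B P R" and diag: "diag_mat B = es" by auto
  note s = similar_mat_witD2[OF C sim]
  have "sum_list es = (\<Sum>i<d. B $$ (i, i))" using s(5) by (simp add: diag[symmetric] diag_mat_def sum_list_sum_nth lessThan_atLeast0)
  also have "\<dots> = (\<Sum>i<d. C $$ (i, i))" using trace_similar[OF s(6,5,7,2)] by (simp add: s(3)[symmetric])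
  also have "Im \<dots> = (\<Sum>i<d. \<Sum>m<k. (cmod (e m i))\<^sup>2)"
  proof -
    have "Im (C $$ (i, i)) = (\<Sum>m<k. (cmod (e m i))\<^sup>2)" if i: "i < d" for i
    proof -
      have "Im (A $$ (i, i)) = 0" using self_adjoint_entry[OF A i i] by (simp add: complex_eq_iff)
      moreover have "e m i * cnj (e m i) = of_real ((cmod (e m i))\<^sup>2)" for m by (rule complex_norm_square[symmetric])
      ultimately show ?thesis using i by (simp add: C_def)
    qed
    then show ?thesis by simp
  qed
  also have "\<dots> = (\<Sum>m<k. \<Sum>i<d. (cmod (e m i))\<^sup>2)" by (rule sum.swap)
  also have "\<dots> = (\<Sum>m<k. 1)"
  proof (rule sum.cong[OF refl])
    fix m assume "m \<in> {..<k}"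
    then have "(nv (e m))\<^sup>2 = 1" using orth[of m m] by (simp add: nv_eqI)
    then show "(\<Sum>i<d. (cmod (e m i))\<^sup>2) = 1" by (simp add: nv_def L2_set_def sum_nonneg)
  qed
  finally have tr: "Im (sum_list es) = k" by simp
  have "\<exists>a\<in>set es. Im a \<noteq> 1"
  proof (rule ccontr)
    assume "\<not> ?thesis"
    then have "Im (sum_list es) = length es" by (induction es) auto
    with tr es k show False by simp
  qed
  then obtain \<mu> where mu: "\<mu> \<in> set es" "Im \<mu> \<noteq> 1" by auto
  have "poly (char_poly C) \<mu> = 0" unfolding es(1) using mu(1) by (rule linear_poly_root)
  then have "eigenvalue C \<mu>" using eigenvalue_root_char_poly[OF C] by simp
  then obtain v where v: "v \<in> carrier_vec d" "v \<noteq> 0\<^sub>v d" "C *\<^sub>v v = \<mu> \<cdot>\<^sub>v v"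
    using C by (auto simp: eigenvalue_def eigenvector_def)
  define y where "y = (\<lambda>i. v $ i)"
  have y0: "nv y \<noteq> 0" using v(1,2) by (auto simp: nv_zero_iff y_def)
  have yC: "ap C y i = \<mu> * y i" if "i < d" for i
    using mult_mat_vec_eq[OF C v(1) that] v(1) that by (simp add: v(3) y_def)
  have yo: "ip y (e m) = 0" if m: "m < k" for m
  proof (rule ccontr)
    \<comment> \<open>Pairing the eigenvalue equation with \<open>e m\<close> and moving
      \<open>A\<close> over to \<open>e m\<close> would force the eigenvalue to be
      \<open>of_real (l m) + \<i>\<close>, which has imaginary part 1.\<close>
    assume n: "ip y (e m) \<noteq> 0"
    have "\<mu> * ip y (e m) = ip (\<lambda>i. \<mu> * y i) (e m)" by (simp add: ip_simps)
    also have "\<dots> = ip (\<lambda>i. ap A y i + \<i> * Q y i) (e m)" by (rule ip_cong) (simp_all add: yC[symmetric] apC)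
    also have "\<dots> = ip y (ap A (e m)) + \<i> * ip (Q y) (e m)" by (simp add: ip_simps self_adjoint_ip[OF A])
    also have "ip y (ap A (e m)) = ip y (\<lambda>i. of_real (l m) * e m i)" by (rule ip_cong) (simp_all add: eig m)
    also have "\<dots> = of_real (l m) * ip y (e m)" by (simp add: ip_simps)
    also have "ip (Q y) (e m) = (\<Sum>n<k. ip y (e n) * ip (e n) (e m))"
    proof -
      have "ip (Q y) (e m) = (\<Sum>i<d. \<Sum>n<k. ip y (e n) * (e n i * cnj (e m i)))"
        unfolding Q_def by (subst ip_def) (simp add: sum_distrib_right mult.assoc)
      also have "\<dots> = (\<Sum>n<k. \<Sum>i<d. ip y (e n) * (e n i * cnj (e m i)))" by (rule sum.swap)
      finally show ?thesis by (simp add: ip_def[of "e _" "e m"] sum_distrib_left)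
    qed
    also have "\<dots> = (\<Sum>n<k. if n = m then ip y (e n) else 0)" by (intro sum.cong) (auto simp: orth m)
    also have "\<dots> = ip y (e m)" using m by simp
    finally have "\<mu> * ip y (e m) = (of_real (l m) + \<i>) * ip y (e m)" by (simp add: algebra_simps)
    with n have "\<mu> = of_real (l m) + \<i>" by simp
    with mu(2) show False by simp
  qed
  then have Qy: "Q y = (\<lambda>i. 0)" by (simp add: Q_def)
  have yA: "ap A y i = \<mu> * y i" if "i < d" for i using yC[OF that] apC[OF that, of y] by (simp add: Qy)
  have "ip (ap A y) y = ip (\<lambda>i. \<mu> * y i) y" by (rule ip_cong) (simp_all add: yA)
  then have "Im (\<mu> * of_real ((nv y)\<^sup>2)) = 0" using self_adjoint_ip_real[OF A, of y] by (simp only: ip_simps ip_self)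
  then have mur: "\<mu> = of_real (Re \<mu>)" using y0 by (simp add: complex_eq_iff)
  define x where "x = (\<lambda>i. of_real (1 / nv y) * y i)"
  have "nv x = 1" unfolding x_def using y0 by (simp only: nv_mult) (simp add: norm_divide)
  moreover have "ip x (e m) = 0" if "m < k" for m unfolding x_def by (simp only: ip_simps yo[OF that] mult_zero_right)
  moreover have "ap A x i = of_real (Re \<mu>) * x i" if "i < d" for i
    unfolding x_def ap_mult using yA[OF that] mur by simp
  ultimately show ?thesis by blast
qed

lemma eigenbasis:
  assumes A: "self_adjoint d A"
  shows "\<exists>e l. (\<forall>m<d. \<forall>n<d. ip (e m) (e n) = (if m = n then 1 else 0)) \<and> (\<forall>m<d. \<forall>i<d. ap A (e m) i = of_real (l m) * e m i)"
proof -
  have "\<exists>e l. (\<forall>m<k. \<forall>n<k. ip (e m) (e n) = (if m = n then 1 else 0)) \<and> (\<forall>m<k. \<forall>i<d. ap A (e m) i = of_real (l m) * e m i)" if "k \<le> d" for k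
    using that
  proof (induction k)
    case (Suc k)
    then obtain e l where o: "\<And>m n. m < k \<Longrightarrow> n < k \<Longrightarrow> ip (e m) (e n) = (if m = n then 1 else 0)"
      and l: "\<And>m i. m < k \<Longrightarrow> i < d \<Longrightarrow> ap A (e m) i = of_real (l m) * e m i" by (metis Suc_leD)
    have "\<exists>x r. nv x = 1 \<and> (\<forall>m<k. ip x (e m) = 0) \<and> (\<forall>i<d. ap A x i = of_real r * x i)"
      by (rule orthogonal_eigenvector[where e = e and l = l, OF A]) (use Suc.prems o l in auto)
    then obtain x r where x: "nv x = 1" "\<forall>m<k. ip x (e m) = 0" "\<forall>i<d. ap A x i = of_real r * x i" by blast
    have x': "ip (e m) x = 0" if "m < k" for m using x(2) that ip_cnj[of x "e m"] by simp
    have xx: "ip x x = 1" using x(1) by (simp add: ip_self)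
    show ?case
      by (rule exI[of _ "e(k := x)"], rule exI[of _ "l(k := r)"]) (use o l x x' xx in \<open>auto simp: less_Suc_eq\<close>)
  qed auto
  then show ?thesis by blast
qed

lemma mult3_diag_entry:
  assumes "U \<in> carrier_mat d d" "i < d" "j < d"
  shows "(U * mat_diag d f * mat_adjoint U) $$ (i, j) = (\<Sum>m<d. U $$ (i, m) * f m * cnj (U $$ (j, m)))"
proof -
  have Ua: "mat_adjoint U \<in> carrier_mat d d" by (rule mat_adjoint_carrier[OF assms(1)])
  have D: "mat_diag d f \<in> carrier_mat d d" by simp
  have "(U * mat_diag d f) $$ (i, m) = U $$ (i, m) * f m" if "m < d" for m
    using assms that by (simp add: mat_diag_mult_right)
  then show ?thesis using assms Ua D by (simp add: scalar_prod_def lessThan_atLeast0 mat_adjoint_index)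
qed

text \<open>By hypothesis \<open>W = mat_adjoint V * U\<close> intertwines the two diagonal
  matrices, so an entry \<open>W $$ (i, j)\<close> can be nonzero only if \<open>l j = k i\<close>.
  Then also \<open>\<phi> (l j) = \<phi> (k i)\<close>, and W intertwines the images under
  \<open>\<phi>\<close>.\<close>

lemma fun_calc_unique:
  assumes U: "U \<in> carrier_mat d d" "U * mat_adjoint U = 1\<^sub>m d" "mat_adjoint U * U = 1\<^sub>m d"
    and V: "V \<in> carrier_mat d d" "V * mat_adjoint V = 1\<^sub>m d" "mat_adjoint V * V = 1\<^sub>m d"
    and eq: "U * mat_diag d (\<lambda>i. complex_of_real (l i)) * mat_adjoint U = V * mat_diag d (\<lambda>i. complex_of_real (k i)) * mat_adjoint V"
  shows "U * mat_diag d (\<lambda>i. \<phi> (l i)) * mat_adjoint U = V * mat_diag d (\<lambda>i. \<phi> (k i)) * mat_adjoint V"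
proof -
  note Ua = mat_adjoint_carrier[OF U(1)] and Va = mat_adjoint_carrier[OF V(1)]
  define W where "W = mat_adjoint V * U"
  have W: "W \<in> carrier_mat d d" using Va U by (auto simp: W_def)
  let ?D = "mat_diag d (\<lambda>i. complex_of_real (l i))" and ?E = "mat_diag d (\<lambda>i. complex_of_real (k i))"
  have c: "?D \<in> carrier_mat d d" "?E \<in> carrier_mat d d" by auto
  have conj: "mat_adjoint V * (U * D * mat_adjoint U) * U = W * D" if D: "D \<in> carrier_mat d d" for D
  proof -
    have "mat_adjoint V * (U * D * mat_adjoint U) * U = mat_adjoint V * (U * D) * (mat_adjoint U * U)"
      using U(1) Va Ua D by (simp add: assoc_mult_mat[of _ d d _ d _ d])
    then show ?thesis using U Va D by (simp add: W_def assoc_mult_mat[of _ d d _ d _ d])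
  qed
  have conj2: "mat_adjoint V * (V * D * mat_adjoint V) * U = D * W" if D: "D \<in> carrier_mat d d" for D
  proof -
    have "mat_adjoint V * (V * D * mat_adjoint V) * U = (mat_adjoint V * V) * D * (mat_adjoint V * U)"
      using V(1) Va U D by (simp add: assoc_mult_mat[of _ d d _ d _ d])
    then show ?thesis using V D by (simp add: W_def)
  qed
  have WD: "W * ?D = ?E * W" using conj[OF c(1)] conj2[OF c(2)] eq by simp
  have "W * mat_diag d (\<lambda>i. \<phi> (l i)) = mat_diag d (\<lambda>i. \<phi> (k i)) * W"
  proof (rule eq_matI)
    fix i j assume "i < dim_row (mat_diag d (\<lambda>i. \<phi> (k i)) * W)" "j < dim_col (mat_diag d (\<lambda>i. \<phi> (k i)) * W)"
    then have ij: "i < d" "j < d" using W by auto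
    have "(W * ?D) $$ (i, j) = (?E * W) $$ (i, j)" by (simp add: WD)
    then have "W $$ (i, j) * complex_of_real (l j) = complex_of_real (k i) * W $$ (i, j)"
      using W ij by (simp add: mat_diag_mult_right mat_diag_mult_left)
    then have "W $$ (i, j) = 0 \<or> l j = k i" by (simp add: mult.commute)
    then show "(W * mat_diag d (\<lambda>i. \<phi> (l i))) $$ (i, j) = (mat_diag d (\<lambda>i. \<phi> (k i)) * W) $$ (i, j)"
      using W ij by (auto simp: mat_diag_mult_right mat_diag_mult_left)
  qed (use W in auto)
  moreover define F G where "F = mat_diag d (\<lambda>i. \<phi> (l i))" and "G = mat_diag d (\<lambda>i. \<phi> (k i))"
  ultimately have FG: "W * F = G * W" and FGc: "F \<in> carrier_mat d d" "G \<in> carrier_mat d d" by auto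
  have VW: "V * W = U"
    using U V Va by (simp add: W_def assoc_mult_mat[of V d d "mat_adjoint V" d U d, symmetric])
  have WU: "W * mat_adjoint U = mat_adjoint V"
    using U V Va Ua by (simp add: W_def assoc_mult_mat[of "mat_adjoint V" d d U d "mat_adjoint U" d])
  have "U * F * mat_adjoint U = V * (W * F) * mat_adjoint U"
    using assoc_mult_mat[OF V(1) W FGc(1)] VW by simp
  also have "\<dots> = V * G * (W * mat_adjoint U)"
    unfolding FG using V(1) W FGc Ua by (simp add: assoc_mult_mat[of _ d d _ d _ d])
  also have "\<dots> = V * G * mat_adjoint V" by (simp only: WU)
  finally show ?thesis by (simp only: F_def G_def)
qed

text \<open>One eigenbasis is fixed for all \<open>\<phi>\<close> and all \<open>z\<close> at once,
  so that functions of \<open>A\<close> can be compared with its resolvents term by term.\<close>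

theorem spectral_decomposition:
  assumes A: "self_adjoint d A"
  obtains e :: "nat \<Rightarrow> nat \<Rightarrow> complex" and l :: "nat \<Rightarrow> real"
  where "\<And>\<phi>. fun_calc d \<phi> A \<in> carrier_mat d d"
    and "\<And>\<phi> i j. i < d \<Longrightarrow> j < d \<Longrightarrow> fun_calc d \<phi> A $$ (i, j) = (\<Sum>m<d. e m i * \<phi> (l m) * cnj (e m j))"
    and "\<And>z i j. Im z \<noteq> 0 \<Longrightarrow> i < d \<Longrightarrow> j < d \<Longrightarrow> resolvent d z A $$ (i, j) = (\<Sum>m<d. e m i * (1 / (z - of_real (l m))) * cnj (e m j))"
    and "\<And>m. m < d \<Longrightarrow> nv (e m) = 1"
proof -
  obtain e l where o: "\<And>m n. m < d \<Longrightarrow> n < d \<Longrightarrow> ip (e m) (e n) = (if m = n then 1 else 0)"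
    and l: "\<And>m i. m < d \<Longrightarrow> i < d \<Longrightarrow> ap A (e m) i = of_real (l m) * e m i" using eigenbasis[OF A] by blast
  note Ac = self_adjoint_carrier[OF A]
  define U where "U = Matrix.mat d d (\<lambda>(i, m). e m i)"
  have U: "U \<in> carrier_mat d d" by (simp add: U_def)
  have Uij: "U $$ (i, m) = e m i" if "i < d" "m < d" for i m using that by (simp add: U_def)
  note Ua = mat_adjoint_carrier[OF U]
  have UaU: "mat_adjoint U * U = 1\<^sub>m d"
  proof (rule eq_matI)
    fix m n assume "m < dim_row (1\<^sub>m d :: complex mat)" "n < dim_col (1\<^sub>m d :: complex mat)"
    then have mn: "m < d" "n < d" by auto
    have "(mat_adjoint U * U) $$ (m, n) = ip (e n) (e m)"
      using U Ua mn by (simp add: scalar_prod_def lessThan_atLeast0 ip_def mat_adjoint_index Uij mult.commute)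
    then show "(mat_adjoint U * U) $$ (m, n) = 1\<^sub>m d $$ (m, n)" using mn o by auto
  qed (use U Ua in auto)
  have UUa: "U * mat_adjoint U = 1\<^sub>m d" by (rule mat_mult_left_right_inverse[OF Ua U UaU])
  have AU: "A * U = U * mat_diag d (\<lambda>i. complex_of_real (l i))"
  proof (rule eq_matI)
    fix i m assume "i < dim_row (U * mat_diag d (\<lambda>i. complex_of_real (l i)))" "m < dim_col (U * mat_diag d (\<lambda>i. complex_of_real (l i)))"
    then have im: "i < d" "m < d" using U by auto
    have "(A * U) $$ (i, m) = ap A (e m) i" using Ac U im by (auto simp: ap_def scalar_prod_def lessThan_atLeast0 Uij intro!: sum.cong)
    also have "\<dots> = (U * mat_diag d (\<lambda>i. complex_of_real (l i))) $$ (i, m)" using U im by (simp add: l mat_diag_mult_right Uij)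
    finally show "(A * U) $$ (i, m) = (U * mat_diag d (\<lambda>i. complex_of_real (l i))) $$ (i, m)" .
  qed (use U Ac in auto)
  have AD: "A = U * mat_diag d (\<lambda>i. complex_of_real (l i)) * mat_adjoint U"
    using assoc_mult_mat[OF Ac U Ua] by (simp add: AU UUa right_mult_one_mat[OF Ac])
  have fc: "fun_calc d \<phi> A = U * mat_diag d (\<lambda>i. \<phi> (l i)) * mat_adjoint U" for \<phi>
    unfolding fun_calc_def
  proof (rule the_equality)
    show "\<exists>U' l'. U' \<in> carrier_mat d d \<and> U' * mat_adjoint U' = 1\<^sub>m d \<and> mat_adjoint U' * U' = 1\<^sub>m d
      \<and> A = U' * mat_diag d (\<lambda>i. complex_of_real (l' i)) * mat_adjoint U'
      \<and> U * mat_diag d (\<lambda>i. \<phi> (l i)) * mat_adjoint U = U' * mat_diag d (\<lambda>i. \<phi> (l' i)) * mat_adjoint U'"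
      using U UUa UaU AD by blast
  next
    fix B assume "\<exists>U' l'. U' \<in> carrier_mat d d \<and> U' * mat_adjoint U' = 1\<^sub>m d \<and> mat_adjoint U' * U' = 1\<^sub>m d
      \<and> A = U' * mat_diag d (\<lambda>i. complex_of_real (l' i)) * mat_adjoint U'
      \<and> B = U' * mat_diag d (\<lambda>i. \<phi> (l' i)) * mat_adjoint U'"
    then obtain V k where V: "V \<in> carrier_mat d d" "V * mat_adjoint V = 1\<^sub>m d" "mat_adjoint V * V = 1\<^sub>m d"
      and AV: "A = V * mat_diag d (\<lambda>i. complex_of_real (k i)) * mat_adjoint V" and B: "B = V * mat_diag d (\<lambda>i. \<phi> (k i)) * mat_adjoint V"
      by blast
    show "B = U * mat_diag d (\<lambda>i. \<phi> (l i)) * mat_adjoint U"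
      unfolding B using fun_calc_unique[OF V U UUa UaU, of k l \<phi>] AD AV by simp
  qed
  show thesis
  proof (rule that[of e l])
    show "fun_calc d \<phi> A \<in> carrier_mat d d" for \<phi> unfolding fc by (intro mult_carrier_mat[OF mult_carrier_mat[OF U] Ua]) simp
    show "fun_calc d \<phi> A $$ (i, j) = (\<Sum>m<d. e m i * \<phi> (l m) * cnj (e m j))" if "i < d" "j < d" for \<phi> i j
      using that by (simp add: fc mult3_diag_entry[OF U] Uij)
    show "nv (e m) = 1" if "m < d" for m
    proof -
      have "(nv (e m))\<^sup>2 = 1" using o[OF that that] by (simp add: nv_eqI)
      then show ?thesis using nv_nonneg[of "e m"] by (simp add: power2_eq_1_iff)
    qed
    show "resolvent d z A $$ (i, j) = (\<Sum>m<d. e m i * (1 / (z - of_real (l m))) * cnj (e m j))" if z: "Im z \<noteq> 0" and ij: "i < d" "j < d" for z i j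
    proof -
      let ?D = "\<lambda>i. if i = j then 1 else (0::complex)"
      have re: "rs z A (e m) i = e m i / (z - of_real (l m))" if m: "m < d" for m
      proof -
        have nz: "z - of_real (l m) \<noteq> 0" using z by (auto simp: complex_eq_iff)
        have "rs z A (\<lambda>i. z * e m i - ap A (e m) i) i = e m i" by (rule rs_left[OF A z ij(1)])
        moreover have "rs z A (\<lambda>i. z * e m i - ap A (e m) i) = rs z A (\<lambda>i. (z - of_real (l m)) * e m i)"
          unfolding rs_def by (rule ap_cong) (simp add: l m algebra_simps)
        ultimately have "(z - of_real (l m)) * rs z A (e m) i = e m i" by (simp only: rs_lin(3))
        then show ?thesis using nz by (simp add: nonzero_eq_divide_eq mult.commute)
      qed
      \<comment> \<open>Completeness of the eigenbasis: the expansion of the j-th coordinate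
        vector.\<close>
      have comp: "?D n = (\<Sum>m<d. cnj (e m j) * e m n)" if n: "n < d" for n
      proof -
        have "(U * mat_adjoint U) $$ (n, j) = (\<Sum>m<d. e m n * cnj (e m j))"
          using U Ua n ij by (simp add: scalar_prod_def lessThan_atLeast0 mat_adjoint_index Uij)
        then show ?thesis using n ij by (simp add: UUa mult.commute)
      qed
      have sumlin: "rs z A (\<lambda>n. \<Sum>m\<in>S. c m * x m n) = (\<lambda>n. \<Sum>m\<in>S. c m * rs z A (x m) n)" if "finite S" for S :: "nat set" and c x
        using that
      proof (induction S rule: finite_induct)
        case empty
        show ?case using rs_lin(3)[of z A 0 "\<lambda>_. 0"] by simp
      next
        case (insert a S)
        then show ?case by (simp add: rs_lin)
      qed
      have "resolvent d z A $$ (i, j) = rs z A ?D i"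
        using ij by (simp add: rs_def ap_def if_distrib[of "\<lambda>c. _ * c"] cong: if_cong)
      also have "rs z A ?D = rs z A (\<lambda>n. \<Sum>m<d. cnj (e m j) * e m n)"
        unfolding rs_def by (rule ap_cong) (rule comp)
      also have "\<dots> i = (\<Sum>m<d. cnj (e m j) * rs z A (e m) i)" by (simp add: sumlin)
      also have "\<dots> = (\<Sum>m<d. e m i * (1 / (z - of_real (l m))) * cnj (e m j))"
        by (intro sum.cong refl) (simp add: re mult.commute)
      finally show ?thesis .
    qed
  qed
qed

subsection \<open>Measurability\<close>

definition mm :: "'a measure \<Rightarrow> ('a \<Rightarrow> complex mat) \<Rightarrow> bool" where
  "mm M X \<longleftrightarrow> (\<forall>w\<in>space M. X w \<in> carrier_mat d d) \<and> (\<forall>i<d. \<forall>j<d. (\<lambda>w. X w $$ (i, j)) \<in> borel_measurable M)"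

definition mv :: "'a measure \<Rightarrow> ('a \<Rightarrow> nat \<Rightarrow> complex) \<Rightarrow> bool" where
  "mv M x \<longleftrightarrow> (\<forall>i. (\<lambda>w. x w i) \<in> borel_measurable M)"

lemma space_mat_borel: "space (mat_borel d) = carrier_mat d d"
  by (simp add: mat_borel_def)

lemma measurable_mat_borel_iff: "X \<in> M \<rightarrow>\<^sub>M mat_borel d \<longleftrightarrow> mm M X"
proof
  let ?f = "\<lambda>A :: complex mat. \<lambda>ij\<in>{..<d} \<times> {..<d}. A $$ ij"
  assume X: "X \<in> M \<rightarrow>\<^sub>M mat_borel d"
  have "?f \<in> mat_borel d \<rightarrow>\<^sub>M Pi\<^sub>M ({..<d} \<times> {..<d}) (\<lambda>_. borel)"
    unfolding mat_borel_def by (rule measurable_vimage_algebra1) (auto simp: space_PiM)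
  from measurable_compose[OF X this] have "(\<lambda>w. ?f (X w)) \<in> M \<rightarrow>\<^sub>M Pi\<^sub>M ({..<d} \<times> {..<d}) (\<lambda>_. borel)" .
  then have "(\<lambda>w. ?f (X w) ij) \<in> borel_measurable M" if "ij \<in> {..<d} \<times> {..<d}" for ij
    by (rule measurable_compose[OF _ measurable_component_singleton[OF that]])
  from this[of "(_, _)"] have "(\<lambda>w. X w $$ (i, j)) \<in> borel_measurable M" if "i < d" "j < d" for i j using that by simp
  then show "mm M X" using measurable_space[OF X] by (auto simp: mm_def space_mat_borel)
next
  assume "mm M X"
  then show "X \<in> M \<rightarrow>\<^sub>M mat_borel d" unfolding mat_borel_def
    by (intro measurable_vimage_algebra2 measurable_restrict) (auto simp: mm_def)
qed

lemma mm_entry: "mm M X \<Longrightarrow> i < d \<Longrightarrow> j < d \<Longrightarrow> (\<lambda>w. X w $$ (i, j)) \<in> borel_measurable M"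
  by (simp add: mm_def)
lemma mm_carrier: "mm M X \<Longrightarrow> w \<in> space M \<Longrightarrow> X w \<in> carrier_mat d d" by (simp add: mm_def)

lemma mm_compose: "mm M X \<Longrightarrow> f \<in> N \<rightarrow>\<^sub>M M \<Longrightarrow> mm N (\<lambda>w. X (f w))"
  by (auto simp: mm_def dest: measurable_space intro: measurable_compose)

lemma mm_const: "A \<in> carrier_mat d d \<Longrightarrow> mm M (\<lambda>_. A)" by (simp add: mm_def)

lemma mm_id: "mm (mat_borel d) (\<lambda>A. A)" using measurable_mat_borel_iff[of "\<lambda>A. A" "mat_borel d"] by simp

lemma mm_diff: assumes "mm M X" "mm M Y" shows "mm M (\<lambda>w. X w - Y w)"
proof -
  have "(\<lambda>w. (X w - Y w) $$ (i, j)) \<in> borel_measurable M" if "i < d" "j < d" for i j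
  proof -
    have "(\<lambda>w. X w $$ (i, j) - Y w $$ (i, j)) \<in> borel_measurable M"
      by (intro borel_measurable_diff mm_entry[OF assms(1)] mm_entry[OF assms(2)] that)
    then show ?thesis by (rule measurable_cong[THEN iffD1, rotated]) (use assms that in \<open>auto simp: mm_def\<close>)
  qed
  then show ?thesis using assms by (auto simp: mm_def intro!: minus_carrier_mat)
qed

lemma mm_smult: assumes "mm M X" "c \<in> borel_measurable M" shows "mm M (\<lambda>w. c w \<cdot>\<^sub>m X w)"
proof -
  have "(\<lambda>w. (c w \<cdot>\<^sub>m X w) $$ (i, j)) \<in> borel_measurable M" if "i < d" "j < d" for i j
  proof -
    have "(\<lambda>w. c w * X w $$ (i, j)) \<in> borel_measurable M"
      by (intro borel_measurable_times mm_entry[OF assms(1)] assms(2) that)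
    then show ?thesis by (rule measurable_cong[THEN iffD1, rotated]) (use assms that in \<open>auto simp: mm_def\<close>)
  qed
  then show ?thesis using assms by (auto simp: mm_def)
qed

lemma mm_mat: "(\<And>i j. i < d \<Longrightarrow> j < d \<Longrightarrow> (\<lambda>w. f w (i, j)) \<in> borel_measurable M) \<Longrightarrow> mm M (\<lambda>w. Matrix.mat d d (f w))"
  by (simp add: mm_def)

lemma mv_const: "mv M (\<lambda>_. x)" by (simp add: mv_def)

lemma mv_ap: assumes "mm M X" "mv M x" shows "mv M (\<lambda>w. ap (X w) (x w))"
  unfolding mv_def ap_def
proof
  fix i
  show "(\<lambda>w. if i < d then \<Sum>j<d. X w $$ (i, j) * x w j else 0) \<in> borel_measurable M"
    using assms(2) by (cases "i < d") (auto simp: mv_def intro!: borel_measurable_sum borel_measurable_times mm_entry[OF assms(1)])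
qed

lemma cnj_measurable: "f \<in> borel_measurable M \<Longrightarrow> (\<lambda>w. cnj (f w)) \<in> borel_measurable M"
  using measurable_compose[of f M borel cnj borel] borel_measurable_continuous_onI[of cnj]
  by (simp add: continuous_on_cnj)

lemma ip_measurable: "mv M x \<Longrightarrow> mv M y \<Longrightarrow> (\<lambda>w. ip (x w) (y w)) \<in> borel_measurable M"
  unfolding ip_def mv_def by (auto intro!: borel_measurable_sum borel_measurable_times cnj_measurable)

lemma nv_measurable: assumes "mv M x" shows "(\<lambda>w. nv (x w)) \<in> borel_measurable M"
proof -
  have [measurable]: "(\<lambda>w. x w i) \<in> borel_measurable M" for i using assms by (simp add: mv_def)
  show ?thesis unfolding nv_def L2_set_def by measurable
qed

lemma fr_measurable: "mm M X \<Longrightarrow> (\<lambda>w. fr (X w)) \<in> borel_measurable M"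
  unfolding fr_def by (intro borel_measurable_sum borel_measurable_norm[THEN measurable_compose[rotated]]) (auto dest: mm_entry)

end

lemma det_measurable:
  assumes "\<And>w. w \<in> space M \<Longrightarrow> Y w \<in> carrier_mat n n"
    and "\<And>i j. i < n \<Longrightarrow> j < n \<Longrightarrow> (\<lambda>w. (Y w :: complex mat) $$ (i, j)) \<in> borel_measurable M"
  shows "(\<lambda>w. det (Y w)) \<in> borel_measurable M"
proof -
  have "(\<lambda>w. \<Sum>p\<in>{p. p permutes {0..<n}}. signof p * (\<Prod>i = 0..<n. Y w $$ (i, p i))) \<in> borel_measurable M"
  proof (intro borel_measurable_sum borel_measurable_times borel_measurable_const borel_measurable_prod)
    fix p i assume "p \<in> {p. p permutes {0..<n}}" "i \<in> {0..<n}"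
    then have "p i < n" "i < n" by (auto dest: permutes_in_image)
    then show "(\<lambda>w. Y w $$ (i, p i)) \<in> borel_measurable M" using assms(2) by blast
  qed
  moreover have "det (Y w) = (\<Sum>p\<in>{p. p permutes {0..<n}}. signof p * (\<Prod>i = 0..<n. Y w $$ (i, p i)))" if "w \<in> space M" for w
    using assms(1)[OF that] by (auto simp: Determinant.det_def)
  ultimately show ?thesis by (simp cong: measurable_cong)
qed

context dim
begin

lemma resolvent_entry_measurable:
  assumes X: "mm M X" and sa: "\<And>w. w \<in> space M \<Longrightarrow> self_adjoint d (X w)"
    and z: "z \<in> borel_measurable M" "\<And>w. w \<in> space M \<Longrightarrow> Im (z w) \<noteq> 0" and ij: "i < d" "j < d"
  shows "(\<lambda>w. resolvent d (z w) (X w) $$ (i, j)) \<in> borel_measurable M"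
proof -
  let ?Y = "\<lambda>w. z w \<cdot>\<^sub>m 1\<^sub>m d - X w"
  have Y: "mm M ?Y" by (intro mm_diff mm_smult mm_const X z) auto
  have d: "(\<lambda>w. det (?Y w)) \<in> borel_measurable M"
    using mm_carrier[OF Y] mm_entry[OF Y] by (rule det_measurable)
  have md: "(\<lambda>w. det (mat_delete (?Y w) j i)) \<in> borel_measurable M"
  proof (rule det_measurable)
    fix w assume "w \<in> space M"
    from mm_carrier[OF Y this] show "mat_delete (?Y w) j i \<in> carrier_mat (d - 1) (d - 1)" by (rule mat_delete_carrier)
  next
    fix a b assume ab: "a < d - 1" "b < d - 1"
    have "(\<lambda>w. ?Y w $$ (if a < j then a else Suc a, if b < i then b else Suc b)) \<in> borel_measurable M"
      using ab by (intro mm_entry[OF Y]) auto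
    then show "(\<lambda>w. mat_delete (?Y w) j i $$ (a, b)) \<in> borel_measurable M"
      by (rule measurable_cong[THEN iffD1, rotated]) (use ab in \<open>simp add: mat_delete_def mm_carrier[OF X, THEN carrier_matD(1)] mm_carrier[OF X, THEN carrier_matD(2)]\<close>)
  qed
  have "(\<lambda>w. (-1) ^ (j + i) * det (mat_delete (?Y w) j i) / det (?Y w)) \<in> borel_measurable M"
    using d md by measurable
  then show ?thesis
    by (rule measurable_cong[THEN iffD1, rotated])
       (use sa z ij in \<open>simp add: resolvent_adj[OF self_adjoint_carrier shifted_det_nonzero] cofactor_def\<close>)
qed

lemma mm_resolvent:
  assumes X: "mm M X" and sa: "\<And>w. w \<in> space M \<Longrightarrow> self_adjoint d (X w)"
    and z: "z \<in> borel_measurable M" "\<And>w. w \<in> space M \<Longrightarrow> Im (z w) \<noteq> 0"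
  shows "mm M (\<lambda>w. resolvent d (z w) (X w))"
  using resolvent_entry_measurable[OF assms] resolvent_carrier sa z(2) by (auto simp: mm_def)

lemma mv_rs:
  assumes X: "mm M X" and sa: "\<And>w. w \<in> space M \<Longrightarrow> self_adjoint d (X w)"
    and z: "z \<in> borel_measurable M" "\<And>w. w \<in> space M \<Longrightarrow> Im (z w) \<noteq> 0" and x: "mv M x"
  shows "mv M (\<lambda>w. rs (z w) (X w) (x w))"
  unfolding rs_def by (intro mv_ap mm_resolvent assms)

text \<open>Vectors with rational coordinates; they replace the supremum in \<open>op_norm\<close>
  by countably many conditions.\<close>

lemma dense_vectors:
  "\<exists>D :: (nat \<Rightarrow> complex) set. countable D \<and> (\<forall>x. \<forall>\<epsilon>>0. \<exists>v\<in>D. nv (\<lambda>i. x i - v i) \<le> \<epsilon>)"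
proof (intro exI conjI allI impI)
  let ?D = "range (\<lambda>(p :: rat list, q :: rat list). \<lambda>i. Complex (of_rat (p ! i)) (of_rat (q ! i)))"
  show "countable ?D" by (intro countable_image) auto
  fix x :: "nat \<Rightarrow> complex" and \<epsilon> :: real assume e: "\<epsilon> > 0"
  define \<delta> where "\<delta> = \<epsilon> / (2 * (real d + 1))"
  have dl: "\<delta> > 0" using e by (simp add: \<delta>_def)
  have "\<exists>q :: rat. \<bar>r - of_rat q\<bar> \<le> \<delta>" for r :: real
  proof -
    obtain q :: rat where "r < of_rat q" "of_rat q < r + \<delta>" using of_rat_dense[of r "r + \<delta>"] dl by auto
    then show ?thesis by (intro exI[of _ q]) auto
  qed
  then obtain f :: "real \<Rightarrow> rat" where f: "\<And>r. \<bar>r - of_rat (f r)\<bar> \<le> \<delta>" by metis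
  define v where "v = (\<lambda>i. Complex (of_rat (map (\<lambda>i. f (Re (x i))) [0..<d] ! i)) (of_rat (map (\<lambda>i. f (Im (x i))) [0..<d] ! i)))"
  show "\<exists>v\<in>?D. nv (\<lambda>i. x i - v i) \<le> \<epsilon>"
  proof (rule bexI)
    show "v \<in> ?D" unfolding v_def by (rule range_eqI[of _ _ "(map (\<lambda>i. f (Re (x i))) [0..<d], map (\<lambda>i. f (Im (x i))) [0..<d])"]) simp
    have "cmod (x i - v i) \<le> 2 * \<delta>" if "i < d" for i
    proof -
      have "cmod (x i - v i) \<le> \<bar>Re (x i - v i)\<bar> + \<bar>Im (x i - v i)\<bar>" by (rule cmod_le)
      also have "\<dots> \<le> \<delta> + \<delta>" using that f[of "Re (x i)"] f[of "Im (x i)"] by (intro add_mono) (auto simp: v_def)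
      finally show ?thesis by simp
    qed
    then have "(\<Sum>i<d. cmod (x i - v i)) \<le> (\<Sum>i<d. 2 * \<delta>)" by (intro sum_mono) auto
    moreover have "nv (\<lambda>i. x i - v i) \<le> (\<Sum>i<d. cmod (x i - v i))" unfolding nv_def by (rule L2_set_le_sum) auto
    moreover have "real d * (2 * \<delta>) \<le> \<epsilon>" using e by (simp add: \<delta>_def field_simps)
    ultimately show "nv (\<lambda>i. x i - v i) \<le> \<epsilon>" by simp
  qed
qed

text \<open>The condition \<open>op_norm A \<le> a\<close> is tested in the homogeneous form
  \<open>nv (ap A v) \<le> a * nv v\<close>, for which a countable dense set in the whole space can
  be used instead of one in the unit sphere.\<close>

lemma op_norm_measurable:
  assumes d: "0 < d" and X: "mm M X" shows "(\<lambda>w. op_norm (X w)) \<in> borel_measurable M"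
proof (rule borel_measurableI_le)
  fix a :: real
  obtain D where D: "countable D" "\<And>x \<epsilon>. \<epsilon> > 0 \<Longrightarrow> \<exists>v\<in>D. nv (\<lambda>i. x i - v i) \<le> \<epsilon>" using dense_vectors by metis
  have iff: "op_norm A \<le> a \<longleftrightarrow> (\<forall>v\<in>D. nv (ap A v) \<le> a * nv v)" if A: "A \<in> carrier_mat d d" for A
  proof
    assume "op_norm A \<le> a"
    then show "\<forall>v\<in>D. nv (ap A v) \<le> a * nv v"
      by (auto intro!: order.trans[OF op_norm_bound[OF d A]] mult_right_mono)
  next
    assume *: "\<forall>v\<in>D. nv (ap A v) \<le> a * nv v"
    show "op_norm A \<le> a"
    proof (rule op_norm_le[OF d A], rule field_le_epsilon)
      fix x \<epsilon> assume x: "nv x = 1" and e: "0 < (\<epsilon>::real)"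
      \<comment> \<open>Chosen such that the error \<open>\<bar>a\<bar> * \<delta>\<close> from the
        norm of v and the error \<open>fr A * \<delta>\<close> from the image of x - v together stay
        below \<epsilon>.\<close>
      define \<delta> where "\<delta> = \<epsilon> / (\<bar>a\<bar> + fr A + 1)"
      have pos: "0 < \<bar>a\<bar> + fr A + 1" using fr_nonneg[of A] by linarith
      then have dl: "\<delta> > 0" using e by (simp add: \<delta>_def)
      from D(2)[OF this, of x] obtain v where v: "v \<in> D" "nv (\<lambda>i. x i - v i) \<le> \<delta>" by blast
      have "nv (ap A x) = nv (\<lambda>i. ap A v i + ap A (\<lambda>i. x i - v i) i)" by (simp add: ap_diff)
      also have "\<dots> \<le> nv (ap A v) + nv (ap A (\<lambda>i. x i - v i))" by (rule nv_add)
      also have "\<dots> \<le> a * nv v + fr A * \<delta>"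
        using * v by (intro add_mono order.trans[OF nv_ap_fr[of A "\<lambda>i. x i - v i"]] mult_left_mono) auto
      also have "a * nv v \<le> a + \<bar>a\<bar> * \<delta>"
      proof -
        have "nv v \<le> nv x + nv (\<lambda>i. x i - v i)" using nv_diff[of x "\<lambda>i. x i - v i"] by simp
        moreover have "nv x \<le> nv v + nv (\<lambda>i. x i - v i)" using nv_add[of v "\<lambda>i. x i - v i"] by simp
        ultimately have "\<bar>nv v - 1\<bar> \<le> \<delta>" using x v(2) by linarith
        then have "\<bar>a * (nv v - 1)\<bar> \<le> \<bar>a\<bar> * \<delta>" by (simp add: abs_mult mult_left_mono)
        then show ?thesis by (simp add: algebra_simps)
      qed
      also have "a + \<bar>a\<bar> * \<delta> + fr A * \<delta> \<le> a + (\<bar>a\<bar> + fr A + 1) * \<delta>" using dl by (simp add: algebra_simps)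
      also have "\<dots> = a + \<epsilon>" using pos by (simp add: \<delta>_def)
      finally show "nv (ap A x) \<le> a + \<epsilon>" by simp
    qed
  qed
  have "{w \<in> space M. \<forall>v\<in>D. nv (ap (X w) v) \<le> a * nv v} \<in> sets M"
  proof -
    have [measurable]: "(\<lambda>w. nv (ap (X w) v)) \<in> borel_measurable M" for v by (intro nv_measurable mv_ap X mv_const)
    note [measurable] = D(1)
    show ?thesis by measurable
  qed
  moreover have "{w \<in> space M. op_norm (X w) \<le> a} = {w \<in> space M. \<forall>v\<in>D. nv (ap (X w) v) \<le> a * nv v}"
    using iff mm_carrier[OF X] by auto
  ultimately show "{w \<in> space M. op_norm (X w) \<le> a} \<in> sets M" by simp
qed

end

context dim
begin

subsection \<open>Pointwise perturbation bounds\<close>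

text \<open>The factors resolvent, \<open>Z\<close>, resolvent: the derivative of the resolvent form
  in the direction \<open>Z\<close>. With five factors, \<open>quin\<close> is half of the second
  derivative.\<close>

definition trip :: "complex \<Rightarrow> complex mat \<Rightarrow> complex mat \<Rightarrow> (nat \<Rightarrow> complex) \<Rightarrow> (nat \<Rightarrow> complex) \<Rightarrow> complex" where
  "trip z A Z w v = ip (rs z A (ap Z (rs z A w))) v"

definition quin :: "complex \<Rightarrow> complex mat \<Rightarrow> complex mat \<Rightarrow> (nat \<Rightarrow> complex) \<Rightarrow> (nat \<Rightarrow> complex) \<Rightarrow> complex" where
  "quin z A Z w v = ip (rs z A (ap Z (rs z A (ap Z (rs z A w))))) v"

lemma trip_eq: "self_adjoint d A \<Longrightarrow> Im z \<noteq> 0 \<Longrightarrow> trip z A Z w v = ip (ap Z (rs z A w)) (rs (cnj z) A v)"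
  by (simp add: trip_def rs_adjoint)

lemma quin_eq: "self_adjoint d A \<Longrightarrow> self_adjoint d Z \<Longrightarrow> Im z \<noteq> 0 \<Longrightarrow>
    quin z A Z w v = ip (rs z A (ap Z (rs z A w))) (ap Z (rs (cnj z) A v))"
  by (simp add: quin_def rs_adjoint self_adjoint_ip)

lemma norm_ip_le: "nv x \<le> a \<Longrightarrow> nv y \<le> b \<Longrightarrow> cmod (ip x y) \<le> a * b"
  using cauchy_schwarz[of x y] mult_mono[of "nv x" a "nv y" b] nv_nonneg[of x] nv_nonneg[of y] by linarith

context
  fixes A A0 Z :: "complex mat" and z :: complex and s :: real and w v :: "nat \<Rightarrow> complex"
  assumes A: "self_adjoint d A" and A0: "self_adjoint d A0" and Z: "self_adjoint d Z"
    and z: "Im z \<noteq> 0" and d0: "0 < d" and s: "0 \<le> s" "s \<le> 1"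
    and AZ: "\<And>i j. i < d \<Longrightarrow> j < d \<Longrightarrow> A $$ (i, j) = A0 $$ (i, j) + of_real s * Z $$ (i, j)"
begin

text \<open>In the application \<open>A0\<close> lacks the summand \<open>Z\<close>, so that
  \<open>u0\<close> and \<open>t0\<close> are independent of it. The fine error bounds are expressed
  through \<open>Z\<close>, and a copy \<open>Y\<close> of it, applied to these two vectors.\<close>

definition "u0 = rs z A0 w"
definition "t0 = rs (cnj z) A0 v"

lemma z_cnj: "Im (cnj z) \<noteq> 0" using z by simp

lemma step_w: "rs z A x = (\<lambda>i. rs z A0 x i + of_real s * rs z A (ap Z (rs z A0 x)) i)"
  by (rule resolvent_identity[OF A A0 z AZ])

lemma step_v: "rs (cnj z) A x = (\<lambda>i. rs (cnj z) A0 x i + of_real s * rs (cnj z) A (ap Z (rs (cnj z) A0 x)) i)"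
  by (rule resolvent_identity[OF A A0 z_cnj AZ])

lemma rsb: "nv (rs z A x) \<le> nv x / \<bar>Im z\<bar>" "nv (rs (cnj z) A x) \<le> nv x / \<bar>Im z\<bar>" "nv (rs z A0 x) \<le> nv x / \<bar>Im z\<bar>" "nv (rs (cnj z) A0 x) \<le> nv x / \<bar>Im z\<bar>"
  using rs_bound[OF A z] rs_bound[OF A z_cnj] rs_bound[OF A0 z] rs_bound[OF A0 z_cnj] by auto

lemma Zb: "nv (ap Z x) \<le> op_norm Z * nv x" by (rule op_norm_bound[OF d0 self_adjoint_carrier[OF Z]])

lemma Zn: "0 \<le> op_norm Z" by (rule op_norm_nonneg[OF d0 self_adjoint_carrier[OF Z]])

lemma y_pos: "0 < \<bar>Im z\<bar>" using z by simp

text \<open>Each outer resolvent is expanded once, the left one after moving it to v by adjunction.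
  In the exact remainder the outer factors \<open>Z\<close> then act on \<open>u0\<close> and
  \<open>t0\<close>, and a single \<open>Z\<close> is left in the middle.\<close>

lemma first_order_expansion:
  "trip z A Z w v - trip z A0 Z w v - 2 * of_real s * quin z A0 Z w v
    = (of_real s)\<^sup>2 * (2 * ip (rs z A (ap Z (rs z A0 (ap Z u0)))) (ap Z t0) + ip (rs z A (ap Z (rs z A (ap Z u0)))) (ap Z t0))"
proof -
  let ?M = "rs z A" and ?Ms = "rs (cnj z) A"
  have 1: "trip z A Z w v = ip (ap Z (\<lambda>i. u0 i + of_real s * ?M (ap Z u0) i)) (\<lambda>i. t0 i + of_real s * ?Ms (ap Z t0) i)"
    unfolding trip_eq[OF A z] u0_def t0_def by (subst step_w, subst step_v) simp
  have 2: "ip (ap Z (?M (ap Z u0))) t0 = ip (?M (ap Z u0)) (ap Z t0)" by (rule self_adjoint_ip[OF Z])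
  have 3: "ip (ap Z u0) (?Ms (ap Z t0)) = ip (?M (ap Z u0)) (ap Z t0)" using rs_adjoint[OF A z] by simp
  have 4: "ip (ap Z (?M (ap Z u0))) (?Ms (ap Z t0)) = ip (?M (ap Z (?M (ap Z u0)))) (ap Z t0)" using rs_adjoint[OF A z] by simp
  have 5: "ip (?M (ap Z u0)) (ap Z t0) = ip (rs z A0 (ap Z u0)) (ap Z t0) + of_real s * ip (?M (ap Z (rs z A0 (ap Z u0)))) (ap Z t0)"
    by (subst step_w) (simp add: ip_simps)
  have 6: "trip z A0 Z w v = ip (ap Z u0) t0" "quin z A0 Z w v = ip (rs z A0 (ap Z u0)) (ap Z t0)"
    unfolding trip_eq[OF A0 z] quin_eq[OF A0 Z z] u0_def t0_def by simp_all
  have "trip z A Z w v = ip (ap Z u0) t0 + 2 * of_real s * ip (?M (ap Z u0)) (ap Z t0) + (of_real s)\<^sup>2 * ip (?M (ap Z (?M (ap Z u0)))) (ap Z t0)"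
    unfolding 1 ap_simps ip_simps 2 3 4 by (simp add: algebra_simps power2_eq_square)
  then show ?thesis unfolding 6 5 by (simp add: algebra_simps power2_eq_square)
qed

text \<open>Only the middle \<open>Z\<close> is estimated by its operator norm; the other two enter
  through vectors, whose mean squares can be summed over the summands. The factor 3 counts the terms
  of the remainder.\<close>

lemma first_order_fine:
  "cmod (trip z A Z w v - trip z A0 Z w v - 2 * of_real s * quin z A0 Z w v) \<le> 3 * op_norm Z / (Im z)\<^sup>2 * nv (ap Z t0) * nv (ap Z u0)"
proof -
  let ?y = "\<bar>Im z\<bar>" and ?a = "nv (ap Z t0)" and ?b = "nv (ap Z u0)" and ?q = "op_norm Z"
  have g: "nv (rs z A (ap Z x)) \<le> ?q * (?b / ?y) / ?y" if "nv x \<le> ?b / ?y" for x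
  proof -
    have "nv (rs z A (ap Z x)) \<le> nv (ap Z x) / ?y" by (rule rsb)
    also have "\<dots> \<le> (?q * nv x) / ?y" using y_pos by (intro divide_right_mono Zb) auto
    also have "\<dots> \<le> ?q * (?b / ?y) / ?y" using y_pos Zn that by (intro divide_right_mono mult_left_mono) auto
    finally show ?thesis .
  qed
  have 1: "cmod (ip (rs z A (ap Z (rs z A0 (ap Z u0)))) (ap Z t0)) \<le> ?q * (?b / ?y) / ?y * ?a"
    by (rule norm_ip_le[OF g order_refl]) (rule rsb)
  have 2: "cmod (ip (rs z A (ap Z (rs z A (ap Z u0)))) (ap Z t0)) \<le> ?q * (?b / ?y) / ?y * ?a"
    by (rule norm_ip_le[OF g order_refl]) (rule rsb)
  have "cmod (2 * ip (rs z A (ap Z (rs z A0 (ap Z u0)))) (ap Z t0) + ip (rs z A (ap Z (rs z A (ap Z u0)))) (ap Z t0)) \<le> 3 * (?q * (?b / ?y) / ?y * ?a)"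
    by (rule order.trans[OF norm_triangle_ineq]) (use 1 2 in \<open>simp add: norm_mult\<close>)
  moreover have "cmod ((of_real s)\<^sup>2 * c) \<le> cmod c" for c
    using s power_le_one[of s 2] by (simp add: norm_mult norm_power mult_left_le_one_le)
  ultimately have "cmod (trip z A Z w v - trip z A0 Z w v - 2 * of_real s * quin z A0 Z w v) \<le> 3 * (?q * (?b / ?y) / ?y * ?a)"
    unfolding first_order_expansion by (meson order.trans)
  also have "\<dots> = 3 * op_norm Z / (Im z)\<^sup>2 * ?a * ?b" using y_pos by (simp add: power2_eq_square field_simps flip: abs_mult)
  finally show ?thesis .
qed

lemma quin_bound:
  assumes B: "self_adjoint d B" and Y: "self_adjoint d Y"
  shows "cmod (quin z B Y w v) \<le> (op_norm Y)\<^sup>2 / \<bar>Im z\<bar> ^ 3 * (nv w * nv v)"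
proof -
  let ?y = "\<bar>Im z\<bar>"
  have n: "0 \<le> op_norm Y" by (rule op_norm_nonneg[OF d0 self_adjoint_carrier[OF Y]])
  have Yb: "nv (ap Y x) \<le> op_norm Y * nv x" for x by (rule op_norm_bound[OF d0 self_adjoint_carrier[OF Y]])
  have Ya: "nv (ap Y (rs z B x)) \<le> op_norm Y * (nv x / ?y)" "nv (ap Y (rs (cnj z) B x)) \<le> op_norm Y * (nv x / ?y)" for x
    using order.trans[OF Yb mult_left_mono[OF rs_bound[OF B z] n]] order.trans[OF Yb mult_left_mono[OF rs_bound[OF B z_cnj] n]] by simp_all
  have "nv (rs z B (ap Y (rs z B w))) \<le> op_norm Y * (nv w / ?y) / ?y"
    by (rule order.trans[OF rs_bound[OF B z] divide_right_mono[OF Ya(1) abs_ge_zero]])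
  then have "cmod (quin z B Y w v) \<le> (op_norm Y * (nv w / ?y) / ?y) * (op_norm Y * (nv v / ?y))"
    unfolding quin_eq[OF B Y z] by (intro norm_ip_le Ya)
  also have "\<dots> = (op_norm Y)\<^sup>2 / ?y ^ 3 * (nv w * nv v)" by (simp add: power2_eq_square power3_eq_cube)
  finally show ?thesis .
qed

text \<open>For large \<open>Z\<close> the expansion stops one order earlier, so that only the
  square of the operator norm occurs, which has finite mean. The 4 consists of 2 for the difference
  of the \<open>trip\<close> terms and 2 for \<open>quin\<close>.\<close>

lemma first_order_crude:
  "cmod (trip z A Z w v - trip z A0 Z w v - 2 * of_real s * quin z A0 Z w v) \<le> 4 * (op_norm Z)\<^sup>2 / \<bar>Im z\<bar> ^ 3 * (nv w * nv v)"
proof -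
  let ?y = "\<bar>Im z\<bar>" and ?q = "op_norm Z"
  have ub: "nv u0 \<le> nv w / ?y" "nv t0 \<le> nv v / ?y" unfolding u0_def t0_def by (rule rsb)+
  have Zx: "nv (ap Z x) \<le> ?q * c" if "nv x \<le> c" for x c using that Zn by (intro order.trans[OF Zb] mult_left_mono)
  have sle: "nv (\<lambda>i. of_real s * x i) \<le> nv x" for x using s by (simp only: nv_mult) (simp add: mult_left_le_one_le)
  have e1: "nv (\<lambda>i. of_real s * rs z A (ap Z u0) i) \<le> ?q * (nv w / ?y) / ?y"
    by (rule order.trans[OF sle order.trans[OF rsb(1) divide_right_mono[OF Zx[OF ub(1)] abs_ge_zero]]])
  have e2: "nv (\<lambda>i. of_real s * rs (cnj z) A (ap Z t0) i) \<le> ?q * (nv v / ?y) / ?y"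
    by (rule order.trans[OF sle order.trans[OF rsb(2) divide_right_mono[OF Zx[OF ub(2)] abs_ge_zero]]])
  have "trip z A Z w v - trip z A0 Z w v = ip (ap Z (\<lambda>i. of_real s * rs z A (ap Z u0) i)) (rs (cnj z) A v) + ip (ap Z u0) (\<lambda>i. of_real s * rs (cnj z) A (ap Z t0) i)"
  proof -
    have dv: "(\<lambda>i. of_real s * rs (cnj z) A (ap Z t0) i) = (\<lambda>i. rs (cnj z) A v i - t0 i)"
      by (subst step_v[of v]) (simp add: t0_def)
    have dw: "(\<lambda>i. of_real s * rs z A (ap Z u0) i) = (\<lambda>i. rs z A w i - u0 i)"
      by (subst step_w[of w]) (simp add: u0_def)
    show ?thesis unfolding trip_eq[OF A z] trip_eq[OF A0 z] dv dw by (simp add: ip_simps ap_simps u0_def t0_def)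
  qed
  also have "cmod \<dots> \<le> (?q * (?q * (nv w / ?y) / ?y)) * (nv v / ?y) + (?q * (nv w / ?y)) * (?q * (nv v / ?y) / ?y)"
  proof (rule norm_triangle_mono)
    show "cmod (ip (ap Z (\<lambda>i. of_real s * rs z A (ap Z u0) i)) (rs (cnj z) A v)) \<le> (?q * (?q * (nv w / ?y) / ?y)) * (nv v / ?y)"
      by (rule norm_ip_le) (rule Zx, rule e1, rule rsb(2))
    show "cmod (ip (ap Z u0) (\<lambda>i. of_real s * rs (cnj z) A (ap Z t0) i)) \<le> (?q * (nv w / ?y)) * (?q * (nv v / ?y) / ?y)"
      by (rule norm_ip_le) (rule Zx, rule ub(1), rule e2)
  qed
  also have "(?q * (?q * (nv w / ?y) / ?y)) * (nv v / ?y) = ?q\<^sup>2 / ?y ^ 3 * (nv w * nv v)"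
    by (simp add: power2_eq_square power3_eq_cube mult_ac)
  also have "(?q * (nv w / ?y)) * (?q * (nv v / ?y) / ?y) = ?q\<^sup>2 / ?y ^ 3 * (nv w * nv v)"
    by (simp add: power2_eq_square power3_eq_cube mult_ac)
  also have "?q\<^sup>2 / ?y ^ 3 * (nv w * nv v) + ?q\<^sup>2 / ?y ^ 3 * (nv w * nv v) = 2 * ?q\<^sup>2 / ?y ^ 3 * (nv w * nv v)" by simp
  finally have 1: "cmod (trip z A Z w v - trip z A0 Z w v) \<le> 2 * ?q\<^sup>2 / ?y ^ 3 * (nv w * nv v)" .
  have "cmod (2 * of_real s * quin z A0 Z w v) \<le> 2 * cmod (quin z A0 Z w v)" using s by (simp add: norm_mult mult_left_le_one_le)
  with quin_bound[OF A0 Z] have 2: "cmod (2 * of_real s * quin z A0 Z w v) \<le> 2 * (?q\<^sup>2 / ?y ^ 3 * (nv w * nv v))" by simp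
  show ?thesis using norm_triangle_ineq4[of "trip z A Z w v - trip z A0 Z w v" "2 * of_real s * quin z A0 Z w v"] 1 2 by simp
qed

context
  fixes Y :: "complex mat"
  assumes Y: "self_adjoint d Y"
begin

lemma Yb: "nv (ap Y x) \<le> op_norm Y * nv x" by (rule op_norm_bound[OF d0 self_adjoint_carrier[OF Y]])

lemma Yn: "0 \<le> op_norm Y" by (rule op_norm_nonneg[OF d0 self_adjoint_carrier[OF Y]])

lemma perturbed_vectors:
  "nv (\<lambda>i. ap Y (rs z A w) i - ap Y u0 i) \<le> op_norm Y * (nv (ap Z u0) / \<bar>Im z\<bar>)"
  "nv (\<lambda>i. ap Y (rs (cnj z) A v) i - ap Y t0 i) \<le> op_norm Y * (nv (ap Z t0) / \<bar>Im z\<bar>)"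
proof -
  have sle: "nv (\<lambda>i. of_real s * x i) \<le> nv x" for x using s by (simp only: nv_mult) (simp add: mult_left_le_one_le)
  have "(\<lambda>i. ap Y (rs z A w) i - ap Y u0 i) = ap Y (\<lambda>i. of_real s * rs z A (ap Z u0) i)"
    unfolding u0_def by (subst step_w) (simp add: ap_simps)
  then show "nv (\<lambda>i. ap Y (rs z A w) i - ap Y u0 i) \<le> op_norm Y * (nv (ap Z u0) / \<bar>Im z\<bar>)"
    using order.trans[OF Yb mult_left_mono[OF order.trans[OF sle rsb(1)] Yn]] by simp
  have "(\<lambda>i. ap Y (rs (cnj z) A v) i - ap Y t0 i) = ap Y (\<lambda>i. of_real s * rs (cnj z) A (ap Z t0) i)"
    unfolding t0_def by (subst step_v) (simp add: ap_simps)
  then show "nv (\<lambda>i. ap Y (rs (cnj z) A v) i - ap Y t0 i) \<le> op_norm Y * (nv (ap Z t0) / \<bar>Im z\<bar>)"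
    using order.trans[OF Yb mult_left_mono[OF order.trans[OF sle rsb(2)] Yn]] by simp
qed

text \<open>Allows \<open>u0\<close> to be replaced by the resolvent vector of the full matrix, at
  the price of a term that is absorbed later.\<close>

lemma perturbed_square:
  "(nv (ap Y u0))\<^sup>2 \<le> 2 * (nv (ap Y (rs z A w)))\<^sup>2 + 2 * (op_norm Y)\<^sup>2 / (Im z)\<^sup>2 * (nv (ap Z u0))\<^sup>2"
proof -
  let ?p = "nv (ap Y (rs z A w))" and ?q = "op_norm Y * (nv (ap Z u0) / \<bar>Im z\<bar>)"
  have "nv (ap Y u0) \<le> ?p + nv (\<lambda>i. ap Y (rs z A w) i - ap Y u0 i)"
    using nv_diff[of "ap Y (rs z A w)" "\<lambda>i. ap Y (rs z A w) i - ap Y u0 i"] by simp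
  then have "nv (ap Y u0) \<le> ?p + ?q" using perturbed_vectors(1) by linarith
  then have "(nv (ap Y u0))\<^sup>2 \<le> (?p + ?q)\<^sup>2" by (intro power_mono) auto
  also have "\<dots> \<le> 2 * ?p\<^sup>2 + 2 * ?q\<^sup>2" using sum_squares_bound[of ?p ?q] by (simp add: power2_sum)
  also have "\<dots> = 2 * ?p\<^sup>2 + 2 * (op_norm Y)\<^sup>2 / (Im z)\<^sup>2 * (nv (ap Z u0))\<^sup>2" by (simp add: power_mult_distrib power_divide)
  finally show ?thesis .
qed

text \<open>Telescoping over the three resolvents in which \<open>A\<close> differs from
  \<open>A0\<close>. Each replacement is paid for with one operator norm, at most \<open>R\<close>,
  while two vector norms are kept.\<close>

lemma second_order_fine:
  assumes R: "op_norm Z \<le> R" "op_norm Y \<le> R" "R \<le> \<bar>Im z\<bar>"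
  shows "cmod (quin z A Y w v - quin z A0 Y w v) \<le> R / (Im z)\<^sup>2 *
    ((nv (ap Y u0) + nv (ap Z u0)) * nv (ap Z t0) + nv (ap Z u0) * nv (ap Y t0) + nv (ap Y u0) * nv (ap Y t0))"
proof -
  let ?y = "\<bar>Im z\<bar>" and ?a = "nv (ap Z t0)" and ?b = "nv (ap Z u0)" and ?a' = "nv (ap Y t0)" and ?b' = "nv (ap Y u0)"
  define p where "p = ap Y (rs z A w)"
  define q where "q = ap Y (rs (cnj z) A v)"
  define p0 where "p0 = ap Y u0"
  define q0 where "q0 = ap Y t0"
  have R0: "0 \<le> R" using Zn R by linarith
  have dp: "nv (\<lambda>i. p i - p0 i) \<le> R * (?b / ?y)" unfolding p_def p0_def
    using R(2) by (intro order.trans[OF perturbed_vectors(1)] mult_right_mono) auto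
  have dq: "nv (\<lambda>i. q i - q0 i) \<le> R * (?a / ?y)" unfolding q_def q0_def
    using R(2) by (intro order.trans[OF perturbed_vectors(2)] mult_right_mono) auto
  have "nv p \<le> ?b' + nv (\<lambda>i. p i - p0 i)" using nv_add[of p0 "\<lambda>i. p i - p0 i"] by (simp add: p0_def)
  \<comment> \<open>Here \<open>R \<le> \<bar>Im z\<bar>\<close> enters; it keeps a second factor R
    out of the final bound.\<close>
  also have "\<dots> \<le> ?b' + ?y * (?b / ?y)" using dp R(3) by (intro add_left_mono order.trans[OF dp] mult_right_mono) auto
  finally have np: "nv p \<le> ?b' + ?b" using y_pos by simp
  have e: "quin z A Y w v - quin z A0 Y w v = ip (rs z A p) (\<lambda>i. q i - q0 i) + ip (rs z A (\<lambda>i. p i - p0 i)) q0 + ip (\<lambda>i. of_real s * rs z A (ap Z (rs z A0 p0)) i) q0"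
  proof -
    have "(\<lambda>i. of_real s * rs z A (ap Z (rs z A0 p0)) i) = (\<lambda>i. rs z A p0 i - rs z A0 p0 i)"
      by (subst (2) step_w) simp
    then show ?thesis
      unfolding quin_eq[OF A Y z] quin_eq[OF A0 Y z] by (simp add: ip_simps rs_lin p_def q_def p0_def q0_def u0_def t0_def)
  qed
  have m1: "nv (rs z A x) \<le> c / ?y" if "nv x \<le> c" for x c using that y_pos by (intro order.trans[OF rsb(1)] divide_right_mono) auto
  have m3: "nv (\<lambda>i. of_real s * rs z A (ap Z (rs z A0 p0)) i) \<le> (R * (?b' / ?y)) / ?y"
  proof -
    have "nv (\<lambda>i. of_real s * rs z A (ap Z (rs z A0 p0)) i) \<le> nv (rs z A (ap Z (rs z A0 p0)))"
      using s by (simp only: nv_mult) (simp add: mult_left_le_one_le)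
    also have "\<dots> \<le> (R * (?b' / ?y)) / ?y"
    proof (rule m1)
      have "nv (ap Z (rs z A0 p0)) \<le> op_norm Z * nv (rs z A0 p0)" by (rule Zb)
      also have "\<dots> \<le> R * (?b' / ?y)" using R(1) R0 rsb(3)[of p0] by (intro mult_mono) (auto simp: p0_def)
      finally show "nv (ap Z (rs z A0 p0)) \<le> R * (?b' / ?y)" .
    qed
    finally show ?thesis .
  qed
  have "cmod (quin z A Y w v - quin z A0 Y w v) \<le> ((?b' + ?b) / ?y) * (R * (?a / ?y)) + (R * (?b / ?y) / ?y) * ?a' + ((R * (?b' / ?y)) / ?y) * ?a'"
    unfolding e by (intro norm_triangle_mono norm_ip_le m1 np dp dq m3) (simp_all add: q0_def)
  also have "\<dots> = R / (Im z)\<^sup>2 * ((?b' + ?b) * ?a + ?b * ?a' + ?b' * ?a')"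
  proof -
    have "(Im z)\<^sup>2 = ?y * ?y" by (simp add: power2_eq_square flip: abs_mult)
    then show ?thesis using y_pos by (simp add: field_simps)
  qed
  finally show ?thesis .
qed

text \<open>\<open>Z\<close> plays the summand contained in \<open>A\<close> and \<open>Y\<close> an
  independent copy of it; the terms subtracted have expectations that vanish or cancel. If both
  norms are at most \<open>R\<close> the fine bounds are used, otherwise the crude ones.\<close>

theorem perturbation_bound:
  assumes R: "0 \<le> R" "R \<le> \<bar>Im z\<bar>" and wv: "nv w = 1" "nv v = 1"
  shows "cmod ((trip z A Z w v - trip z A0 Z w v - 2 * of_real s * quin z A0 Z w v) - 2 * of_real s * (quin z A Y w v - quin z A0 Y w v))
    \<le> 4 * R / (Im z)\<^sup>2 * ((nv (ap Z t0))\<^sup>2 + (nv (ap Z u0))\<^sup>2 + (nv (ap Y t0))\<^sup>2 + (nv (ap Y u0))\<^sup>2)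
      + 8 / \<bar>Im z\<bar> ^ 3 * ((if op_norm Z > R then (op_norm Z)\<^sup>2 else 0) + (if op_norm Y > R then (op_norm Y)\<^sup>2 else 0))" (is "cmod (?P - 2 * of_real s * ?Q) \<le> ?F + ?C")
proof -
  let ?a = "nv (ap Z t0)" and ?b = "nv (ap Z u0)" and ?a' = "nv (ap Y t0)" and ?b' = "nv (ap Y u0)" and ?y = "\<bar>Im z\<bar>"
  have t: "cmod (?P - 2 * of_real s * ?Q) \<le> cmod ?P + 2 * cmod ?Q"
  proof -
    have "cmod (2 * of_real s * ?Q) \<le> 2 * cmod ?Q" using s by (simp add: norm_mult mult_left_le_one_le)
    then show ?thesis using norm_triangle_ineq4[of ?P "2 * of_real s * ?Q"] by linarith
  qed
  have F0: "0 \<le> ?F" using R by (intro mult_nonneg_nonneg divide_nonneg_nonneg add_nonneg_nonneg) auto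
  have C0: "0 \<le> ?C" using y_pos by (intro mult_nonneg_nonneg divide_nonneg_nonneg add_nonneg_nonneg) auto
  show ?thesis
  proof (cases "op_norm Z \<le> R \<and> op_norm Y \<le> R")
    case True
    have "cmod ?P \<le> 3 * op_norm Z / (Im z)\<^sup>2 * ?a * ?b" by (rule first_order_fine)
    also have "\<dots> \<le> 3 * R / (Im z)\<^sup>2 * ?a * ?b"
      using True by (intro mult_right_mono divide_right_mono mult_left_mono) auto
    finally have 1: "cmod ?P \<le> R / (Im z)\<^sup>2 * (3 * (?a * ?b))" by (simp add: algebra_simps)
    have 2: "cmod ?Q \<le> R / (Im z)\<^sup>2 * ((?b' + ?b) * ?a + ?b * ?a' + ?b' * ?a')"
      using True R by (intro second_order_fine) auto
    have am: "2 * (x * y) \<le> x\<^sup>2 + y\<^sup>2" for x y :: real using sum_squares_bound[of x y] by simp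
    \<comment> \<open>After 2 x y \<le> x^2 + y^2 the largest coefficient is 7/2, at the squares of
      \<open>?a\<close> and \<open>?b\<close>; it is rounded up to 4.\<close>
    have "3 * (?a * ?b) + 2 * ((?b' + ?b) * ?a + ?b * ?a' + ?b' * ?a') \<le> 4 * (?a\<^sup>2 + ?b\<^sup>2 + ?a'\<^sup>2 + ?b'\<^sup>2)"
      using am[of ?a ?b] am[of ?b' ?a] am[of ?b ?a'] am[of ?b' ?a'] by (simp add: algebra_simps) (smt (verit) zero_le_power2)
    then have f1: "R / (Im z)\<^sup>2 * (3 * (?a * ?b) + 2 * ((?b' + ?b) * ?a + ?b * ?a' + ?b' * ?a')) \<le> R / (Im z)\<^sup>2 * (4 * (?a\<^sup>2 + ?b\<^sup>2 + ?a'\<^sup>2 + ?b'\<^sup>2))"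
      using R by (intro mult_left_mono) auto
    have f2: "cmod ?P + 2 * cmod ?Q \<le> R / (Im z)\<^sup>2 * (3 * (?a * ?b) + 2 * ((?b' + ?b) * ?a + ?b * ?a' + ?b' * ?a'))"
      unfolding distrib_left[of "R / (Im z)\<^sup>2" "3 * _"] using 1 2 by (simp only: mult.left_commute[of _ 2])
    have f3: "R / (Im z)\<^sup>2 * (4 * (?a\<^sup>2 + ?b\<^sup>2 + ?a'\<^sup>2 + ?b'\<^sup>2)) = ?F" by simp
    have "cmod ?P + 2 * cmod ?Q \<le> ?F" using order.trans[OF f2 f1] unfolding f3 .
    then show ?thesis using t C0 by linarith
  next
    case False
    have 1: "cmod ?P \<le> 4 * (op_norm Z)\<^sup>2 / ?y ^ 3" using first_order_crude by (simp add: wv)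
    have 2: "cmod ?Q \<le> 2 * ((op_norm Y)\<^sup>2 / ?y ^ 3)"
      using norm_triangle_ineq4[of "quin z A Y w v" "quin z A0 Y w v"] quin_bound[OF A Y] quin_bound[OF A0 Y] by (simp add: wv)
    define e where "e = (if op_norm Z > R then (op_norm Z)\<^sup>2 else 0) + (if op_norm Y > R then (op_norm Y)\<^sup>2 else 0)"
    have m: "x\<^sup>2 \<le> y\<^sup>2" if "0 \<le> x" "x \<le> y" for x y :: real using that by (intro power_mono)
    \<comment> \<open>At least one of the norms exceeds R. If only one does, it is the larger one,
      and twice its square accounts for both.\<close>
    have "(op_norm Z)\<^sup>2 + (op_norm Y)\<^sup>2 \<le> 2 * e"
      unfolding e_def using False m[OF Zn, of "op_norm Y"] m[OF Yn, of "op_norm Z"] by (auto simp: not_le)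
    then have "((op_norm Z)\<^sup>2 + (op_norm Y)\<^sup>2) / ?y ^ 3 \<le> (2 * e) / ?y ^ 3"
      using y_pos by (intro divide_right_mono) auto
    then have "4 * (op_norm Z)\<^sup>2 / ?y ^ 3 + 4 * ((op_norm Y)\<^sup>2 / ?y ^ 3) \<le> 8 / ?y ^ 3 * e" by (simp add: add_divide_distrib)
    then have "cmod ?P + 2 * cmod ?Q \<le> 8 / ?y ^ 3 * e" using 1 2 by linarith
    then have "cmod ?P + 2 * cmod ?Q \<le> ?C" unfolding e_def .
    then show ?thesis using t F0 by linarith
  qed
qed

end

end

end

section \<open>Random matrices\<close>

lemma pair_fst_integrable:
  assumes "prob_space M" "prob_space N" "f \<in> borel_measurable M"
  shows "integrable (M \<Otimes>\<^sub>M N) (\<lambda>p. f (fst p)) \<longleftrightarrow> integrable M (f :: _ \<Rightarrow> 'b :: {banach, second_countable_topology})"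
    "(\<integral>p. f (fst p) \<partial>(M \<Otimes>\<^sub>M N)) = (\<integral>x. f x \<partial>M)"
proof -
  interpret N: prob_space N by fact
  have "distr (M \<Otimes>\<^sub>M N) M fst = M" by (rule N.distr_pair_fst)
  then show "integrable (M \<Otimes>\<^sub>M N) (\<lambda>p. f (fst p)) \<longleftrightarrow> integrable M f" "(\<integral>p. f (fst p) \<partial>(M \<Otimes>\<^sub>M N)) = (\<integral>x. f x \<partial>M)"
    using integrable_distr_eq[of fst "M \<Otimes>\<^sub>M N" M f] integral_distr[of fst "M \<Otimes>\<^sub>M N" M f] assms(3) by simp_all
qed

lemma pair_snd_integrable:
  assumes "prob_space M" "prob_space N" "f \<in> borel_measurable N"
  shows "integrable (M \<Otimes>\<^sub>M N) (\<lambda>p. f (snd p)) \<longleftrightarrow> integrable N (f :: _ \<Rightarrow> 'b :: {banach, second_countable_topology})"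
    "(\<integral>p. f (snd p) \<partial>(M \<Otimes>\<^sub>M N)) = (\<integral>x. f x \<partial>N)"
proof -
  interpret M: prob_space M by fact
  interpret N: prob_space N by fact
  interpret P: pair_prob_space M N ..
  interpret Q: pair_prob_space N M ..
  have "distr (M \<Otimes>\<^sub>M N) N snd = N"
  proof -
    have "distr (M \<Otimes>\<^sub>M N) N snd = distr (distr (N \<Otimes>\<^sub>M M) (M \<Otimes>\<^sub>M N) (\<lambda>(x, y). (y, x))) N snd"
      by (subst P.distr_pair_swap) simp
    also have "\<dots> = distr (N \<Otimes>\<^sub>M M) N fst"
      by (subst distr_distr) (auto simp: comp_def case_prod_beta)
    also have "\<dots> = N" by (rule M.distr_pair_fst)
    finally show ?thesis .
  qed
  then show "integrable (M \<Otimes>\<^sub>M N) (\<lambda>p. f (snd p)) \<longleftrightarrow> integrable N f" "(\<integral>p. f (snd p) \<partial>(M \<Otimes>\<^sub>M N)) = (\<integral>x. f x \<partial>N)"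
    using integrable_distr_eq[of snd "M \<Otimes>\<^sub>M N" N f] integral_distr[of snd "M \<Otimes>\<^sub>M N" N f] assms(3) by simp_all
qed

lemma integrable_square_add:
  assumes "f \<in> borel_measurable M" "g \<in> borel_measurable M" "integrable M (\<lambda>x. (f x :: real)\<^sup>2)" "integrable M (\<lambda>x. (g x)\<^sup>2)"
  shows "integrable M (\<lambda>x. (f x + g x)\<^sup>2)"
proof (rule Bochner_Integration.integrable_bound)
  show "integrable M (\<lambda>x. 2 * (f x)\<^sup>2 + 2 * (g x)\<^sup>2)" using assms by simp
  show "(\<lambda>x. (f x + g x)\<^sup>2) \<in> borel_measurable M" using assms by measurable
  have "(a + b)\<^sup>2 \<le> 2 * a\<^sup>2 + 2 * b\<^sup>2" for a b :: real using sum_squares_bound[of a b] by (simp add: power2_sum)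
  then show "AE x in M. norm ((f x + g x)\<^sup>2) \<le> norm (2 * (f x)\<^sup>2 + 2 * (g x)\<^sup>2)" by (intro AE_I2) simp
qed

lemma integrable_square_sum:
  assumes "finite I" "\<And>i. i \<in> I \<Longrightarrow> f i \<in> borel_measurable M" "\<And>i. i \<in> I \<Longrightarrow> integrable M (\<lambda>x. (f i x :: real)\<^sup>2)"
  shows "integrable M (\<lambda>x. (\<Sum>i\<in>I. f i x)\<^sup>2)"
  using assms
proof (induction I rule: finite_induct)
  case (insert a I)
  have "integrable M (\<lambda>x. (f a x + (\<Sum>i\<in>I. f i x))\<^sup>2)"
    by (rule integrable_square_add) (use insert in \<open>auto intro!: borel_measurable_sum\<close>)
  then show ?case using insert.hyps by simp
qed simp

lemma integrable_product_squares:
  fixes f g :: "'a \<Rightarrow> complex"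
  assumes "f \<in> borel_measurable M" "g \<in> borel_measurable M" "integrable M (\<lambda>x. (cmod (f x))\<^sup>2)" "integrable M (\<lambda>x. (cmod (g x))\<^sup>2)"
  shows "integrable M (\<lambda>x. f x * cnj (g x))"
proof (rule Bochner_Integration.integrable_bound)
  show "integrable M (\<lambda>x. (cmod (f x))\<^sup>2 + (cmod (g x))\<^sup>2)" using assms by simp
  show "(\<lambda>x. f x * cnj (g x)) \<in> borel_measurable M"
    using assms(1,2) by (intro borel_measurable_times dim.cnj_measurable)
  have "a * b \<le> a\<^sup>2 + b\<^sup>2" if "0 \<le> a" "0 \<le> b" for a b :: real
    using sum_squares_bound[of a b] mult_nonneg_nonneg[OF that] by simp
  then show "AE x in M. norm (f x * cnj (g x)) \<le> norm ((cmod (f x))\<^sup>2 + (cmod (g x))\<^sup>2)"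
    by (intro AE_I2) (simp add: norm_mult)
qed

lemma integral_sum2:
  fixes f :: "nat \<Rightarrow> nat \<Rightarrow> 'a \<Rightarrow> complex"
  assumes "\<And>j k. j < d \<Longrightarrow> k < d \<Longrightarrow> integrable M (f j k)"
  shows "(\<integral>w. (\<Sum>j<d. \<Sum>k<d. f j k w) \<partial>M) = (\<Sum>j<d. \<Sum>k<d. \<integral>w. f j k w \<partial>M)"
proof -
  have "(\<integral>w. (\<Sum>j<d. \<Sum>k<d. f j k w) \<partial>M) = (\<Sum>j<d. \<integral>w. (\<Sum>k<d. f j k w) \<partial>M)"
    by (rule Bochner_Integration.integral_sum) (auto intro!: Bochner_Integration.integrable_sum assms)
  also have "\<dots> = (\<Sum>j<d. \<Sum>k<d. \<integral>w. f j k w \<partial>M)"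
    by (intro sum.cong refl Bochner_Integration.integral_sum) (auto intro!: assms)
  finally show ?thesis .
qed

lemma integral_sum4:
  fixes f :: "nat \<Rightarrow> nat \<Rightarrow> nat \<Rightarrow> nat \<Rightarrow> 'a \<Rightarrow> complex"
  assumes i: "\<And>j a b k. j < d \<Longrightarrow> a < d \<Longrightarrow> b < d \<Longrightarrow> k < d \<Longrightarrow> integrable M (f j a b k)"
  shows "(\<integral>w. (\<Sum>j<d. \<Sum>a<d. \<Sum>b<d. \<Sum>k<d. f j a b k w) \<partial>M) = (\<Sum>j<d. \<Sum>a<d. \<Sum>b<d. \<Sum>k<d. \<integral>w. f j a b k w \<partial>M)"
proof -
  have "(\<integral>w. (\<Sum>j<d. \<Sum>a<d. \<Sum>b<d. \<Sum>k<d. f j a b k w) \<partial>M) = (\<Sum>j<d. \<Sum>a<d. \<integral>w. (\<Sum>b<d. \<Sum>k<d. f j a b k w) \<partial>M)"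
    by (rule integral_sum2) (auto intro!: Bochner_Integration.integrable_sum i)
  also have "\<dots> = (\<Sum>j<d. \<Sum>a<d. \<Sum>b<d. \<Sum>k<d. \<integral>w. f j a b k w \<partial>M)"
    by (intro sum.cong refl integral_sum2) (auto intro!: i)
  finally show ?thesis .
qed

section \<open>Square-integrable random matrices, their second moments, and independent
  copies\<close>

context dim
begin

definition sqi :: "'a measure \<Rightarrow> ('a \<Rightarrow> complex mat) \<Rightarrow> bool" where
  "sqi M X \<longleftrightarrow> mm M X \<and> (\<forall>j<d. \<forall>k<d. integrable M (\<lambda>w. (cmod (X w $$ (j, k)))\<^sup>2))"

lemma sqi_fr: assumes "sqi M X" shows "integrable M (\<lambda>w. (fr (X w))\<^sup>2)"
  unfolding fr_def
proof (rule integrable_square_sum)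
  fix i assume i: "i \<in> {..<d}"
  show m: "(\<lambda>w. \<Sum>j<d. cmod (X w $$ (i, j))) \<in> borel_measurable M"
    using assms i by (intro borel_measurable_sum borel_measurable_norm[THEN measurable_compose[rotated]]) (auto simp: sqi_def dest: mm_entry)
  show "integrable M (\<lambda>w. (\<Sum>j<d. cmod (X w $$ (i, j)))\<^sup>2)"
  proof (rule integrable_square_sum)
    show "(\<lambda>w. cmod (X w $$ (i, j))) \<in> borel_measurable M" if "j \<in> {..<d}" for j
      using assms i that by (intro borel_measurable_norm[THEN measurable_compose[rotated]]) (auto simp: sqi_def dest: mm_entry)
  qed (use assms i in \<open>auto simp: sqi_def\<close>)
qed simp

lemma sqi_op_norm: assumes "0 < d" "sqi M X" shows "integrable M (\<lambda>w. (op_norm (X w))\<^sup>2)"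
proof (rule Bochner_Integration.integrable_bound[OF sqi_fr[OF assms(2)]])
  have m: "mm M X" using assms by (simp add: sqi_def)
  show "(\<lambda>w. (op_norm (X w))\<^sup>2) \<in> borel_measurable M" using op_norm_measurable[OF assms(1) m] by simp
  show "AE w in M. norm ((op_norm (X w))\<^sup>2) \<le> norm ((fr (X w))\<^sup>2)"
    using mm_carrier[OF m] op_norm_le_fr[OF assms(1)] op_norm_nonneg[OF assms(1)] by (intro AE_I2) (auto intro!: power_mono)
qed

lemma sqi_op_norm1: assumes "prob_space M" "0 < d" "sqi M X" shows "integrable M (\<lambda>w. op_norm (X w))"
proof -
  interpret prob_space M by fact
  have "mm M X" using assms by (simp add: sqi_def)
  then show ?thesis
    by (rule square_integrable_imp_integrable[OF op_norm_measurable[OF assms(2)] sqi_op_norm[OF assms(2,3)]])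
qed

lemma sqi_entry: assumes "prob_space M" "sqi M X" "j < d" "k < d" shows "integrable M (\<lambda>w. X w $$ (j, k))"
proof -
  interpret prob_space M by fact
  have m: "(\<lambda>w. X w $$ (j, k)) \<in> borel_measurable M" using assms by (auto simp: sqi_def mm_def)
  then have "integrable M (\<lambda>w. cmod (X w $$ (j, k)))"
    by (rule square_integrable_imp_integrable[OF borel_measurable_norm[THEN measurable_compose[rotated]]]) (use assms in \<open>auto simp: sqi_def\<close>)
  then show ?thesis using m by (rule integrable_norm_cancel)
qed

lemma sqi_product: "sqi M X \<Longrightarrow> sqi M Y \<Longrightarrow> j < d \<Longrightarrow> k < d \<Longrightarrow> a < d \<Longrightarrow> b < d \<Longrightarrow> integrable M (\<lambda>w. X w $$ (j, k) * cnj (Y w $$ (a, b)))"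
  by (rule integrable_product_squares) (auto simp: sqi_def dest: mm_entry)

lemma ip_ap_expectation:
  assumes "\<And>j k. j < d \<Longrightarrow> k < d \<Longrightarrow> integrable M (\<lambda>w. Y w $$ (j, k))"
  shows "(\<integral>w. ip (ap (Y w) x) y \<partial>M) = ip (ap (mat_expectation d M Y) x) y" "integrable M (\<lambda>w. ip (ap (Y w) x) y)"
proof -
  have e: "ip (ap (Y w) x) y = (\<Sum>j<d. \<Sum>k<d. (x k * cnj (y j)) * Y w $$ (j, k))" for w
    by (auto simp: ip_def ap_def sum_distrib_right sum_distrib_left mult_ac intro!: sum.cong)
  show "integrable M (\<lambda>w. ip (ap (Y w) x) y)" unfolding e using assms by (intro Bochner_Integration.integrable_sum integrable_mult_right) auto
  have "(\<integral>w. ip (ap (Y w) x) y \<partial>M) = (\<Sum>j<d. \<Sum>k<d. (x k * cnj (y j)) * (\<integral>w. Y w $$ (j, k) \<partial>M))"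
    unfolding e by (rule integral_sum2[THEN trans]) (use assms in auto)
  also have "\<dots> = ip (ap (mat_expectation d M Y) x) y"
    by (auto simp: ip_def ap_def mat_expectation_def sum_distrib_right sum_distrib_left mult_ac intro!: sum.cong)
  finally show "(\<integral>w. ip (ap (Y w) x) y \<partial>M) = ip (ap (mat_expectation d M Y) x) y" .
qed

text \<open>Self-adjointness turns the second factor \<open>Y w $$ (b, k)\<close> into a conjugate,
  so the expectation is linear in the covariances of the entries. It is thus additive over
  independent centred summands, and equal for matrices with equal covariances.\<close>

lemma second_moment_form:
  assumes Y: "sqi M Y" and sa: "\<And>w. w \<in> space M \<Longrightarrow> self_adjoint d (Y w)"
  shows "(\<integral>w. ip (ap (Y w) (ap B (ap (Y w) x))) t \<partial>M)
    = (\<Sum>j<d. \<Sum>a<d. \<Sum>b<d. \<Sum>k<d. (cnj (t j) * B $$ (a, b) * x k) * (\<integral>w. Y w $$ (j, a) * cnj (Y w $$ (k, b)) \<partial>M))"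
    "integrable M (\<lambda>w. ip (ap (Y w) (ap B (ap (Y w) x))) t)"
proof -
  let ?f = "\<lambda>w. \<Sum>j<d. \<Sum>a<d. \<Sum>b<d. \<Sum>k<d. (cnj (t j) * B $$ (a, b) * x k) * (Y w $$ (j, a) * cnj (Y w $$ (k, b)))"
  have e: "ip (ap (Y w) (ap B (ap (Y w) x))) t = ?f w" if "w \<in> space M" for w
  proof -
    have "ip (ap (Y w) (ap B (ap (Y w) x))) t = (\<Sum>j<d. \<Sum>a<d. \<Sum>b<d. \<Sum>k<d. (cnj (t j) * B $$ (a, b) * x k) * (Y w $$ (j, a) * Y w $$ (b, k)))"
      by (auto simp: ip_def ap_def sum_distrib_right sum_distrib_left mult_ac intro!: sum.cong)
    then show ?thesis using self_adjoint_entry[OF sa[OF that]] by simp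
  qed
  have i: "integrable M (\<lambda>w. (cnj (t j) * B $$ (a, b) * x k) * (Y w $$ (j, a) * cnj (Y w $$ (k, b))))" if "j < d" "a < d" "b < d" "k < d" for j a b k
    using that by (intro integrable_mult_right sqi_product Y)
  have "integrable M ?f" by (intro Bochner_Integration.integrable_sum i) auto
  then show "integrable M (\<lambda>w. ip (ap (Y w) (ap B (ap (Y w) x))) t)"
    using Bochner_Integration.integrable_cong[of M M "\<lambda>w. ip (ap (Y w) (ap B (ap (Y w) x))) t" ?f] e by blast
  have "(\<integral>w. ip (ap (Y w) (ap B (ap (Y w) x))) t \<partial>M) = (\<integral>w. ?f w \<partial>M)"
    by (rule Bochner_Integration.integral_cong[OF refl e])
  also have "\<dots> = (\<Sum>j<d. \<Sum>a<d. \<Sum>b<d. \<Sum>k<d. (cnj (t j) * B $$ (a, b) * x k) * (\<integral>w. Y w $$ (j, a) * cnj (Y w $$ (k, b)) \<partial>M))"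
    by (rule integral_sum4[THEN trans]) (use i in auto)
  finally show "(\<integral>w. ip (ap (Y w) (ap B (ap (Y w) x))) t \<partial>M)
    = (\<Sum>j<d. \<Sum>a<d. \<Sum>b<d. \<Sum>k<d. (cnj (t j) * B $$ (a, b) * x k) * (\<integral>w. Y w $$ (j, a) * cnj (Y w $$ (k, b)) \<partial>M))" .
qed

text \<open>The identity matrix is inserted to give the squared norm the shape of
  \<open>second_moment_form\<close>.\<close>

lemma nv_ap_square: "self_adjoint d A \<Longrightarrow> of_real ((nv (ap A x))\<^sup>2) = ip (ap A (ap (1\<^sub>m d) (ap A x))) x"
proof -
  assume A: "self_adjoint d A"
  have "ap A (ap (1\<^sub>m d) (ap A x)) = ap A (ap A x)" by (rule ap_cong) (simp add: ap_one)
  then show ?thesis using self_adjoint_ip[OF A, of "ap A x" x] by (simp add: ip_self)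
qed

text \<open>Resolvents are under control for self-adjoint matrices only. Composing with
  \<open>proj\<close> yields functions that are measurable on all of \<open>mat_borel d\<close> and
  unchanged at the values that occur.\<close>

definition proj :: "complex mat \<Rightarrow> complex mat" where
  "proj A = (if self_adjoint d A then A else 0\<^sub>m d d)"

lemma self_adjoint_zero: "self_adjoint d (0\<^sub>m d d)" by (simp add: self_adjoint_iff)

lemma self_adjoint_proj: "self_adjoint d (proj A)" by (simp add: proj_def self_adjoint_zero)

lemma proj_id: "self_adjoint d A \<Longrightarrow> proj A = A" by (simp add: proj_def)

lemma mm_proj: assumes X: "mm M X" shows "mm M (\<lambda>w. proj (X w))"
proof -
  have S: "{w \<in> space M. self_adjoint d (X w)} \<in> sets M"
  proof -
    have [measurable]: "(\<lambda>w. X w $$ (i, j)) \<in> borel_measurable M" "(\<lambda>w. cnj (X w $$ (i, j))) \<in> borel_measurable M" if "i < d" "j < d" for i j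
      using mm_entry[OF X that] by (auto intro: cnj_measurable)
    have "{w \<in> space M. self_adjoint d (X w)} = {w \<in> space M. \<forall>i\<in>{..<d}. \<forall>j\<in>{..<d}. X w $$ (i, j) = cnj (X w $$ (j, i))}"
      using mm_carrier[OF X] by (auto simp: self_adjoint_iff)
    also have "\<dots> \<in> sets M" by (intro sets.sets_Collect_finite_All borel_measurable_eq) auto
    finally show ?thesis .
  qed
  have "(\<lambda>w. proj (X w) $$ (i, j)) \<in> borel_measurable M" if "i < d" "j < d" for i j
  proof -
    have "(\<lambda>w. if w \<in> {w \<in> space M. self_adjoint d (X w)} then X w $$ (i, j) else 0) \<in> borel_measurable M"
      using S mm_entry[OF X that] by (intro measurable_If_set) auto
    then show ?thesis by (rule measurable_cong[THEN iffD1, rotated]) (use that in \<open>auto simp: proj_def\<close>)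
  qed
  then show ?thesis using self_adjoint_carrier[OF self_adjoint_proj] by (simp add: mm_def)
qed

lemma mm_measurable: "f \<in> M \<rightarrow>\<^sub>M mat_borel d \<Longrightarrow> mm M f" by (simp add: measurable_mat_borel_iff)

text \<open>On the product of two copies of the sample space the three matrices
  \<open>X (fst p)\<close>, \<open>R (fst p)\<close>, \<open>X (snd p)\<close> are independent, and
  the first and third have the same law.\<close>

lemma exchange_distr:
  assumes "prob_space M" and ind: "prob_space.indep_var M (mat_borel d) X (mat_borel d) R"
  defines "T \<equiv> mat_borel d \<Otimes>\<^sub>M (mat_borel d \<Otimes>\<^sub>M mat_borel d)"
  shows "distr (M \<Otimes>\<^sub>M M) T (\<lambda>p. (X (fst p), R (fst p), X (snd p))) = distr (M \<Otimes>\<^sub>M M) T (\<lambda>p. (X (snd p), R (fst p), X (fst p)))"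
proof -
  interpret prob_space M by fact
  interpret P: pair_prob_space M M ..
  have [measurable]: "X \<in> M \<rightarrow>\<^sub>M mat_borel d" "R \<in> M \<rightarrow>\<^sub>M mat_borel d" using ind by (auto dest: indep_var_rv1 indep_var_rv2)
  define \<mu> where "\<mu> = distr M (mat_borel d) X"
  define \<rho> where "\<rho> = distr M (mat_borel d) R"
  interpret mu: prob_space \<mu> unfolding \<mu>_def by (rule prob_space_distr) simp
  interpret rho: prob_space \<rho> unfolding \<rho>_def by (rule prob_space_distr) simp
  interpret MM: pair_prob_space \<mu> \<mu> ..
  interpret MR: pair_prob_space \<mu> \<rho> ..
  have sets_mu[measurable_cong, simp]: "sets \<mu> = sets (mat_borel d)" "sets \<rho> = sets (mat_borel d)" by (simp_all add: \<mu>_def \<rho>_def)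
  have joint: "distr M (mat_borel d \<Otimes>\<^sub>M mat_borel d) (\<lambda>w. (X w, R w)) = \<mu> \<Otimes>\<^sub>M \<rho>"
    using ind unfolding indep_var_distribution_eq \<mu>_def \<rho>_def by simp
  \<comment> \<open>By independence and Fubini, integrals over the triple are iterated integrals
    over the laws \<mu>, \<rho> and \<mu>; the swap becomes a change of the order of
    integration.\<close>
  have key: "(\<integral>\<^sup>+p. f (X (fst p)) (R (fst p)) (X (snd p)) \<partial>(M \<Otimes>\<^sub>M M)) = (\<integral>\<^sup>+x'. \<integral>\<^sup>+x. \<integral>\<^sup>+r. f x r x' \<partial>\<rho> \<partial>\<mu> \<partial>\<mu>)"
    if [measurable]: "(\<lambda>(x, r, x'). f x r x') \<in> borel_measurable T" for f :: "complex mat \<Rightarrow> complex mat \<Rightarrow> complex mat \<Rightarrow> ennreal"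
  proof -
    have fm: "(\<lambda>t. f (fst t) (fst (snd t)) (snd (snd t))) \<in> borel_measurable T" using that by (simp add: case_prod_beta')
    have [measurable]: "(\<lambda>p. f (X (fst p)) (R (fst p)) (X (snd p))) \<in> borel_measurable (M \<Otimes>\<^sub>M M)"
      by (rule measurable_compose[OF _ fm, of "\<lambda>p. (X (fst p), R (fst p), X (snd p))", simplified]) (simp add: T_def)
    have g: "(\<lambda>q. f (fst q) (snd q) x') \<in> borel_measurable (mat_borel d \<Otimes>\<^sub>M mat_borel d)" if "x' \<in> carrier_mat d d" for x'
      by (rule measurable_compose[OF _ fm, of "\<lambda>q. (fst q, snd q, x')", simplified]) (use that in \<open>simp add: T_def space_mat_borel\<close>)
    have "(\<integral>\<^sup>+p. f (X (fst p)) (R (fst p)) (X (snd p)) \<partial>(M \<Otimes>\<^sub>M M)) = (\<integral>\<^sup>+w'. \<integral>\<^sup>+w. f (X w) (R w) (X w') \<partial>M \<partial>M)"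
      by (subst P.nn_integral_snd[symmetric]) (auto simp: case_prod_beta')
    also have "\<dots> = (\<integral>\<^sup>+w'. \<integral>\<^sup>+x. \<integral>\<^sup>+r. f x r (X w') \<partial>\<rho> \<partial>\<mu> \<partial>M)"
    proof (rule nn_integral_cong)
      fix w' assume "w' \<in> space M"
      then have c: "X w' \<in> carrier_mat d d" using measurable_space[of X M "mat_borel d"] by (simp add: space_mat_borel)
      have "(\<integral>\<^sup>+w. f (X w) (R w) (X w') \<partial>M) = (\<integral>\<^sup>+q. f (fst q) (snd q) (X w') \<partial>distr M (mat_borel d \<Otimes>\<^sub>M mat_borel d) (\<lambda>w. (X w, R w)))"
        using g[OF c] by (subst nn_integral_distr) auto
      also have "\<dots> = (\<integral>\<^sup>+x. \<integral>\<^sup>+r. f x r (X w') \<partial>\<rho> \<partial>\<mu>)"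
        unfolding joint using g[OF c] by (subst rho.nn_integral_fst[symmetric]) (auto cong: measurable_cong_sets)
      finally show "(\<integral>\<^sup>+w. f (X w) (R w) (X w') \<partial>M) = (\<integral>\<^sup>+x. \<integral>\<^sup>+r. f x r (X w') \<partial>\<rho> \<partial>\<mu>)" .
    qed
    also have "\<dots> = (\<integral>\<^sup>+x'. \<integral>\<^sup>+x. \<integral>\<^sup>+r. f x r x' \<partial>\<rho> \<partial>\<mu> \<partial>\<mu>)"
    proof -
      have "(\<lambda>q. f (fst (snd q)) (snd (snd q)) (fst q)) \<in> borel_measurable (mat_borel d \<Otimes>\<^sub>M (mat_borel d \<Otimes>\<^sub>M mat_borel d))"
        by (rule measurable_compose[OF _ fm, of "\<lambda>q. (fst (snd q), snd (snd q), fst q)", simplified]) (simp add: T_def)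
      then have h: "(\<lambda>q. f (fst (snd q)) (snd (snd q)) (fst q)) \<in> borel_measurable (mat_borel d \<Otimes>\<^sub>M (\<mu> \<Otimes>\<^sub>M \<rho>))"
        by (simp cong: measurable_cong_sets sets_pair_measure_cong)
      have "(\<lambda>x'. \<integral>\<^sup>+q. f (fst q) (snd q) x' \<partial>(\<mu> \<Otimes>\<^sub>M \<rho>)) \<in> borel_measurable (mat_borel d)"
        using MR.borel_measurable_nn_integral_fst[OF h] by simp
      moreover have "(\<integral>\<^sup>+q. f (fst q) (snd q) x' \<partial>(\<mu> \<Otimes>\<^sub>M \<rho>)) = (\<integral>\<^sup>+x. \<integral>\<^sup>+r. f x r x' \<partial>\<rho> \<partial>\<mu>)" if "x' \<in> space (mat_borel d)" for x'
        using g[of x'] that by (subst rho.nn_integral_fst[symmetric]) (auto simp: space_mat_borel cong: measurable_cong_sets)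
      ultimately have "(\<lambda>x'. \<integral>\<^sup>+x. \<integral>\<^sup>+r. f x r x' \<partial>\<rho> \<partial>\<mu>) \<in> borel_measurable (mat_borel d)"
        by (simp cong: measurable_cong)
      then have "(\<lambda>x'. \<integral>\<^sup>+x. \<integral>\<^sup>+r. f x r x' \<partial>\<rho> \<partial>\<mu>) \<in> borel_measurable (distr M (mat_borel d) X)" by simp
      then have "(\<integral>\<^sup>+x'. \<integral>\<^sup>+x. \<integral>\<^sup>+r. f x r x' \<partial>\<rho> \<partial>\<mu> \<partial>distr M (mat_borel d) X) = (\<integral>\<^sup>+w'. \<integral>\<^sup>+x. \<integral>\<^sup>+r. f x r (X w') \<partial>\<rho> \<partial>\<mu> \<partial>M)"
        by (intro nn_integral_distr) auto
      then show ?thesis by (simp add: \<mu>_def)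
    qed
    finally show ?thesis .
  qed
  show ?thesis
  proof (rule measure_eqI)
    fix A assume "A \<in> sets (distr (M \<Otimes>\<^sub>M M) T (\<lambda>p. (X (fst p), R (fst p), X (snd p))))"
    then have A[measurable]: "A \<in> sets T" by simp
    have [measurable]: "(\<lambda>p. (X (fst p), R (fst p), X (snd p))) \<in> (M \<Otimes>\<^sub>M M) \<rightarrow>\<^sub>M T" "(\<lambda>p. (X (snd p), R (fst p), X (fst p))) \<in> (M \<Otimes>\<^sub>M M) \<rightarrow>\<^sub>M T"
      unfolding T_def by measurable
    have sw: "(\<lambda>(x, r, x'). (x', r, x)) \<in> T \<rightarrow>\<^sub>M T" unfolding T_def by measurable
    have m1: "(\<lambda>(x, r, x'). indicator A (x, r, x') :: ennreal) \<in> borel_measurable T" by (simp add: case_prod_beta')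
    have m2: "(\<lambda>(x, r, x'). indicator A (x', r, x) :: ennreal) \<in> borel_measurable T"
      using measurable_compose[OF sw borel_measurable_indicator[OF A]] by (simp add: case_prod_beta')
    have "emeasure (distr (M \<Otimes>\<^sub>M M) T (\<lambda>p. (X (fst p), R (fst p), X (snd p)))) A = (\<integral>\<^sup>+p. indicator A (X (fst p), R (fst p), X (snd p)) \<partial>(M \<Otimes>\<^sub>M M))"
      by (subst nn_integral_indicator[symmetric], simp, subst nn_integral_distr) auto
    also have "\<dots> = (\<integral>\<^sup>+x'. \<integral>\<^sup>+x. \<integral>\<^sup>+r. indicator A (x, r, x') \<partial>\<rho> \<partial>\<mu> \<partial>\<mu>)" by (rule key[OF m1])
    also have "\<dots> = (\<integral>\<^sup>+x. \<integral>\<^sup>+x'. \<integral>\<^sup>+r. indicator A (x, r, x') \<partial>\<rho> \<partial>\<mu> \<partial>\<mu>)"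
    proof (rule MM.Fubini')
      have "(\<lambda>(q, r). (fst q, r, snd q)) \<in> ((mat_borel d \<Otimes>\<^sub>M mat_borel d) \<Otimes>\<^sub>M mat_borel d) \<rightarrow>\<^sub>M T" unfolding T_def by measurable
      from measurable_compose[OF this borel_measurable_indicator[OF A]]
      have "(\<lambda>q. indicator A (fst (fst q), snd q, snd (fst q)) :: ennreal) \<in> borel_measurable ((\<mu> \<Otimes>\<^sub>M \<mu>) \<Otimes>\<^sub>M \<rho>)"
        by (simp add: case_prod_beta' cong: measurable_cong_sets sets_pair_measure_cong)
      from rho.borel_measurable_nn_integral_fst[OF this]
      show "(\<lambda>(x, x'). \<integral>\<^sup>+r. indicator A (x, r, x') \<partial>\<rho>) \<in> borel_measurable (\<mu> \<Otimes>\<^sub>M \<mu>)" by (simp add: case_prod_beta')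
    qed
    also have "\<dots> = (\<integral>\<^sup>+p. indicator A (X (snd p), R (fst p), X (fst p)) \<partial>(M \<Otimes>\<^sub>M M))" by (rule key[OF m2, symmetric])
    also have "\<dots> = emeasure (distr (M \<Otimes>\<^sub>M M) T (\<lambda>p. (X (snd p), R (fst p), X (fst p)))) A"
      by (subst nn_integral_indicator[symmetric], simp, subst nn_integral_distr) auto
    finally show "emeasure (distr (M \<Otimes>\<^sub>M M) T (\<lambda>p. (X (fst p), R (fst p), X (snd p)))) A = emeasure (distr (M \<Otimes>\<^sub>M M) T (\<lambda>p. (X (snd p), R (fst p), X (fst p)))) A" .
  qed simp
qed

lemma exchange:
  fixes F :: "complex mat \<Rightarrow> complex mat \<Rightarrow> complex mat \<Rightarrow> 'b :: {banach, second_countable_topology}"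
  assumes "prob_space M" and ind: "prob_space.indep_var M (mat_borel d) X (mat_borel d) R"
    and sa: "\<And>w. w \<in> space M \<Longrightarrow> self_adjoint d (X w)" "\<And>w. w \<in> space M \<Longrightarrow> self_adjoint d (R w)"
    and F: "(\<lambda>t. F (proj (fst t)) (proj (fst (snd t))) (proj (snd (snd t)))) \<in> borel_measurable (mat_borel d \<Otimes>\<^sub>M (mat_borel d \<Otimes>\<^sub>M mat_borel d))"
  shows "(\<integral>p. F (X (fst p)) (R (fst p)) (X (snd p)) \<partial>(M \<Otimes>\<^sub>M M)) = (\<integral>p. F (X (snd p)) (R (fst p)) (X (fst p)) \<partial>(M \<Otimes>\<^sub>M M))"
proof -
  interpret prob_space M by fact
  let ?T = "mat_borel d \<Otimes>\<^sub>M (mat_borel d \<Otimes>\<^sub>M mat_borel d)"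
  have [measurable]: "X \<in> M \<rightarrow>\<^sub>M mat_borel d" "R \<in> M \<rightarrow>\<^sub>M mat_borel d" using ind by (auto dest: indep_var_rv1 indep_var_rv2)
  let ?F = "\<lambda>t. F (proj (fst t)) (proj (fst (snd t))) (proj (snd (snd t)))"
  have "(\<integral>p. F (X (fst p)) (R (fst p)) (X (snd p)) \<partial>(M \<Otimes>\<^sub>M M)) = (\<integral>p. ?F (X (fst p), R (fst p), X (snd p)) \<partial>(M \<Otimes>\<^sub>M M))"
    by (intro Bochner_Integration.integral_cong refl) (auto simp: space_pair_measure sa proj_id)
  also have "\<dots> = (\<integral>t. ?F t \<partial>distr (M \<Otimes>\<^sub>M M) ?T (\<lambda>p. (X (fst p), R (fst p), X (snd p))))"
    using F by (subst integral_distr) auto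
  also have "\<dots> = (\<integral>t. ?F t \<partial>distr (M \<Otimes>\<^sub>M M) ?T (\<lambda>p. (X (snd p), R (fst p), X (fst p))))"
    by (subst exchange_distr[OF assms(1) ind]) simp
  also have "\<dots> = (\<integral>p. ?F (X (snd p), R (fst p), X (fst p)) \<partial>(M \<Otimes>\<^sub>M M))"
    using F by (subst integral_distr) auto
  also have "\<dots> = (\<integral>p. F (X (snd p)) (R (fst p)) (X (fst p)) \<partial>(M \<Otimes>\<^sub>M M))"
    by (intro Bochner_Integration.integral_cong refl) (auto simp: space_pair_measure sa proj_id)
  finally show ?thesis .
qed

definition lin :: "complex mat \<Rightarrow> real \<Rightarrow> complex mat \<Rightarrow> complex mat" where
  "lin B s R = Matrix.mat d d (\<lambda>jk. B $$ jk + of_real s * R $$ jk)"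

lemma lin_sa: "self_adjoint d B \<Longrightarrow> self_adjoint d R \<Longrightarrow> self_adjoint d (lin B s R)"
  unfolding self_adjoint_iff[of "lin B s R"] using self_adjoint_entry[of B] self_adjoint_entry[of R] by (simp add: lin_def)

lemma lin_mm: "mm N X \<Longrightarrow> mm N (\<lambda>w. lin B s (X w))"
  unfolding lin_def by (intro mm_mat borel_measurable_add borel_measurable_times borel_measurable_const mm_entry)

lemma lin_rs_mv:
  assumes B: "self_adjoint d B" and X: "mm N X" "\<And>w. w \<in> space N \<Longrightarrow> self_adjoint d (X w)" and z: "Im z \<noteq> 0" and x: "mv N x"
  shows "mv N (\<lambda>w. rs z (lin B s (X w)) (x w))"
  using assms by (intro mv_rs lin_mm lin_sa) auto

end

section \<open>Sums of independent random matrices\<close>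

lemma sum_swap5:
  "(\<Sum>j\<in>A. \<Sum>a\<in>B. \<Sum>b\<in>C. \<Sum>k\<in>D. \<Sum>i\<in>I. f j a b k i) = (\<Sum>i\<in>I. \<Sum>j\<in>A. \<Sum>a\<in>B. \<Sum>b\<in>C. \<Sum>k\<in>D. f j a b k i)"
  by (simp only: sum.swap[of _ I])

lemma norm_square_le: "(x::real)\<^sup>2 \<le> y \<Longrightarrow> norm (x\<^sup>2) \<le> norm y" by simp

lemma (in dim) ip_sum_left: "ip (\<lambda>k. \<Sum>i\<in>J. f i k) t = (\<Sum>i\<in>J. ip (f i) t)"
  by (simp add: ip_def sum_distrib_right sum.swap[of _ J])

locale random_sum = dim d + prob_space M for d :: nat and M :: "'a measure" +
  fixes n :: nat and Z :: "nat \<Rightarrow> 'a \<Rightarrow> complex mat"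
  assumes d0: "0 < d"
    and indep: "indep_vars (\<lambda>_. mat_borel d) Z {1..n}"
    and sa: "\<And>i w. i \<in> {1..n} \<Longrightarrow> w \<in> space M \<Longrightarrow> self_adjoint d (Z i w)"
    and sq: "\<And>i j k. i \<in> {1..n} \<Longrightarrow> j < d \<Longrightarrow> k < d \<Longrightarrow> integrable M (\<lambda>w. (cmod (Z i w $$ (j, k)))\<^sup>2)"
    and mean: "\<And>i j k. i \<in> {1..n} \<Longrightarrow> j < d \<Longrightarrow> k < d \<Longrightarrow> (\<integral>w. Z i w $$ (j, k) \<partial>M) = 0"
begin

declare One_nat_def [simp del]

lemma prob_M: "prob_space M" by unfold_locales

lemma Z_rv: "i \<in> {1..n} \<Longrightarrow> Z i \<in> M \<rightarrow>\<^sub>M mat_borel d"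
  using indep by (simp add: indep_vars_def)

lemma Z_mm: "i \<in> {1..n} \<Longrightarrow> mm M (Z i)"
  using Z_rv by (simp add: measurable_mat_borel_iff)

lemma Z_sqi: "i \<in> {1..n} \<Longrightarrow> sqi M (Z i)"
  using Z_mm sq by (simp add: sqi_def)

definition Sm :: "nat set \<Rightarrow> 'a \<Rightarrow> complex mat" where
  "Sm J w = Matrix.mat d d (\<lambda>jk. \<Sum>i\<in>J. Z i w $$ jk)"

lemma Sm_entry: "j < d \<Longrightarrow> k < d \<Longrightarrow> Sm J w $$ (j, k) = (\<Sum>i\<in>J. Z i w $$ (j, k))"
  by (simp add: Sm_def)

lemma ap_Sm: "ap (Sm J w) x = (\<lambda>k. \<Sum>i\<in>J. ap (Z i w) x k)"
  by (auto simp: ap_def Sm_entry sum_distrib_right sum.swap[of _ J])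

lemma Sm_mm: "J \<subseteq> {1..n} \<Longrightarrow> mm M (Sm J)"
  unfolding Sm_def by (intro mm_mat borel_measurable_sum mm_entry[OF Z_mm]) auto

lemma Sm_sa: "J \<subseteq> {1..n} \<Longrightarrow> w \<in> space M \<Longrightarrow> self_adjoint d (Sm J w)"
  unfolding self_adjoint_iff by (auto simp: Sm_entry self_adjoint_entry[OF sa] subset_eq intro!: sum.cong) (simp add: Sm_def)

lemma Sm_sqi: "J \<subseteq> {1..n} \<Longrightarrow> sqi M (Sm J)"
  unfolding sqi_def
proof (intro conjI allI impI Sm_mm, assumption)
  fix j k assume J: "J \<subseteq> {1..n}" and jk: "j < d" "k < d"
  have fin: "finite J" using J finite_subset by blast
  have m: "(\<lambda>w. Z i w $$ (j, k)) \<in> borel_measurable M" if "i \<in> J" for i using that J jk mm_entry[OF Z_mm] by blast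
  show "integrable M (\<lambda>w. (cmod (Sm J w $$ (j, k)))\<^sup>2)"
  proof (rule Bochner_Integration.integrable_bound)
    show "integrable M (\<lambda>w. (\<Sum>i\<in>J. cmod (Z i w $$ (j, k)))\<^sup>2)"
      by (rule integrable_square_sum[OF fin borel_measurable_norm[THEN measurable_compose[rotated]]]) (use m J jk sq in auto)
    show "(\<lambda>w. (cmod (Sm J w $$ (j, k)))\<^sup>2) \<in> borel_measurable M"
      using mm_entry[OF Sm_mm[OF J] jk] by measurable
    show "AE w in M. norm ((cmod (Sm J w $$ (j, k)))\<^sup>2) \<le> norm ((\<Sum>i\<in>J. cmod (Z i w $$ (j, k)))\<^sup>2)"
      using jk by (intro AE_I2) (auto simp: Sm_entry intro!: power_mono norm_sum)
  qed
qed

lemma Sm_all: "sqi M (Sm {1..n})" "w \<in> space M \<Longrightarrow> self_adjoint d (Sm {1..n} w)"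
  by (rule Sm_sqi, simp) (rule Sm_sa, auto)

lemma indep_split:
  assumes i: "i \<in> {1..n}" and g: "g \<in> mat_borel d \<rightarrow>\<^sub>M N1" and G: "G \<in> Pi\<^sub>M ({1..n} - {i}) (\<lambda>_. mat_borel d) \<rightarrow>\<^sub>M N2"
  shows "indep_var N1 (\<lambda>w. g (Z i w)) N2 (\<lambda>w. G (restrict (\<lambda>j. Z j w) ({1..n} - {i})))"
proof -
  have "indep_var (Pi\<^sub>M {i} (\<lambda>_. mat_borel d)) (\<lambda>w. restrict (\<lambda>j. Z j w) {i}) (Pi\<^sub>M ({1..n} - {i}) (\<lambda>_. mat_borel d)) (\<lambda>w. restrict (\<lambda>j. Z j w) ({1..n} - {i}))"
    by (rule indep_var_restrict[OF indep]) (use i in auto)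
  from indep_var_compose[OF this measurable_compose[OF measurable_component_singleton[of i] g] G]
  show ?thesis by (simp add: comp_def)
qed

lemma indep_rest: assumes i: "i \<in> {1..n}" shows "indep_var (mat_borel d) (Z i) (mat_borel d) (Sm ({1..n} - {i}))"
proof -
  let ?G = "\<lambda>f. Matrix.mat d d (\<lambda>jk. \<Sum>j\<in>{1..n} - {i}. f j $$ jk)"
  have c: "mm (Pi\<^sub>M ({1..n} - {i}) (\<lambda>_. mat_borel d)) (\<lambda>f. f j)" if "j \<in> {1..n} - {i}" for j
    using measurable_component_singleton[OF that, of "\<lambda>_. mat_borel d"] by (simp add: measurable_mat_borel_iff)
  have "?G \<in> Pi\<^sub>M ({1..n} - {i}) (\<lambda>_. mat_borel d) \<rightarrow>\<^sub>M mat_borel d"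
    unfolding measurable_mat_borel_iff by (intro mm_mat borel_measurable_sum mm_entry[OF c])
  note ind = indep_split[OF i measurable_ident_sets[OF refl] this]
  have "?G (restrict (\<lambda>j. Z j w) ({1..n} - {i})) = Sm ({1..n} - {i}) w" for w
    by (rule eq_matI) (auto simp: Sm_def intro!: sum.cong)
  with ind show ?thesis by simp
qed

text \<open>Cross covariances vanish, because \<open>Z i\<close> is centred and independent of the
  sum of the other summands.\<close>

lemma cov_Sm:
  assumes "j < d" "a < d" "k < d" "b < d"
  shows "(\<integral>w. Sm {1..n} w $$ (j, a) * cnj (Sm {1..n} w $$ (k, b)) \<partial>M) = (\<Sum>i=1..n. \<integral>w. Z i w $$ (j, a) * cnj (Z i w $$ (k, b)) \<partial>M)"
proof -
  let ?S = "Sm {1..n}"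
  have tm: "(\<integral>w. Z i w $$ (j, a) * cnj (?S w $$ (k, b)) \<partial>M) = (\<integral>w. Z i w $$ (j, a) * cnj (Z i w $$ (k, b)) \<partial>M)" if i: "i \<in> {1..n}" for i
  proof -
    let ?R = "Sm ({1..n} - {i})"
    have R: "sqi M ?R" by (rule Sm_sqi) auto
    have e: "?S w $$ (k, b) = Z i w $$ (k, b) + ?R w $$ (k, b)" for w
      using i assms by (simp add: Sm_entry sum.remove)
    have "(\<lambda>A. A $$ (j, a)) \<in> borel_measurable (mat_borel d)" "(\<lambda>A. cnj (A $$ (k, b))) \<in> borel_measurable (mat_borel d)"
      using mm_entry[OF mm_id] assms by (auto intro: cnj_measurable)
    from indep_var_compose[OF indep_rest[OF i] this]
    have "indep_var borel (\<lambda>w. Z i w $$ (j, a)) borel (\<lambda>w. cnj (?R w $$ (k, b)))" by (simp add: comp_def)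
    from indep_var_lebesgue_integral[OF this] have z: "(\<integral>w. Z i w $$ (j, a) * cnj (?R w $$ (k, b)) \<partial>M) = 0"
      using mean[OF i assms(1,2)] sqi_entry[OF prob_M Z_sqi[OF i] assms(1,2)] sqi_entry[OF prob_M R assms(3,4)] by simp
    have "(\<integral>w. Z i w $$ (j, a) * cnj (?S w $$ (k, b)) \<partial>M) = (\<integral>w. Z i w $$ (j, a) * cnj (Z i w $$ (k, b)) + Z i w $$ (j, a) * cnj (?R w $$ (k, b)) \<partial>M)"
      by (simp add: e algebra_simps)
    also have "\<dots> = (\<integral>w. Z i w $$ (j, a) * cnj (Z i w $$ (k, b)) \<partial>M) + (\<integral>w. Z i w $$ (j, a) * cnj (?R w $$ (k, b)) \<partial>M)"
      by (intro Bochner_Integration.integral_add sqi_product Z_sqi R i assms)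
    finally show ?thesis using z by simp
  qed
  have "(\<integral>w. ?S w $$ (j, a) * cnj (?S w $$ (k, b)) \<partial>M) = (\<integral>w. (\<Sum>i=1..n. Z i w $$ (j, a) * cnj (?S w $$ (k, b))) \<partial>M)"
    using assms(1,2) by (simp add: Sm_entry[of j a] sum_distrib_right)
  also have "\<dots> = (\<Sum>i=1..n. \<integral>w. Z i w $$ (j, a) * cnj (?S w $$ (k, b)) \<partial>M)"
    by (intro Bochner_Integration.integral_sum sqi_product Z_sqi Sm_sqi assms) auto
  also have "\<dots> = (\<Sum>i=1..n. \<integral>w. Z i w $$ (j, a) * cnj (Z i w $$ (k, b)) \<partial>M)"
    by (intro sum.cong refl tm)
  finally show ?thesis .
qed

lemma second_moment_sum:
  "(\<integral>w. ip (ap (Sm {1..n} w) (ap B (ap (Sm {1..n} w) x))) t \<partial>M) = (\<Sum>i=1..n. \<integral>w. ip (ap (Z i w) (ap B (ap (Z i w) x))) t \<partial>M)"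
proof -
  have "(\<integral>w. ip (ap (Sm {1..n} w) (ap B (ap (Sm {1..n} w) x))) t \<partial>M)
    = (\<Sum>j<d. \<Sum>a<d. \<Sum>b<d. \<Sum>k<d. (cnj (t j) * B $$ (a, b) * x k) * (\<Sum>i=1..n. \<integral>w. Z i w $$ (j, a) * cnj (Z i w $$ (k, b)) \<partial>M))"
    by (subst second_moment_form(1)[OF Sm_all]) (auto intro!: sum.cong simp: cov_Sm)
  also have "\<dots> = (\<Sum>i=1..n. \<Sum>j<d. \<Sum>a<d. \<Sum>b<d. \<Sum>k<d. (cnj (t j) * B $$ (a, b) * x k) * (\<integral>w. Z i w $$ (j, a) * cnj (Z i w $$ (k, b)) \<partial>M))"
    unfolding sum_distrib_left by (rule sum_swap5)
  also have "\<dots> = (\<Sum>i=1..n. \<integral>w. ip (ap (Z i w) (ap B (ap (Z i w) x))) t \<partial>M)"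
    by (intro sum.cong refl second_moment_form(1)[symmetric] Z_sqi sa)
  finally show ?thesis .
qed

lemma nv_square_integrable:
  "sqi M Y \<Longrightarrow> (\<And>w. w \<in> space M \<Longrightarrow> self_adjoint d (Y w)) \<Longrightarrow> integrable M (\<lambda>w. (nv (ap (Y w) x))\<^sup>2)"
  "sqi M Y \<Longrightarrow> (\<And>w. w \<in> space M \<Longrightarrow> self_adjoint d (Y w)) \<Longrightarrow> of_real (\<integral>w. (nv (ap (Y w) x))\<^sup>2 \<partial>M) = (\<integral>w. ip (ap (Y w) (ap (1\<^sub>m d) (ap (Y w) x))) x \<partial>M)"
proof -
  assume Y: "sqi M Y" and sa: "\<And>w. w \<in> space M \<Longrightarrow> self_adjoint d (Y w)"
  have e: "complex_of_real ((nv (ap (Y w) x))\<^sup>2) = ip (ap (Y w) (ap (1\<^sub>m d) (ap (Y w) x))) x" if "w \<in> space M" for w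
    by (rule nv_ap_square[OF sa[OF that]])
  have "integrable M (\<lambda>w. complex_of_real ((nv (ap (Y w) x))\<^sup>2))"
    using second_moment_form(2)[OF Y sa, of "1\<^sub>m d" x x]
    by (subst Bochner_Integration.integrable_cong[OF refl e]) auto
  then show "integrable M (\<lambda>w. (nv (ap (Y w) x))\<^sup>2)" by (simp only: complex_of_real_integrable_eq)
  show "of_real (\<integral>w. (nv (ap (Y w) x))\<^sup>2 \<partial>M) = (\<integral>w. ip (ap (Y w) (ap (1\<^sub>m d) (ap (Y w) x))) x \<partial>M)"
    unfolding integral_complex_of_real[symmetric] by (rule Bochner_Integration.integral_cong[OF refl e])
qed

text \<open>The parameter \<sigma>^2 of the model; \<open>Sm {1..n}\<close> is already
  centred.\<close>

definition sg :: real where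
  "sg = op_norm (mat_expectation d M (\<lambda>w. Sm {1..n} w * Sm {1..n} w))"

text \<open>This is how \<sigma> enters: for a fixed x the mean square of the sum applied to x is
  the quadratic form of the expected square of the sum, and since cross terms vanish it is the total
  of the mean squares of the summands.\<close>

lemma sum_square_bound:
  "(\<integral>w. (nv (ap (Sm {1..n} w) x))\<^sup>2 \<partial>M) \<le> sg * (nv x)\<^sup>2"
  "(\<Sum>i=1..n. \<integral>w. (nv (ap (Z i w) x))\<^sup>2 \<partial>M) = (\<integral>w. (nv (ap (Sm {1..n} w) x))\<^sup>2 \<partial>M)"
proof -
  let ?S = "Sm {1..n}"
  note S = Sm_all(1) and Ssa = Sm_all(2)
  have "complex_of_real (\<Sum>i=1..n. \<integral>w. (nv (ap (Z i w) x))\<^sup>2 \<partial>M) = (\<Sum>i=1..n. \<integral>w. ip (ap (Z i w) (ap (1\<^sub>m d) (ap (Z i w) x))) x \<partial>M)"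
    unfolding of_real_sum by (intro sum.cong refl nv_square_integrable(2) Z_sqi sa)
  also have "\<dots> = complex_of_real (\<integral>w. (nv (ap (?S w) x))\<^sup>2 \<partial>M)"
    unfolding second_moment_sum[symmetric] by (rule nv_square_integrable(2)[symmetric, OF S Ssa])
  finally show "(\<Sum>i=1..n. \<integral>w. (nv (ap (Z i w) x))\<^sup>2 \<partial>M) = (\<integral>w. (nv (ap (?S w) x))\<^sup>2 \<partial>M)" by (simp only: of_real_eq_iff)
  have int: "integrable M (\<lambda>w. (?S w * ?S w) $$ (j, k))" if "j < d" "k < d" for j k
  proof -
    have "integrable M (\<lambda>w. \<Sum>l<d. ?S w $$ (j, l) * cnj (?S w $$ (k, l)))"
      using that by (intro Bochner_Integration.integrable_sum sqi_product S) auto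
    moreover have "(\<Sum>l<d. ?S w $$ (j, l) * cnj (?S w $$ (k, l))) = (?S w * ?S w) $$ (j, k)" if "w \<in> space M" for w
      using self_adjoint_carrier[OF Ssa[OF that]] self_adjoint_entry[OF Ssa[OF that]] \<open>j < d\<close> \<open>k < d\<close>
      by (auto simp: scalar_prod_def lessThan_atLeast0 intro!: sum.cong)
    ultimately show ?thesis by (simp cong: Bochner_Integration.integrable_cong)
  qed
  have "complex_of_real (\<integral>w. (nv (ap (?S w) x))\<^sup>2 \<partial>M) = (\<integral>w. ip (ap (?S w * ?S w) x) x \<partial>M)"
  proof (rule trans[OF nv_square_integrable(2)[OF S Ssa]], assumption, rule Bochner_Integration.integral_cong[OF refl])
    fix w assume "w \<in> space M"
    note c = self_adjoint_carrier[OF Ssa[OF this]]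
    have "ap (?S w) (ap (1\<^sub>m d) (ap (?S w) x)) = ap (?S w) (ap (?S w) x)" by (rule ap_cong) (simp add: ap_one)
    then show "ip (ap (?S w) (ap (1\<^sub>m d) (ap (?S w) x))) x = ip (ap (?S w * ?S w) x) x" by (simp add: ap_mult_mat[OF c c])
  qed
  also have "\<dots> = ip (ap (mat_expectation d M (\<lambda>w. ?S w * ?S w)) x) x" by (rule ip_ap_expectation(1)[OF int])
  finally have e: "complex_of_real (\<integral>w. (nv (ap (?S w) x))\<^sup>2 \<partial>M) = ip (ap (mat_expectation d M (\<lambda>w. ?S w * ?S w)) x) x" .
  have "\<bar>\<integral>w. (nv (ap (?S w) x))\<^sup>2 \<partial>M\<bar> = cmod (ip (ap (mat_expectation d M (\<lambda>w. ?S w * ?S w)) x) x)"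
    using arg_cong[OF e, of cmod] by (simp only: norm_of_real)
  also have "\<dots> \<le> sg * nv x * nv x"
    unfolding sg_def by (rule op_norm_ip[OF d0]) (simp add: mat_expectation_def)
  finally show "(\<integral>w. (nv (ap (?S w) x))\<^sup>2 \<partial>M) \<le> sg * (nv x)\<^sup>2" by (simp add: power2_eq_square mult.assoc)
qed

lemma sg_nonneg: "0 \<le> sg"
  unfolding sg_def by (rule op_norm_nonneg[OF d0]) (simp add: mat_expectation_def)

subsection \<open>The largest summand\<close>

abbreviation "\<zeta> i w \<equiv> op_norm (Z i w)"

definition Mx :: "'a \<Rightarrow> real" where "Mx w = Max (insert 0 ((\<lambda>i. \<zeta> i w) ` {1..n}))"

definition r :: real where "r = R_bar n M Z"

lemma zeta_nonneg: "i \<in> {1..n} \<Longrightarrow> w \<in> space M \<Longrightarrow> 0 \<le> \<zeta> i w"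
  using op_norm_nonneg[OF d0] mm_carrier[OF Z_mm] by blast

lemma zeta_measurable [measurable]: "i \<in> {1..n} \<Longrightarrow> \<zeta> i \<in> borel_measurable M"
  by (rule op_norm_measurable[OF d0 Z_mm])

lemma zeta_sq_integrable: "i \<in> {1..n} \<Longrightarrow> integrable M (\<lambda>w. (\<zeta> i w)\<^sup>2)"
  by (rule sqi_op_norm[OF d0 Z_sqi])

lemma zeta_le_Mx: "i \<in> {1..n} \<Longrightarrow> \<zeta> i w \<le> Mx w" unfolding Mx_def by (rule Max_ge) auto

lemma Mx_measurable [measurable]: "Mx \<in> borel_measurable M"
proof -
  have "(\<lambda>w. Max ((\<lambda>i. if i = 0 then 0 else \<zeta> i w) ` {0..n})) \<in> borel_measurable M"
  proof (rule borel_measurable_Max)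
    fix i assume "i \<in> {0..n}"
    then show "(\<lambda>w. if i = 0 then 0 else \<zeta> i w) \<in> borel_measurable M" by (cases "i = 0") auto
  qed simp
  moreover have "(\<lambda>i. if i = 0 then 0 else \<zeta> i w) ` {0..n} = insert 0 ((\<lambda>i. \<zeta> i w) ` {1..n})" for w
  proof -
    have "{0..n} = insert 0 {1..n}" by auto
    then show ?thesis by auto
  qed
  ultimately show ?thesis by (simp add: Mx_def[abs_def])
qed

lemma Mx_sq_integrable: "integrable M (\<lambda>w. (Mx w)\<^sup>2)"
proof (rule Bochner_Integration.integrable_bound)
  show "integrable M (\<lambda>w. \<Sum>i=1..n. (\<zeta> i w)\<^sup>2)" by (intro Bochner_Integration.integrable_sum zeta_sq_integrable)
  show "AE w in M. norm ((Mx w)\<^sup>2) \<le> norm (\<Sum>i=1..n. (\<zeta> i w)\<^sup>2)"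
  proof (intro AE_I2)
    fix w
    have "Mx w \<in> insert 0 ((\<lambda>i. \<zeta> i w) ` {1..n})" unfolding Mx_def by (rule Max_in) auto
    then have "(Mx w)\<^sup>2 \<le> (\<Sum>i=1..n. (\<zeta> i w)\<^sup>2)"
    proof (elim insertE imageE)
      fix i assume "Mx w = \<zeta> i w" "i \<in> {1..n}"
      then show ?thesis using member_le_sum[of i "{1..n}" "\<lambda>i. (\<zeta> i w)\<^sup>2"] by simp
    qed (simp add: sum_nonneg)
    then show "norm ((Mx w)\<^sup>2) \<le> norm (\<Sum>i=1..n. (\<zeta> i w)\<^sup>2)" by simp
  qed
qed measurable

lemma r_sq: "r\<^sup>2 = (\<integral>w. (Mx w)\<^sup>2 \<partial>M)" and r_nonneg: "0 \<le> r"
  by (simp_all add: r_def R_bar_def Mx_def)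

lemma zeta_sq_le: assumes i: "i \<in> {1..n}" shows "(\<integral>w. (\<zeta> i w)\<^sup>2 \<partial>M) \<le> r\<^sup>2"
  unfolding r_sq
  by (intro integral_mono zeta_sq_integrable Mx_sq_integrable i power_mono zeta_le_Mx zeta_nonneg)

text \<open>The threshold is twice the root mean square of the largest summand, which by Markov's
  inequality exceeds it with probability at most 1/4.\<close>

definition tail :: "nat \<Rightarrow> 'a \<Rightarrow> real" where
  "tail i w = (if \<zeta> i w > 2 * r then (\<zeta> i w)\<^sup>2 else 0)"

lemma tail_nonneg: "0 \<le> tail i w" and tail_le: "tail i w \<le> (\<zeta> i w)\<^sup>2" by (auto simp: tail_def)

lemma tail_measurable [measurable]: "i \<in> {1..n} \<Longrightarrow> tail i \<in> borel_measurable M"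
  unfolding tail_def[abs_def] by measurable

lemma tail_integrable: "i \<in> {1..n} \<Longrightarrow> integrable M (tail i)"
  by (rule Bochner_Integration.integrable_bound[OF zeta_sq_integrable]) (auto simp: tail_def)

text \<open>With probability at least \<open>3/4\<close> all other summands are at most \<open>2 r\<close>, and by independence this event costs only a constant factor;
  on it, \<open>Z\<^sub>i\<close> is the largest summand whenever it exceeds \<open>2 r\<close>.\<close>

lemma tail_sum: "(\<Sum>i=1..n. \<integral>w. tail i w \<partial>M) \<le> 2 * r\<^sup>2"
proof (cases "r = 0")
  case True
  \<comment> \<open>Markov's inequality below divides by r; for r = 0 all second moments of the
    norms vanish.\<close>
  have "(\<integral>w. tail i w \<partial>M) \<le> r\<^sup>2" if "i \<in> {1..n}" for i
    using integral_mono[OF tail_integrable[OF that] zeta_sq_integrable[OF that] tail_le] zeta_sq_le[OF that] by simp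
  then have "(\<Sum>i=1..n. \<integral>w. tail i w \<partial>M) \<le> (\<Sum>i=1..n. r\<^sup>2)" by (rule sum_mono)
  then show ?thesis using True by simp
next
  case False
  with r_nonneg have r: "r > 0" by simp
  \<comment> \<open>The event that all summands except \<open>Z i\<close> are below the threshold;
    it is independent of \<open>tail i\<close>.\<close>
  define e where "e i w = (if \<forall>j\<in>{1..n} - {i}. \<zeta> j w \<le> 2 * r then 1 else 0 :: real)" for i w
  have em[measurable]: "e i \<in> borel_measurable M" for i unfolding e_def[abs_def] by measurable
  have ei: "integrable M (e i)" for i by (rule integrable_const_bound[of _ 1]) (auto simp: e_def)
  have eprob: "1 / 2 \<le> (\<integral>w. e i w \<partial>M)" for i
  proof -
    have "(\<integral>w. 1 - e i w \<partial>M) \<le> (\<integral>w. (Mx w)\<^sup>2 / (2 * r)\<^sup>2 \<partial>M)"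
    proof (rule integral_mono)
      fix w
      show "1 - e i w \<le> (Mx w)\<^sup>2 / (2 * r)\<^sup>2"
      proof (cases "\<forall>j\<in>{1..n} - {i}. \<zeta> j w \<le> 2 * r")
        case False
        then obtain j where "j \<in> {1..n} - {i}" "\<not> \<zeta> j w \<le> 2 * r" by blast
        then have "2 * r \<le> Mx w" using zeta_le_Mx[of j w] by simp
        then have "(2 * r)\<^sup>2 \<le> (Mx w)\<^sup>2" using r by (intro power_mono) auto
        then have "1 \<le> (Mx w)\<^sup>2 / (2 * r)\<^sup>2" using r by (simp add: le_divide_eq)
        then show ?thesis using False by (simp add: e_def)
      qed (simp add: e_def)
    qed (use ei Mx_sq_integrable in auto)
    also have "\<dots> = 1 / 4" using r by (simp add: r_sq[symmetric] power_mult_distrib)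
    finally show ?thesis using ei by (simp add: prob_space)
  qed
  have ind: "(\<integral>w. tail i w * e i w \<partial>M) = (\<integral>w. tail i w \<partial>M) * (\<integral>w. e i w \<partial>M)" "integrable M (\<lambda>w. tail i w * e i w)" if i: "i \<in> {1..n}" for i
  proof -
    let ?g = "\<lambda>A. if op_norm A > 2 * r then (op_norm A)\<^sup>2 else 0 :: real"
    let ?G = "\<lambda>f. if \<forall>j\<in>{1..n} - {i}. op_norm (f j) \<le> 2 * r then 1 else 0 :: real"
    have [measurable]: "op_norm \<in> borel_measurable (mat_borel d)" using op_norm_measurable[OF d0 mm_id] by simp
    have g: "?g \<in> borel_measurable (mat_borel d)" by measurable
    have G: "?G \<in> borel_measurable (Pi\<^sub>M ({1..n} - {i}) (\<lambda>_. mat_borel d))" by measurable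
    have "?G (restrict (\<lambda>j. Z j w) ({1..n} - {i})) = e i w" for w by (auto simp: e_def)
    with indep_split[OF i g G] have "indep_var borel (tail i) borel (e i)"
      by (simp add: tail_def[abs_def])
    from indep_var_lebesgue_integral[OF this tail_integrable[OF i] ei] indep_var_integrable[OF this tail_integrable[OF i] ei]
    show "(\<integral>w. tail i w * e i w \<partial>M) = (\<integral>w. tail i w \<partial>M) * (\<integral>w. e i w \<partial>M)" "integrable M (\<lambda>w. tail i w * e i w)" .
  qed
  \<comment> \<open>At each sample point at most one index contributes: if \<open>tail i\<close> and
    \<open>e i\<close> are both nonzero, then all other summands are at most 2 r and have tail
    0.\<close>
  have pt: "(\<Sum>i=1..n. tail i w * e i w) \<le> (Mx w)\<^sup>2" if w: "w \<in> space M" for w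
  proof (cases "\<exists>i\<in>{1..n}. tail i w * e i w \<noteq> 0")
    case True
    then obtain i where i: "i \<in> {1..n}" "tail i w * e i w \<noteq> 0" by auto
    then have ei: "\<forall>j\<in>{1..n} - {i}. \<zeta> j w \<le> 2 * r" by (auto simp: e_def split: if_splits)
    have "(\<Sum>j=1..n. tail j w * e j w) = tail i w * e i w + (\<Sum>j\<in>{1..n} - {i}. tail j w * e j w)"
      using i by (simp add: sum.remove)
    also have "(\<Sum>j\<in>{1..n} - {i}. tail j w * e j w) = 0"
    proof (intro sum.neutral ballI)
      fix j assume "j \<in> {1..n} - {i}"
      with ei have "\<zeta> j w \<le> 2 * r" by blast
      then show "tail j w * e j w = 0" by (simp add: tail_def)
    qed
    also have "tail i w * e i w \<le> (\<zeta> i w)\<^sup>2" using tail_le[of i w] by (auto simp: e_def)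
    also have "\<dots> \<le> (Mx w)\<^sup>2" using i w by (intro power_mono zeta_le_Mx zeta_nonneg)
    finally show ?thesis by simp
  next
    case False
    then have "(\<Sum>i=1..n. tail i w * e i w) = 0" by (intro sum.neutral) auto
    then show ?thesis by simp
  qed
  have "(\<Sum>i=1..n. \<integral>w. tail i w \<partial>M) * (1 / 2) = (\<Sum>i=1..n. (\<integral>w. tail i w \<partial>M) * (1 / 2))" by (rule sum_distrib_right)
  also have "\<dots> \<le> (\<Sum>i=1..n. (\<integral>w. tail i w \<partial>M) * (\<integral>w. e i w \<partial>M))"
    by (intro sum_mono mult_left_mono eprob integral_nonneg_AE) (auto simp: tail_nonneg)
  also have "\<dots> = (\<Sum>i=1..n. \<integral>w. tail i w * e i w \<partial>M)" by (intro sum.cong refl ind(1)[symmetric])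
  also have "\<dots> = (\<integral>w. (\<Sum>i=1..n. tail i w * e i w) \<partial>M)" by (intro Bochner_Integration.integral_sum[symmetric] ind(2))
  also have "\<dots> \<le> (\<integral>w. (Mx w)\<^sup>2 \<partial>M)" by (intro integral_mono Bochner_Integration.integrable_sum ind(2) Mx_sq_integrable pt)
  finally show ?thesis by (simp add: r_sq)
qed

subsection \<open>Replacing a summand by its second moment\<close>

context
  fixes B :: "complex mat" and s :: real
  assumes B: "self_adjoint d B" and s: "0 \<le> s" "s \<le> 1"
begin

abbreviation "lc \<equiv> lin B s"

lemmas lc_sa = lin_sa[OF B] and lc_mm = lin_mm[where B = B and s = s] and lc_rs_mv = lin_rs_mv[OF B]

abbreviation "A w \<equiv> lc (Sm {1..n} w)"

lemma A_sa: "w \<in> space M \<Longrightarrow> self_adjoint d (A w)" by (intro lc_sa Sm_sa) auto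

text \<open>\<open>Q\<close> applies an independent copy of \<open>Z i\<close> to the resolvent
  vector of the full sum: with this vector frozen, the mean squares of the copies add up to the
  variance. In \<open>bsq\<close> the resolvent lacks \<open>Z i\<close>, so the copy can be
  exchanged for \<open>Z i\<close> itself.\<close>

definition Q :: "complex \<Rightarrow> (nat \<Rightarrow> complex) \<Rightarrow> nat \<Rightarrow> real" where
  "Q z x i = (\<integral>p. (nv (ap (Z i (snd p)) (rs z (A (fst p)) x)))\<^sup>2 \<partial>(M \<Otimes>\<^sub>M M))"

definition bsq :: "complex \<Rightarrow> (nat \<Rightarrow> complex) \<Rightarrow> nat \<Rightarrow> real" where
  "bsq z x i = (\<integral>w. (nv (ap (Z i w) (rs z (lc (Sm ({1..n} - {i}) w)) x)))\<^sup>2 \<partial>M)"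

context
  fixes i assumes i: "i \<in> {1..n}"
begin

abbreviation "R \<equiv> Sm ({1..n} - {i})"
abbreviation "A0 w \<equiv> lc (R w)"

lemma A_A0: "j < d \<Longrightarrow> k < d \<Longrightarrow> A w $$ (j, k) = A0 w $$ (j, k) + of_real s * Z i w $$ (j, k)"
proof -
  assume jk: "j < d" "k < d"
  have "(\<Sum>l=1..n. Z l w $$ (j, k)) = Z i w $$ (j, k) + (\<Sum>l\<in>{1..n} - {i}. Z l w $$ (j, k))"
    by (rule sum.remove) (use i in auto)
  then show ?thesis using jk by (simp add: lin_def Sm_entry algebra_simps)
qed

lemma R_sa: "w \<in> space M \<Longrightarrow> self_adjoint d (R w)" by (rule Sm_sa) auto
lemma A0_sa: "w \<in> space M \<Longrightarrow> self_adjoint d (A0 w)" by (intro lc_sa R_sa)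
lemma R_mm: "mm M R" by (rule Sm_mm) auto

lemma mm_P:
  "mm (M \<Otimes>\<^sub>M M) (\<lambda>p. Z i (fst p))" "mm (M \<Otimes>\<^sub>M M) (\<lambda>p. Z i (snd p))" "mm (M \<Otimes>\<^sub>M M) (\<lambda>p. R (fst p))" "mm (M \<Otimes>\<^sub>M M) (\<lambda>p. Sm {1..n} (fst p))"
  by (intro mm_compose[OF Z_mm[OF i]] mm_compose[OF R_mm] mm_compose[OF Sm_mm[OF order_refl]] measurable_fst measurable_snd)+

lemma space_P: "p \<in> space (M \<Otimes>\<^sub>M M) \<Longrightarrow> fst p \<in> space M" "p \<in> space (M \<Otimes>\<^sub>M M) \<Longrightarrow> snd p \<in> space M"
  by (auto simp: space_pair_measure)

lemma mv_P:
  assumes z: "Im z \<noteq> 0"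
  shows "mv (M \<Otimes>\<^sub>M M) x \<Longrightarrow> mv (M \<Otimes>\<^sub>M M) (\<lambda>p. rs z (A (fst p)) (x p))" "mv (M \<Otimes>\<^sub>M M) x \<Longrightarrow> mv (M \<Otimes>\<^sub>M M) (\<lambda>p. rs z (A0 (fst p)) (x p))"
  by (rule lc_rs_mv[OF mm_P(4) _ z] lc_rs_mv[OF mm_P(3) _ z]; auto intro!: Sm_sa simp: space_pair_measure)+

lemma zeta_P_integrable:
  "integrable (M \<Otimes>\<^sub>M M) (\<lambda>p. (\<zeta> i (fst p))\<^sup>2)" "integrable (M \<Otimes>\<^sub>M M) (\<lambda>p. (\<zeta> i (snd p))\<^sup>2)"
  "integrable (M \<Otimes>\<^sub>M M) (\<lambda>p. \<zeta> i (fst p))"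
  using pair_fst_integrable(1)[OF prob_M prob_M, of "\<lambda>w. (\<zeta> i w)\<^sup>2"] pair_snd_integrable(1)[OF prob_M prob_M, of "\<lambda>w. (\<zeta> i w)\<^sup>2"]
    pair_fst_integrable(1)[OF prob_M prob_M, of "\<lambda>w. \<zeta> i w"] zeta_sq_integrable[OF i] sqi_op_norm1[OF prob_M d0 Z_sqi[OF i]] zeta_measurable[OF i]
  by simp_all

lemma ap_Z_bound: "w \<in> space M \<Longrightarrow> nv (ap (Z i w) x) \<le> \<zeta> i w * nv x"
  by (rule op_norm_bound[OF d0 self_adjoint_carrier[OF sa[OF i]]])

lemma ap_Z_rs_bound:
  assumes "w \<in> space M" "self_adjoint d C" "Im z \<noteq> 0"
  shows "(nv (ap (Z i w) (rs z C x)))\<^sup>2 \<le> (\<zeta> i w)\<^sup>2 * (nv x / \<bar>Im z\<bar>)\<^sup>2"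
proof -
  have "nv (ap (Z i w) (rs z C x)) \<le> \<zeta> i w * (nv x / \<bar>Im z\<bar>)"
    by (rule order.trans[OF ap_Z_bound[OF assms(1)] mult_left_mono[OF rs_bound[OF assms(2,3)] zeta_nonneg[OF i assms(1)]]])
  then have "(nv (ap (Z i w) (rs z C x)))\<^sup>2 \<le> (\<zeta> i w * (nv x / \<bar>Im z\<bar>))\<^sup>2" by (intro power_mono) auto
  then show ?thesis by (simp only: power_mult_distrib)
qed

lemma square_P_integrable:
  assumes z: "Im z \<noteq> 0"
  shows "integrable (M \<Otimes>\<^sub>M M) (\<lambda>p. (nv (ap (Z i (fst p)) (rs z (A0 (fst p)) x)))\<^sup>2)"
    "integrable (M \<Otimes>\<^sub>M M) (\<lambda>p. (nv (ap (Z i (snd p)) (rs z (A0 (fst p)) x)))\<^sup>2)"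
    "integrable (M \<Otimes>\<^sub>M M) (\<lambda>p. (nv (ap (Z i (snd p)) (rs z (A (fst p)) x)))\<^sup>2)"
proof -
  have m: "(\<lambda>p. (nv (f p))\<^sup>2) \<in> borel_measurable (M \<Otimes>\<^sub>M M)" if "mv (M \<Otimes>\<^sub>M M) f" for f
    using nv_measurable[OF that] by measurable
  show "integrable (M \<Otimes>\<^sub>M M) (\<lambda>p. (nv (ap (Z i (fst p)) (rs z (A0 (fst p)) x)))\<^sup>2)"
    by (rule Bochner_Integration.integrable_bound[OF integrable_mult_left[OF zeta_P_integrable(1), of "(nv x / \<bar>Im z\<bar>)\<^sup>2"] m[OF mv_ap[OF mm_P(1) mv_P(2)[OF z mv_const]]]])
       (intro AE_I2 norm_square_le ap_Z_rs_bound A0_sa space_P z)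
  show "integrable (M \<Otimes>\<^sub>M M) (\<lambda>p. (nv (ap (Z i (snd p)) (rs z (A0 (fst p)) x)))\<^sup>2)"
    by (rule Bochner_Integration.integrable_bound[OF integrable_mult_left[OF zeta_P_integrable(2), of "(nv x / \<bar>Im z\<bar>)\<^sup>2"] m[OF mv_ap[OF mm_P(2) mv_P(2)[OF z mv_const]]]])
       (intro AE_I2 norm_square_le ap_Z_rs_bound A0_sa space_P z)
  show "integrable (M \<Otimes>\<^sub>M M) (\<lambda>p. (nv (ap (Z i (snd p)) (rs z (A (fst p)) x)))\<^sup>2)"
    by (rule Bochner_Integration.integrable_bound[OF integrable_mult_left[OF zeta_P_integrable(2), of "(nv x / \<bar>Im z\<bar>)\<^sup>2"] m[OF mv_ap[OF mm_P(2) mv_P(1)[OF z mv_const]]]])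
       (intro AE_I2 norm_square_le ap_Z_rs_bound A_sa space_P z)
qed

lemma mm_T:
  defines "T \<equiv> mat_borel d \<Otimes>\<^sub>M (mat_borel d \<Otimes>\<^sub>M mat_borel d)"
  shows "mm T (\<lambda>t. proj (fst t))" "mm T (\<lambda>t. proj (fst (snd t)))"
  unfolding T_def by (intro mm_proj mm_measurable; measurable)+

text \<open>Since \<open>R\<close> omits \<open>Z i\<close>, the original and its copy have the same
  joint law with it.\<close>

lemma exchange_A0:
  fixes F :: "complex mat \<Rightarrow> complex mat \<Rightarrow> 'b :: {banach, second_countable_topology}"
  assumes "(\<lambda>t. F (proj (fst t)) (proj (fst (snd t)))) \<in> borel_measurable (mat_borel d \<Otimes>\<^sub>M (mat_borel d \<Otimes>\<^sub>M mat_borel d))"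
  shows "(\<integral>p. F (Z i (snd p)) (R (fst p)) \<partial>(M \<Otimes>\<^sub>M M)) = (\<integral>p. F (Z i (fst p)) (R (fst p)) \<partial>(M \<Otimes>\<^sub>M M))"
  using exchange[OF prob_M indep_rest[OF i] sa[OF i] R_sa, where F = "\<lambda>x r x'. F x r"] assms by simp

lemma bsq_exchange:
  assumes z: "Im z \<noteq> 0"
  shows "(\<integral>p. (nv (ap (Z i (snd p)) (rs z (A0 (fst p)) x)))\<^sup>2 \<partial>(M \<Otimes>\<^sub>M M)) = bsq z x i"
    "(\<integral>p. (nv (ap (Z i (fst p)) (rs z (A0 (fst p)) x)))\<^sup>2 \<partial>(M \<Otimes>\<^sub>M M)) = bsq z x i"
proof -
  have "(\<lambda>t. nv (ap (proj (fst t)) (rs z (lc (proj (fst (snd t)))) x))) \<in> borel_measurable (mat_borel d \<Otimes>\<^sub>M (mat_borel d \<Otimes>\<^sub>M mat_borel d))"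
    by (intro nv_measurable mv_ap lc_rs_mv mm_T mv_const z self_adjoint_proj)
  then have m: "(\<lambda>t. (nv (ap (proj (fst t)) (rs z (lc (proj (fst (snd t)))) x)))\<^sup>2) \<in> borel_measurable (mat_borel d \<Otimes>\<^sub>M (mat_borel d \<Otimes>\<^sub>M mat_borel d))"
    by measurable
  have m2: "(\<lambda>w. nv (ap (Z i w) (rs z (A0 w) x))) \<in> borel_measurable M"
    by (intro nv_measurable mv_ap lc_rs_mv Z_mm i R_mm R_sa mv_const z)
  then have m2: "(\<lambda>w. (nv (ap (Z i w) (rs z (A0 w) x)))\<^sup>2) \<in> borel_measurable M" by measurable
  show 2: "(\<integral>p. (nv (ap (Z i (fst p)) (rs z (A0 (fst p)) x)))\<^sup>2 \<partial>(M \<Otimes>\<^sub>M M)) = bsq z x i"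
    unfolding bsq_def by (rule pair_fst_integrable(2)[OF prob_M prob_M m2])
  show "(\<integral>p. (nv (ap (Z i (snd p)) (rs z (A0 (fst p)) x)))\<^sup>2 \<partial>(M \<Otimes>\<^sub>M M)) = bsq z x i"
    using exchange_A0[where F = "\<lambda>x' r. (nv (ap x' (rs z (lc r) x)))\<^sup>2", OF m] 2 by simp
qed

text \<open>A bound of \<open>bsq\<close> by itself: passing to the full resolvent gives 2 Q plus 2
  / y^2 times the mean of \<zeta>^2 times \<open>bsq\<close>. With 2 r \<le> y the last term is at
  most half of \<open>bsq\<close> and is absorbed on the left.\<close>

lemma bsq_bound:
  assumes z: "Im z \<noteq> 0" "2 * r \<le> \<bar>Im z\<bar>"
  shows "bsq z x i \<le> 4 * Q z x i"
proof -
  interpret P: pair_prob_space M M ..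
  let ?b = "\<lambda>w. (nv (ap (Z i w) (rs z (A0 w) x)))\<^sup>2"
  have bi: "integrable M ?b"
  proof (rule Bochner_Integration.integrable_bound[OF integrable_mult_left[OF zeta_sq_integrable[OF i], of "(nv x / \<bar>Im z\<bar>)\<^sup>2"]])
    have "(\<lambda>w. nv (ap (Z i w) (rs z (A0 w) x))) \<in> borel_measurable M"
      by (intro nv_measurable mv_ap lc_rs_mv Z_mm i R_mm R_sa mv_const z)
    then show "?b \<in> borel_measurable M" by measurable
  qed (intro AE_I2 norm_square_le ap_Z_rs_bound A0_sa z)
  have pint: "integrable (M \<Otimes>\<^sub>M M) (\<lambda>p. ?b (fst p) * (\<zeta> i (snd p))\<^sup>2)"
    "(\<integral>p. ?b (fst p) * (\<zeta> i (snd p))\<^sup>2 \<partial>(M \<Otimes>\<^sub>M M)) = bsq z x i * (\<integral>w. (\<zeta> i w)\<^sup>2 \<partial>M)"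
  proof -
    have m: "(\<lambda>p. ?b (fst p) * (\<zeta> i (snd p))\<^sup>2) \<in> borel_measurable (M \<Otimes>\<^sub>M M)"
      using borel_measurable_integrable[OF bi] zeta_measurable[OF i] by measurable
    show i1: "integrable (M \<Otimes>\<^sub>M M) (\<lambda>p. ?b (fst p) * (\<zeta> i (snd p))\<^sup>2)"
      by (rule P.Fubini_integrable[OF m]) (use bi zeta_sq_integrable[OF i] in \<open>auto simp: abs_mult\<close>)
    show "(\<integral>p. ?b (fst p) * (\<zeta> i (snd p))\<^sup>2 \<partial>(M \<Otimes>\<^sub>M M)) = bsq z x i * (\<integral>w. (\<zeta> i w)\<^sup>2 \<partial>M)"
      using P.integral_fst'[OF i1] by (simp add: bsq_def)
  qed
  have "bsq z x i = (\<integral>p. (nv (ap (Z i (snd p)) (rs z (A0 (fst p)) x)))\<^sup>2 \<partial>(M \<Otimes>\<^sub>M M))" using bsq_exchange[OF z(1)] by simp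
  also have "\<dots> \<le> (\<integral>p. 2 * (nv (ap (Z i (snd p)) (rs z (A (fst p)) x)))\<^sup>2 + (2 / (Im z)\<^sup>2) * (?b (fst p) * (\<zeta> i (snd p))\<^sup>2) \<partial>(M \<Otimes>\<^sub>M M))"
  proof (intro integral_mono Bochner_Integration.integrable_add integrable_mult_right square_P_integrable z pint)
    fix p assume p: "p \<in> space (M \<Otimes>\<^sub>M M)"
    note sp = space_P[OF p]
    show "(nv (ap (Z i (snd p)) (rs z (A0 (fst p)) x)))\<^sup>2 \<le> 2 * (nv (ap (Z i (snd p)) (rs z (A (fst p)) x)))\<^sup>2 + (2 / (Im z)\<^sup>2) * (?b (fst p) * (\<zeta> i (snd p))\<^sup>2)"
      using perturbed_square[OF A_sa[OF sp(1)] A0_sa[OF sp(1)] sa[OF i sp(1)] z(1) d0 s A_A0 sa[OF i sp(2)], of x]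
      by (simp add: u0_def[OF A_sa[OF sp(1)] A0_sa[OF sp(1)] sa[OF i sp(1)] z(1) d0 s A_A0] mult_ac)
  qed
  also have "\<dots> = 2 * Q z x i + (2 / (Im z)\<^sup>2) * (bsq z x i * (\<integral>w. (\<zeta> i w)\<^sup>2 \<partial>M))"
    using square_P_integrable(3)[OF z(1)] pint by (subst Bochner_Integration.integral_add) (auto simp: Q_def)
  also have "(2 / (Im z)\<^sup>2) * (bsq z x i * (\<integral>w. (\<zeta> i w)\<^sup>2 \<partial>M)) \<le> (1 / 2) * bsq z x i"
  proof -
    have b0: "0 \<le> bsq z x i" unfolding bsq_def by simp
    have "(\<integral>w. (\<zeta> i w)\<^sup>2 \<partial>M) \<le> r\<^sup>2" by (rule zeta_sq_le[OF i])
    also have "\<dots> \<le> (Im z)\<^sup>2 / 4" using power_mono[OF z(2), of 2] r_nonneg by simp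
    finally have "(2 / (Im z)\<^sup>2) * (\<integral>w. (\<zeta> i w)\<^sup>2 \<partial>M) \<le> (2 / (Im z)\<^sup>2) * ((Im z)\<^sup>2 / 4)" by (intro mult_left_mono) auto
    also have "\<dots> = 1 / 2" using z(1) by simp
    finally have "((2 / (Im z)\<^sup>2) * (\<integral>w. (\<zeta> i w)\<^sup>2 \<partial>M)) * bsq z x i \<le> (1 / 2) * bsq z x i" using b0 by (rule mult_right_mono)
    then show ?thesis by (simp add: mult_ac)
  qed
  finally show ?thesis by simp
qed

text \<open>The expansion around \<open>A0\<close> is added and subtracted. Its first-order term has
  mean 0, as \<open>Z i\<close> is centred and independent of \<open>A0\<close>, and its
  second-order terms for \<open>Z i\<close> and for the copy have equal means by exchange. What
  remains is the mean of the expression estimated in \<open>perturbation_bound\<close>.\<close>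

lemma replacement_error:
  assumes z: "Im z \<noteq> 0" "2 * r \<le> \<bar>Im z\<bar>" and wv: "nv w = 1" "nv v = 1"
  shows "cmod ((\<integral>x. trip z (A x) (Z i x) w v \<partial>M) - 2 * of_real s * (\<integral>p. quin z (A (fst p)) (Z i (snd p)) w v \<partial>(M \<Otimes>\<^sub>M M)))
    \<le> 16 * r / (Im z)\<^sup>2 * (bsq z w i + bsq (cnj z) v i) + 16 / \<bar>Im z\<bar> ^ 3 * (\<integral>x. tail i x \<partial>M)"
    "integrable (M \<Otimes>\<^sub>M M) (\<lambda>p. quin z (A (fst p)) (Z i (snd p)) w v)"
    "integrable M (\<lambda>x. trip z (A x) (Z i x) w v)"
proof -
  interpret P: pair_prob_space M M ..
  let ?P = "M \<Otimes>\<^sub>M M" and ?y = "\<bar>Im z\<bar>"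
  have z': "Im (cnj z) \<noteq> 0" "2 * r \<le> \<bar>Im (cnj z)\<bar>" using z by auto
  have y: "0 < ?y" using z by simp
  have tripb: "cmod (trip z C (Z i x) w v) \<le> \<zeta> i x * (1 / ?y\<^sup>2)" if "self_adjoint d C" "x \<in> space M" for C x
  proof -
    have "cmod (trip z C (Z i x) w v) \<le> (\<zeta> i x * (nv w / ?y)) * (nv v / \<bar>Im (cnj z)\<bar>)"
      unfolding trip_eq[OF that(1) z(1)]
      by (rule norm_ip_le[OF order.trans[OF ap_Z_bound[OF that(2)] mult_left_mono[OF rs_bound[OF that(1) z(1)] zeta_nonneg[OF i that(2)]]] rs_bound[OF that(1) z'(1)]])
    then show ?thesis using wv by (simp add: power2_eq_square)
  qed
  have quinb: "cmod (quin z C (Z i x) w v) \<le> (\<zeta> i x)\<^sup>2 * (1 / ?y ^ 3)" if C: "self_adjoint d C" and "x \<in> space M" for C x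
    using quin_bound[OF C C sa[OF i that(2)] z(1) d0 order_refl zero_le_one _ C sa[OF i that(2)], of w v] wv by simp
  have tm: "(\<lambda>p. trip z (A (fst p)) (Z i (fst p)) w v) \<in> borel_measurable ?P" "(\<lambda>p. trip z (A0 (fst p)) (Z i (fst p)) w v) \<in> borel_measurable ?P"
     "(\<lambda>p. trip z (A0 (fst p)) (Z i (snd p)) w v) \<in> borel_measurable ?P"
    unfolding trip_def by (intro ip_measurable mv_P mv_ap mm_P mv_const z(1))+
  have qm: "(\<lambda>p. quin z (A (fst p)) (Z i (snd p)) w v) \<in> borel_measurable ?P" "(\<lambda>p. quin z (A0 (fst p)) (Z i (fst p)) w v) \<in> borel_measurable ?P"
     "(\<lambda>p. quin z (A0 (fst p)) (Z i (snd p)) w v) \<in> borel_measurable ?P"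
    unfolding quin_def by (intro ip_measurable mv_P mv_ap mm_P mv_const z(1))+
  have tmM: "(\<lambda>x. trip z (A x) (Z i x) w v) \<in> borel_measurable M"
    unfolding trip_def by (intro ip_measurable lc_rs_mv mv_ap Z_mm i Sm_mm Sm_sa order_refl mv_const z(1))
  have le: "norm a \<le> norm b" if "norm a \<le> b" for a :: complex and b :: real using that by simp
  show ti: "integrable M (\<lambda>x. trip z (A x) (Z i x) w v)"
    by (rule Bochner_Integration.integrable_bound[OF integrable_mult_left[OF sqi_op_norm1[OF prob_M d0 Z_sqi[OF i]], of "1 / ?y\<^sup>2"] tmM])
       (intro AE_I2 le tripb A_sa)
  have zetaP3: "integrable ?P (\<lambda>p. \<zeta> i (snd p))"
    using pair_snd_integrable(1)[OF prob_M prob_M, of "\<lambda>w. \<zeta> i w"] sqi_op_norm1[OF prob_M d0 Z_sqi[OF i]] zeta_measurable[OF i] by simp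
  have tP: "integrable ?P (\<lambda>p. trip z (A (fst p)) (Z i (fst p)) w v)"
    by (rule Bochner_Integration.integrable_bound[OF integrable_mult_left[OF zeta_P_integrable(3), of "1 / ?y\<^sup>2"] tm(1)])
       (intro AE_I2 le tripb A_sa space_P)
  have tP0: "integrable ?P (\<lambda>p. trip z (A0 (fst p)) (Z i (fst p)) w v)"
    by (rule Bochner_Integration.integrable_bound[OF integrable_mult_left[OF zeta_P_integrable(3), of "1 / ?y\<^sup>2"] tm(2)])
       (intro AE_I2 le tripb A0_sa space_P)
  have tP0': "integrable ?P (\<lambda>p. trip z (A0 (fst p)) (Z i (snd p)) w v)"
    by (rule Bochner_Integration.integrable_bound[OF integrable_mult_left[OF zetaP3, of "1 / ?y\<^sup>2"] tm(3)])
       (intro AE_I2 le tripb A0_sa space_P)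
  show qP: "integrable ?P (\<lambda>p. quin z (A (fst p)) (Z i (snd p)) w v)"
    by (rule Bochner_Integration.integrable_bound[OF integrable_mult_left[OF zeta_P_integrable(2), of "1 / ?y ^ 3"] qm(1)])
       (intro AE_I2 le quinb A_sa space_P)
  have qP0: "integrable ?P (\<lambda>p. quin z (A0 (fst p)) (Z i (fst p)) w v)"
    by (rule Bochner_Integration.integrable_bound[OF integrable_mult_left[OF zeta_P_integrable(1), of "1 / ?y ^ 3"] qm(2)])
       (intro AE_I2 le quinb A0_sa space_P)
  have qP0': "integrable ?P (\<lambda>p. quin z (A0 (fst p)) (Z i (snd p)) w v)"
    by (rule Bochner_Integration.integrable_bound[OF integrable_mult_left[OF zeta_P_integrable(2), of "1 / ?y ^ 3"] qm(3)])
       (intro AE_I2 le quinb A0_sa space_P)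
  have exq: "(\<integral>p. quin z (A0 (fst p)) (Z i (snd p)) w v \<partial>?P) = (\<integral>p. quin z (A0 (fst p)) (Z i (fst p)) w v \<partial>?P)"
    by (rule exchange_A0[where F = "\<lambda>x r. quin z (lc r) x w v"], unfold quin_def)
       (intro ip_measurable lc_rs_mv mv_ap mm_T mv_const z self_adjoint_proj)
  have ext: "(\<integral>p. trip z (A0 (fst p)) (Z i (fst p)) w v \<partial>?P) = 0"
  proof -
    have "(\<integral>p. trip z (A0 (fst p)) (Z i (fst p)) w v \<partial>?P) = (\<integral>p. trip z (A0 (fst p)) (Z i (snd p)) w v \<partial>?P)"
      by (rule exchange_A0[where F = "\<lambda>x r. trip z (lc r) x w v", symmetric], unfold trip_def)
         (intro ip_measurable lc_rs_mv mv_ap mm_T mv_const z self_adjoint_proj)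
    also have "\<dots> = (\<integral>x. \<integral>x'. trip z (A0 x) (Z i x') w v \<partial>M \<partial>M)"
      using P.integral_fst'[OF tP0'] by simp
    also have "\<dots> = (\<integral>x. 0 \<partial>M)"
    proof (rule Bochner_Integration.integral_cong[OF refl])
      fix x assume x: "x \<in> space M"
      have "(\<integral>x'. trip z (A0 x) (Z i x') w v \<partial>M) = (\<integral>x'. ip (ap (Z i x') (rs z (A0 x) w)) (rs (cnj z) (A0 x) v) \<partial>M)"
        unfolding trip_eq[OF A0_sa[OF x] z(1)] ..
      also have "\<dots> = ip (ap (mat_expectation d M (Z i)) (rs z (A0 x) w)) (rs (cnj z) (A0 x) v)"
        by (rule ip_ap_expectation(1)[OF sqi_entry[OF prob_M Z_sqi[OF i]]])
      also have "\<dots> = 0" by (simp add: ip_def ap_def mat_expectation_def mean[OF i])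
      finally show "(\<integral>x'. trip z (A0 x) (Z i x') w v \<partial>M) = 0" .
    qed
    finally show ?thesis by simp
  qed
  let ?t = "\<lambda>p. trip z (A (fst p)) (Z i (fst p)) w v" and ?ta = "\<lambda>p. trip z (A0 (fst p)) (Z i (fst p)) w v"
    and ?q = "\<lambda>p. quin z (A (fst p)) (Z i (snd p)) w v" and ?qb = "\<lambda>p. quin z (A0 (fst p)) (Z i (fst p)) w v" and ?qc = "\<lambda>p. quin z (A0 (fst p)) (Z i (snd p)) w v"
  let ?I = "\<lambda>p. (?t p - ?ta p - 2 * of_real s * ?qb p) - 2 * of_real s * (?q p - ?qc p)"
  have Ii: "integrable ?P ?I" using tP tP0 qP qP0 qP0' by (intro Bochner_Integration.integrable_diff integrable_mult_right)
  have "(\<integral>x. trip z (A x) (Z i x) w v \<partial>M) = (\<integral>p. ?t p \<partial>?P)"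
    by (rule pair_fst_integrable(2)[OF prob_M prob_M tmM, symmetric])
  moreover have "(\<integral>p. ?I p \<partial>?P) = ((\<integral>p. ?t p \<partial>?P) - (\<integral>p. ?ta p \<partial>?P) - 2 * of_real s * (\<integral>p. ?qb p \<partial>?P)) - 2 * of_real s * ((\<integral>p. ?q p \<partial>?P) - (\<integral>p. ?qc p \<partial>?P))"
    using tP tP0 qP qP0 qP0' by (simp add: Bochner_Integration.integral_diff Bochner_Integration.integrable_diff)
  ultimately have eq: "(\<integral>x. trip z (A x) (Z i x) w v \<partial>M) - 2 * of_real s * (\<integral>p. ?q p \<partial>?P) = (\<integral>p. ?I p \<partial>?P)"
    using ext exq by (simp add: algebra_simps)
  let ?sq = "\<lambda>p. (nv (ap (Z i (fst p)) (rs (cnj z) (A0 (fst p)) v)))\<^sup>2 + (nv (ap (Z i (fst p)) (rs z (A0 (fst p)) w)))\<^sup>2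
      + (nv (ap (Z i (snd p)) (rs (cnj z) (A0 (fst p)) v)))\<^sup>2 + (nv (ap (Z i (snd p)) (rs z (A0 (fst p)) w)))\<^sup>2"
  let ?bd = "\<lambda>p. (4 * (2 * r) / (Im z)\<^sup>2) * ?sq p + (8 / ?y ^ 3) * (tail i (fst p) + tail i (snd p))"
  have sqi: "integrable ?P ?sq" by (intro Bochner_Integration.integrable_add square_P_integrable z z')
  have tli: "integrable ?P (\<lambda>p. tail i (fst p))" "integrable ?P (\<lambda>p. tail i (snd p))"
    using pair_fst_integrable(1)[OF prob_M prob_M tail_measurable[OF i]] pair_snd_integrable(1)[OF prob_M prob_M tail_measurable[OF i]] tail_integrable[OF i] by auto
  have "cmod (\<integral>p. ?I p \<partial>?P) \<le> (\<integral>p. ?bd p \<partial>?P)"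
  proof (rule order.trans[OF integral_norm_bound], rule integral_mono)
    show "integrable ?P (\<lambda>p. cmod (?I p))" by (rule integrable_norm[OF Ii])
    show "integrable ?P ?bd" by (intro Bochner_Integration.integrable_add integrable_mult_right sqi tli)
    fix p assume p: "p \<in> space ?P"
    note sp = space_P[OF p]
    note ctx = A_sa[OF sp(1)] A0_sa[OF sp(1)] sa[OF i sp(1)] z(1) d0 s A_A0
    \<comment> \<open>The threshold is the one in \<open>tail\<close>, so that the truncated squares
      of the pointwise bound are the tails of the original and of the copy.\<close>
    have "0 \<le> 2 * r" using r_nonneg by simp
    from perturbation_bound[OF ctx sa[OF i sp(2)] this z(2) wv]
    show "norm (?I p) \<le> ?bd p" unfolding tail_def by (simp only: u0_def[OF ctx] t0_def[OF ctx] simp_thms)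
  qed
  also have "(\<integral>p. ?bd p \<partial>?P) = (4 * (2 * r) / (Im z)\<^sup>2) * (\<integral>p. ?sq p \<partial>?P) + (8 / ?y ^ 3) * (\<integral>p. tail i (fst p) + tail i (snd p) \<partial>?P)"
    using sqi tli by (subst Bochner_Integration.integral_add) (auto simp del: distrib_left_numeral)
  also have "(\<integral>p. ?sq p \<partial>?P) = 2 * (bsq z w i + bsq (cnj z) v i)"
    using square_P_integrable[OF z(1)] square_P_integrable[OF z'(1)] bsq_exchange[OF z(1), of w] bsq_exchange[OF z'(1), of v]
    by simp
  also have "(\<integral>p. tail i (fst p) + tail i (snd p) \<partial>?P) = 2 * (\<integral>x. tail i x \<partial>M)"
    using tli pair_fst_integrable(2)[OF prob_M prob_M tail_measurable[OF i]] pair_snd_integrable(2)[OF prob_M prob_M tail_measurable[OF i]] by simp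
  finally show "cmod ((\<integral>x. trip z (A x) (Z i x) w v \<partial>M) - 2 * of_real s * (\<integral>p. ?q p \<partial>?P))
    \<le> 16 * r / (Im z)\<^sup>2 * (bsq z w i + bsq (cnj z) v i) + 16 / ?y ^ 3 * (\<integral>x. tail i x \<partial>M)"
    unfolding eq by (simp add: algebra_simps)
qed

end

text \<open>Fubini with the resolvent integrated last: for a frozen resolvent vector, which has norm
  at most 1 / y, the copies obey \<open>sum_square_bound\<close>.\<close>

lemma Q_sum:
  assumes z: "Im z \<noteq> 0" and x: "nv x = 1"
  shows "(\<Sum>i=1..n. Q z x i) \<le> sg / (Im z)\<^sup>2"
proof -
  interpret P: pair_prob_space M M ..
  note int = square_P_integrable(3)[OF _ z]
  have ints: "integrable (M \<Otimes>\<^sub>M M) (\<lambda>p. \<Sum>i=1..n. (nv (ap (Z i (snd p)) (rs z (A (fst p)) x)))\<^sup>2)"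
    by (intro Bochner_Integration.integrable_sum int)
  have "(\<Sum>i=1..n. Q z x i) = (\<integral>p. (\<Sum>i=1..n. (nv (ap (Z i (snd p)) (rs z (A (fst p)) x)))\<^sup>2) \<partial>(M \<Otimes>\<^sub>M M))"
    unfolding Q_def by (intro Bochner_Integration.integral_sum[symmetric] int)
  also have "\<dots> = (\<integral>w. \<integral>w'. (\<Sum>i=1..n. (nv (ap (Z i w') (rs z (A w) x)))\<^sup>2) \<partial>M \<partial>M)"
    using P.integral_fst'[OF ints] by simp
  also have "\<dots> \<le> (\<integral>w. sg / (Im z)\<^sup>2 \<partial>M)"
  proof (rule integral_mono)
    show "integrable M (\<lambda>w. \<integral>w'. (\<Sum>i=1..n. (nv (ap (Z i w') (rs z (A w) x)))\<^sup>2) \<partial>M)"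
      using P.integrable_fst'[OF ints] by simp
    fix w assume w: "w \<in> space M"
    let ?u = "rs z (A w) x"
    have "(\<integral>w'. (\<Sum>i=1..n. (nv (ap (Z i w') ?u))\<^sup>2) \<partial>M) = (\<Sum>i=1..n. \<integral>w'. (nv (ap (Z i w') ?u))\<^sup>2 \<partial>M)"
      by (intro Bochner_Integration.integral_sum nv_square_integrable Z_sqi sa)
    also have "\<dots> \<le> sg * (nv ?u)\<^sup>2" using sum_square_bound[of ?u] by simp
    also have "\<dots> \<le> sg * (1 / \<bar>Im z\<bar>)\<^sup>2" using rs_bound[OF A_sa[OF w] z, of x] x by (intro mult_left_mono power_mono sg_nonneg) auto
    finally show "(\<integral>w'. (\<Sum>i=1..n. (nv (ap (Z i w') ?u))\<^sup>2) \<partial>M) \<le> sg / (Im z)\<^sup>2" by (simp add: power_divide)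
  qed simp
  finally show ?thesis by (simp add: prob_space)
qed

text \<open>The left-hand side is additive over the summands, so the individual errors add. The
  constant 128 is 16 times 8, the 8 coming from \<open>bsq \<le> 4 Q\<close> for both vectors of the
  form, and 32 is 16 times the 2 of \<open>tail_sum\<close>.\<close>

theorem replacement_error_sum:
  assumes z: "Im z \<noteq> 0" "2 * r \<le> \<bar>Im z\<bar>" and wv: "nv w = 1" "nv v = 1"
  shows "cmod ((\<integral>x. trip z (A x) (Sm {1..n} x) w v \<partial>M) - 2 * of_real s * (\<integral>x. \<integral>x'. quin z (A x) (Sm {1..n} x') w v \<partial>M \<partial>M))
    \<le> 128 * r * sg / (Im z)^4 + 32 * r\<^sup>2 / \<bar>Im z\<bar> ^ 3"
proof -
  interpret P: pair_prob_space M M ..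
  let ?y = "\<bar>Im z\<bar>"
  note re = replacement_error[OF _ z wv]
  have z': "Im (cnj z) \<noteq> 0" "2 * r \<le> \<bar>Im (cnj z)\<bar>" using z by auto
  have tr: "(\<integral>x. trip z (A x) (Sm {1..n} x) w v \<partial>M) = (\<Sum>i=1..n. \<integral>x. trip z (A x) (Z i x) w v \<partial>M)"
  proof -
    have "trip z (A x) (Sm {1..n} x) w v = (\<Sum>i=1..n. trip z (A x) (Z i x) w v)" if "x \<in> space M" for x
      unfolding trip_eq[OF A_sa[OF that] z(1)] ap_Sm ip_sum_left ..
    then have "(\<integral>x. trip z (A x) (Sm {1..n} x) w v \<partial>M) = (\<integral>x. (\<Sum>i=1..n. trip z (A x) (Z i x) w v) \<partial>M)"
      by (intro Bochner_Integration.integral_cong refl)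
    then show ?thesis by (simp add: Bochner_Integration.integral_sum re(3))
  qed
  have qu: "(\<integral>x. \<integral>x'. quin z (A x) (Sm {1..n} x') w v \<partial>M \<partial>M) = (\<Sum>i=1..n. \<integral>p. quin z (A (fst p)) (Z i (snd p)) w v \<partial>(M \<Otimes>\<^sub>M M))"
  proof -
    have qe: "quin z (A x) Y w v = ip (ap Y (ap (resolvent d z (A x)) (ap Y (rs z (A x) w)))) (rs (cnj z) (A x) v)" if "x \<in> space M" for x Y
      unfolding quin_def rs_adjoint[OF A_sa[OF that] z(1)] by (simp add: rs_def)
    have "(\<integral>x'. quin z (A x) (Sm {1..n} x') w v \<partial>M) = (\<Sum>i=1..n. \<integral>x'. quin z (A x) (Z i x') w v \<partial>M)" if "x \<in> space M" for x
      unfolding qe[OF that] by (rule second_moment_sum)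
    then have "(\<integral>x. \<integral>x'. quin z (A x) (Sm {1..n} x') w v \<partial>M \<partial>M) = (\<integral>x. (\<Sum>i=1..n. \<integral>x'. quin z (A x) (Z i x') w v \<partial>M) \<partial>M)"
      by (intro Bochner_Integration.integral_cong refl)
    also have "\<dots> = (\<Sum>i=1..n. \<integral>x. \<integral>x'. quin z (A x) (Z i x') w v \<partial>M \<partial>M)"
      using P.integrable_fst'[OF re(2)] by (intro Bochner_Integration.integral_sum) simp
    also have "\<dots> = (\<Sum>i=1..n. \<integral>p. quin z (A (fst p)) (Z i (snd p)) w v \<partial>(M \<Otimes>\<^sub>M M))"
      using P.integral_fst'[OF re(2)] by (intro sum.cong refl) simp
    finally show ?thesis .
  qed
  have bs: "(\<Sum>i=1..n. bsq z w i + bsq (cnj z) v i) \<le> 8 * sg / (Im z)\<^sup>2"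
  proof -
    have "(\<Sum>i=1..n. bsq z w i + bsq (cnj z) v i) \<le> (\<Sum>i=1..n. 4 * Q z w i + 4 * Q (cnj z) v i)"
      by (intro sum_mono add_mono bsq_bound z z')
    also have "\<dots> = 4 * (\<Sum>i=1..n. Q z w i) + 4 * (\<Sum>i=1..n. Q (cnj z) v i)" by (simp add: sum.distrib sum_distrib_left)
    also have "\<dots> \<le> 8 * sg / (Im z)\<^sup>2" using Q_sum[OF z(1) wv(1)] Q_sum[OF z'(1) wv(2)] by simp
    finally show ?thesis .
  qed
  have "cmod ((\<integral>x. trip z (A x) (Sm {1..n} x) w v \<partial>M) - 2 * of_real s * (\<integral>x. \<integral>x'. quin z (A x) (Sm {1..n} x') w v \<partial>M \<partial>M))
    \<le> (\<Sum>i=1..n. cmod ((\<integral>x. trip z (A x) (Z i x) w v \<partial>M) - 2 * of_real s * (\<integral>p. quin z (A (fst p)) (Z i (snd p)) w v \<partial>(M \<Otimes>\<^sub>M M))))"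
    unfolding tr qu sum_distrib_left sum_subtractf[symmetric] by (rule norm_sum)
  also have "\<dots> \<le> (\<Sum>i=1..n. 16 * r / (Im z)\<^sup>2 * (bsq z w i + bsq (cnj z) v i) + 16 / ?y ^ 3 * (\<integral>x. tail i x \<partial>M))"
    by (intro sum_mono re(1))
  also have "\<dots> = 16 * r / (Im z)\<^sup>2 * (\<Sum>i=1..n. bsq z w i + bsq (cnj z) v i) + 16 / ?y ^ 3 * (\<Sum>i=1..n. \<integral>x. tail i x \<partial>M)"
    by (subst sum.distrib) (simp only: sum_distrib_left[symmetric])
  also have "\<dots> \<le> 16 * r / (Im z)\<^sup>2 * (8 * sg / (Im z)\<^sup>2) + 16 / ?y ^ 3 * (2 * r\<^sup>2)"
    using r_nonneg by (intro add_mono mult_left_mono bs tail_sum) auto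
  also have "\<dots> = 128 * r * sg / (Im z)^4 + 32 * r\<^sup>2 / ?y ^ 3"
    by (simp add: power2_eq_square power4_eq_xxxx)
  finally show ?thesis .
qed

end

end

section \<open>Gaussian integration by parts\<close>

text \<open>Treats normal and constant variables together; afterwards Gaussian variables are used
  only through integrability and the characteristic function.\<close>

lemma gaussian_rv_char:
  assumes "prob_space N" and g: "gaussian_rv N Y"
  shows "integrable N Y" "integrable N (\<lambda>w. (Y w)\<^sup>2)"
    "(\<integral>w. iexp (Y w - (\<integral>w. Y w \<partial>N)) \<partial>N) = exp (- of_real (\<integral>w. (Y w - (\<integral>w. Y w \<partial>N))\<^sup>2 \<partial>N) / 2)"
proof -
  interpret prob_space N by fact
  have Ym[measurable]: "Y \<in> borel_measurable N" using g by (simp add: gaussian_rv_def)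
  consider (normal) \<mu> s where "0 < s" "distributed N lborel Y (\<lambda>x. ennreal (normal_density \<mu> s x))" | (const) \<mu> where "AE w in N. Y w = \<mu>"
    using g by (auto simp: gaussian_rv_def)
  then have "integrable N Y \<and> integrable N (\<lambda>w. (Y w)\<^sup>2) \<and>
    (\<integral>w. iexp (Y w - (\<integral>w. Y w \<partial>N)) \<partial>N) = exp (- of_real (\<integral>w. (Y w - (\<integral>w. Y w \<partial>N))\<^sup>2 \<partial>N) / 2)"
  proof cases
    case const
    have 1: "integrable N Y" "integrable N (\<lambda>w. (Y w)\<^sup>2)"
      by (rule Bochner_Integration.integrable_cong_AE[THEN iffD2, of _ _ "\<lambda>_. \<mu>"]; use const in auto)
         (rule Bochner_Integration.integrable_cong_AE[THEN iffD2, of _ _ "\<lambda>_. \<mu>\<^sup>2"]; use const in auto)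
    have m: "(\<integral>w. Y w \<partial>N) = \<mu>" using const by (subst integral_cong_AE[of _ _ "\<lambda>_. \<mu>"]) (auto simp: prob_space)
    have 2: "(\<integral>w. iexp (Y w - \<mu>) \<partial>N) = 1" using const by (subst integral_cong_AE[of _ _ "\<lambda>_. 1"]) (auto simp: prob_space)
    have 3: "(\<integral>w. (Y w - \<mu>)\<^sup>2 \<partial>N) = 0" using const by (subst integral_cong_AE[of _ _ "\<lambda>_. 0"]) auto
    show ?thesis using 1 unfolding m 2 3 by simp
  next
    case normal
    note D = normal(2)
    have m: "(\<integral>w. Y w \<partial>N) = \<mu>" by (rule normal_distributed_expectation[OF normal])
    have v: "(\<integral>w. (Y w - \<mu>)\<^sup>2 \<partial>N) = s\<^sup>2" using normal_distributed_variance[OF normal] unfolding m .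
    have i1: "integrable N (\<lambda>w. Y w - \<mu>)"
      using distributed_integrable[OF D, of "\<lambda>x. x - \<mu>"] integrable_normal_moment[of s \<mu> 1] normal(1) by simp
    have i2: "integrable N (\<lambda>w. (Y w - \<mu>)\<^sup>2)"
      using distributed_integrable[OF D, of "\<lambda>x. (x - \<mu>)\<^sup>2"] integrable_normal_moment[of s \<mu> 2] normal(1) by simp
    have 1: "integrable N Y" using Bochner_Integration.integrable_add[OF i1 integrable_const[of \<mu>]] by simp
    have "integrable N (\<lambda>w. (Y w - \<mu>)\<^sup>2 + (2 * \<mu> * Y w - \<mu>\<^sup>2))" using i2 1 by simp
    also have "(\<lambda>w. (Y w - \<mu>)\<^sup>2 + (2 * \<mu> * Y w - \<mu>\<^sup>2)) = (\<lambda>w. (Y w)\<^sup>2)" by (auto simp: power2_eq_square algebra_simps)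
    finally have 2: "integrable N (\<lambda>w. (Y w)\<^sup>2)" .
    have "distributed N lborel (\<lambda>w. (Y w - \<mu>) / s) (\<lambda>x. ennreal (std_normal_density x))"
      using normal_standard_normal_convert[OF normal(1), of Y \<mu>] D by simp
    then have d: "distr N lborel (\<lambda>w. (Y w - \<mu>) / s) = std_normal_distribution" by (simp add: distributed_def)
    have "(\<integral>w. iexp (Y w - \<mu>) \<partial>N) = (\<integral>w. iexp (s * ((Y w - \<mu>) / s)) \<partial>N)" using normal(1) by simp
    also have "\<dots> = (\<integral>x. iexp (s * x) \<partial>distr N lborel (\<lambda>w. (Y w - \<mu>) / s))" by (subst integral_distr) auto
    also have "\<dots> = char std_normal_distribution s" unfolding d char_def ..
    also have "\<dots> = exp (- of_real (s\<^sup>2) / 2)" by (simp add: char_std_normal_distribution exp_of_real[symmetric])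
    finally have 3: "(\<integral>w. iexp (Y w - \<mu>) \<partial>N) = exp (- of_real (s\<^sup>2) / 2)" .
    show ?thesis using 1 2 3 unfolding m v by simp
  qed
  then show "integrable N Y" "integrable N (\<lambda>w. (Y w)\<^sup>2)"
    "(\<integral>w. iexp (Y w - (\<integral>w. Y w \<partial>N)) \<partial>N) = exp (- of_real (\<integral>w. (Y w - (\<integral>w. Y w \<partial>N))\<^sup>2 \<partial>N) / 2)" by auto
qed

locale gaussian_matrix = dim d + prob_space N for d :: nat and N :: "'b measure" +
  fixes G :: "'b \<Rightarrow> complex mat"
  assumes d0: "0 < d"
    and G_mm: "mm N G"
    and G_sa: "\<And>w. w \<in> space N \<Longrightarrow> self_adjoint d (G w)"
    and gauss: "jointly_gaussian_entries d N G"
begin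

lemma prob_N: "prob_space N" by unfold_locales

definition Gt :: "'b \<Rightarrow> complex mat" where
  "Gt = centered d N G"

lemma mean_carrier: "mat_expectation d N G \<in> carrier_mat d d" by (simp add: mat_expectation_def)

lemma combination_gaussian: "gaussian_rv N (\<lambda>w. \<Sum>j<d. \<Sum>k<d. a j k * Re (G w $$ (j, k)) + b j k * Im (G w $$ (j, k)))"
  using gauss by (auto simp: jointly_gaussian_entries_def)

lemma entry_gaussian: "j < d \<Longrightarrow> k < d \<Longrightarrow> gaussian_rv N (\<lambda>w. Re (G w $$ (j, k)))" "j < d \<Longrightarrow> k < d \<Longrightarrow> gaussian_rv N (\<lambda>w. Im (G w $$ (j, k)))"
proof -
  assume jk: "j < d" "k < d"
  have s: "(\<Sum>j'<d. \<Sum>k'<d. (if j' = j \<and> k' = k then 1 else 0) * f j' k') = (f j k :: real)" for f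
  proof -
    have "(\<Sum>j'<d. \<Sum>k'<d. (if j' = j \<and> k' = k then 1 else 0) * f j' k') = (\<Sum>j'<d. if j' = j then \<Sum>k'<d. if k' = k then f j' k' else 0 else 0)"
      by (intro sum.cong refl) (auto simp: if_distrib[of "\<lambda>x. x * _"] cong: if_cong)
    then show ?thesis using jk by simp
  qed
  show "gaussian_rv N (\<lambda>w. Re (G w $$ (j, k)))"
    using combination_gaussian[of "\<lambda>j' k'. if j' = j \<and> k' = k then 1 else 0" "\<lambda>_ _. 0"] by (simp add: s)
  show "gaussian_rv N (\<lambda>w. Im (G w $$ (j, k)))"
    using combination_gaussian[of "\<lambda>_ _. 0" "\<lambda>j' k'. if j' = j \<and> k' = k then 1 else 0"] by (simp add: s)
qed

lemma G_sqi: "sqi N G"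
  unfolding sqi_def
proof (intro conjI allI impI G_mm)
  fix j k assume jk: "j < d" "k < d"
  have "integrable N (\<lambda>w. (Re (G w $$ (j, k)))\<^sup>2 + (Im (G w $$ (j, k)))\<^sup>2)"
    using gaussian_rv_char(2)[OF prob_N entry_gaussian(1)[OF jk]] gaussian_rv_char(2)[OF prob_N entry_gaussian(2)[OF jk]] by simp
  then show "integrable N (\<lambda>w. (cmod (G w $$ (j, k)))\<^sup>2)" by (simp add: cmod_power2)
qed

lemma G_entry_integrable: "j < d \<Longrightarrow> k < d \<Longrightarrow> integrable N (\<lambda>w. G w $$ (j, k))"
  by (rule sqi_entry[OF prob_N G_sqi])

lemma Gt_entry: "w \<in> space N \<Longrightarrow> j < d \<Longrightarrow> k < d \<Longrightarrow> Gt w $$ (j, k) = G w $$ (j, k) - (\<integral>w. G w $$ (j, k) \<partial>N)"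
  using mm_carrier[OF G_mm] by (simp add: Gt_def centered_def mat_expectation_def)

lemma Gt_mm: "mm N Gt"
  unfolding Gt_def centered_def[abs_def] by (intro mm_diff G_mm mm_const mean_carrier)

lemma Gt_sa: "w \<in> space N \<Longrightarrow> self_adjoint d (Gt w)"
proof -
  assume w: "w \<in> space N"
  have "cnj (\<integral>w. G w $$ (k, j) \<partial>N) = (\<integral>w. G w $$ (j, k) \<partial>N)" if "j < d" "k < d" for j k
  proof -
    have "cnj (\<integral>w. G w $$ (k, j) \<partial>N) = (\<integral>w. cnj (G w $$ (k, j)) \<partial>N)" by simp
    also have "\<dots> = (\<integral>w. G w $$ (j, k) \<partial>N)" using that by (intro Bochner_Integration.integral_cong refl self_adjoint_entry G_sa)
    finally show ?thesis .
  qed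
  then show ?thesis
    unfolding self_adjoint_iff using w mm_carrier[OF Gt_mm w] by (simp add: Gt_entry self_adjoint_entry[OF G_sa])
qed

lemma Gt_sqi: "sqi N Gt"
  unfolding sqi_def
proof (intro conjI allI impI Gt_mm)
  fix j k assume jk: "j < d" "k < d"
  let ?m = "\<integral>w. G w $$ (j, k) \<partial>N"
  have "integrable N (\<lambda>w. (cmod (G w $$ (j, k)) + cmod ?m)\<^sup>2)"
  proof (rule integrable_square_add)
    show "(\<lambda>w. cmod (G w $$ (j, k))) \<in> borel_measurable N" using mm_entry[OF G_mm jk] by measurable
  qed (use G_sqi jk in \<open>auto simp: sqi_def\<close>)
  then show "integrable N (\<lambda>w. (cmod (Gt w $$ (j, k)))\<^sup>2)"
  proof (rule Bochner_Integration.integrable_bound)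
    show "(\<lambda>w. (cmod (Gt w $$ (j, k)))\<^sup>2) \<in> borel_measurable N" using mm_entry[OF Gt_mm jk] by measurable
    show "AE w in N. norm ((cmod (Gt w $$ (j, k)))\<^sup>2) \<le> norm ((cmod (G w $$ (j, k)) + cmod ?m)\<^sup>2)"
      using jk by (intro AE_I2) (auto simp: Gt_entry intro!: power_mono norm_triangle_ineq4)
  qed
qed

subsection \<open>Rotation invariance\<close>

text \<open>\<open>True\<close> selects the real part. For self-adjoint matrices these real
  coordinates are redundant, which is harmless as only linear combinations of them are used.\<close>

definition co :: "nat \<times> nat \<times> bool \<Rightarrow> complex mat \<Rightarrow> real" where
  "co x A = (case x of (j, k, b) \<Rightarrow> if b then Re (A $$ (j, k)) else Im (A $$ (j, k)))"

abbreviation "J \<equiv> {..<d} \<times> {..<d} \<times> (UNIV :: bool set)"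

definition L :: "(nat \<times> nat \<times> bool \<Rightarrow> real) \<Rightarrow> 'b \<Rightarrow> real" where
  "L \<alpha> w = (\<Sum>x\<in>J. \<alpha> x * co x (Gt w))"

lemma sum_J: "(\<Sum>x\<in>J. f x) = (\<Sum>j<d. \<Sum>k<d. f (j, k, True) + f (j, k, False))" for f :: "_ \<Rightarrow> real"
proof -
  have "(\<Sum>x\<in>J. f x) = (\<Sum>j<d. \<Sum>y\<in>{..<d} \<times> UNIV. f (j, y))" by (subst sum.cartesian_product) simp
  also have "\<dots> = (\<Sum>j<d. \<Sum>k<d. \<Sum>b\<in>UNIV. f (j, k, b))"
    by (intro sum.cong refl, subst sum.cartesian_product) simp
  finally show ?thesis by (simp add: UNIV_bool add.commute)
qed

lemma co_measurable [measurable]: "x \<in> J \<Longrightarrow> (\<lambda>w. co x (Gt w)) \<in> borel_measurable N"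
  using mm_entry[OF Gt_mm] by (auto simp: co_def split: prod.split intro!: borel_measurable_Re[THEN measurable_compose[rotated]])

text \<open>\<open>L \<alpha>\<close> is a linear combination of entries of \<open>G\<close> minus
  its mean, so the hypothesis on \<open>G\<close> applies directly.\<close>

lemma L_gaussian:
  "integrable N (\<lambda>w. (L \<alpha> w)\<^sup>2)" "L \<alpha> \<in> borel_measurable N" "(\<integral>w. iexp (L \<alpha> w) \<partial>N) = exp (- of_real (\<integral>w. (L \<alpha> w)\<^sup>2 \<partial>N) / 2)"
proof -
  define Y where "Y = (\<lambda>w. \<Sum>j<d. \<Sum>k<d. \<alpha> (j, k, True) * Re (G w $$ (j, k)) + \<alpha> (j, k, False) * Im (G w $$ (j, k)))"
  have Y: "gaussian_rv N Y" unfolding Y_def by (rule combination_gaussian)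
  have i: "integrable N (\<lambda>w. Re (G w $$ (j, k)))" "integrable N (\<lambda>w. Im (G w $$ (j, k)))" if "j < d" "k < d" for j k
    using gaussian_rv_char(1)[OF prob_N entry_gaussian(1)[OF that]] gaussian_rv_char(1)[OF prob_N entry_gaussian(2)[OF that]] by auto
  have EY: "(\<integral>w. Y w \<partial>N) = (\<Sum>j<d. \<Sum>k<d. \<alpha> (j, k, True) * (\<integral>w. Re (G w $$ (j, k)) \<partial>N) + \<alpha> (j, k, False) * (\<integral>w. Im (G w $$ (j, k)) \<partial>N))"
  proof -
    have "(\<integral>w. Y w \<partial>N) = (\<Sum>j<d. \<integral>w. (\<Sum>k<d. \<alpha> (j, k, True) * Re (G w $$ (j, k)) + \<alpha> (j, k, False) * Im (G w $$ (j, k))) \<partial>N)"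
      unfolding Y_def by (rule Bochner_Integration.integral_sum) (auto intro!: Bochner_Integration.integrable_sum i)
    also have "\<dots> = (\<Sum>j<d. \<Sum>k<d. \<integral>w. \<alpha> (j, k, True) * Re (G w $$ (j, k)) + \<alpha> (j, k, False) * Im (G w $$ (j, k)) \<partial>N)"
      by (intro sum.cong refl Bochner_Integration.integral_sum) (auto intro!: i)
    also have "\<dots> = (\<Sum>j<d. \<Sum>k<d. \<alpha> (j, k, True) * (\<integral>w. Re (G w $$ (j, k)) \<partial>N) + \<alpha> (j, k, False) * (\<integral>w. Im (G w $$ (j, k)) \<partial>N))"
      by (intro sum.cong refl) (simp add: i)
    finally show ?thesis .
  qed
  have LY: "L \<alpha> w = Y w - (\<integral>w. Y w \<partial>N)" if w: "w \<in> space N" for w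
  proof -
    have "L \<alpha> w = (\<Sum>j<d. \<Sum>k<d. \<alpha> (j, k, True) * Re (Gt w $$ (j, k)) + \<alpha> (j, k, False) * Im (Gt w $$ (j, k)))"
      unfolding L_def sum_J by (simp add: co_def)
    also have "\<dots> = (\<Sum>j<d. \<Sum>k<d. (\<alpha> (j, k, True) * Re (G w $$ (j, k)) + \<alpha> (j, k, False) * Im (G w $$ (j, k)))
        - (\<alpha> (j, k, True) * (\<integral>w. Re (G w $$ (j, k)) \<partial>N) + \<alpha> (j, k, False) * (\<integral>w. Im (G w $$ (j, k)) \<partial>N)))"
      using w by (intro sum.cong refl) (simp add: Gt_entry G_entry_integrable algebra_simps)
    also have "\<dots> = Y w - (\<integral>w. Y w \<partial>N)" unfolding EY by (simp add: Y_def sum_subtractf)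
    finally show ?thesis .
  qed
  note gY = gaussian_rv_char[OF prob_N Y]
  have [measurable]: "Y \<in> borel_measurable N" using gY(1) by auto
  show "L \<alpha> \<in> borel_measurable N" unfolding L_def[abs_def] by (intro borel_measurable_sum borel_measurable_times borel_measurable_const co_measurable)
  have "integrable N (\<lambda>w. (Y w - (\<integral>w. Y w \<partial>N))\<^sup>2)"
    using integrable_square_add[of Y N "\<lambda>_. - (\<integral>w. Y w \<partial>N)"] gY by simp
  then show "integrable N (\<lambda>w. (L \<alpha> w)\<^sup>2)" by (simp add: LY cong: Bochner_Integration.integrable_cong)
  show "(\<integral>w. iexp (L \<alpha> w) \<partial>N) = exp (- of_real (\<integral>w. (L \<alpha> w)\<^sup>2 \<partial>N) / 2)"
    using gY(3) by (simp add: LY cong: Bochner_Integration.integral_cong)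
qed

definition rt :: "real \<Rightarrow> real \<Rightarrow> complex mat \<Rightarrow> complex mat \<Rightarrow> complex mat" where
  "rt a b A B = Matrix.mat d d (\<lambda>jk. of_real a * A $$ jk + of_real b * B $$ jk)"

lemma rt_sa: "self_adjoint d A \<Longrightarrow> self_adjoint d B \<Longrightarrow> self_adjoint d (rt a b A B)"
  unfolding self_adjoint_iff[of "rt a b A B"] using self_adjoint_entry[of A] self_adjoint_entry[of B] by (simp add: rt_def)

lemma rt_mm: "mm K X \<Longrightarrow> mm K Y \<Longrightarrow> mm K (\<lambda>w. rt a b (X w) (Y w))"
  unfolding rt_def by (intro mm_mat borel_measurable_add borel_measurable_times borel_measurable_const mm_entry)

lemma co_rt: "x \<in> J \<Longrightarrow> co x (rt a b A B) = a * co x A + b * co x B"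
  by (auto simp: co_def rt_def)

lemma ap_rt: "ap (rt a b A B) x = (\<lambda>i. of_real a * ap A x i + of_real b * ap B x i)"
  by (auto simp: ap_def rt_def sum.distrib sum_distrib_left algebra_simps)

lemma char_pair:
  "(\<integral>p. iexp (L \<alpha> (fst p) + L \<beta> (snd p)) \<partial>(N \<Otimes>\<^sub>M N)) = exp (- of_real ((\<integral>w. (L \<alpha> w)\<^sup>2 \<partial>N) + (\<integral>w. (L \<beta> w)\<^sup>2 \<partial>N)) / 2)"
proof -
  interpret P: pair_prob_space N N ..
  note [measurable] = L_gaussian(2)
  have int: "integrable (N \<Otimes>\<^sub>M N) (\<lambda>p. iexp (L \<alpha> (fst p)) * iexp (L \<beta> (snd p)))"
    by (rule P.integrable_const_bound[of _ 1]) (auto simp: norm_mult)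
  have "(\<integral>p. iexp (L \<alpha> (fst p) + L \<beta> (snd p)) \<partial>(N \<Otimes>\<^sub>M N)) = (\<integral>p. iexp (L \<alpha> (fst p)) * iexp (L \<beta> (snd p)) \<partial>(N \<Otimes>\<^sub>M N))"
    by (simp add: exp_add[symmetric] algebra_simps)
  also have "\<dots> = (\<integral>w. \<integral>w'. iexp (L \<alpha> w) * iexp (L \<beta> w') \<partial>N \<partial>N)" using P.integral_fst'[OF int] by simp
  also have "\<dots> = (\<integral>w. iexp (L \<alpha> w) \<partial>N) * (\<integral>w. iexp (L \<beta> w) \<partial>N)" by simp
  also have "\<dots> = exp (- of_real ((\<integral>w. (L \<alpha> w)\<^sup>2 \<partial>N) + (\<integral>w. (L \<beta> w)\<^sup>2 \<partial>N)) / 2)"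
    unfolding L_gaussian(3) by (simp add: exp_add[symmetric] diff_divide_distrib)
  finally show ?thesis .
qed

definition cvec :: "complex mat \<Rightarrow> complex mat \<Rightarrow> bool \<times> nat \<times> nat \<times> bool \<Rightarrow> real" where
  "cvec A B = (\<lambda>(c, x). co x (if c then A else B))"

definition mk :: "(nat \<times> nat \<times> bool \<Rightarrow> real) \<Rightarrow> complex mat" where
  "mk f = Matrix.mat d d (\<lambda>(j, k). Complex (f (j, k, True)) (f (j, k, False)))"

lemma mk_co: "A \<in> carrier_mat d d \<Longrightarrow> (\<And>x. x \<in> J \<Longrightarrow> f x = co x A) \<Longrightarrow> mk f = A"
  by (rule eq_matI) (auto simp: mk_def co_def)

text \<open>The characteristic function of two independent copies depends only on the sum of the
  variances of two linear forms. Rotating the matrices rotates the coefficient vectors, which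
  preserves this sum, and uniqueness gives equality of the joint laws. No covariance has to be
  computed.\<close>

lemma rotation_invariance:
  fixes F :: "complex mat \<Rightarrow> complex mat \<Rightarrow> complex"
  assumes F: "(\<lambda>t. F (proj (fst t)) (proj (snd t))) \<in> borel_measurable (mat_borel d \<Otimes>\<^sub>M mat_borel d)"
    and cs: "c\<^sup>2 + s\<^sup>2 = 1"
  shows "(\<integral>p. F (rt c s (Gt (fst p)) (Gt (snd p))) (rt (- s) c (Gt (fst p)) (Gt (snd p))) \<partial>(N \<Otimes>\<^sub>M N)) = (\<integral>p. F (Gt (fst p)) (Gt (snd p)) \<partial>(N \<Otimes>\<^sub>M N))"
proof -
  interpret P: pair_prob_space N N ..
  let ?P = "N \<Otimes>\<^sub>M N" and ?I = "(UNIV :: bool set) \<times> J"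
  have fin: "finite ?I" by auto
  define X1 where "X1 = (\<lambda>(x :: bool \<times> nat \<times> nat \<times> bool) p. cvec (Gt (fst p)) (Gt (snd p)) x)"
  define X2 where "X2 = (\<lambda>(x :: bool \<times> nat \<times> nat \<times> bool) p. cvec (rt c s (Gt (fst p)) (Gt (snd p))) (rt (- s) c (Gt (fst p)) (Gt (snd p))) x)"
  have sI: "(\<Sum>x\<in>?I. f x) = (\<Sum>x\<in>J. f (True, x)) + (\<Sum>x\<in>J. f (False, x))" for f :: "_ \<Rightarrow> real"
  proof -
    have "(\<Sum>x\<in>?I. f x) = (\<Sum>c\<in>UNIV. \<Sum>x\<in>J. f (c, x))" by (subst sum.cartesian_product) simp
    then show ?thesis by (simp add: UNIV_bool)
  qed
  have m1: "X1 x \<in> borel_measurable ?P" if "x \<in> ?I" for x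
  proof -
    obtain b y where x: "x = (b, y)" "y \<in> J" using \<open>x \<in> ?I\<close> by auto
    have [measurable]: "(\<lambda>p. co y (Gt (fst p))) \<in> borel_measurable ?P" "(\<lambda>p. co y (Gt (snd p))) \<in> borel_measurable ?P"
      using co_measurable[OF x(2)] by measurable
    show ?thesis unfolding X1_def cvec_def x(1) by (cases b) simp_all
  qed
  have m2: "X2 x \<in> borel_measurable ?P" if "x \<in> ?I" for x
  proof -
    obtain b y where x: "x = (b, y)" "y \<in> J" using \<open>x \<in> ?I\<close> by auto
    have [measurable]: "(\<lambda>p. co y (Gt (fst p))) \<in> borel_measurable ?P" "(\<lambda>p. co y (Gt (snd p))) \<in> borel_measurable ?P"
      using co_measurable[OF x(2)] by measurable
    show ?thesis unfolding X2_def cvec_def x(1) using x(2) by (cases b) (simp_all add: co_rt)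
  qed
  have S1: "(\<Sum>x\<in>?I. a x * X1 x p) = L (\<lambda>x. a (True, x)) (fst p) + L (\<lambda>x. a (False, x)) (snd p)" for a p
    unfolding sI by (simp add: X1_def cvec_def L_def)
  have S2: "(\<Sum>x\<in>?I. a x * X2 x p) = L (\<lambda>x. c * a (True, x) - s * a (False, x)) (fst p) + L (\<lambda>x. s * a (True, x) + c * a (False, x)) (snd p)" for a p
    unfolding sI by (simp add: X2_def cvec_def L_def co_rt sum.distrib sum_distrib_left sum_subtractf algebra_simps)
  \<comment> \<open>Already pointwise (c x - s y)^2 + (s x + c y)^2 = x^2 + y^2.\<close>
  have q: "(\<integral>w. (L (\<lambda>x. c * \<alpha> x - s * \<beta> x) w)\<^sup>2 \<partial>N) + (\<integral>w. (L (\<lambda>x. s * \<alpha> x + c * \<beta> x) w)\<^sup>2 \<partial>N) = (\<integral>w. (L \<alpha> w)\<^sup>2 \<partial>N) + (\<integral>w. (L \<beta> w)\<^sup>2 \<partial>N)" for \<alpha> \<beta>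
  proof -
    have l: "L (\<lambda>x. c * \<alpha> x - s * \<beta> x) w = c * L \<alpha> w - s * L \<beta> w" "L (\<lambda>x. s * \<alpha> x + c * \<beta> x) w = s * L \<alpha> w + c * L \<beta> w" for w
      by (simp_all add: L_def sum.distrib sum_distrib_left sum_subtractf algebra_simps)
    have "(c * x - s * y)\<^sup>2 + (s * x + c * y)\<^sup>2 = (c\<^sup>2 + s\<^sup>2) * (x\<^sup>2 + y\<^sup>2)" for x y
      by (simp add: power2_eq_square algebra_simps)
    then have "(c * x - s * y)\<^sup>2 + (s * x + c * y)\<^sup>2 = x\<^sup>2 + y\<^sup>2" for x y by (simp add: cs)
    then have "(L (\<lambda>x. c * \<alpha> x - s * \<beta> x) w)\<^sup>2 + (L (\<lambda>x. s * \<alpha> x + c * \<beta> x) w)\<^sup>2 = (L \<alpha> w)\<^sup>2 + (L \<beta> w)\<^sup>2" for w by (simp add: l)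
    then show ?thesis using L_gaussian(1) by (simp flip: Bochner_Integration.integral_add)
  qed
  have D: "distr ?P (Pi\<^sub>M ?I (\<lambda>_. borel)) (\<lambda>p. \<lambda>x\<in>?I. X1 x p) = distr ?P (Pi\<^sub>M ?I (\<lambda>_. borel)) (\<lambda>p. \<lambda>x\<in>?I. X2 x p)"
  proof (rule joint_char_uniqueness[OF _ _ fin m1 m2])
    show "prob_space ?P" "prob_space ?P" by unfold_locales
    fix a
    show "(\<integral>p. iexp (\<Sum>x\<in>?I. a x * X1 x p) \<partial>?P) = (\<integral>p. iexp (\<Sum>x\<in>?I. a x * X2 x p) \<partial>?P)"
      unfolding S1 S2 char_pair q ..
  qed
  \<comment> \<open>Uniqueness is available for real coordinates, so \<open>F\<close> is transported
    to them by \<open>mk\<close>, the inverse of \<open>co\<close>.\<close>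
  define F' where "F' f = F (proj (mk (\<lambda>x. f (True, x)))) (proj (mk (\<lambda>x. f (False, x))))" for f :: "bool \<times> nat \<times> nat \<times> bool \<Rightarrow> real"
  have mkm: "(\<lambda>f. mk (\<lambda>x. f (b, x))) \<in> Pi\<^sub>M ?I (\<lambda>_. borel) \<rightarrow>\<^sub>M mat_borel d" for b
    unfolding measurable_mat_borel_iff mk_def
  proof (rule mm_mat)
    fix j k assume "j < d" "k < d"
    then have [measurable]: "(\<lambda>f. f (b, j, k, b')) \<in> borel_measurable (Pi\<^sub>M ?I (\<lambda>_. borel :: real measure))" for b'
      by (intro measurable_component_singleton) auto
    show "(\<lambda>f. case (j, k) of (j, k) \<Rightarrow> Complex (f (b, j, k, True)) (f (b, j, k, False))) \<in> borel_measurable (Pi\<^sub>M ?I (\<lambda>_. borel))"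
      unfolding prod.case Complex_eq by measurable
  qed
  have F'm: "F' \<in> borel_measurable (Pi\<^sub>M ?I (\<lambda>_. borel))"
    unfolding F'_def[abs_def] by (rule measurable_compose[OF measurable_Pair[OF mkm[of True] mkm[of False]] F, simplified])
  have e: "F' (\<lambda>x\<in>?I. cvec A B x) = F A B" if "self_adjoint d A" "self_adjoint d B" for A B
  proof -
    have "mk (\<lambda>x. (\<lambda>x\<in>?I. cvec A B x) (True, x)) = A" "mk (\<lambda>x. (\<lambda>x\<in>?I. cvec A B x) (False, x)) = B"
      using that by (auto intro!: mk_co self_adjoint_carrier simp: cvec_def)
    then show ?thesis using that by (simp add: F'_def proj_id)
  qed
  have "(\<integral>p. F (Gt (fst p)) (Gt (snd p)) \<partial>?P) = (\<integral>p. F' (\<lambda>x\<in>?I. X1 x p) \<partial>?P)"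
    by (rule Bochner_Integration.integral_cong[OF refl]) (simp add: X1_def e Gt_sa space_pair_measure mem_Times_iff)
  also have "\<dots> = (\<integral>f. F' f \<partial>distr ?P (Pi\<^sub>M ?I (\<lambda>_. borel)) (\<lambda>p. \<lambda>x\<in>?I. X1 x p))"
    by (rule integral_distr[symmetric, OF measurable_restrict F'm]) (rule m1)
  also have "\<dots> = (\<integral>f. F' f \<partial>distr ?P (Pi\<^sub>M ?I (\<lambda>_. borel)) (\<lambda>p. \<lambda>x\<in>?I. X2 x p))" unfolding D ..
  also have "\<dots> = (\<integral>p. F' (\<lambda>x\<in>?I. X2 x p) \<partial>?P)"
    by (rule integral_distr[OF measurable_restrict F'm]) (rule m2)
  also have "\<dots> = (\<integral>p. F (rt c s (Gt (fst p)) (Gt (snd p))) (rt (- s) c (Gt (fst p)) (Gt (snd p))) \<partial>?P)"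
    by (rule Bochner_Integration.integral_cong[OF refl]) (simp add: X2_def e Gt_sa rt_sa space_pair_measure mem_Times_iff)
  finally show ?thesis by simp
qed

end

section \<open>Continuity of resolvents and dominating functions\<close>

context dim
begin

lemma ap_tendsto:
  assumes "\<And>i j. i < d \<Longrightarrow> j < d \<Longrightarrow> (\<lambda>n. A n $$ (i, j)) \<longlonglongrightarrow> A' $$ (i, j)" "\<And>j. j < d \<Longrightarrow> (\<lambda>n. x n j) \<longlonglongrightarrow> x' j"
  shows "(\<lambda>n. ap (A n) (x n) i) \<longlonglongrightarrow> ap A' x' i"
proof (cases "i < d")
  case True
  then show ?thesis unfolding ap_def using assms by (auto intro!: tendsto_sum tendsto_mult)
qed (simp add: ap_def)

lemma ip_tendsto:
  assumes "\<And>j. j < d \<Longrightarrow> (\<lambda>n. x n j) \<longlonglongrightarrow> x' j" "\<And>j. j < d \<Longrightarrow> (\<lambda>n. y n j) \<longlonglongrightarrow> y' j"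
  shows "(\<lambda>n. ip (x n) (y n)) \<longlonglongrightarrow> ip x' y'"
  unfolding ip_def using assms by (auto intro!: tendsto_sum tendsto_mult tendsto_cnj)

lemma nv_tendsto_0:
  assumes "\<And>j. j < d \<Longrightarrow> (\<lambda>n. x n j) \<longlonglongrightarrow> x' j"
  shows "(\<lambda>n. nv (\<lambda>j. x n j - x' j)) \<longlonglongrightarrow> 0"
proof -
  have "(\<lambda>n. \<Sum>j<d. (cmod (x n j - x' j))\<^sup>2) \<longlonglongrightarrow> (\<Sum>j<d. (cmod (x' j - x' j))\<^sup>2)"
    using assms by (intro tendsto_sum tendsto_power tendsto_norm tendsto_diff tendsto_const) auto
  then have "(\<lambda>n. sqrt (\<Sum>j<d. (cmod (x n j - x' j))\<^sup>2)) \<longlonglongrightarrow> sqrt 0" by (intro tendsto_real_sqrt) simp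
  then show ?thesis by (simp add: nv_def L2_set_def)
qed

lemma rs_tendsto:
  assumes sa: "\<And>n. self_adjoint d (A n)" "self_adjoint d A'" and z: "Im z \<noteq> 0"
    and A: "\<And>i j. i < d \<Longrightarrow> j < d \<Longrightarrow> (\<lambda>n. A n $$ (i, j)) \<longlonglongrightarrow> A' $$ (i, j)" and x: "\<And>j. j < d \<Longrightarrow> (\<lambda>n. x n j) \<longlonglongrightarrow> x' j"
    and i: "i < d"
  shows "(\<lambda>n. rs z (A n) (x n) i) \<longlonglongrightarrow> rs z A' x' i"
proof -
  let ?u = "rs z A' x'"
  define D where "D n = Matrix.mat d d (\<lambda>jk. A n $$ jk - A' $$ jk)" for n
  have id: "rs z (A n) x' = (\<lambda>i. ?u i + 1 * rs z (A n) (ap (D n) ?u) i)" for n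
    by (rule resolvent_identity[OF sa z]) (simp add: D_def)
  have "(\<lambda>n. D n $$ (i, j)) \<longlonglongrightarrow> (0\<^sub>m d d :: complex mat) $$ (i, j)" if "i < d" "j < d" for i j
    using LIM_zero[OF A[OF that]] that by (simp add: D_def)
  from ap_tendsto[OF this tendsto_const] have "(\<lambda>n. ap (D n) ?u j) \<longlonglongrightarrow> ap (0\<^sub>m d d) ?u j" for j .
  moreover have "ap (0\<^sub>m d d) ?u j = 0" for j by (simp add: ap_def)
  ultimately have "(\<lambda>n. ap (D n) ?u j) \<longlonglongrightarrow> 0" for j by simp
  from nv_tendsto_0[OF this] have 1: "(\<lambda>n. nv (ap (D n) ?u)) \<longlonglongrightarrow> 0" by simp
  have 2: "(\<lambda>n. nv (\<lambda>j. x n j - x' j)) \<longlonglongrightarrow> 0" by (rule nv_tendsto_0[OF x])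
  have 3: "(\<lambda>n. (nv (\<lambda>j. x n j - x' j) + nv (ap (D n) ?u)) / \<bar>Im z\<bar>) \<longlonglongrightarrow> 0"
    using tendsto_divide[OF tendsto_add[OF 2 1] tendsto_const[of "\<bar>Im z\<bar>"]] z by simp
  have "(\<lambda>n. rs z (A n) (x n) i - ?u i) \<longlonglongrightarrow> 0"
  proof (rule Lim_null_comparison[OF always_eventually 3], rule allI)
    fix n
    have e: "(\<lambda>i. rs z (A n) (x n) i - ?u i) = (\<lambda>i. rs z (A n) (\<lambda>j. x n j - x' j) i + rs z (A n) (ap (D n) ?u) i)"
      using fun_cong[OF id[of n]] by (auto simp: rs_lin)
    have "norm (rs z (A n) (x n) i - ?u i) \<le> nv (\<lambda>i. rs z (A n) (x n) i - ?u i)" by (rule component_le_nv[OF i])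
    also have "\<dots> \<le> nv (rs z (A n) (\<lambda>j. x n j - x' j)) + nv (rs z (A n) (ap (D n) ?u))" unfolding e by (rule nv_add)
    also have "\<dots> \<le> nv (\<lambda>j. x n j - x' j) / \<bar>Im z\<bar> + nv (ap (D n) ?u) / \<bar>Im z\<bar>" by (intro add_mono rs_bound sa z)
    finally show "norm (rs z (A n) (x n) i - ?u i) \<le> (nv (\<lambda>j. x n j - x' j) + nv (ap (D n) ?u)) / \<bar>Im z\<bar>" by (simp add: add_divide_distrib)
  qed
  then show ?thesis by (rule LIM_zero_cancel)
qed

text \<open>A bound through \<open>fr\<close>, which is square-integrable for the matrices
  considered; it serves to dominate integrands.\<close>

lemma trip_fr:
  assumes A: "self_adjoint d A" and z: "Im z \<noteq> 0"
  shows "cmod (trip z A Y w v) \<le> fr Y / \<bar>Im z\<bar>\<^sup>2 * (nv w * nv v)"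
proof -
  have z': "Im (cnj z) \<noteq> 0" using z by simp
  have "nv (ap Y (rs z A w)) \<le> fr Y * (nv w / \<bar>Im z\<bar>)"
    by (rule order.trans[OF nv_ap_fr mult_left_mono[OF rs_bound[OF A z] fr_nonneg]])
  then have "cmod (trip z A Y w v) \<le> (fr Y * (nv w / \<bar>Im z\<bar>)) * (nv v / \<bar>Im (cnj z)\<bar>)"
    unfolding trip_eq[OF A z] by (rule norm_ip_le[OF _ rs_bound[OF A z']])
  then show ?thesis by (simp add: power2_eq_square)
qed

lemma quin_fr:
  assumes A: "self_adjoint d A" and Y: "self_adjoint d Y" and z: "Im z \<noteq> 0"
  shows "cmod (quin z A Y w v) \<le> (fr Y)\<^sup>2 / \<bar>Im z\<bar> ^ 3 * (nv w * nv v)"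
proof -
  have z': "Im (cnj z) \<noteq> 0" using z by simp
  have Ya: "nv (ap Y (rs z A w)) \<le> fr Y * (nv w / \<bar>Im z\<bar>)"
    by (rule order.trans[OF nv_ap_fr mult_left_mono[OF rs_bound[OF A z] fr_nonneg]])
  have Yb: "nv (ap Y (rs (cnj z) A v)) \<le> fr Y * (nv v / \<bar>Im (cnj z)\<bar>)"
    by (rule order.trans[OF nv_ap_fr mult_left_mono[OF rs_bound[OF A z'] fr_nonneg]])
  have "nv (rs z A (ap Y (rs z A w))) \<le> fr Y * (nv w / \<bar>Im z\<bar>) / \<bar>Im z\<bar>"
    by (rule order.trans[OF rs_bound[OF A z] divide_right_mono[OF Ya abs_ge_zero]])
  from norm_ip_le[OF this Yb] show ?thesis
    unfolding quin_eq[OF A Y z] by (simp add: power2_eq_square power3_eq_cube mult_ac)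
qed

end

lemma one_minus_cos_le: "\<bar>cos x - 1\<bar> \<le> \<bar>x\<bar>" for x :: real
proof -
  have "cos x - 1 = - 2 * (sin (x / 2))\<^sup>2" using cos_double_sin[of "x / 2"] by simp
  then have "\<bar>cos x - 1\<bar> = 2 * (\<bar>sin (x / 2)\<bar> * \<bar>sin (x / 2)\<bar>)" by (simp add: power2_eq_square abs_mult)
  also have "\<dots> \<le> 2 * (\<bar>x / 2\<bar> * 1)" by (intro mult_left_mono mult_mono abs_sin_x_le_abs_x) auto
  finally show ?thesis by simp
qed

context gaussian_matrix
begin

lemma rt_bound:
  assumes "\<bar>a\<bar> \<le> 1" "\<bar>b\<bar> \<le> 1" shows "nv (ap (rt a b A B) x) \<le> (fr A + fr B) * nv x"
proof -
  have "nv (ap (rt a b A B) x) \<le> \<bar>a\<bar> * nv (ap A x) + \<bar>b\<bar> * nv (ap B x)"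
    unfolding ap_rt using nv_add[of "\<lambda>i. of_real a * ap A x i" "\<lambda>i. of_real b * ap B x i"] by (simp add: nv_mult)
  also have "\<dots> \<le> 1 * (fr A * nv x) + 1 * (fr B * nv x)"
    using assms by (intro add_mono mult_mono nv_ap_fr) auto
  finally show ?thesis by (simp add: algebra_simps)
qed

text \<open>In the application a and b are the difference quotients of sine and cosine at 0, bounded
  by 1 and tending to 1 and 0. The increment is then \<theta> times an expression that can be
  dominated and has a pointwise limit.\<close>

lemma rotated_trip_expansion:
  fixes c :: real
  assumes X: "self_adjoint d X" "self_adjoint d Y" "self_adjoint d C" and z: "Im z \<noteq> 0"
    and ab: "cos' = 1 + \<theta> * b" "sin' = \<theta> * a"
  defines "A \<equiv> lin C c X" and "A' \<equiv> lin C c (rt cos' sin' X Y)"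
  shows "trip z A' (rt (- sin') cos' X Y) w v = trip z A Y w v + of_real \<theta> * (
    ip (ap (rt (- a) b X Y) (rs z A' w)) (rs (cnj z) A' v)
    + of_real c * ip (ap Y (rs z A' (ap (rt b a X Y) (rs z A w)))) (rs (cnj z) A' v)
    + of_real c * ip (ap Y (rs z A w)) (rs (cnj z) A' (ap (rt b a X Y) (rs (cnj z) A v))))"
proof -
  have A: "self_adjoint d A" and A': "self_adjoint d A'" unfolding A_def A'_def by (intro lin_sa rt_sa X)+
  have z': "Im (cnj z) \<noteq> 0" using z by simp
  have e: "A' $$ (i, j) = A $$ (i, j) + of_real (c * \<theta>) * rt b a X Y $$ (i, j)" if "i < d" "j < d" for i j
    using that by (simp add: A_def A'_def lin_def rt_def ab algebra_simps)
  have i1: "rs z A' w = (\<lambda>i. rs z A w i + of_real (c * \<theta>) * rs z A' (ap (rt b a X Y) (rs z A w)) i)"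
    by (rule resolvent_identity[OF A' A z e])
  have i2: "rs (cnj z) A' v = (\<lambda>i. rs (cnj z) A v i + of_real (c * \<theta>) * rs (cnj z) A' (ap (rt b a X Y) (rs (cnj z) A v)) i)"
    by (rule resolvent_identity[OF A' A z' e])
  define u t u' t' p q where "u = rs z A w" and "t = rs (cnj z) A v" and "u' = rs z A' w" and "t' = rs (cnj z) A' v"
    and "p = rs z A' (ap (rt b a X Y) u)" and "q = rs (cnj z) A' (ap (rt b a X Y) t)"
  have u': "u' = (\<lambda>i. u i + of_real (c * \<theta>) * p i)" and t': "t' = (\<lambda>i. t i + of_real (c * \<theta>) * q i)"
    using i1 i2 unfolding u_def t_def u'_def t'_def p_def q_def by auto
  have r: "ap (rt (- sin') cos' X Y) u' = (\<lambda>i. ap Y u' i + of_real \<theta> * ap (rt (- a) b X Y) u' i)"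
    unfolding ap_rt ab by (auto simp: algebra_simps)
  have "ip (ap (rt (- sin') cos' X Y) u') t' = of_real \<theta> * ip (ap (rt (- a) b X Y) u') t' + ip (ap Y u') t'"
    unfolding r by (simp add: ip_simps)
  also have "ip (ap Y u') t' = ip (ap Y u) t' + of_real (c * \<theta>) * ip (ap Y p) t'"
    by (subst u') (simp add: ip_simps ap_simps)
  also have "ip (ap Y u) t' = ip (ap Y u) t + of_real (c * \<theta>) * ip (ap Y u) q"
    by (subst t') (simp add: ip_simps)
  finally show ?thesis
    unfolding trip_eq[OF A z] trip_eq[OF A' z] u_def[symmetric] t_def[symmetric] u'_def[symmetric] t'_def[symmetric] p_def[symmetric] q_def[symmetric]
    by (simp add: algebra_simps)
qed

text \<open>Rotating the pair \<open>(G, G')\<close> of independent copies does not change the expectation of a function of it;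
  the derivative at angle \<open>0\<close> of the rotated expectation therefore vanishes, which is the integration by parts formula.\<close>

theorem integration_by_parts:
  assumes C: "self_adjoint d C" and z: "Im z \<noteq> 0"
  shows "(\<integral>x. trip z (lin C c (Gt x)) (Gt x) w v \<partial>N) = 2 * of_real c * (\<integral>x. \<integral>x'. quin z (lin C c (Gt x)) (Gt x') w v \<partial>N \<partial>N)"
    "integrable (N \<Otimes>\<^sub>M N) (\<lambda>p. quin z (lin C c (Gt (fst p))) (Gt (snd p)) w v)"
    "integrable N (\<lambda>x. trip z (lin C c (Gt x)) (Gt x) w v)"
proof -
  interpret P: pair_prob_space N N ..
  let ?P = "N \<Otimes>\<^sub>M N" and ?y = "\<bar>Im z\<bar>"
  have y: "0 < ?y" and z': "Im (cnj z) \<noteq> 0" using z by simp_all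
  have mmP: "mm ?P (\<lambda>p. Gt (fst p))" "mm ?P (\<lambda>p. Gt (snd p))"
    by (intro mm_compose[OF Gt_mm] measurable_fst measurable_snd)+
  have saP: "self_adjoint d (Gt (fst p))" "self_adjoint d (Gt (snd p))" if "p \<in> space ?P" for p
    using that by (auto simp: space_pair_measure intro: Gt_sa)
  have frN: "integrable N (\<lambda>x. (fr (Gt x))\<^sup>2)" by (rule sqi_fr[OF Gt_sqi])
  have frm: "(\<lambda>x. fr (Gt x)) \<in> borel_measurable N" by (rule fr_measurable[OF Gt_mm])
  have frN1: "integrable N (\<lambda>x. fr (Gt x))" by (rule square_integrable_imp_integrable[OF frm frN])
  have frP: "integrable ?P (\<lambda>p. (fr (Gt (fst p)))\<^sup>2)" "integrable ?P (\<lambda>p. (fr (Gt (snd p)))\<^sup>2)" "integrable ?P (\<lambda>p. fr (Gt (fst p)))" "integrable ?P (\<lambda>p. fr (Gt (snd p)))"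
    using pair_fst_integrable(1)[OF prob_N prob_N, of "\<lambda>x. (fr (Gt x))\<^sup>2"] pair_snd_integrable(1)[OF prob_N prob_N, of "\<lambda>x. (fr (Gt x))\<^sup>2"]
      pair_fst_integrable(1)[OF prob_N prob_N frm] pair_snd_integrable(1)[OF prob_N prob_N frm] frN frN1 frm by auto
  define K where "K p = fr (Gt (fst p)) + fr (Gt (snd p))" for p :: "'b \<times> 'b"
  have K0: "0 \<le> K p" for p by (simp add: K_def)
  have Ki: "integrable ?P K" unfolding K_def[abs_def] using frP by simp
  have K2: "integrable ?P (\<lambda>p. (K p)\<^sup>2)" unfolding K_def
    using frP by (intro integrable_square_add borel_measurable_integrable)
  have le: "norm a \<le> norm b" if "norm a \<le> b" for a :: complex and b :: real using that by simp
  have tm: "(\<lambda>p. trip z (lin C c (Gt (fst p))) (Gt (fst p)) w v) \<in> borel_measurable ?P"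
    "(\<lambda>p. trip z (lin C c (Gt (fst p))) (Gt (snd p)) w v) \<in> borel_measurable ?P"
    "(\<lambda>p. quin z (lin C c (Gt (fst p))) (Gt (snd p)) w v) \<in> borel_measurable ?P"
    unfolding trip_def quin_def by (intro ip_measurable lin_rs_mv mv_ap mmP mv_const z C saP; assumption)+
  have tmN: "(\<lambda>x. trip z (lin C c (Gt x)) (Gt x) w v) \<in> borel_measurable N"
    unfolding trip_def by (intro ip_measurable lin_rs_mv mv_ap Gt_mm mv_const z C Gt_sa; assumption)
  have tb: "norm (trip z (lin C c X) Y w v) \<le> fr Y * (1 / ?y\<^sup>2 * (nv w * nv v))" if "self_adjoint d X" for X Y
    using trip_fr[OF lin_sa[OF C that] z, of c Y w v] by simp
  have qb: "norm (quin z (lin C c X) Y w v) \<le> (fr Y)\<^sup>2 * (1 / ?y ^ 3 * (nv w * nv v))" if "self_adjoint d X" "self_adjoint d Y" for X Y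
    using quin_fr[OF lin_sa[OF C that(1)] that(2) z, of c w v] by simp
  show iN: "integrable N (\<lambda>x. trip z (lin C c (Gt x)) (Gt x) w v)"
    by (rule Bochner_Integration.integrable_bound[OF integrable_mult_left[OF frN1, of "1 / ?y\<^sup>2 * (nv w * nv v)"] tmN]) (intro AE_I2 le tb Gt_sa)
  have i1: "integrable ?P (\<lambda>p. trip z (lin C c (Gt (fst p))) (Gt (fst p)) w v)"
    by (rule Bochner_Integration.integrable_bound[OF integrable_mult_left[OF frP(3), of "1 / ?y\<^sup>2 * (nv w * nv v)"] tm(1)]) (intro AE_I2 le tb saP)
  have i2: "integrable ?P (\<lambda>p. trip z (lin C c (Gt (fst p))) (Gt (snd p)) w v)"
    by (rule Bochner_Integration.integrable_bound[OF integrable_mult_left[OF frP(4), of "1 / ?y\<^sup>2 * (nv w * nv v)"] tm(2)]) (intro AE_I2 le tb saP)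
  show i3: "integrable ?P (\<lambda>p. quin z (lin C c (Gt (fst p))) (Gt (snd p)) w v)"
    by (rule Bochner_Integration.integrable_bound[OF integrable_mult_left[OF frP(2), of "1 / ?y ^ 3 * (nv w * nv v)"] tm(3)]) (intro AE_I2 le qb saP)
  \<comment> \<open>A sequence of angles tending to 0, so that dominated convergence
    applies.\<close>
  define \<theta> where "\<theta> n = 1 / real (Suc n)" for n
  define a where "a n = sin (\<theta> n) / \<theta> n" for n
  define b where "b n = (cos (\<theta> n) - 1) / \<theta> n" for n
  have th: "0 < \<theta> n" for n by (simp add: \<theta>_def)
  have ab: "cos (\<theta> n) = 1 + \<theta> n * b n" "sin (\<theta> n) = \<theta> n * a n" for n using th[of n] by (simp_all add: a_def b_def)
  have a1: "\<bar>a n\<bar> \<le> 1" and b1: "\<bar>b n\<bar> \<le> 1" for n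
    using th[of n] abs_sin_x_le_abs_x[of "\<theta> n"] one_minus_cos_le[of "\<theta> n"] by (auto simp: a_def b_def)
  have a_lim: "a \<longlonglongrightarrow> 1" unfolding a_def[abs_def] \<theta>_def by real_asymp
  have b_lim: "b \<longlonglongrightarrow> 0" unfolding b_def[abs_def] \<theta>_def by real_asymp
  have c_lim: "(\<lambda>n. cos (\<theta> n)) \<longlonglongrightarrow> 1" unfolding \<theta>_def by real_asymp
  have s_lim: "(\<lambda>n. sin (\<theta> n)) \<longlonglongrightarrow> 0" unfolding \<theta>_def by real_asymp
  define A where "A p = lin C c (Gt (fst p))" for p :: "'b \<times> 'b"
  define A' where "A' n p = lin C c (rt (cos (\<theta> n)) (sin (\<theta> n)) (Gt (fst p)) (Gt (snd p)))" for n and p :: "'b \<times> 'b"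
  define rr where "rr x y p = rt x y (Gt (fst p)) (Gt (snd p))" for x y and p :: "'b \<times> 'b"
  define E where "E n p = ip (ap (rr (- a n) (b n) p) (rs z (A' n p) w)) (rs (cnj z) (A' n p) v)
    + of_real c * ip (ap (Gt (snd p)) (rs z (A' n p) (ap (rr (b n) (a n) p) (rs z (A p) w)))) (rs (cnj z) (A' n p) v)
    + of_real c * ip (ap (Gt (snd p)) (rs z (A p) w)) (rs (cnj z) (A' n p) (ap (rr (b n) (a n) p) (rs (cnj z) (A p) v)))" for n and p :: "'b \<times> 'b"
  \<comment> \<open>The pointwise limit of \<open>E n\<close>. The first term comes from turning the
    direction \<open>Gt (snd p)\<close> towards \<open>- Gt (fst p)\<close>, the second from the two
    resolvents, whose derivatives contribute equally.\<close>
  define D where "D p = - trip z (A p) (Gt (fst p)) w v + 2 * of_real c * quin z (A p) (Gt (snd p)) w v" for p :: "'b \<times> 'b"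
  have saA: "self_adjoint d (A p)" "self_adjoint d (A' n p)" if "p \<in> space ?P" for n p
    unfolding A_def A'_def by (intro lin_sa rt_sa saP C that)+
  have expand: "trip z (A' n p) (rt (- sin (\<theta> n)) (cos (\<theta> n)) (Gt (fst p)) (Gt (snd p))) w v = trip z (A p) (Gt (snd p)) w v + of_real (\<theta> n) * E n p"
    if p: "p \<in> space ?P" for n p
    unfolding E_def A_def A'_def rr_def by (rule rotated_trip_expansion[OF saP[OF p] C z ab])
  have rot: "(\<integral>p. trip z (A' n p) (rt (- sin (\<theta> n)) (cos (\<theta> n)) (Gt (fst p)) (Gt (snd p))) w v \<partial>?P) = (\<integral>p. trip z (A p) (Gt (snd p)) w v \<partial>?P)" for n
    unfolding A_def A'_def
  proof (rule rotation_invariance[where F = "\<lambda>X Y. trip z (lin C c X) Y w v"])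
    have "mm (mat_borel d \<Otimes>\<^sub>M mat_borel d) (\<lambda>t. proj (fst t))" "mm (mat_borel d \<Otimes>\<^sub>M mat_borel d) (\<lambda>t. proj (snd t))"
      by (intro mm_proj mm_measurable; measurable)+
    then show "(\<lambda>t. trip z (lin C c (proj (fst t))) (proj (snd t)) w v) \<in> borel_measurable (mat_borel d \<Otimes>\<^sub>M mat_borel d)"
      unfolding trip_def by (intro ip_measurable lin_rs_mv mv_ap mv_const z C self_adjoint_proj)
  qed simp
  have rsb: "nv (rs z (A p) x) \<le> nv x / ?y" "nv (rs (cnj z) (A p) x) \<le> nv x / ?y" "nv (rs z (A' n p) x) \<le> nv x / ?y" "nv (rs (cnj z) (A' n p) x) \<le> nv x / ?y"
    if "p \<in> space ?P" for n p x
    using rs_bound[OF saA(1)[OF that] z] rs_bound[OF saA(1)[OF that] z'] rs_bound[OF saA(2)[OF that] z] rs_bound[OF saA(2)[OF that] z'] by auto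
  have rrb: "nv (ap (rr x y p) u) \<le> K p * k" if "\<bar>x\<bar> \<le> 1" "\<bar>y\<bar> \<le> 1" "nv u \<le> k" for x y p u k
    unfolding rr_def K_def by (rule order.trans[OF rt_bound[OF that(1,2)] mult_left_mono[OF that(3)]]) simp
  have Gb: "nv (ap (Gt (snd p)) u) \<le> K p * k" if "nv u \<le> k" for p u k
  proof -
    have "nv (ap (Gt (snd p)) u) \<le> fr (Gt (snd p)) * nv u" by (rule nv_ap_fr)
    also have "\<dots> \<le> K p * k" using that K0 by (intro mult_mono) (auto simp: K_def)
    finally show ?thesis .
  qed
  define bd where "bd p = (nv w * nv v) * (K p / ?y\<^sup>2 + 2 * \<bar>c\<bar> * (K p)\<^sup>2 / ?y ^ 3)" for p :: "'b \<times> 'b"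
  have bdi: "integrable ?P bd" unfolding bd_def using Ki K2 by simp
  have Eb: "norm (E n p) \<le> bd p" if p: "p \<in> space ?P" for n p
  proof -
    have n1: "\<bar>- a n\<bar> \<le> 1" using a1 by simp
    have cm: "cmod (of_real c * x) \<le> \<bar>c\<bar> * k" if "cmod x \<le> k" for x k
      using mult_left_mono[OF that abs_ge_zero[of c]] by (simp add: norm_mult)
    have 1: "cmod (ip (ap (rr (- a n) (b n) p) (rs z (A' n p) w)) (rs (cnj z) (A' n p) v)) \<le> (K p * (nv w / ?y)) * (nv v / ?y)"
      by (rule norm_ip_le[OF rrb[OF n1 b1 rsb(3)[OF p]] rsb(4)[OF p]])
    have 2: "cmod (ip (ap (Gt (snd p)) (rs z (A' n p) (ap (rr (b n) (a n) p) (rs z (A p) w)))) (rs (cnj z) (A' n p) v)) \<le> (K p * ((K p * (nv w / ?y)) / ?y)) * (nv v / ?y)"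
      by (rule norm_ip_le[OF Gb[OF order.trans[OF rsb(3)[OF p] divide_right_mono[OF rrb[OF b1 a1 rsb(1)[OF p]] abs_ge_zero]]] rsb(4)[OF p]])
    have 3: "cmod (ip (ap (Gt (snd p)) (rs z (A p) w)) (rs (cnj z) (A' n p) (ap (rr (b n) (a n) p) (rs (cnj z) (A p) v)))) \<le> (K p * (nv w / ?y)) * ((K p * (nv v / ?y)) / ?y)"
      by (rule norm_ip_le[OF Gb[OF rsb(1)[OF p]] order.trans[OF rsb(4)[OF p] divide_right_mono[OF rrb[OF b1 a1 rsb(2)[OF p]] abs_ge_zero]]])
    have "norm (E n p) \<le> (K p * (nv w / ?y)) * (nv v / ?y) + \<bar>c\<bar> * ((K p * ((K p * (nv w / ?y)) / ?y)) * (nv v / ?y)) + \<bar>c\<bar> * ((K p * (nv w / ?y)) * ((K p * (nv v / ?y)) / ?y))"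
      unfolding E_def by (rule norm_triangle_mono[OF norm_triangle_mono[OF 1 cm[OF 2]] cm[OF 3]])
    also have "\<dots> = bd p" by (simp add: bd_def power2_eq_square power3_eq_cube field_simps)
    finally show ?thesis .
  qed
  have Em: "E n \<in> borel_measurable ?P" for n
  proof -
    have mA: "mm ?P (A' n)" unfolding A'_def by (intro lin_mm rt_mm mmP)
    have mA2: "mm ?P A" unfolding A_def by (intro lin_mm mmP)
    have mr: "mm ?P (rr x y)" for x y unfolding rr_def by (intro rt_mm mmP)
    have mvr: "mv ?P (\<lambda>p. rs \<zeta> (A' n p) (x p))" "mv ?P (\<lambda>p. rs \<zeta> (A p) (x p))" if "mv ?P x" "Im \<zeta> \<noteq> 0" for x \<zeta>
      using that saA by (intro mv_rs mA mA2; auto)+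
    show ?thesis unfolding E_def[abs_def]
      by (intro borel_measurable_add borel_measurable_times borel_measurable_const ip_measurable mv_ap mvr mr mmP mv_const z z')
  qed
  have Elim: "(\<lambda>n. E n p) \<longlonglongrightarrow> D p" if p: "p \<in> space ?P" for p
  proof -
    let ?X = "Gt (fst p)" and ?Y = "Gt (snd p)"
    have rl: "(\<lambda>n. rr (x n) (y n) p $$ (i, j)) \<longlonglongrightarrow> rr x' y' p $$ (i, j)" if "x \<longlonglongrightarrow> x'" "y \<longlonglongrightarrow> y'" "i < d" "j < d" for x y x' y' i j
      using that unfolding rr_def rt_def by (auto intro!: tendsto_add tendsto_mult tendsto_of_real)
    have Al: "(\<lambda>n. A' n p $$ (i, j)) \<longlonglongrightarrow> A p $$ (i, j)" if ij: "i < d" "j < d" for i j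
    proof -
      have "(\<lambda>n. C $$ (i, j) + of_real c * rr (cos (\<theta> n)) (sin (\<theta> n)) p $$ (i, j)) \<longlonglongrightarrow> C $$ (i, j) + of_real c * rr 1 0 p $$ (i, j)"
        by (intro tendsto_add tendsto_mult tendsto_const rl c_lim s_lim ij)
      then show ?thesis using ij by (simp add: A_def A'_def lin_def rr_def rt_def)
    qed
    have rsl: "(\<lambda>n. rs \<zeta> (A' n p) (x n) i) \<longlonglongrightarrow> rs \<zeta> (A p) x' i" if "\<And>j. j < d \<Longrightarrow> (\<lambda>n. x n j) \<longlonglongrightarrow> x' j" "Im \<zeta> \<noteq> 0" "i < d" for x x' \<zeta> i
      by (rule rs_tendsto[OF saA(2)[OF p] saA(1)[OF p] that(2) Al that(1,3)])
    have na: "(\<lambda>n. - a n) \<longlonglongrightarrow> - 1" using tendsto_minus[OF a_lim] by simp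
    have 1: "(\<lambda>n. ip (ap (rr (- a n) (b n) p) (rs z (A' n p) w)) (rs (cnj z) (A' n p) v)) \<longlonglongrightarrow> ip (ap (rr (- 1) 0 p) (rs z (A p) w)) (rs (cnj z) (A p) v)"
      by (intro ip_tendsto ap_tendsto rl rsl na b_lim tendsto_const z z'; assumption)
    have 2: "(\<lambda>n. ip (ap ?Y (rs z (A' n p) (ap (rr (b n) (a n) p) (rs z (A p) w)))) (rs (cnj z) (A' n p) v)) \<longlonglongrightarrow> ip (ap ?Y (rs z (A p) (ap (rr 0 1 p) (rs z (A p) w)))) (rs (cnj z) (A p) v)"
      by (intro ip_tendsto ap_tendsto rl rsl a_lim b_lim tendsto_const z z'; assumption)
    have 3: "(\<lambda>n. ip (ap ?Y (rs z (A p) w)) (rs (cnj z) (A' n p) (ap (rr (b n) (a n) p) (rs (cnj z) (A p) v)))) \<longlonglongrightarrow> ip (ap ?Y (rs z (A p) w)) (rs (cnj z) (A p) (ap (rr 0 1 p) (rs (cnj z) (A p) v)))"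
      by (intro ip_tendsto ap_tendsto rl rsl a_lim b_lim tendsto_const z z'; assumption)
    have r1: "ap (rr (- 1) 0 p) x = (\<lambda>i. (- 1) * ap ?X x i)" "ap (rr 0 1 p) x = ap ?Y x" for x
      unfolding rr_def ap_rt by auto
    have "(\<lambda>n. E n p) \<longlonglongrightarrow> ip (ap (rr (- 1) 0 p) (rs z (A p) w)) (rs (cnj z) (A p) v)
      + of_real c * ip (ap ?Y (rs z (A p) (ap (rr 0 1 p) (rs z (A p) w)))) (rs (cnj z) (A p) v)
      + of_real c * ip (ap ?Y (rs z (A p) w)) (rs (cnj z) (A p) (ap (rr 0 1 p) (rs (cnj z) (A p) v)))"
      unfolding E_def by (intro tendsto_add tendsto_mult tendsto_const 1 2 3)
    also have "ip (ap ?Y (rs z (A p) (ap (rr 0 1 p) (rs z (A p) w)))) (rs (cnj z) (A p) v) = quin z (A p) ?Y w v"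
      unfolding r1 quin_eq[OF saA(1)[OF p] saP(2)[OF p] z] by (rule self_adjoint_ip[OF saP(2)[OF p]])
    also have "ip (ap ?Y (rs z (A p) w)) (rs (cnj z) (A p) (ap (rr 0 1 p) (rs (cnj z) (A p) v))) = quin z (A p) ?Y w v"
      unfolding r1 quin_eq[OF saA(1)[OF p] saP(2)[OF p] z] by (rule rs_adjoint[OF saA(1)[OF p] z, symmetric])
    also have "ip (ap (rr (- 1) 0 p) (rs z (A p) w)) (rs (cnj z) (A p) v) = - trip z (A p) ?X w v"
      unfolding r1 ip_mult_left trip_eq[OF saA(1)[OF p] z] by simp
    finally show ?thesis by (simp add: D_def mult.assoc)
  qed
  have Ei: "integrable ?P (E n)" for n
    by (rule Bochner_Integration.integrable_bound[OF bdi Em]) (intro AE_I2 le Eb)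
  \<comment> \<open>By invariance the rotated and the original expectation agree for every n, so the
    mean of \<open>E n\<close> is exactly 0 and not only in the limit.\<close>
  have E0: "(\<integral>p. E n p \<partial>?P) = 0" for n
  proof -
    have "(\<integral>p. trip z (A p) (Gt (snd p)) w v \<partial>?P) = (\<integral>p. trip z (A p) (Gt (snd p)) w v + of_real (\<theta> n) * E n p \<partial>?P)"
      unfolding rot[of n, symmetric] by (rule Bochner_Integration.integral_cong[OF refl expand])
    also have "\<dots> = (\<integral>p. trip z (A p) (Gt (snd p)) w v \<partial>?P) + of_real (\<theta> n) * (\<integral>p. E n p \<partial>?P)"
      using i2 Ei by (simp add: A_def)
    finally show ?thesis using th[of n] by simp
  qed
  have Dm: "D \<in> borel_measurable ?P" unfolding D_def[abs_def] A_def using i1 i3 by (intro borel_measurable_integrable Bochner_Integration.integrable_add Bochner_Integration.integrable_minus integrable_mult_right)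
  have "(\<lambda>n. \<integral>p. E n p \<partial>?P) \<longlonglongrightarrow> (\<integral>p. D p \<partial>?P)"
    by (rule integral_dominated_convergence[OF Dm Em bdi]) (intro AE_I2 Elim Eb; assumption)+
  then have "(\<integral>p. D p \<partial>?P) = 0" unfolding E0 by (simp add: LIMSEQ_const_iff)
  also have "(\<integral>p. D p \<partial>?P) = - (\<integral>p. trip z (lin C c (Gt (fst p))) (Gt (fst p)) w v \<partial>?P) + 2 * of_real c * (\<integral>p. quin z (lin C c (Gt (fst p))) (Gt (snd p)) w v \<partial>?P)"
    unfolding D_def A_def using i1 i3 by simp
  also have "(\<integral>p. trip z (lin C c (Gt (fst p))) (Gt (fst p)) w v \<partial>?P) = (\<integral>x. trip z (lin C c (Gt x)) (Gt x) w v \<partial>N)"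
    by (rule pair_fst_integrable(2)[OF prob_N prob_N tmN])
  also have "(\<integral>p. quin z (lin C c (Gt (fst p))) (Gt (snd p)) w v \<partial>?P) = (\<integral>x. \<integral>x'. quin z (lin C c (Gt x)) (Gt x') w v \<partial>N \<partial>N)"
    using P.integral_fst'[OF i3] by simp
  finally show "(\<integral>x. trip z (lin C c (Gt x)) (Gt x) w v \<partial>N) = 2 * of_real c * (\<integral>x. \<integral>x'. quin z (lin C c (Gt x)) (Gt x') w v \<partial>N \<partial>N)"
    by (simp add: algebra_simps)
qed

end

section \<open>Comparison of a sum with its Gaussian model\<close>

lemma first_order_bounds:
  fixes f f' :: "real \<Rightarrow> real"
  assumes f: "\<And>x. (f has_real_derivative f' x) (at x)"
  shows "(\<And>x. \<bar>f' x\<bar> \<le> 1) \<Longrightarrow> \<bar>f b - f a\<bar> \<le> \<bar>b - a\<bar>"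
    "(\<And>x y. \<bar>f' x - f' y\<bar> \<le> \<bar>x - y\<bar>) \<Longrightarrow> \<bar>f b - f a - (b - a) * f' a\<bar> \<le> (b - a)\<^sup>2"
proof -
  have mv: "\<exists>\<xi>. \<bar>\<xi> - a\<bar> \<le> \<bar>b - a\<bar> \<and> f b - f a = (b - a) * f' \<xi>"
  proof (cases a b rule: linorder_cases)
    case less
    from MVT2[OF less f] show ?thesis by force
  next
    case greater
    from MVT2[OF greater f] obtain \<xi> where "b < \<xi>" "\<xi> < a" "f a - f b = (a - b) * f' \<xi>" by blast
    then show ?thesis by (intro exI[of _ \<xi>]) (auto simp: algebra_simps)
  qed auto
  then obtain \<xi> where \<xi>: "\<bar>\<xi> - a\<bar> \<le> \<bar>b - a\<bar>" "f b - f a = (b - a) * f' \<xi>" by blast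
  show "\<bar>f b - f a\<bar> \<le> \<bar>b - a\<bar>" if "\<And>x. \<bar>f' x\<bar> \<le> 1"
    using mult_left_mono[OF that[of \<xi>] abs_ge_zero[of "b - a"]] by (simp add: \<xi>(2) abs_mult)
  assume lip: "\<And>x y. \<bar>f' x - f' y\<bar> \<le> \<bar>x - y\<bar>"
  have "f b - f a - (b - a) * f' a = (b - a) * (f' \<xi> - f' a)" unfolding \<xi>(2) by (simp add: algebra_simps)
  then have "\<bar>f b - f a - (b - a) * f' a\<bar> \<le> \<bar>b - a\<bar> * \<bar>b - a\<bar>"
    using mult_left_mono[OF order.trans[OF lip \<xi>(1)] abs_ge_zero[of "b - a"]] by (simp add: abs_mult)
  then show "\<bar>f b - f a - (b - a) * f' a\<bar> \<le> (b - a)\<^sup>2" by (simp add: power2_eq_square)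
qed

lemma sin_cos_first_order:
  "\<bar>sin b - sin a\<bar> \<le> \<bar>b - a\<bar>" "\<bar>cos b - cos a\<bar> \<le> \<bar>b - a\<bar>"
  "\<bar>sin b - sin a - (b - a) * cos a\<bar> \<le> (b - a)\<^sup>2" "\<bar>cos b - cos a + (b - a) * sin a\<bar> \<le> (b - a)\<^sup>2" for a b :: real
proof -
  have s: "(sin has_real_derivative cos x) (at x)" and c: "(cos has_real_derivative - sin x) (at x)" for x :: real
    by (auto intro!: derivative_eq_intros)
  show 1: "\<bar>sin b - sin a\<bar> \<le> \<bar>b - a\<bar>" for a b :: real by (rule first_order_bounds(1)[OF s]) simp
  show 2: "\<bar>cos b - cos a\<bar> \<le> \<bar>b - a\<bar>" for a b :: real by (rule first_order_bounds(1)[OF c]) simp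
  show "\<bar>sin b - sin a - (b - a) * cos a\<bar> \<le> (b - a)\<^sup>2" by (rule first_order_bounds(2)[OF s 2])
  show "\<bar>cos b - cos a + (b - a) * sin a\<bar> \<le> (b - a)\<^sup>2"
    using first_order_bounds(2)[OF c, of b a] 1 by (simp add: abs_minus_commute)
qed

lemma (in dim) rs_mv:
  "mm K X \<Longrightarrow> (\<And>w. w \<in> space K \<Longrightarrow> self_adjoint d (X w)) \<Longrightarrow> Im z \<noteq> 0 \<Longrightarrow> mv K x \<Longrightarrow> mv K (\<lambda>w. rs z (X w) (x w))"
  by (rule mv_rs) auto

locale comparison = dim d + S: random_sum d M n Z + H: gaussian_matrix d N G
  for d :: nat and M :: "'a measure" and n :: nat and Z :: "nat \<Rightarrow> 'a \<Rightarrow> complex mat"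
    and N :: "'b measure" and G :: "'b \<Rightarrow> complex mat" +
  fixes Z0 :: "complex mat"
  assumes Z0: "self_adjoint d Z0"
    and cov: "\<And>i j k l. i < d \<Longrightarrow> j < d \<Longrightarrow> k < d \<Longrightarrow> l < d \<Longrightarrow>
      (\<integral>g. H.Gt g $$ (i, j) * cnj (H.Gt g $$ (k, l)) \<partial>N) = (\<integral>x. S.Sm {1..n} x $$ (i, j) * cnj (S.Sm {1..n} x $$ (k, l)) \<partial>M)"
begin

abbreviation "Y \<equiv> S.Sm {1..n}"
abbreviation "W \<equiv> H.Gt"

lemma Y: "sqi M Y" "mm M Y" "x \<in> space M \<Longrightarrow> self_adjoint d (Y x)"
  using S.Sm_all by (auto simp: sqi_def)

text \<open>Second-moment forms only see covariances of entries, which agree by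
  \<open>cov\<close>.\<close>

lemma second_moments_agree:
  "(\<integral>g. ip (ap (W g) (ap B (ap (W g) x))) t \<partial>N) = (\<integral>y. ip (ap (Y y) (ap B (ap (Y y) x))) t \<partial>M)"
  by (subst second_moment_form(1)[OF H.Gt_sqi H.Gt_sa], assumption, subst second_moment_form(1)[OF Y(1,3)], assumption)
    (intro sum.cong refl, simp add: cov)

lemma gaussian_square_bound: "(\<integral>g. (nv (ap (W g) x))\<^sup>2 \<partial>N) \<le> S.sg * (nv x)\<^sup>2"
proof -
  have "complex_of_real (\<integral>g. (nv (ap (W g) x))\<^sup>2 \<partial>N) = (\<integral>g. ip (ap (W g) (ap (1\<^sub>m d) (ap (W g) x))) x \<partial>N)"
    unfolding integral_complex_of_real[symmetric] by (intro Bochner_Integration.integral_cong refl nv_ap_square H.Gt_sa)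
  also have "\<dots> = complex_of_real (\<integral>y. (nv (ap (Y y) x))\<^sup>2 \<partial>M)"
    unfolding second_moments_agree integral_complex_of_real[symmetric]
    by (intro Bochner_Integration.integral_cong refl nv_ap_square[symmetric] Y)
  finally have "(\<integral>g. (nv (ap (W g) x))\<^sup>2 \<partial>N) = (\<integral>y. (nv (ap (Y y) x))\<^sup>2 \<partial>M)" by (simp only: of_real_eq_iff)
  then show ?thesis using S.sum_square_bound(1)[of x] by simp
qed

text \<open>Bracketed with the Gaussian part as the base, for the replacement estimate with
  \<open>W\<close> frozen; \<open>rot_mat_alt\<close> reverses the roles for integration by parts
  with \<open>Y\<close> frozen.\<close>

definition rot_mat :: "real \<Rightarrow> 'a \<times> 'b \<Rightarrow> complex mat" where
  "rot_mat \<theta> p = lin (lin Z0 (cos \<theta>) (W (snd p))) (sin \<theta>) (Y (fst p))"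

lemma rot_mat_alt: "rot_mat \<theta> p = lin (lin Z0 (sin \<theta>) (Y (fst p))) (cos \<theta>) (W (snd p))"
  unfolding rot_mat_def lin_def by (rule eq_matI) (auto simp: algebra_simps)

sublocale P: pair_prob_space M N
  using S.prob_M H.prob_N by (simp add: pair_prob_space_def pair_sigma_finite_def prob_space_imp_sigma_finite)

abbreviation "P \<equiv> M \<Otimes>\<^sub>M N"

lemma space_P: "p \<in> space P \<Longrightarrow> fst p \<in> space M" "p \<in> space P \<Longrightarrow> snd p \<in> space N"
  by (auto simp: space_pair_measure)

lemma mm_P: "mm P (\<lambda>p. Y (fst p))" "mm P (\<lambda>p. W (snd p))"
  by (rule mm_compose[OF Y(2) measurable_fst], rule mm_compose[OF H.Gt_mm measurable_snd])

lemma rot_mat_sa: "p \<in> space P \<Longrightarrow> self_adjoint d (rot_mat \<theta> p)"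
  unfolding rot_mat_def by (intro lin_sa Z0 H.Gt_sa Y space_P)

lemma rot_mat_mm: "mm P (rot_mat \<theta>)"
proof -
  have "rot_mat \<theta> = (\<lambda>p. Matrix.mat d d (\<lambda>jk. Z0 $$ jk + of_real (cos \<theta>) * W (snd p) $$ jk + of_real (sin \<theta>) * Y (fst p) $$ jk))"
    unfolding rot_mat_def lin_def by (auto intro!: eq_matI)
  then show ?thesis
    using mm_P by (auto intro!: mm_mat borel_measurable_add borel_measurable_times borel_measurable_const mm_entry)
qed

definition fr_sum :: "'a \<times> 'b \<Rightarrow> real" where "fr_sum p = fr (Y (fst p)) + fr (W (snd p))"

lemma fr_sum_nonneg: "0 \<le> fr_sum p" by (simp add: fr_sum_def)

lemma fr_integrable:
  "integrable M (\<lambda>x. (fr (Y x))\<^sup>2)" "integrable M (\<lambda>x. fr (Y x))" "integrable N (\<lambda>g. (fr (W g))\<^sup>2)" "integrable N (\<lambda>g. fr (W g))"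
proof -
  show 1: "integrable M (\<lambda>x. (fr (Y x))\<^sup>2)" and 2: "integrable N (\<lambda>g. (fr (W g))\<^sup>2)" by (intro sqi_fr Y H.Gt_sqi)+
  show "integrable M (\<lambda>x. fr (Y x))" by (rule S.square_integrable_imp_integrable[OF fr_measurable[OF Y(2)] 1])
  show "integrable N (\<lambda>g. fr (W g))" by (rule H.square_integrable_imp_integrable[OF fr_measurable[OF H.Gt_mm] 2])
qed

lemma fr_P_integrable:
  "integrable P (\<lambda>p. fr (Y (fst p)))" "integrable P (\<lambda>p. fr (W (snd p)))" "integrable P fr_sum" "integrable P (\<lambda>p. (fr_sum p)\<^sup>2)"
proof -
  note f = pair_fst_integrable(1)[OF S.prob_M H.prob_N, THEN iffD2] and s = pair_snd_integrable(1)[OF S.prob_M H.prob_N, THEN iffD2]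
  show 1: "integrable P (\<lambda>p. fr (Y (fst p)))" by (rule f[OF fr_measurable[OF Y(2)] fr_integrable(2)])
  show 2: "integrable P (\<lambda>p. fr (W (snd p)))" by (rule s[OF fr_measurable[OF H.Gt_mm] fr_integrable(4)])
  show "integrable P fr_sum" unfolding fr_sum_def[abs_def] using 1 2 by simp
  have 3: "integrable P (\<lambda>p. (fr (Y (fst p)))\<^sup>2)" by (rule f[OF borel_measurable_integrable[OF fr_integrable(1)] fr_integrable(1)])
  have 4: "integrable P (\<lambda>p. (fr (W (snd p)))\<^sup>2)" by (rule s[OF borel_measurable_integrable[OF fr_integrable(3)] fr_integrable(3)])
  show "integrable P (\<lambda>p. (fr_sum p)\<^sup>2)" unfolding fr_sum_def
    by (rule integrable_square_add[OF borel_measurable_integrable[OF 1] borel_measurable_integrable[OF 2] 3 4])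
qed

context
  fixes z :: complex and w v :: "nat \<Rightarrow> complex"
  assumes z: "0 < Im z" and wv: "nv w = 1" "nv v = 1"
begin

lemma z0: "Im z \<noteq> 0" "Im (cnj z) \<noteq> 0" "\<bar>Im z\<bar> = Im z" using z by auto

lemma trip_bound: "self_adjoint d A \<Longrightarrow> norm (trip z A X w v) \<le> fr X * (1 / (Im z)\<^sup>2)"
  using trip_fr[OF _ z0(1), of A X w v] wv by simp

lemma trip_P_integrable:
  "integrable P (\<lambda>p. trip z (rot_mat \<theta> p) (Y (fst p)) w v)" "integrable P (\<lambda>p. trip z (rot_mat \<theta> p) (W (snd p)) w v)"
proof -
  have m: "(\<lambda>p. trip z (rot_mat \<theta> p) (Y (fst p)) w v) \<in> borel_measurable P" "(\<lambda>p. trip z (rot_mat \<theta> p) (W (snd p)) w v) \<in> borel_measurable P"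
    unfolding trip_def by (intro ip_measurable rs_mv mv_ap rot_mat_mm rot_mat_sa mm_P mv_const z0; assumption)+
  have le: "norm a \<le> norm b" if "norm a \<le> b" for a :: complex and b :: real using that by simp
  show "integrable P (\<lambda>p. trip z (rot_mat \<theta> p) (Y (fst p)) w v)"
    by (rule Bochner_Integration.integrable_bound[OF integrable_mult_left[OF fr_P_integrable(1), of "1 / (Im z)\<^sup>2"] m(1)]) (intro AE_I2 le trip_bound rot_mat_sa)
  show "integrable P (\<lambda>p. trip z (rot_mat \<theta> p) (W (snd p)) w v)"
    by (rule Bochner_Integration.integrable_bound[OF integrable_mult_left[OF fr_P_integrable(2), of "1 / (Im z)\<^sup>2"] m(2)]) (intro AE_I2 le trip_bound rot_mat_sa)
qed

text \<open>The quantity to which both parts of the derivative reduce: an average over an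
  independent copy while \<open>A\<close> is frozen. The copy may be taken of \<open>Y\<close> or of
  \<open>W\<close>.\<close>

definition quad_form :: "complex mat \<Rightarrow> complex" where "quad_form A = (\<integral>x. quin z A (Y x) w v \<partial>M)"

lemma quad_form_gaussian: "self_adjoint d A \<Longrightarrow> (\<integral>g. quin z A (W g) w v \<partial>N) = quad_form A"
proof -
  assume A: "self_adjoint d A"
  have q: "quin z A X w v = ip (ap X (ap (resolvent d z A) (ap X (rs z A w)))) (rs (cnj z) A v)" for X
    unfolding quin_def rs_adjoint[OF A z0(1)] by (simp add: rs_def)
  show ?thesis unfolding quad_form_def q by (rule second_moments_agree)
qed

lemma quad_form_integrable: "integrable P (\<lambda>p. quad_form (rot_mat \<theta> p))"
proof (rule P.integrable_const_bound[of _ "(\<integral>x. (fr (Y x))\<^sup>2 * (1 / Im z ^ 3) \<partial>M)"])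
  show "AE p in P. norm (quad_form (rot_mat \<theta> p)) \<le> (\<integral>x. (fr (Y x))\<^sup>2 * (1 / Im z ^ 3) \<partial>M)"
  proof (intro AE_I2)
    fix p assume p: "p \<in> space P"
    have "norm (quin z (rot_mat \<theta> p) (Y x) w v) \<le> (fr (Y x))\<^sup>2 * (1 / Im z ^ 3)" if "x \<in> space M" for x
      using quin_fr[OF rot_mat_sa[OF p] Y(3)[OF that] z0(1), of \<theta> w v] wv z0(3) by simp
    then show "norm (quad_form (rot_mat \<theta> p)) \<le> (\<integral>x. (fr (Y x))\<^sup>2 * (1 / Im z ^ 3) \<partial>M)"
      unfolding quad_form_def by (intro order.trans[OF integral_norm_bound] integral_mono' integrable_mult_left fr_integrable) (use z in auto)
  qed
  show "(\<lambda>p. quad_form (rot_mat \<theta> p)) \<in> borel_measurable P"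
    unfolding quad_form_def
  proof (rule S.borel_measurable_lebesgue_integral)
    have m: "mm (P \<Otimes>\<^sub>M M) (\<lambda>q. rot_mat \<theta> (fst q))" "mm (P \<Otimes>\<^sub>M M) (\<lambda>q. Y (snd q))"
      by (rule mm_compose[OF rot_mat_mm measurable_fst], rule mm_compose[OF Y(2) measurable_snd])
    have sa: "self_adjoint d (rot_mat \<theta> (fst q))" if "q \<in> space (P \<Otimes>\<^sub>M M)" for q
      using that by (auto simp: space_pair_measure intro: rot_mat_sa)
    have "(\<lambda>q. quin z (rot_mat \<theta> (fst q)) (Y (snd q)) w v) \<in> borel_measurable (P \<Otimes>\<^sub>M M)"
      unfolding quin_def by (intro ip_measurable rs_mv mv_ap mv_const m sa z0; assumption)
    then show "(\<lambda>(p, x). quin z (rot_mat \<theta> p) (Y x) w v) \<in> borel_measurable (P \<Otimes>\<^sub>M M)" by (simp add: case_prod_beta')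
  qed
qed

definition path_deriv :: "real \<Rightarrow> complex" where
  "path_deriv \<theta> = of_real (cos \<theta>) * (\<integral>p. trip z (rot_mat \<theta> p) (Y (fst p)) w v \<partial>P) - of_real (sin \<theta>) * (\<integral>p. trip z (rot_mat \<theta> p) (W (snd p)) w v \<partial>P)"

text \<open>With \<open>Y\<close> frozen the term in \<open>W\<close> equals
  \<open>2 * cos \<theta>\<close> times the mean of \<open>quad_form\<close>; with \<open>W\<close>
  frozen the term in \<open>Y\<close> is \<open>2 * sin \<theta>\<close> times the same mean up to
  the replacement error. The prefactors \<open>cos \<theta>\<close> and
  \<open>- sin \<theta>\<close> make the main terms cancel.\<close>

lemma path_deriv_bound:
  assumes r: "2 * S.r \<le> Im z" and \<theta>: "0 \<le> \<theta>" "\<theta> \<le> pi / 2"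
  shows "cmod (path_deriv \<theta>) \<le> 128 * S.r * S.sg / (Im z)^4 + 32 * S.r\<^sup>2 / Im z ^ 3" (is "_ \<le> ?E")
proof -
  \<comment> \<open>The replacement estimate takes weights in [0, 1], hence angles in the first
    quadrant.\<close>
  have s: "0 \<le> sin \<theta>" "sin \<theta> \<le> 1" using \<theta> by (auto intro!: sin_ge_zero)
  let ?B = "\<lambda>g. lin Z0 (cos \<theta>) (W g)" and ?C = "\<lambda>x. lin Z0 (sin \<theta>) (Y x)"
  have XB: "rot_mat \<theta> (x, g) = lin (?B g) (sin \<theta>) (Y x)" and XC: "rot_mat \<theta> (x, g) = lin (?C x) (cos \<theta>) (W g)" for x g
    by (simp add: rot_mat_def) (simp add: rot_mat_alt)
  let ?Q = "\<integral>p. quad_form (rot_mat \<theta> p) \<partial>P"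
  have i1: "integrable P (\<lambda>(x, g). trip z (rot_mat \<theta> (x, g)) (Y x) w v)" and i2: "integrable P (\<lambda>(x, g). trip z (rot_mat \<theta> (x, g)) (W g) w v)"
    and i3: "integrable P (\<lambda>(x, g). quad_form (rot_mat \<theta> (x, g)))"
    using trip_P_integrable[of \<theta>] quad_form_integrable[of \<theta>] by (simp_all add: case_prod_beta')
  have W: "(\<integral>p. trip z (rot_mat \<theta> p) (W (snd p)) w v \<partial>P) = 2 * of_real (cos \<theta>) * ?Q"
  proof -
    have "(\<integral>p. trip z (rot_mat \<theta> p) (W (snd p)) w v \<partial>P) = (\<integral>x. \<integral>g. trip z (rot_mat \<theta> (x, g)) (W g) w v \<partial>N \<partial>M)"
      using P.integral_fst[OF i2] by (simp add: case_prod_beta')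
    also have "\<dots> = (\<integral>x. 2 * of_real (cos \<theta>) * (\<integral>g. quad_form (rot_mat \<theta> (x, g)) \<partial>N) \<partial>M)"
    proof (rule Bochner_Integration.integral_cong[OF refl])
      fix x assume x: "x \<in> space M"
      have C: "self_adjoint d (?C x)" by (intro lin_sa Z0 Y x)
      have "(\<integral>g. trip z (rot_mat \<theta> (x, g)) (W g) w v \<partial>N) = 2 * of_real (cos \<theta>) * (\<integral>g. \<integral>g'. quin z (rot_mat \<theta> (x, g)) (W g') w v \<partial>N \<partial>N)"
        unfolding XC by (rule H.integration_by_parts(1)[OF C z0(1)])
      also have "(\<integral>g. \<integral>g'. quin z (rot_mat \<theta> (x, g)) (W g') w v \<partial>N \<partial>N) = (\<integral>g. quad_form (rot_mat \<theta> (x, g)) \<partial>N)"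
        using x by (intro Bochner_Integration.integral_cong refl quad_form_gaussian rot_mat_sa) (simp add: space_pair_measure)
      finally show "(\<integral>g. trip z (rot_mat \<theta> (x, g)) (W g) w v \<partial>N) = 2 * of_real (cos \<theta>) * (\<integral>g. quad_form (rot_mat \<theta> (x, g)) \<partial>N)" .
    qed
    also have "\<dots> = 2 * of_real (cos \<theta>) * ?Q"
      using P.integral_fst[OF i3] by (simp add: case_prod_beta')
    finally show ?thesis .
  qed
  have "cmod ((\<integral>p. trip z (rot_mat \<theta> p) (Y (fst p)) w v \<partial>P) - 2 * of_real (sin \<theta>) * ?Q) \<le> ?E"
  proof -
    let ?a = "\<lambda>g. \<integral>x. trip z (rot_mat \<theta> (x, g)) (Y x) w v \<partial>M" and ?b = "\<lambda>g. \<integral>x. quad_form (rot_mat \<theta> (x, g)) \<partial>M"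
    have ia: "integrable N ?a" and ib: "integrable N ?b" using P.integrable_snd[OF i1] P.integrable_snd[OF i3] by auto
    have e: "(\<integral>p. trip z (rot_mat \<theta> p) (Y (fst p)) w v \<partial>P) - 2 * of_real (sin \<theta>) * ?Q = (\<integral>g. ?a g - 2 * of_real (sin \<theta>) * ?b g \<partial>N)"
      using ia ib P.integral_snd[OF i1] P.integral_snd[OF i3] by (simp add: case_prod_beta')
    have "cmod (\<integral>g. ?a g - 2 * of_real (sin \<theta>) * ?b g \<partial>N) \<le> (\<integral>g. cmod (?a g - 2 * of_real (sin \<theta>) * ?b g) \<partial>N)" by (rule integral_norm_bound)
    also have "\<dots> \<le> (\<integral>g. ?E \<partial>N)"
    proof (rule integral_mono)
      show "integrable N (\<lambda>g. cmod (?a g - 2 * of_real (sin \<theta>) * ?b g))" using ia ib by simp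
      fix g assume g: "g \<in> space N"
      have B: "self_adjoint d (?B g)" by (intro lin_sa Z0 H.Gt_sa g)
      show "cmod (?a g - 2 * of_real (sin \<theta>) * ?b g) \<le> ?E"
        using S.replacement_error_sum[OF B s z0(1) _ wv] r unfolding XB quad_form_def z0(3) by simp
    qed simp
    also have "\<dots> = ?E" by (simp add: H.prob_space)
    finally show ?thesis unfolding e .
  qed
  note err = this
  have "path_deriv \<theta> = of_real (cos \<theta>) * ((\<integral>p. trip z (rot_mat \<theta> p) (Y (fst p)) w v \<partial>P) - 2 * of_real (sin \<theta>) * ?Q)"
    unfolding path_deriv_def W by (simp add: algebra_simps)
  then have "cmod (path_deriv \<theta>) = \<bar>cos \<theta>\<bar> * cmod ((\<integral>p. trip z (rot_mat \<theta> p) (Y (fst p)) w v \<partial>P) - 2 * of_real (sin \<theta>) * ?Q)"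
    by (simp add: norm_mult)
  also have "\<dots> \<le> 1 * ?E" by (intro mult_mono err) auto
  finally show ?thesis by simp
qed

definition path_form :: "real \<Rightarrow> complex" where
  "path_form \<theta> = (\<integral>p. ip (rs z (rot_mat \<theta> p) w) v \<partial>P)"

lemma ip_rs_bound: "self_adjoint d A \<Longrightarrow> cmod (ip (rs z A w) v) \<le> 1 / Im z"
  using norm_ip_le[OF rs_bound[OF _ z0(1), of A w] order_refl, of v] wv z0(3) by simp

lemma path_form_integrable: "integrable P (\<lambda>p. ip (rs z (rot_mat \<theta> p) w) v)"
proof (rule P.integrable_const_bound[of _ "1 / Im z"])
  show "(\<lambda>p. ip (rs z (rot_mat \<theta> p) w) v) \<in> borel_measurable P" by (intro ip_measurable rs_mv rot_mat_mm rot_mat_sa mv_const z0)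
qed (intro AE_I2 ip_rs_bound rot_mat_sa)

text \<open>Three errors are quadratic in the step: those of sine and of cosine, and the second
  resolvent step. Their size depends on the sample point only through \<open>fr_sum\<close>, whose
  square is integrable.\<close>

lemma expansion_pointwise:
  assumes p: "p \<in> space P"
  shows "cmod (ip (rs z (rot_mat t p) w) v - ip (rs z (rot_mat s p) w) v
      - of_real (t - s) * (of_real (cos s) * trip z (rot_mat s p) (Y (fst p)) w v - of_real (sin s) * trip z (rot_mat s p) (W (snd p)) w v))
    \<le> (fr_sum p / (Im z)\<^sup>2 + (fr_sum p)\<^sup>2 / Im z ^ 3) * (t - s)\<^sup>2"
proof -
  let ?Y = "Y (fst p)" and ?W = "W (snd p)" and ?y = "Im z" and ?\<delta> = "\<bar>t - s\<bar>"
  define A A' a b where "A = rot_mat s p" and "A' = rot_mat t p" and "a = sin t - sin s" and "b = cos t - cos s"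
  define u t' D where "u = rs z A w" and "t' = rs (cnj z) A v" and "D = H.rt a b ?Y ?W"
  note defs = A_def A'_def u_def t'_def D_def
  have sa: "self_adjoint d A" "self_adjoint d A'" unfolding A_def A'_def by (intro rot_mat_sa p)+
  have e: "A' $$ (i, j) = A $$ (i, j) + 1 * D $$ (i, j)" if "i < d" "j < d" for i j
    using that by (simp add: A_def A'_def D_def rot_mat_def lin_def H.rt_def a_def b_def algebra_simps)
  have id: "rs z A' x = (\<lambda>i. rs z A x i + 1 * rs z A' (ap D (rs z A x)) i)" for x
    by (rule resolvent_identity[OF sa(2,1) z0(1) e])
  have apD: "ap D x = (\<lambda>i. of_real a * ap ?Y x i + of_real b * ap ?W x i)" for x unfolding D_def by (rule H.ap_rt)
  have "ip (rs z A' w) v = ip u v + ip (rs z A' (ap D u)) v"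
    by (subst id) (simp add: ip_simps u_def)
  also have "ip (rs z A' (ap D u)) v = ip (rs z A (ap D u)) v + ip (rs z A' (ap D (rs z A (ap D u)))) v"
    by (subst id) (simp add: ip_simps)
  also have "ip (rs z A (ap D u)) v = of_real a * ip (ap ?Y u) t' + of_real b * ip (ap ?W u) t'"
    unfolding rs_adjoint[OF sa(1) z0(1)] apD t'_def by (simp add: ip_simps)
  finally have e1: "ip (rs z A' w) v - ip u v - of_real (t - s) * (of_real (cos s) * ip (ap ?Y u) t' - of_real (sin s) * ip (ap ?W u) t')
    = of_real (a - (t - s) * cos s) * ip (ap ?Y u) t' + of_real (b + (t - s) * sin s) * ip (ap ?W u) t' + ip (rs z A' (ap D (rs z A (ap D u)))) v"
    by (simp add: algebra_simps)
  have nu: "nv u \<le> 1 / ?y" "nv t' \<le> 1 / ?y"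
    using rs_bound[OF sa(1) z0(1), of w] rs_bound[OF sa(1) z0(2), of v] wv z0(3) by (simp_all add: u_def t'_def)
  have T: "cmod (ip (ap X u) t') \<le> fr X / ?y\<^sup>2" for X
    using norm_ip_le[OF order.trans[OF nv_ap_fr mult_left_mono[OF nu(1) fr_nonneg]] nu(2), of X] by (simp add: power2_eq_square)
  have ab: "\<bar>a\<bar> \<le> ?\<delta>" "\<bar>b\<bar> \<le> ?\<delta>" unfolding a_def b_def by (rule sin_cos_first_order)+
  have nD: "nv (ap D x) \<le> ?\<delta> * fr_sum p * nv x" for x
  proof -
    have "nv (ap D x) \<le> \<bar>a\<bar> * nv (ap ?Y x) + \<bar>b\<bar> * nv (ap ?W x)"
      unfolding apD using nv_add[of "\<lambda>i. of_real a * ap ?Y x i" "\<lambda>i. of_real b * ap ?W x i"] by (simp add: nv_mult)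
    also have "\<dots> \<le> ?\<delta> * (fr ?Y * nv x) + ?\<delta> * (fr ?W * nv x)" using ab by (intro add_mono mult_mono nv_ap_fr) auto
    finally show ?thesis by (simp add: fr_sum_def algebra_simps)
  qed
  have c0: "0 \<le> ?\<delta> * fr_sum p" using fr_sum_nonneg by simp
  have "nv (rs z A' (ap D (rs z A (ap D u)))) \<le> (?\<delta> * fr_sum p * ((?\<delta> * fr_sum p * (1 / ?y)) / ?y)) / ?y"
  proof -
    have 1: "nv (rs z A (ap D u)) \<le> (?\<delta> * fr_sum p * (1 / ?y)) / ?y"
      using order.trans[OF rs_bound[OF sa(1) z0(1)] divide_right_mono[OF order.trans[OF nD mult_left_mono[OF nu(1) c0]] abs_ge_zero]] z0(3) by simp
    show ?thesis
      using order.trans[OF rs_bound[OF sa(2) z0(1)] divide_right_mono[OF order.trans[OF nD mult_left_mono[OF 1 c0]] abs_ge_zero]] z0(3) by simp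
  qed
  then have T3: "cmod (ip (rs z A' (ap D (rs z A (ap D u)))) v) \<le> (?\<delta> * fr_sum p * ((?\<delta> * fr_sum p * (1 / ?y)) / ?y)) / ?y * 1"
    by (rule norm_ip_le) (simp add: wv)
  have cm: "cmod (of_real c * x) \<le> k * l" if "\<bar>c\<bar> \<le> k" "cmod x \<le> l" for c k l x
    using mult_mono[OF that] that(1) by (simp add: norm_mult)
  have "cmod (of_real (a - (t - s) * cos s) * ip (ap ?Y u) t' + of_real (b + (t - s) * sin s) * ip (ap ?W u) t' + ip (rs z A' (ap D (rs z A (ap D u)))) v)
    \<le> (t - s)\<^sup>2 * (fr ?Y / ?y\<^sup>2) + (t - s)\<^sup>2 * (fr ?W / ?y\<^sup>2) + (?\<delta> * fr_sum p * ((?\<delta> * fr_sum p * (1 / ?y)) / ?y)) / ?y * 1"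
    unfolding a_def b_def by (rule norm_triangle_mono[OF norm_triangle_mono[OF cm[OF _ T] cm[OF _ T]] T3[unfolded a_def b_def]]) (rule sin_cos_first_order)+
  also have "\<dots> = (fr_sum p / ?y\<^sup>2 + (fr_sum p)\<^sup>2 / ?y ^ 3) * (t - s)\<^sup>2"
  proof -
    have "?\<delta> * ?\<delta> = (t - s)\<^sup>2" by (simp add: power2_eq_square)
    then have "(?\<delta> * fr_sum p * ((?\<delta> * fr_sum p * (1 / ?y)) / ?y)) / ?y * 1 = (t - s)\<^sup>2 * ((fr_sum p)\<^sup>2 / ?y ^ 3)"
      by (simp add: power2_eq_square power3_eq_cube mult_ac)
    then show ?thesis by (simp add: fr_sum_def algebra_simps add_divide_distrib)
  qed
  finally show ?thesis
    unfolding e1[symmetric] trip_eq[OF sa(1)[unfolded A_def] z0(1)] by (simp add: defs)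
qed

lemma path_form_derivative: "(path_form has_vector_derivative path_deriv s) (at s)"
proof (rule has_vector_derivative_quadratic[of 1])
  fix t :: real
  let ?f = "\<lambda>t p. ip (rs z (rot_mat t p) w) v" and ?y = "Im z"
  let ?g = "\<lambda>p. of_real (cos s) * trip z (rot_mat s p) (Y (fst p)) w v - of_real (sin s) * trip z (rot_mat s p) (W (snd p)) w v"
  have ig: "integrable P ?g" using trip_P_integrable by simp
  have ih: "integrable P (\<lambda>p. ?f t p - ?f s p - of_real (t - s) * ?g p)"
    by (intro Bochner_Integration.integrable_diff integrable_mult_right ig path_form_integrable)
  have ik: "integrable P (\<lambda>p. fr_sum p / ?y\<^sup>2 + (fr_sum p)\<^sup>2 / ?y ^ 3)" using fr_P_integrable by simp
  have "path_deriv s = (\<integral>p. ?g p \<partial>P)" unfolding path_deriv_def using trip_P_integrable by simp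
  then have "path_form t - path_form s - (t - s) *\<^sub>R path_deriv s = (\<integral>p. ?f t p - ?f s p - of_real (t - s) * ?g p \<partial>P)"
    unfolding path_form_def using path_form_integrable ig by (simp add: scaleR_conv_of_real del: of_real_diff)
  moreover have "norm (\<integral>p. ?f t p - ?f s p - of_real (t - s) * ?g p \<partial>P) \<le> (\<integral>p. (fr_sum p / ?y\<^sup>2 + (fr_sum p)\<^sup>2 / ?y ^ 3) * (t - s)\<^sup>2 \<partial>P)"
    by (rule order.trans[OF integral_norm_bound integral_mono[OF integrable_norm[OF ih] integrable_mult_left[OF ik]]]) (rule expansion_pointwise)
  ultimately show "norm (path_form t - path_form s - (t - s) *\<^sub>R path_deriv s) \<le> (\<integral>p. fr_sum p / ?y\<^sup>2 + (fr_sum p)\<^sup>2 / ?y ^ 3 \<partial>P) * (t - s)\<^sup>2" by simp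
qed simp

text \<open>Mean value inequality over an interval of length \<pi> / 2, which is rounded up to
  2.\<close>

lemma path_form_difference:
  assumes r: "2 * S.r \<le> Im z"
  shows "cmod (path_form (pi / 2) - path_form 0) \<le> 2 * (128 * S.r * S.sg / (Im z)^4 + 32 * S.r\<^sup>2 / Im z ^ 3)" (is "_ \<le> 2 * ?E")
proof -
  have "norm (path_form (pi / 2) - path_form 0) \<le> ?E * norm (pi / 2 - 0)"
  proof (rule differentiable_bound[of "{0..pi/2}"])
    show "(path_form has_derivative (\<lambda>h. h *\<^sub>R path_deriv s)) (at s within {0..pi/2})" for s
      using path_form_derivative[of s] unfolding has_vector_derivative_def by (rule has_derivative_at_withinI)
    show "onorm (\<lambda>h. h *\<^sub>R path_deriv s) \<le> ?E" if "s \<in> {0..pi/2}" for s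
    proof (rule onorm_le)
      fix h show "norm (h *\<^sub>R path_deriv s) \<le> ?E * norm h"
        using that mult_left_mono[OF path_deriv_bound[OF r, of s] abs_ge_zero[of h]] by (simp add: mult.commute)
    qed
  qed auto
  also have "\<dots> \<le> ?E * 2" using pi_less_4 z S.r_nonneg S.sg_nonneg by (intro mult_left_mono) auto
  finally show ?thesis by simp
qed

lemma path_form_end: "path_form (pi / 2) = (\<integral>x. ip (rs z (lin Z0 1 (Y x)) w) v \<partial>M)" "path_form 0 = (\<integral>g. ip (rs z (lin Z0 1 (W g)) w) v \<partial>N)"
proof -
  have X: "rot_mat (pi / 2) p = lin Z0 1 (Y (fst p))" "rot_mat 0 p = lin Z0 1 (W (snd p))" for p
    unfolding rot_mat_def lin_def by (auto intro!: eq_matI)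
  have m: "(\<lambda>x. ip (rs z (lin Z0 1 (Y x)) w) v) \<in> borel_measurable M" "(\<lambda>g. ip (rs z (lin Z0 1 (W g)) w) v) \<in> borel_measurable N"
    by (intro ip_measurable lin_rs_mv Z0 Y H.Gt_mm H.Gt_sa mv_const z0; assumption)+
  show "path_form (pi / 2) = (\<integral>x. ip (rs z (lin Z0 1 (Y x)) w) v \<partial>M)" unfolding path_form_def X
    by (rule pair_fst_integrable(2)[OF S.prob_M H.prob_N m(1)])
  show "path_form 0 = (\<integral>g. ip (rs z (lin Z0 1 (W g)) w) v \<partial>N)" unfolding path_form_def X
    by (rule pair_snd_integrable(2)[OF S.prob_M H.prob_N m(2)])
qed

text \<open>Comparison with the deterministic resolvent of \<open>Z0\<close>: one resolvent step
  costs the mean norm of \<open>X k\<close> applied to a fixed vector of norm at most 1 / y. Used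
  for \<open>Y\<close> and for \<open>W\<close>, this gives the two bounds that hold for every
  y.\<close>

lemma resolvent_shift_bound:
  assumes "prob_space K" and X: "sqi K X" "\<And>k. k \<in> space K \<Longrightarrow> self_adjoint d (X k)"
    and sq: "\<And>x. (\<integral>k. (nv (ap (X k) x))\<^sup>2 \<partial>K) \<le> S.sg * (nv x)\<^sup>2"
  shows "cmod ((\<integral>k. ip (rs z (lin Z0 1 (X k)) w) v \<partial>K) - ip (rs z Z0 w) v) \<le> sqrt S.sg / (Im z)\<^sup>2"
    "cmod (\<integral>k. ip (rs z (lin Z0 1 (X k)) w) v \<partial>K) \<le> 1 / Im z"
proof -
  interpret K: prob_space K by fact
  let ?u = "rs z Z0 w" and ?y = "Im z" and ?f = "\<lambda>k. ip (rs z (lin Z0 1 (X k)) w) v"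
  have sa: "self_adjoint d (lin Z0 1 (X k))" if "k \<in> space K" for k by (intro lin_sa Z0 X that)
  have mX: "mm K X" using X by (simp add: sqi_def)
  have "?f \<in> borel_measurable K" by (intro ip_measurable lin_rs_mv Z0 X mX mv_const z0)
  then have i: "integrable K ?f" by (rule K.integrable_const_bound[of _ "1 / ?y", rotated]) (intro AE_I2 ip_rs_bound sa)
  have "cmod (\<integral>k. ?f k \<partial>K) \<le> (\<integral>k. 1 / ?y \<partial>K)"
    by (rule order.trans[OF integral_norm_bound integral_mono[OF integrable_norm[OF i]]]) (simp, rule ip_rs_bound[OF sa])
  then show "cmod (\<integral>k. ?f k \<partial>K) \<le> 1 / ?y" by (simp add: K.prob_space)
  let ?n = "\<lambda>k. nv (ap (X k) ?u)"
  have nm: "?n \<in> borel_measurable K" by (intro nv_measurable mv_ap mX mv_const)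
  have fi: "integrable K (\<lambda>k. (fr (X k) * nv ?u)\<^sup>2)" using sqi_fr[OF X(1)] by (simp add: power_mult_distrib)
  have n2: "integrable K (\<lambda>k. (?n k)\<^sup>2)"
  proof (rule Bochner_Integration.integrable_bound[OF fi])
    show "(\<lambda>k. (?n k)\<^sup>2) \<in> borel_measurable K" using nm by measurable
    show "AE k in K. norm ((?n k)\<^sup>2) \<le> norm ((fr (X k) * nv ?u)\<^sup>2)" by (intro AE_I2) (simp add: power_mono nv_ap_fr)
  qed
  have n1: "integrable K ?n" by (rule K.square_integrable_imp_integrable[OF nm n2])
  \<comment> \<open>Jensen's inequality, in the form that a variance is nonnegative.\<close>
  have "(\<integral>k. ?n k \<partial>K)\<^sup>2 \<le> (\<integral>k. (?n k)\<^sup>2 \<partial>K)"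
    using K.variance_eq[OF n1 n2] K.variance_positive[of ?n] by simp
  also have "\<dots> \<le> S.sg * (nv ?u)\<^sup>2" by (rule sq)
  also have "\<dots> \<le> S.sg * (1 / ?y)\<^sup>2"
    using rs_bound[OF Z0 z0(1), of w] wv z0(3) by (intro mult_left_mono power_mono S.sg_nonneg) auto
  finally have "(\<integral>k. ?n k \<partial>K) \<le> sqrt (S.sg * (1 / ?y)\<^sup>2)" by (rule real_le_rsqrt)
  then have E: "(\<integral>k. ?n k \<partial>K) \<le> sqrt S.sg / ?y" using z by (simp add: real_sqrt_mult real_sqrt_divide)
  have pw: "cmod (?f k - ip ?u v) \<le> ?n k / ?y" if k: "k \<in> space K" for k
  proof -
    have "rs z (lin Z0 1 (X k)) w = (\<lambda>i. ?u i + 1 * rs z (lin Z0 1 (X k)) (ap (X k) ?u) i)"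
      by (rule resolvent_identity[OF sa[OF k] Z0 z0(1)]) (simp add: lin_def)
    then have "?f k = ip ?u v + ip (rs z (lin Z0 1 (X k)) (ap (X k) ?u)) v" by (simp add: ip_simps)
    moreover have "cmod (ip (rs z (lin Z0 1 (X k)) (ap (X k) ?u)) v) \<le> ?n k / \<bar>?y\<bar> * 1"
      by (rule norm_ip_le[OF rs_bound[OF sa[OF k] z0(1)]]) (simp add: wv)
    ultimately show ?thesis using z0(3) by simp
  qed
  have "(\<integral>k. ?f k \<partial>K) - ip ?u v = (\<integral>k. ?f k - ip ?u v \<partial>K)" using i by (simp add: K.prob_space)
  also have "cmod \<dots> \<le> (\<integral>k. ?n k / ?y \<partial>K)"
    by (rule order.trans[OF integral_norm_bound integral_mono]) (use i n1 pw in auto)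
  also have "\<dots> \<le> sqrt S.sg / ?y / ?y" using divide_right_mono[OF E, of ?y] z by simp
  finally show "cmod ((\<integral>k. ?f k \<partial>K) - ip ?u v) \<le> sqrt S.sg / ?y\<^sup>2" by (simp add: power2_eq_square)
qed

text \<open>If \<sigma> \<le> R then \<tau> dominates \<sigma>. Otherwise \<tau> dominates R, and
  for y > 2 \<tau> the interpolation estimate is available; the constant is 96 = 256 / 4 + 64 / 2,
  from \<open>e1\<close> and \<open>e2\<close>.\<close>

theorem resolvent_form_difference:
  "cmod ((\<integral>x. ip (rs z (lin Z0 1 (Y x)) w) v \<partial>M) - (\<integral>g. ip (rs z (lin Z0 1 (W g)) w) v \<partial>N))
    \<le> 96 * (S.r powr (1/10) * sqrt S.sg powr (9/10)) / (Im z)\<^sup>2" (is "cmod (?a - ?b) \<le> _")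
proof -
  let ?r = S.r and ?\<sigma> = "sqrt S.sg" and ?y = "Im z"
  define \<tau> where "\<tau> = ?r powr (1/10) * ?\<sigma> powr (9/10)"
  have \<sigma>: "0 \<le> ?\<sigma>" using S.sg_nonneg by simp
  have r: "0 \<le> ?r" by (rule S.r_nonneg)
  have \<tau>0: "0 \<le> \<tau>" by (simp add: \<tau>_def)
  have pw: "x powr (1/10) * x powr (9/10) = x" if "0 \<le> x" for x :: real using that by (simp flip: powr_add)
  note bY = resolvent_shift_bound[OF S.prob_M Y(1,3) S.sum_square_bound(1)]
  note bW = resolvent_shift_bound[OF H.prob_N H.Gt_sqi H.Gt_sa gaussian_square_bound]
  have 1: "cmod (?a - ?b) \<le> 2 / ?y" using norm_triangle_le_diff[OF add_mono[OF bY(2) bW(2)]] by simp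
  have 2: "cmod (?a - ?b) \<le> 2 * ?\<sigma> / ?y\<^sup>2"
    using norm_triangle_le_diff[OF add_mono[OF bY(1) bW(1)]] by simp
  have "cmod (?a - ?b) \<le> 96 * \<tau> / ?y\<^sup>2"
  proof (cases "?\<sigma> \<le> ?r")
    case True
    have "?\<sigma> = ?\<sigma> powr (1/10) * ?\<sigma> powr (9/10)" using pw[OF \<sigma>] by simp
    also have "\<dots> \<le> \<tau>" unfolding \<tau>_def using True \<sigma> by (intro mult_right_mono powr_mono2) auto
    finally have "2 * ?\<sigma> / ?y\<^sup>2 \<le> 96 * \<tau> / ?y\<^sup>2" using \<tau>0 by (intro divide_right_mono) auto
    then show ?thesis using 2 by linarith
  next
    case False
    have r\<tau>: "?r \<le> \<tau>"
    proof -
      have "?r = ?r powr (1/10) * ?r powr (9/10)" using pw[OF r] by simp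
      also have "\<dots> \<le> \<tau>" unfolding \<tau>_def using False r by (intro mult_left_mono powr_mono2) auto
      finally show ?thesis .
    qed
    show ?thesis
    proof (cases "?y \<le> 2 * \<tau>")
      case True
      have "2 / ?y = 2 * ?y / ?y\<^sup>2" using z by (simp add: power2_eq_square)
      also have "\<dots> \<le> 96 * \<tau> / ?y\<^sup>2" using True \<tau>0 by (intro divide_right_mono) auto
      finally show ?thesis using 1 by linarith
    next
      case y: False
      \<comment> \<open>A share R^(7/10) of R is exchanged for \<sigma>^(7/10), which is larger
        since R < \<sigma>; the product R^(3/10) \<sigma>^(27/10) is \<tau>^3.\<close>
      have c: "?r * ?\<sigma>\<^sup>2 \<le> \<tau> ^ 3"
      proof (cases "?r = 0")
        case False
        then have r0: "0 < ?r" using r by simp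
        then have s0: "0 < ?\<sigma>" using \<open>\<not> ?\<sigma> \<le> ?r\<close> by linarith
        have "?r * ?\<sigma>\<^sup>2 = ?r powr (3/10) * ?r powr (7/10) * ?\<sigma> powr 2" using r0 s0 by (simp flip: powr_add)
        also have "\<dots> \<le> ?r powr (3/10) * ?\<sigma> powr (7/10) * ?\<sigma> powr 2"
          using \<open>\<not> ?\<sigma> \<le> ?r\<close> r0 by (intro mult_right_mono mult_left_mono powr_mono2) auto
        also have "\<dots> = ?r powr (3/10) * ?\<sigma> powr (27/10)" by (simp add: mult.assoc flip: powr_add)
        also have "\<dots> = \<tau> ^ 3" using r0 s0 by (simp add: \<tau>_def power_mult_distrib powr_powr flip: powr_numeral)
        finally show ?thesis .
      qed (use \<tau>0 in simp)
      have e1: "?r * ?\<sigma>\<^sup>2 / ?y\<^sup>2 \<le> \<tau> / 4"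
      proof -
        have "4 * \<tau>\<^sup>2 \<le> ?y\<^sup>2" using power_mono[of "2 * \<tau>" ?y 2] y \<tau>0 by (simp add: power_mult_distrib)
        from mult_left_mono[OF this \<tau>0] have "4 * \<tau> ^ 3 \<le> \<tau> * ?y\<^sup>2" by (simp add: power2_eq_square power3_eq_cube)
        then show ?thesis using c z by (simp add: field_simps)
      qed
      have e2: "?r\<^sup>2 / ?y \<le> \<tau> / 2"
      proof -
        have "?r\<^sup>2 \<le> \<tau>\<^sup>2" using r r\<tau> by (intro power_mono)
        moreover have "\<tau> * (2 * \<tau>) \<le> \<tau> * ?y" using y \<tau>0 by (intro mult_left_mono) auto
        ultimately show ?thesis using z by (simp add: field_simps power2_eq_square)
      qed
      have "cmod (?a - ?b) \<le> 2 * (128 * ?r * S.sg / ?y^4 + 32 * ?r\<^sup>2 / ?y ^ 3)"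
        using path_form_difference y r\<tau> unfolding path_form_end by simp
      also have "\<dots> = (256 * (?r * ?\<sigma>\<^sup>2 / ?y\<^sup>2) + 64 * (?r\<^sup>2 / ?y)) / ?y\<^sup>2"
        unfolding real_sqrt_pow2[OF S.sg_nonneg] using z by (simp add: field_simps power2_eq_square power3_eq_cube power4_eq_xxxx)
      also have "\<dots> \<le> (256 * (\<tau> / 4) + 64 * (\<tau> / 2)) / ?y\<^sup>2" using e1 e2 by (intro divide_right_mono) auto
      finally show ?thesis by simp
    qed
  qed
  then show ?thesis by (simp add: \<tau>_def)
qed

end

end

section \<open>Functions of random matrices\<close>

lemma has_field_derivative_quadratic:
  fixes F :: "complex \<Rightarrow> complex"
  assumes "\<delta> > 0" and q: "\<And>z. cmod (z - s) \<le> \<delta> \<Longrightarrow> cmod (F z - F s - (z - s) * D) \<le> K * (cmod (z - s))\<^sup>2"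
  shows "(F has_field_derivative D) (at s)"
  unfolding has_field_derivative_iff
proof (rule LIM_zero_cancel, rule Lim_null_comparison)
  have "eventually (\<lambda>z. dist z s < \<delta> \<and> z \<noteq> s) (at s)" using assms(1) by (auto simp: eventually_at)
  then show "eventually (\<lambda>z. norm ((F z - F s) / (z - s) - D) \<le> K * cmod (z - s)) (at s)"
  proof eventually_elim
    case (elim z)
    then have n: "0 < cmod (z - s)" "cmod (z - s) \<le> \<delta>" by (auto simp: dist_norm)
    have "(F z - F s) / (z - s) - D = (F z - F s - (z - s) * D) / (z - s)" using n by (simp add: field_simps)
    then have "norm ((F z - F s) / (z - s) - D) \<le> K * (cmod (z - s))\<^sup>2 / cmod (z - s)"
      using q[OF n(2)] n(1) by (simp add: norm_divide divide_right_mono)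
    then show ?case using n(1) by (simp add: power2_eq_square)
  qed
  show "((\<lambda>z. K * cmod (z - s)) \<longlongrightarrow> 0) (at s)" by (auto intro!: tendsto_eq_intros)
qed

lemma is_weak_deriv_cnj:
  assumes "is_weak_deriv k f g" shows "is_weak_deriv k (\<lambda>x. cnj (f x)) (\<lambda>x. cnj (g x))"
  unfolding is_weak_deriv_def
proof (intro conjI allI impI)
  show "integrable lborel (\<lambda>x. cnj (g x))" using assms by (simp add: is_weak_deriv_def)
  fix \<psi> assume "test_function \<psi>"
  then have "(\<integral>x. complex_of_real ((deriv ^^ k) \<psi> x) * f x \<partial>lborel) = (-1) ^ k * (\<integral>x. complex_of_real (\<psi> x) * g x \<partial>lborel)"
    using assms by (simp add: is_weak_deriv_def)
  from arg_cong[OF this, of cnj] have "cnj (\<integral>x. complex_of_real ((deriv ^^ k) \<psi> x) * f x \<partial>lborel) = (-1) ^ k * cnj (\<integral>x. complex_of_real (\<psi> x) * g x \<partial>lborel)" by simp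
  then show "(\<integral>x. complex_of_real ((deriv ^^ k) \<psi> x) * cnj (f x) \<partial>lborel) = (-1) ^ k * (\<integral>x. complex_of_real (\<psi> x) * cnj (g x) \<partial>lborel)"
    by (simp flip: Bochner_Integration.integral_cnj)
qed

context dim
begin

text \<open>The second term equals the form at the conjugate of z, but it is expressed by a form at
  z with w and v exchanged. Thus only resolvent forms in the upper half-plane occur, to which
  \<open>halfplane_function\<close> applies.\<close>

definition pois :: "complex \<Rightarrow> complex mat \<Rightarrow> (nat \<Rightarrow> complex) \<Rightarrow> (nat \<Rightarrow> complex) \<Rightarrow> complex" where
  "pois z A w v = \<i> / 2 * (ip (rs z A w) v - cnj (ip (rs z A v) w))"

text \<open>The same coefficients \<alpha> and eigenvalues serve every \<open>\<phi>\<close> and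
  every point of the half-plane, which reduces limits for matrices to scalar Poisson
  integrals.\<close>

lemma pois_spectral:
  assumes A: "self_adjoint d A"
  obtains \<alpha> :: "nat \<Rightarrow> complex" and l :: "nat \<Rightarrow> real"
  where "\<And>\<phi>. ip (ap (fun_calc d \<phi> A) w) v = (\<Sum>m<d. \<alpha> m * \<phi> (l m))"
    and "\<And>x y. 0 < y \<Longrightarrow> pois (Complex x y) A w v = (\<Sum>m<d. \<alpha> m * of_real (y / ((x - l m)\<^sup>2 + y\<^sup>2)))"
proof (rule spectral_decomposition[OF A])
  fix e :: "nat \<Rightarrow> nat \<Rightarrow> complex" and l :: "nat \<Rightarrow> real"
  assume f: "\<And>\<phi> i j. i < d \<Longrightarrow> j < d \<Longrightarrow> fun_calc d \<phi> A $$ (i, j) = (\<Sum>m<d. e m i * \<phi> (l m) * cnj (e m j))"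
    and r: "\<And>z i j. Im z \<noteq> 0 \<Longrightarrow> i < d \<Longrightarrow> j < d \<Longrightarrow> resolvent d z A $$ (i, j) = (\<Sum>m<d. e m i * (1 / (z - of_real (l m))) * cnj (e m j))"
  have g: "ip (ap B w) v = (\<Sum>m<d. (ip (e m) v * ip w (e m)) * b m)"
    if "\<And>i j. i < d \<Longrightarrow> j < d \<Longrightarrow> B $$ (i, j) = (\<Sum>m<d. e m i * b m * cnj (e m j))" for B b w v
  proof -
    have "ip (ap B w) v = (\<Sum>i<d. \<Sum>j<d. \<Sum>m<d. e m i * b m * cnj (e m j) * w j * cnj (v i))"
      by (auto simp: ip_def ap_def that sum_distrib_right intro!: sum.cong)
    also have "\<dots> = (\<Sum>i<d. \<Sum>m<d. \<Sum>j<d. e m i * b m * cnj (e m j) * w j * cnj (v i))"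
      by (intro sum.cong refl sum.swap)
    also have "\<dots> = (\<Sum>m<d. \<Sum>i<d. \<Sum>j<d. e m i * b m * cnj (e m j) * w j * cnj (v i))" by (rule sum.swap)
    also have "\<dots> = (\<Sum>m<d. (ip (e m) v * ip w (e m)) * b m)"
      unfolding ip_def sum_product by (intro sum.cong refl) (simp add: sum_distrib_left sum_distrib_right mult_ac)
    finally show ?thesis .
  qed
  show thesis
  proof (rule that[of "\<lambda>m. ip (e m) v * ip w (e m)" l])
    show "ip (ap (fun_calc d \<phi> A) w) v = (\<Sum>m<d. ip (e m) v * ip w (e m) * \<phi> (l m))" for \<phi> by (rule g[OF f])
    fix x y :: real assume y: "0 < y"
    let ?z = "Complex x y"
    have z: "Im ?z \<noteq> 0" using y by simp
    have R: "ip (ap (resolvent d ?z A) w') v' = (\<Sum>m<d. ip (e m) v' * ip w' (e m) * (1 / (?z - of_real (l m))))" for w' v'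
      by (rule g) (rule r[OF z])
    have c: "cnj (ip (e m) w * ip v (e m) * (1 / (?z - of_real (l m)))) = ip (e m) v * ip w (e m) * (1 / cnj (?z - of_real (l m)))" for m
      by (simp add: ip_cnj[symmetric, of w] ip_cnj[symmetric, of "e m" v] mult_ac)
    \<comment> \<open>The factor \<open>\<i> / 2\<close> turns the difference of a number and its
      conjugate into minus its imaginary part, and the imaginary part of 1 / (z - t) is - y / ((x -
      t)^2 + y^2).\<close>
    have k: "\<i> / 2 * (1 / (?z - of_real t) - 1 / cnj (?z - of_real t)) = of_real (y / ((x - t)\<^sup>2 + y\<^sup>2))" for t
    proof -
      have s: "(x - t)\<^sup>2 + y\<^sup>2 \<noteq> 0" using y by (simp add: sum_power2_eq_zero_iff)
      have n: "?z - of_real t = Complex (x - t) y" by (simp add: complex_eq_iff)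
      have p: "Complex (x - t) y * cnj (Complex (x - t) y) = of_real ((x - t)\<^sup>2 + y\<^sup>2)" by (simp add: complex_mult_cnj)
      have n0: "Complex (x - t) y \<noteq> 0" "cnj (Complex (x - t) y) \<noteq> 0" using y by (auto simp: complex_eq_iff)
      have "1 / Complex (x - t) y - 1 / cnj (Complex (x - t) y) = (cnj (Complex (x - t) y) - Complex (x - t) y) / (Complex (x - t) y * cnj (Complex (x - t) y))"
        using n0 by (simp add: field_simps)
      also have "\<dots> = (- 2 * \<i> * of_real y) / of_real ((x - t)\<^sup>2 + y\<^sup>2)" unfolding p by (simp add: complex_eq_iff)
      finally show ?thesis unfolding n by simp
    qed
    have "pois ?z A w v = \<i> / 2 * ((\<Sum>m<d. ip (e m) v * ip w (e m) * (1 / (?z - of_real (l m)))) - (\<Sum>m<d. ip (e m) v * ip w (e m) * (1 / cnj (?z - of_real (l m)))))"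
      unfolding pois_def rs_def R cnj_sum c ..
    also have "\<dots> = (\<Sum>m<d. ip (e m) v * ip w (e m) * (\<i> / 2 * (1 / (?z - of_real (l m)) - 1 / cnj (?z - of_real (l m)))))"
      by (simp add: sum_subtractf[symmetric] sum_distrib_left right_diff_distrib mult_ac)
    finally show "pois ?z A w v = (\<Sum>m<d. ip (e m) v * ip w (e m) * of_real (y / ((x - l m)\<^sup>2 + y\<^sup>2)))" unfolding k .
  qed
qed

lemma poisson_kernel_integrable:
  fixes \<phi> :: "real \<Rightarrow> complex"
  assumes "integrable lborel \<phi>" "0 < y"
  shows "integrable lborel (\<lambda>x. \<phi> x * of_real (y / ((x - l)\<^sup>2 + y\<^sup>2)))"
proof (rule Bochner_Integration.integrable_bound)
  show "integrable lborel (\<lambda>x. norm (\<phi> x) * (1 / y))" using assms by simp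
  have [measurable]: "\<phi> \<in> borel_measurable borel" using assms by auto
  show "(\<lambda>x. \<phi> x * of_real (y / ((x - l)\<^sup>2 + y\<^sup>2))) \<in> borel_measurable lborel" by measurable
  have k: "\<bar>y / ((x - l)\<^sup>2 + y\<^sup>2)\<bar> \<le> 1 / y" for x
  proof -
    have "y / ((x - l)\<^sup>2 + y\<^sup>2) \<le> y / y\<^sup>2" using assms(2) by (intro divide_left_mono) (auto simp: sum_power2_gt_zero_iff intro!: mult_pos_pos)
    then show ?thesis using assms(2) by (simp add: power2_eq_square)
  qed
  show "AE x in lborel. norm (\<phi> x * of_real (y / ((x - l)\<^sup>2 + y\<^sup>2))) \<le> norm (norm (\<phi> x) * (1 / y))"
  proof (intro AE_I2)
    fix x
    have e: "norm (norm (\<phi> x) * (1 / y)) = norm (\<phi> x) * (1 / y)" using assms(2) by simp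
    show "norm (\<phi> x * of_real (y / ((x - l)\<^sup>2 + y\<^sup>2))) \<le> norm (norm (\<phi> x) * (1 / y))"
      unfolding e unfolding norm_mult norm_of_real by (rule mult_left_mono[OF k norm_ge_zero])
  qed
qed

lemma poisson_functional_calculus:
  assumes A: "self_adjoint d A" and \<phi>: "continuous_on UNIV \<phi>" "integrable lborel \<phi>" and Y: "\<And>n. Y n > 0" "Y \<longlonglongrightarrow> 0"
  shows "(\<lambda>n. \<integral>x. \<phi> x * pois (Complex x (Y n)) A w v \<partial>lborel) \<longlonglongrightarrow> pi * ip (ap (fun_calc d \<phi> A) w) v"
proof (rule pois_spectral[OF A, of w v])
  fix \<alpha> :: "nat \<Rightarrow> complex" and l :: "nat \<Rightarrow> real"
  assume f: "\<And>\<phi>. ip (ap (fun_calc d \<phi> A) w) v = (\<Sum>m<d. \<alpha> m * \<phi> (l m))"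
    and p: "\<And>x y. 0 < y \<Longrightarrow> pois (Complex x y) A w v = (\<Sum>m<d. \<alpha> m * of_real (y / ((x - l m)\<^sup>2 + y\<^sup>2)))"
  have "(\<integral>x. \<phi> x * pois (Complex x (Y n)) A w v \<partial>lborel) = (\<Sum>m<d. \<alpha> m * (\<integral>x. \<phi> x * of_real (Y n / ((x - l m)\<^sup>2 + (Y n)\<^sup>2)) \<partial>lborel))" for n
  proof -
    have "(\<integral>x. \<phi> x * pois (Complex x (Y n)) A w v \<partial>lborel) = (\<integral>x. (\<Sum>m<d. \<alpha> m * (\<phi> x * of_real (Y n / ((x - l m)\<^sup>2 + (Y n)\<^sup>2)))) \<partial>lborel)"
      unfolding p[OF Y(1)] by (simp add: sum_distrib_left mult_ac)
    also have "\<dots> = (\<Sum>m<d. \<integral>x. \<alpha> m * (\<phi> x * of_real (Y n / ((x - l m)\<^sup>2 + (Y n)\<^sup>2))) \<partial>lborel)"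
      by (intro Bochner_Integration.integral_sum integrable_mult_right poisson_kernel_integrable \<phi> Y)
    finally show ?thesis by (simp only: integral_mult_right_zero)
  qed
  then have "(\<lambda>n. \<integral>x. \<phi> x * pois (Complex x (Y n)) A w v \<partial>lborel) \<longlonglongrightarrow> (\<Sum>m<d. \<alpha> m * (pi * \<phi> (l m)))"
    by (simp only:) (intro tendsto_sum tendsto_mult tendsto_const poisson_limit \<phi> Y)
  then show ?thesis unfolding f by (simp add: sum_distrib_left mult_ac)
qed

end

text \<open>For \<open>h z = \<langle>(z - A)\<inverse> w, v\<rangle>\<close> and \<open>h'\<close> with \<open>w\<close> and \<open>v\<close> exchanged, the integrand is \<open>\<phi>\<close> times the Poisson kernel
  of \<open>A\<close>, which is the half-difference of the resolvents at \<open>z\<close> and at its conjugate.\<close>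

lemma poisson_line_bound:
  fixes h h' :: "complex \<Rightarrow> complex"
  assumes h: "halfplane_function h B" "halfplane_function h' B"
    and f: "integrable lborel f" "is_weak_deriv 0 f g0" "is_weak_deriv 3 f g3" and y: "0 < y" "y \<le> 1"
    and i: "integrable lborel (\<lambda>x. f x * h (Complex x y))" "integrable lborel (\<lambda>x. cnj (f x) * h' (Complex x y))"
  shows "cmod (\<integral>x. f x * (\<i> / 2 * (h (Complex x y) - cnj (h' (Complex x y)))) \<partial>lborel)
    \<le> 44 * B * ((\<integral>x. norm (g0 x) \<partial>lborel) + (\<integral>x. norm (g3 x) \<partial>lborel))"
proof -
  let ?a = "\<integral>x. f x * h (Complex x y) \<partial>lborel" and ?b = "\<integral>x. cnj (f x) * h' (Complex x y) \<partial>lborel"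
  have i': "integrable lborel (\<lambda>x. f x * cnj (h' (Complex x y)))" using integrable_cnj[OF i(2)] by simp
  have b: "(\<integral>x. f x * cnj (h' (Complex x y)) \<partial>lborel) = cnj ?b" by (simp flip: Bochner_Integration.integral_cnj)
  have "(\<integral>x. f x * (\<i> / 2 * (h (Complex x y) - cnj (h' (Complex x y)))) \<partial>lborel)
    = (\<integral>x. \<i> / 2 * (f x * h (Complex x y) - f x * cnj (h' (Complex x y))) \<partial>lborel)"
    by (intro Bochner_Integration.integral_cong refl) (simp add: algebra_simps)
  also have "\<dots> = \<i> / 2 * (?a - cnj ?b)" using i(1) i' by (simp flip: b)
  finally have e: "(\<integral>x. f x * (\<i> / 2 * (h (Complex x y) - cnj (h' (Complex x y)))) \<partial>lborel) = \<i> / 2 * (?a - cnj ?b)" .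
  have "cmod ?a \<le> 44 * B * ((\<integral>x. norm (g0 x) \<partial>lborel) + (\<integral>x. norm (g3 x) \<partial>lborel))"
    by (rule halfplane_function.line_integral_bound[OF h(1) f y])
  moreover have "cmod ?b \<le> 44 * B * ((\<integral>x. norm (g0 x) \<partial>lborel) + (\<integral>x. norm (g3 x) \<partial>lborel))"
    using halfplane_function.line_integral_bound[OF h(2) _ is_weak_deriv_cnj[OF f(2)] is_weak_deriv_cnj[OF f(3)] y] f(1) by simp
  moreover have "cmod (?a - cnj ?b) \<le> cmod ?a + cmod ?b" using norm_triangle_ineq4[of ?a "cnj ?b"] by simp
  ultimately show ?thesis unfolding e by (simp add: norm_mult)
qed

section \<open>Resolvent forms of a random matrix and the expectation of its functional
  calculus\<close>

locale random_matrix = dim d + prob_space K for d :: nat and K :: "'k measure" +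
  fixes X :: "'k \<Rightarrow> complex mat"
  assumes X: "mm K X" "\<And>k. k \<in> space K \<Longrightarrow> self_adjoint d (X k)"
begin

definition res_form :: "(nat \<Rightarrow> complex) \<Rightarrow> (nat \<Rightarrow> complex) \<Rightarrow> complex \<Rightarrow> complex" where
  "res_form w v z = (\<integral>k. ip (rs z (X k) w) v \<partial>K)"

context
  fixes w v :: "nat \<Rightarrow> complex"
  assumes wv: "nv w = 1" "nv v = 1"
begin

lemma ip_rs_le: "self_adjoint d A \<Longrightarrow> Im z \<noteq> 0 \<Longrightarrow> cmod (ip (rs z A w) v) \<le> 1 / \<bar>Im z\<bar>"
  using norm_ip_le[OF rs_bound order_refl, of A z w v] wv by simp

lemma res_form_bound: "Im z \<noteq> 0 \<Longrightarrow> cmod (res_form w v z) \<le> 1 / \<bar>Im z\<bar>"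
proof -
  assume z: "Im z \<noteq> 0"
  have "cmod (res_form w v z) \<le> (\<integral>k. 1 / \<bar>Im z\<bar> \<partial>K)"
    unfolding res_form_def by (intro order.trans[OF integral_norm_bound] integral_mono' ip_rs_le X z) auto
  then show ?thesis by (simp add: prob_space)
qed

lemma res_form_integrable: "Im z \<noteq> 0 \<Longrightarrow> integrable K (\<lambda>k. ip (rs z (X k) w) v)"
proof (rule integrable_const_bound[of _ "1 / \<bar>Im z\<bar>"])
  assume z: "Im z \<noteq> 0"
  show "(\<lambda>k. ip (rs z (X k) w) v) \<in> borel_measurable K" by (intro ip_measurable rs_mv X mv_const z)
  show "AE k in K. norm (ip (rs z (X k) w) v) \<le> 1 / \<bar>Im z\<bar>" by (intro AE_I2 ip_rs_le X z)
qed

text \<open>The resolvent identity in the spectral parameter, used twice, gives a quadratic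
  remainder whose constant is uniform over the sample space, so it can be integrated.\<close>

lemma res_form_holomorphic: "res_form w v holomorphic_on {z. 0 < Im z}"
proof -
  have "\<exists>D. (res_form w v has_field_derivative D) (at s)" if s: "0 < Im s" for s
  proof -
    let ?y = "Im s" and ?g = "\<lambda>k. - ip (rs s (X k) (rs s (X k) w)) v"
    have s0: "Im s \<noteq> 0" using s by simp
    have gi: "integrable K ?g"
    proof (rule integrable_const_bound[of _ "1 / ?y / ?y * 1"])
      show "?g \<in> borel_measurable K" by (intro borel_measurable_uminus ip_measurable rs_mv X mv_const s0)
      show "AE k in K. norm (?g k) \<le> 1 / ?y / ?y * 1"
      proof (intro AE_I2)
        fix k assume "k \<in> space K"
        note b = rs_bound[OF X(2)[OF this] s0]
        have "nv (rs s (X k) (rs s (X k) w)) \<le> 1 / \<bar>?y\<bar> / \<bar>?y\<bar>"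
          using order.trans[OF b divide_right_mono[OF b abs_ge_zero], of w] wv by simp
        from norm_ip_le[OF this, of v 1] show "norm (?g k) \<le> 1 / ?y / ?y * 1" using s wv by simp
      qed
    qed
    have "(res_form w v has_field_derivative (\<integral>k. ?g k \<partial>K)) (at s)"
    proof (rule has_field_derivative_quadratic[of "?y / 2"])
      fix z assume "cmod (z - s) \<le> ?y / 2"
      then have z: "?y / 2 \<le> Im z" using abs_Im_le_cmod[of "z - s"] by simp
      then have z0: "Im z \<noteq> 0" using s by auto
      have ii: "integrable K (\<lambda>k. ip (rs z (X k) w) v - ip (rs s (X k) w) v - (z - s) * ?g k)"
        by (intro Bochner_Integration.integrable_diff integrable_mult_right gi res_form_integrable z0 s0)
      have "res_form w v z - res_form w v s - (z - s) * (\<integral>k. ?g k \<partial>K) = (\<integral>k. ip (rs z (X k) w) v - ip (rs s (X k) w) v - (z - s) * ?g k \<partial>K)"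
        unfolding res_form_def
        by (subst Bochner_Integration.integral_diff; (intro Bochner_Integration.integrable_diff integrable_mult_right gi res_form_integrable z0 s0)?)
          (subst Bochner_Integration.integral_diff; (intro res_form_integrable z0 s0)?; simp)
      also have "cmod \<dots> \<le> (\<integral>k. 2 / ?y ^ 3 * (cmod (z - s))\<^sup>2 \<partial>K)"
      proof (rule order.trans[OF integral_norm_bound integral_mono[OF integrable_norm[OF ii]]])
        fix k assume k: "k \<in> space K"
        let ?u = "rs s (X k) w" and ?t = "rs s (X k) (rs s (X k) w)"
        note b = rs_bound[OF X(2)[OF k] s0] and bz = rs_bound[OF X(2)[OF k] z0]
        have "rs z (X k) w = (\<lambda>i. ?u i + (s - z) * rs z (X k) ?u i)" "rs z (X k) ?u = (\<lambda>i. ?t i + (s - z) * rs z (X k) ?t i)"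
          by (rule resolvent_identity_shift[OF X(2)[OF k] z0 s0])+
        then have "ip (rs z (X k) w) v = ip ?u v + (s - z) * (ip ?t v + (s - z) * ip (rs z (X k) ?t) v)" by (simp add: ip_simps)
        then have "ip (rs z (X k) w) v - ip ?u v - (z - s) * ?g k = (z - s)\<^sup>2 * ip (rs z (X k) ?t) v"
          by (simp add: power2_eq_square algebra_simps)
        moreover have "cmod (ip (rs z (X k) ?t) v) \<le> 1 / ?y / ?y / (?y / 2) * 1"
        proof (rule norm_ip_le)
          have "nv ?t \<le> 1 / ?y / ?y"
            using order.trans[OF b divide_right_mono[OF b abs_ge_zero], of w] wv s by simp
          then have "nv (rs z (X k) ?t) \<le> 1 / ?y / ?y / \<bar>Im z\<bar>" by (intro order.trans[OF bz] divide_right_mono) auto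
          also have "\<dots> \<le> 1 / ?y / ?y / (?y / 2)" using z s by (intro divide_left_mono) auto
          finally show "nv (rs z (X k) ?t) \<le> 1 / ?y / ?y / (?y / 2)" .
        qed (simp add: wv)
        ultimately show "norm (ip (rs z (X k) w) v - ip ?u v - (z - s) * ?g k) \<le> 2 / ?y ^ 3 * (cmod (z - s))\<^sup>2"
          using mult_left_mono[of "cmod (ip (rs z (X k) ?t) v)" "1 / ?y / ?y / (?y / 2) * 1" "(cmod (z - s))\<^sup>2"]
          by (simp add: norm_mult norm_power power3_eq_cube mult_ac)
      qed simp
      finally show "cmod (res_form w v z - res_form w v s - (z - s) * (\<integral>k. ?g k \<partial>K)) \<le> 2 / ?y ^ 3 * (cmod (z - s))\<^sup>2" by (simp add: prob_space)
    qed (use s in simp)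
    then show ?thesis by blast
  qed
  then show ?thesis unfolding holomorphic_on_def field_differentiable_def by (metis DERIV_subset mem_Collect_eq subset_UNIV)
qed

text \<open>The constant comes from 1 / y \<le> 2 / y^2 for y \<le> 2. For a single form it serves
  domination only; the small constant belongs to differences of two forms.\<close>

lemma res_form_halfplane: "halfplane_function (res_form w v) 2"
proof
  show "res_form w v holomorphic_on {z. 0 < Im z}" by (rule res_form_holomorphic)
  fix z assume z: "0 < Im z" "Im z \<le> 2"
  have "1 / Im z \<le> 2 / (Im z)\<^sup>2" using z by (simp add: field_simps power2_eq_square)
  then show "cmod (res_form w v z) \<le> 2 / (Im z)\<^sup>2" using res_form_bound[of z] z by simp
qed

lemma pois_le: "self_adjoint d A \<Longrightarrow> 0 < y \<Longrightarrow> cmod (pois (Complex x y) A w v) \<le> 1 / y"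
proof -
  assume A: "self_adjoint d A" and y: "0 < y"
  have 1: "cmod (ip (rs (Complex x y) A w) v) \<le> 1 / y" using ip_rs_le[OF A, of "Complex x y"] y by simp
  have "cmod (ip (rs (Complex x y) A v) w) \<le> 1 / y"
    using norm_ip_le[OF rs_bound[OF A, of "Complex x y" v] order_refl, of w] y wv by simp
  then show ?thesis
    using norm_triangle_ineq4[of "ip (rs (Complex x y) A w) v" "cnj (ip (rs (Complex x y) A v) w)"] 1
    by (simp add: pois_def norm_mult)
qed

text \<open>Fubini on the product with Lebesgue measure; at a fixed height y the kernel is bounded
  by 1 / y and \<open>\<phi>\<close> is integrable.\<close>

lemma pois_expectation:
  fixes \<phi> :: "real \<Rightarrow> complex"
  assumes \<phi>: "integrable lborel \<phi>" and y: "0 < y"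
  shows "(\<integral>k. \<integral>x. \<phi> x * pois (Complex x y) (X k) w v \<partial>lborel \<partial>K) = (\<integral>x. \<phi> x * (\<integral>k. pois (Complex x y) (X k) w v \<partial>K) \<partial>lborel)"
    "(\<lambda>k. \<integral>x. \<phi> x * pois (Complex x y) (X k) w v \<partial>lborel) \<in> borel_measurable K"
    "integrable lborel (\<lambda>x. \<phi> x * res_form w v (Complex x y))"
proof -
  interpret Q: pair_sigma_finite K lborel ..
  let ?P = "K \<Otimes>\<^sub>M lborel"
  have \<phi>m: "\<phi> \<in> borel_measurable borel" using \<phi> by auto
  have mX: "mm ?P (\<lambda>q. X (fst q))" by (rule mm_compose[OF X(1) measurable_fst])
  have sX: "self_adjoint d (X (fst q))" if "q \<in> space ?P" for q using that by (auto simp: space_pair_measure intro: X)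
  have zm: "(\<lambda>q. Complex (snd q) y) \<in> borel_measurable ?P" unfolding Complex_eq by measurable
  have rm: "(\<lambda>q. ip (rs (Complex (snd q) y) (X (fst q)) a) b) \<in> borel_measurable ?P" for a b
    by (intro ip_measurable mv_rs mX sX zm mv_const) (use y in auto)
  have pm: "(\<lambda>q. \<phi> (snd q) * pois (Complex (snd q) y) (X (fst q)) w v) \<in> borel_measurable ?P"
    unfolding pois_def
    by (intro borel_measurable_times borel_measurable_diff borel_measurable_const cnj_measurable rm measurable_compose[OF measurable_snd]) (use \<phi>m in simp)
  have hm: "(\<lambda>q. \<phi> (snd q) * ip (rs (Complex (snd q) y) (X (fst q)) w) v) \<in> borel_measurable ?P"
    by (intro borel_measurable_times rm measurable_compose[OF measurable_snd]) (use \<phi>m in simp)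
  have fub: "integrable ?P (\<lambda>q. \<phi> (snd q) * g (snd q) (fst q))"
    if m: "(\<lambda>q. \<phi> (snd q) * g (snd q) (fst q)) \<in> borel_measurable ?P"
      and b: "\<And>x k. k \<in> space K \<Longrightarrow> cmod (g x k) \<le> 1 / y" for g :: "real \<Rightarrow> 'k \<Rightarrow> complex"
  proof -
    have le: "norm (\<phi> x * g x k) \<le> norm (norm (\<phi> x) * (1 / y))" if "k \<in> space K" for x k
      using mult_left_mono[OF b[OF that] norm_ge_zero[of "\<phi> x"], of x] y by (simp add: norm_mult)
    have int: "integrable lborel (\<lambda>x. \<phi> x * g x k)" if k: "k \<in> space K" for k
    proof (rule Bochner_Integration.integrable_bound)
      show "integrable lborel (\<lambda>x. norm (\<phi> x) * (1 / y))" using \<phi> by simp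
      show "(\<lambda>x. \<phi> x * g x k) \<in> borel_measurable lborel"
        using measurable_compose[OF measurable_Pair1'[OF k] m] by simp
      show "AE x in lborel. norm (\<phi> x * g x k) \<le> norm (norm (\<phi> x) * (1 / y))" by (intro AE_I2 le k)
    qed
    show ?thesis
    proof (rule Q.Fubini_integrable[OF m])
      have "(\<lambda>k. \<integral>x. norm (\<phi> x * g x k) \<partial>lborel) \<in> borel_measurable K"
      proof (rule lborel.borel_measurable_lebesgue_integral)
        show "(\<lambda>(k, x). norm (\<phi> x * g x k)) \<in> borel_measurable ?P"
          unfolding case_prod_beta' using measurable_compose[OF m borel_measurable_norm] by simp
      qed
      then show "integrable K (\<lambda>k. \<integral>x. norm (\<phi> (snd (k, x)) * g (snd (k, x)) (fst (k, x))) \<partial>lborel)"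
        unfolding fst_conv snd_conv
      proof (rule integrable_const_bound[of _ "\<integral>x. norm (\<phi> x) * (1 / y) \<partial>lborel", rotated])
        show "AE k in K. norm (\<integral>x. norm (\<phi> x * g x k) \<partial>lborel) \<le> (\<integral>x. norm (\<phi> x) * (1 / y) \<partial>lborel)"
        proof (intro AE_I2)
          fix k assume k: "k \<in> space K"
          have "(\<integral>x. norm (\<phi> x * g x k) \<partial>lborel) \<le> (\<integral>x. norm (\<phi> x) * (1 / y) \<partial>lborel)"
            by (rule integral_mono) (use int[OF k] \<phi> le[OF k] y in auto)
          then show "norm (\<integral>x. norm (\<phi> x * g x k) \<partial>lborel) \<le> (\<integral>x. norm (\<phi> x) * (1 / y) \<partial>lborel)" by simp
        qed
      qed
      show "AE k in K. integrable lborel (\<lambda>x. \<phi> (snd (k, x)) * g (snd (k, x)) (fst (k, x)))" using int by (intro AE_I2) simp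
    qed
  qed
  have ip1: "integrable ?P (\<lambda>(k, x). \<phi> x * pois (Complex x y) (X k) w v)"
    using fub[OF pm] pois_le[OF X(2) y] by (simp add: case_prod_beta')
  have "(\<integral>k. \<integral>x. \<phi> x * pois (Complex x y) (X k) w v \<partial>lborel \<partial>K) = (\<integral>x. \<integral>k. \<phi> x * pois (Complex x y) (X k) w v \<partial>K \<partial>lborel)"
    by (rule Q.Fubini_integral[OF ip1, symmetric])
  then show "(\<integral>k. \<integral>x. \<phi> x * pois (Complex x y) (X k) w v \<partial>lborel \<partial>K) = (\<integral>x. \<phi> x * (\<integral>k. pois (Complex x y) (X k) w v \<partial>K) \<partial>lborel)"
    by (simp only: integral_mult_right_zero)
  show "(\<lambda>k. \<integral>x. \<phi> x * pois (Complex x y) (X k) w v \<partial>lborel) \<in> borel_measurable K"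
    using borel_measurable_integrable[OF Q.integrable_fst[OF ip1]] by simp
  have hb: "cmod (ip (rs (Complex x y) (X k) w) v) \<le> 1 / y" if "k \<in> space K" for x k
    using ip_rs_le[OF X(2)[OF that], of "Complex x y"] y by simp
  have ih: "integrable ?P (\<lambda>(k, x). \<phi> x * ip (rs (Complex x y) (X k) w) v)"
    using fub[OF hm] hb by (simp add: case_prod_beta')
  show "integrable lborel (\<lambda>x. \<phi> x * res_form w v (Complex x y))"
    using Q.integrable_snd[OF ih] unfolding res_form_def by (simp only: integral_mult_right_zero)
qed

end

lemma pois_mean: "nv w = 1 \<Longrightarrow> nv v = 1 \<Longrightarrow> 0 < Im z \<Longrightarrow> (\<integral>k. pois z (X k) w v \<partial>K) = \<i> / 2 * (res_form w v z - cnj (res_form v w z))"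
  unfolding pois_def res_form_def using res_form_integrable[of w v z] res_form_integrable[of v w z]
  by (simp flip: Bochner_Integration.integral_cnj)

text \<open>Poisson integrals converge at every sample point; the question is domination, as
  boundedness of \<open>\<phi>\<close> is not given. It comes from the line estimate applied to each
  fixed matrix. Measurability of \<open>fun_calc d \<phi> (X k)\<close> in k results from the same
  limit.\<close>

theorem fun_calc_form_limit:
  assumes wv: "nv w = 1" "nv v = 1" and \<phi>: "continuous_on UNIV \<phi>" "integrable lborel \<phi>"
    and g: "is_weak_deriv 0 \<phi> g0" "is_weak_deriv 3 \<phi> g3" and Y: "\<And>n. 0 < Y n" "\<And>n. Y n \<le> 1" "Y \<longlonglongrightarrow> 0"
  shows "(\<lambda>n. \<integral>x. \<phi> x * (\<i> / 2 * (res_form w v (Complex x (Y n)) - cnj (res_form v w (Complex x (Y n))))) \<partial>lborel)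
      \<longlonglongrightarrow> pi * (\<integral>k. ip (ap (fun_calc d \<phi> (X k)) w) v \<partial>K)"
    "integrable K (\<lambda>k. ip (ap (fun_calc d \<phi> (X k)) w) v)"
proof -
  let ?S = "(\<integral>x. norm (g0 x) \<partial>lborel) + (\<integral>x. norm (g3 x) \<partial>lborel)"
  let ?s = "\<lambda>n k. \<integral>x. \<phi> x * pois (Complex x (Y n)) (X k) w v \<partial>lborel"
  let ?f = "\<lambda>k. pi * ip (ap (fun_calc d \<phi> (X k)) w) v"
  have lim: "(\<lambda>n. ?s n k) \<longlonglongrightarrow> ?f k" if "k \<in> space K" for k
    by (rule poisson_functional_calculus[OF X(2)[OF that] \<phi> Y(1,3)])
  have sm: "?s n \<in> borel_measurable K" for n by (rule pois_expectation(2)[OF wv \<phi>(2) Y(1)])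
  have fm: "?f \<in> borel_measurable K" by (rule borel_measurable_LIMSEQ_metric[OF sm lim])
  have b: "norm (?s n k) \<le> 44 * 2 * ?S" if k: "k \<in> space K" for n k
  proof -
    \<comment> \<open>The matrix at a fixed sample point is regarded as a constant random matrix,
      which makes the bound uniform in n and in the sample point.\<close>
    interpret A: random_matrix d K "\<lambda>_. X k"
      by unfold_locales (use X(2)[OF k] in \<open>auto intro!: mm_const self_adjoint_carrier\<close>)
    have h: "A.res_form a b = (\<lambda>z. ip (rs z (X k) a) b)" for a b by (rule ext) (simp add: A.res_form_def prob_space)
    note \<phi>c = integrable_cnj[OF \<phi>(2)]
    show ?thesis unfolding pois_def
      by (rule poisson_line_bound[OF A.res_form_halfplane[OF wv, unfolded h] A.res_form_halfplane[OF wv(2,1), unfolded h] \<phi>(2) g Y(1,2)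
        A.pois_expectation(3)[OF wv \<phi>(2) Y(1), unfolded h] A.pois_expectation(3)[OF wv(2,1) \<phi>c Y(1), unfolded h]])
  qed
  have i: "integrable K (\<lambda>k. 44 * 2 * ?S)" by simp
  have "integrable K ?f"
    by (rule integrable_dominated_convergence[OF fm sm i]) (use lim b in \<open>auto intro!: AE_I2\<close>)
  then have "integrable K (\<lambda>k. (1 / pi) * ?f k)" by (rule integrable_mult_right)
  then show "integrable K (\<lambda>k. ip (ap (fun_calc d \<phi> (X k)) w) v)" by simp
  have "(\<lambda>n. \<integral>k. ?s n k \<partial>K) \<longlonglongrightarrow> (\<integral>k. ?f k \<partial>K)"
    by (rule integral_dominated_convergence[OF fm sm i]) (use lim b in \<open>auto intro!: AE_I2\<close>)
  moreover have "(\<integral>k. ?s n k \<partial>K) = (\<integral>x. \<phi> x * (\<i> / 2 * (res_form w v (Complex x (Y n)) - cnj (res_form v w (Complex x (Y n))))) \<partial>lborel)" for n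
    unfolding pois_expectation(1)[OF wv \<phi>(2) Y(1)]
    by (intro Bochner_Integration.integral_cong refl arg_cong2[where f = "(*)"] pois_mean wv) (simp add: Y)
  ultimately show "(\<lambda>n. \<integral>x. \<phi> x * (\<i> / 2 * (res_form w v (Complex x (Y n)) - cnj (res_form v w (Complex x (Y n))))) \<partial>lborel)
      \<longlonglongrightarrow> pi * (\<integral>k. ip (ap (fun_calc d \<phi> (X k)) w) v \<partial>K)" by simp
qed

end

text \<open>The line estimate is applied to the difference of the two resolvent forms, with the
  constant \<open>B\<close>, before the height tends to 0.\<close>

lemma fun_calc_difference:
  assumes 1: "random_matrix d K X" and 2: "random_matrix d K' X'"
    and wv: "dim.nv d w = 1" "dim.nv d v = 1" and \<phi>: "continuous_on UNIV \<phi>" "integrable lborel \<phi>"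
    and g: "is_weak_deriv 0 \<phi> g0" "is_weak_deriv 3 \<phi> g3"
    and B: "\<And>z. 0 < Im z \<Longrightarrow> cmod (random_matrix.res_form d K X w v z - random_matrix.res_form d K' X' w v z) \<le> B / (Im z)\<^sup>2"
      "\<And>z. 0 < Im z \<Longrightarrow> cmod (random_matrix.res_form d K X v w z - random_matrix.res_form d K' X' v w z) \<le> B / (Im z)\<^sup>2"
  shows "cmod ((\<integral>k. dim.ip d (dim.ap d (fun_calc d \<phi> (X k)) w) v \<partial>K) - (\<integral>k. dim.ip d (dim.ap d (fun_calc d \<phi> (X' k)) w) v \<partial>K'))
    \<le> 44 * B * ((\<integral>x. norm (g0 x) \<partial>lborel) + (\<integral>x. norm (g3 x) \<partial>lborel))" (is "cmod (?a - ?b) \<le> ?R")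
proof -
  interpret A: random_matrix d K X by (rule 1)
  interpret B: random_matrix d K' X' by (rule 2)
  define Y where "Y n = 1 / real (Suc n)" for n
  have Y: "0 < Y n" "Y n \<le> 1" for n by (simp_all add: Y_def)
  have Y0: "Y \<longlonglongrightarrow> 0" unfolding Y_def[abs_def] by real_asymp
  note \<phi>c = integrable_cnj[OF \<phi>(2)]
  let ?h = "\<lambda>z. A.res_form w v z - B.res_form w v z" and ?h' = "\<lambda>z. A.res_form v w z - B.res_form v w z"
  let ?I = "\<lambda>n. \<integral>x. \<phi> x * (\<i> / 2 * (?h (Complex x (Y n)) - cnj (?h' (Complex x (Y n))))) \<partial>lborel"
  note iA = A.pois_expectation(3)[OF wv \<phi>(2) Y(1)] A.pois_expectation(3)[OF wv(2,1) \<phi>c Y(1)]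
  note iB = B.pois_expectation(3)[OF wv \<phi>(2) Y(1)] B.pois_expectation(3)[OF wv(2,1) \<phi>c Y(1)]
  have ii: "integrable lborel (\<lambda>x. \<phi> x * ?h (Complex x (Y n)))" "integrable lborel (\<lambda>x. cnj (\<phi> x) * ?h' (Complex x (Y n)))" for n
    unfolding right_diff_distrib using iA[of n] iB[of n] by auto
  have hp: "halfplane_function ?h B" "halfplane_function ?h' B"
    using B by (unfold_locales; auto intro!: holomorphic_on_diff A.res_form_holomorphic B.res_form_holomorphic wv)+
  have bd: "cmod (?I n) \<le> ?R" for n by (rule poisson_line_bound[OF hp \<phi>(2) g Y ii])
  have e: "?I n = (\<integral>x. \<phi> x * (\<i> / 2 * (A.res_form w v (Complex x (Y n)) - cnj (A.res_form v w (Complex x (Y n))))) \<partial>lborel)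
      - (\<integral>x. \<phi> x * (\<i> / 2 * (B.res_form w v (Complex x (Y n)) - cnj (B.res_form v w (Complex x (Y n))))) \<partial>lborel)" for n
  proof -
    have j: "integrable lborel (\<lambda>x. \<phi> x * (\<i> / 2 * (a x - cnj (b x))))"
      if "integrable lborel (\<lambda>x. \<phi> x * a x)" "integrable lborel (\<lambda>x. cnj (\<phi> x) * b x)" for a b :: "real \<Rightarrow> complex"
    proof -
      have "integrable lborel (\<lambda>x. \<i> / 2 * (\<phi> x * a x - \<phi> x * cnj (b x)))"
        using that(1) integrable_cnj[OF that(2)] by (intro integrable_mult_right Bochner_Integration.integrable_diff) auto
      then show ?thesis by (simp add: algebra_simps)
    qed
    show ?thesis
      unfolding Bochner_Integration.integral_diff[OF j[OF iA[of n]] j[OF iB[of n]], symmetric]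
      by (intro Bochner_Integration.integral_cong refl) (simp add: algebra_simps)
  qed
  have "?I \<longlonglongrightarrow> pi * ?a - pi * ?b"
    unfolding e by (intro tendsto_diff A.fun_calc_form_limit(1)[OF wv \<phi> g Y Y0] B.fun_calc_form_limit(1)[OF wv \<phi> g Y Y0])
  then have "(\<lambda>n. cmod (?I n)) \<longlonglongrightarrow> cmod (pi * ?a - pi * ?b)" by (rule tendsto_norm)
  then have "cmod (pi * ?a - pi * ?b) \<le> ?R" by (rule LIMSEQ_le_const2) (use bd in blast)
  moreover have "cmod (pi * ?a - pi * ?b) = pi * cmod (?a - ?b)" by (simp add: norm_mult flip: right_diff_distrib)
  \<comment> \<open>The factor \<pi> of the Poisson limit is bounded below by 1.\<close>
  moreover have "1 * cmod (?a - ?b) \<le> pi * cmod (?a - ?b)" using pi_gt3 by (intro mult_right_mono) auto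
  ultimately show ?thesis by simp
qed

section \<open>The bounds for a model\<close>

text \<open>Coordinate vectors have norm 1, so integrability and measurability of forms pass to
  entries.\<close>

lemma (in dim) entry_as_form: "i < d \<Longrightarrow> j < d \<Longrightarrow> A $$ (i, j) = ip (ap A (\<lambda>k. if k = j then 1 else 0)) (\<lambda>k. if k = i then 1 else 0)"
  by (simp add: ip_def ap_def if_distrib[of cnj] if_distrib[of "\<lambda>x. _ * x"] cong: if_cong)

lemma (in dim) expectation_difference_bound:
  assumes d: "0 < d" and C: "0 \<le> C"
    and i: "\<And>w v. nv w = 1 \<Longrightarrow> nv v = 1 \<Longrightarrow> integrable M (\<lambda>x. ip (ap (A x) w) v)" "\<And>w v. nv w = 1 \<Longrightarrow> nv v = 1 \<Longrightarrow> integrable N (\<lambda>x. ip (ap (B x) w) v)"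
    and b: "\<And>w v. nv w = 1 \<Longrightarrow> nv v = 1 \<Longrightarrow> cmod ((\<integral>x. ip (ap (A x) w) v \<partial>M) - (\<integral>x. ip (ap (B x) w) v \<partial>N)) \<le> C"
  shows "op_norm (mat_expectation d M A - mat_expectation d N B) \<le> C"
proof (rule op_norm_le_ip[OF d _ C])
  show "mat_expectation d M A - mat_expectation d N B \<in> carrier_mat d d" by (intro minus_carrier_mat) (simp add: mat_expectation_def)
  fix w v assume wv: "nv w = 1" "nv v = 1"
  have "integrable M (\<lambda>x. A x $$ (j, k))" "integrable N (\<lambda>x. B x $$ (j, k))" if "j < d" "k < d" for j k
    unfolding entry_as_form[OF that] by (intro i nv_delta that)+
  note e = ip_ap_expectation(1)[OF this(1)] ip_ap_expectation(1)[OF this(2)]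
  have "ap (mat_expectation d M A - mat_expectation d N B) w = (\<lambda>i. ap (mat_expectation d M A) w i + (-1) * ap (mat_expectation d N B) w i)"
    by (rule ap_lincomb) (simp add: mat_expectation_def)
  then have "ip (ap (mat_expectation d M A - mat_expectation d N B) w) v = ip (ap (mat_expectation d M A) w) v - ip (ap (mat_expectation d N B) w) v"
    by (simp only: ip_simps) simp
  then show "cmod (ip (ap (mat_expectation d M A - mat_expectation d N B) w) v) \<le> C"
    using b[OF wv] e by simp
qed

lemma sobolev_weak_derivs:
  assumes "\<phi> \<in> sobolev_W1 3"
  obtains g0 g3 where "integrable lborel \<phi>" "is_weak_deriv 0 \<phi> g0" "is_weak_deriv 3 \<phi> g3"
    "(\<integral>x. norm (g0 x) \<partial>lborel) + (\<integral>x. norm (g3 x) \<partial>lborel) \<le> sobolev_norm 3 \<phi>"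
proof -
  define g where "g i = (SOME g. is_weak_deriv i \<phi> g)" for i
  have g: "is_weak_deriv i \<phi> (g i)" if "i \<le> 3" for i
    using someI_ex[of "is_weak_deriv i \<phi>"] assms that by (simp add: g_def sobolev_W1_def)
  have "(\<Sum>i\<in>{0, 3}. \<integral>x. cmod (g i x) \<partial>lborel) \<le> (\<Sum>i\<le>3. \<integral>x. cmod (g i x) \<partial>lborel)" by (rule sum_mono2) auto
  then show thesis using that[of "g 0" "g 3"] g assms by (simp add: sobolev_norm_def g_def[symmetric] sobolev_W1_def)
qed

context comparison
begin

abbreviation "\<epsilon>\<^sub>0 \<equiv> S.r powr (1/10) * sqrt S.sg powr (9/10)"

lemma rm_X: "random_matrix d M (\<lambda>x. lin Z0 1 (Y x))" and rm_G: "random_matrix d N (\<lambda>g. lin Z0 1 (W g))"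
  by (auto simp: random_matrix_def random_matrix_axioms_def S.prob_M H.prob_N intro!: lin_mm lin_sa Y H.Gt_mm H.Gt_sa Z0)

lemma resolvent_bound:
  assumes z: "0 < Im z"
  shows "op_norm (mat_expectation d M (\<lambda>x. resolvent d z (lin Z0 1 (Y x))) - mat_expectation d N (\<lambda>g. resolvent d z (lin Z0 1 (W g)))) \<le> 96 * \<epsilon>\<^sub>0 / (Im z)\<^sup>2"
proof (rule expectation_difference_bound[OF S.d0])
  fix w v assume wv: "nv w = 1" "nv v = 1"
  show "integrable M (\<lambda>x. ip (ap (resolvent d z (lin Z0 1 (Y x))) w) v)" "integrable N (\<lambda>g. ip (ap (resolvent d z (lin Z0 1 (W g))) w) v)"
    using random_matrix.res_form_integrable[OF rm_X wv, of z] random_matrix.res_form_integrable[OF rm_G wv, of z] z by (simp_all add: rs_def)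
  show "cmod ((\<integral>x. ip (ap (resolvent d z (lin Z0 1 (Y x))) w) v \<partial>M) - (\<integral>g. ip (ap (resolvent d z (lin Z0 1 (W g))) w) v \<partial>N)) \<le> 96 * \<epsilon>\<^sub>0 / (Im z)\<^sup>2"
    using resolvent_form_difference[OF z wv] by (simp add: rs_def)
qed simp

lemma fun_calc_integrable:
  assumes \<phi>: "\<phi> \<in> sobolev_W1 3" "continuous_on UNIV \<phi>" and wv: "nv w = 1" "nv v = 1"
  shows "integrable M (\<lambda>x. ip (ap (fun_calc d \<phi> (lin Z0 1 (Y x))) w) v)" "integrable N (\<lambda>g. ip (ap (fun_calc d \<phi> (lin Z0 1 (W g))) w) v)"
proof -
  from sobolev_weak_derivs[OF \<phi>(1)] obtain g0 g3 where g: "integrable lborel \<phi>" "is_weak_deriv 0 \<phi> g0" "is_weak_deriv 3 \<phi> g3" by blast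
  have Y: "(\<lambda>n. 1 / real (Suc n)) \<longlonglongrightarrow> 0" by real_asymp
  show "integrable M (\<lambda>x. ip (ap (fun_calc d \<phi> (lin Z0 1 (Y x))) w) v)"
    by (rule random_matrix.fun_calc_form_limit(2)[OF rm_X wv \<phi>(2) g _ _ Y]) auto
  show "integrable N (\<lambda>g. ip (ap (fun_calc d \<phi> (lin Z0 1 (W g))) w) v)"
    by (rule random_matrix.fun_calc_form_limit(2)[OF rm_G wv \<phi>(2) g _ _ Y]) auto
qed

text \<open>4224 is the product of 44, from the line estimate, and 96, from the resolvent
  bound.\<close>

lemma fun_calc_bound:
  assumes \<phi>: "\<phi> \<in> sobolev_W1 3" "continuous_on UNIV \<phi>"
  shows "op_norm (mat_expectation d M (\<lambda>x. fun_calc d \<phi> (lin Z0 1 (Y x))) - mat_expectation d N (\<lambda>g. fun_calc d \<phi> (lin Z0 1 (W g)))) \<le> 4224 * \<epsilon>\<^sub>0 * sobolev_norm 3 \<phi>"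
proof (rule expectation_difference_bound[OF S.d0 _ fun_calc_integrable[OF \<phi>]])
  show "0 \<le> 4224 * \<epsilon>\<^sub>0 * sobolev_norm 3 \<phi>" by (auto simp: sobolev_norm_def intro!: mult_nonneg_nonneg sum_nonneg)
  fix w v assume wv: "nv w = 1" "nv v = 1"
  obtain g0 g3 where g: "integrable lborel \<phi>" "is_weak_deriv 0 \<phi> g0" "is_weak_deriv 3 \<phi> g3"
    and n: "(\<integral>x. norm (g0 x) \<partial>lborel) + (\<integral>x. norm (g3 x) \<partial>lborel) \<le> sobolev_norm 3 \<phi>" using sobolev_weak_derivs[OF \<phi>(1)] by blast
  have B: "cmod (random_matrix.res_form d M (\<lambda>x. lin Z0 1 (Y x)) a b z - random_matrix.res_form d N (\<lambda>g. lin Z0 1 (W g)) a b z) \<le> (96 * \<epsilon>\<^sub>0) / (Im z)\<^sup>2"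
    if "0 < Im z" "nv a = 1" "nv b = 1" for a b z
    using resolvent_form_difference[OF that] unfolding random_matrix.res_form_def[OF rm_X] random_matrix.res_form_def[OF rm_G] by simp
  have "cmod ((\<integral>x. ip (ap (fun_calc d \<phi> (lin Z0 1 (Y x))) w) v \<partial>M) - (\<integral>g. ip (ap (fun_calc d \<phi> (lin Z0 1 (W g))) w) v \<partial>N))
    \<le> 44 * (96 * \<epsilon>\<^sub>0) * ((\<integral>x. norm (g0 x) \<partial>lborel) + (\<integral>x. norm (g3 x) \<partial>lborel))"
    by (rule fun_calc_difference[OF rm_X rm_G wv \<phi>(2) g B[OF _ wv] B[OF _ wv(2,1)]])
  also have "\<dots> \<le> 44 * (96 * \<epsilon>\<^sub>0) * sobolev_norm 3 \<phi>" by (intro mult_left_mono n) simp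
  finally show "cmod ((\<integral>x. ip (ap (fun_calc d \<phi> (lin Z0 1 (Y x))) w) v \<partial>M) - (\<integral>g. ip (ap (fun_calc d \<phi> (lin Z0 1 (W g))) w) v \<partial>N))
    \<le> 4224 * \<epsilon>\<^sub>0 * sobolev_norm 3 \<phi>" by simp
qed

end

section \<open>Translation of a model into the setting of the comparison\<close>

context
  fixes d n :: nat and M :: "'a measure" and Z0 :: "complex mat" and Z :: "nat \<Rightarrow> 'a \<Rightarrow> complex mat"
  assumes d: "2 \<le> d" and model: "summand_model d n M Z0 Z"
begin

lemma random_sum_model: "random_sum d M n Z"
proof -
  have "(\<integral>w. Z i w $$ (j, k) \<partial>M) = 0" if "i \<in> {1..n}" "j < d" "k < d" for i j k
  proof -
    have "mat_expectation d M (Z i) $$ (j, k) = 0\<^sub>m d d $$ (j, k)" using model that by (simp add: summand_model_def)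
    then show ?thesis using that by (simp add: mat_expectation_def)
  qed
  then show ?thesis
    using model d by (auto simp: summand_model_def random_sum_def random_sum_axioms_def)
qed

interpretation S: random_sum d M n Z by (rule random_sum_model)

lemma rand_sum_eq: "rand_sum d n Z0 Z x = S.lin Z0 1 (S.Sm {1..n} x)"
  unfolding rand_sum_def S.lin_def by (rule eq_matI) (simp_all add: S.Sm_entry)

lemma rand_sum_mean: "mat_expectation d M (rand_sum d n Z0 Z) = Z0"
proof (rule eq_matI)
  have c: "Z0 \<in> carrier_mat d d" using model by (simp add: summand_model_def self_adjoint_def)
  show "dim_row (mat_expectation d M (rand_sum d n Z0 Z)) = dim_row Z0" "dim_col (mat_expectation d M (rand_sum d n Z0 Z)) = dim_col Z0"
    using c by (auto simp: mat_expectation_def)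
  fix j k assume "j < dim_row Z0" "k < dim_col Z0"
  then have jk: "j < d" "k < d" using c by auto
  have i: "integrable M (\<lambda>x. Z i x $$ (j, k))" if "i \<in> {1..n}" for i by (rule S.sqi_entry[OF S.prob_M S.Z_sqi[OF that] jk])
  have "(\<integral>x. Z0 $$ (j, k) + (\<Sum>i=1..n. Z i x $$ (j, k)) \<partial>M) = (\<integral>x. Z0 $$ (j, k) \<partial>M) + (\<integral>x. (\<Sum>i=1..n. Z i x $$ (j, k)) \<partial>M)"
    by (intro Bochner_Integration.integral_add Bochner_Integration.integrable_sum i) simp_all
  also have "(\<integral>x. (\<Sum>i=1..n. Z i x $$ (j, k)) \<partial>M) = 0"
    by (subst Bochner_Integration.integral_sum) (use i S.mean jk in auto)
  finally show "mat_expectation d M (rand_sum d n Z0 Z) $$ (j, k) = Z0 $$ (j, k)"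
    using jk by (simp add: mat_expectation_def rand_sum_def S.prob_space)
qed

lemma centered_rand_sum: "centered d M (rand_sum d n Z0 Z) x = S.Sm {1..n} x"
proof -
  have c: "Z0 \<in> carrier_mat d d" using model by (simp add: summand_model_def self_adjoint_def)
  show ?thesis unfolding centered_def rand_sum_mean unfolding rand_sum_def S.Sm_def using c by (intro eq_matI) auto
qed

lemma sigma_std_rand_sum: "sigma_std d M (rand_sum d n Z0 Z) = sqrt S.sg"
  by (simp add: sigma_std_def centered_rand_sum S.sg_def)

text \<open>A real supremum exceeds its elements only if the set is bounded above; the bound is
  \<sigma>, by Cauchy-Schwarz.\<close>

lemma sigma_star_nonneg: "0 \<le> sigma_star d M (rand_sum d n Z0 Z)"
proof -
  let ?f = "\<lambda>(v, w). sqrt (\<integral>x. (cmod ((centered d M (rand_sum d n Z0 Z) x *\<^sub>v w) \<bullet>c v))\<^sup>2 \<partial>M)"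
  have d0: "0 < d" using d by simp
  obtain u where u: "u \<in> unit_vecs d" using S.unit_vecs_nonempty[OF d0] by blast
  have b: "?f (v, w) \<le> sqrt S.sg" if vw: "v \<in> unit_vecs d" "w \<in> unit_vecs d" for v w
  proof -
    have c: "v \<in> carrier_vec d" "w \<in> carrier_vec d" using vw by (auto simp: unit_vecs_def)
    have Sc: "S.Sm {1..n} x \<in> carrier_mat d d" for x by (simp add: S.Sm_def)
    have e: "(S.Sm {1..n} x *\<^sub>v w) \<bullet>c v = S.ip (S.ap (S.Sm {1..n} x) (\<lambda>i. w $ i)) (\<lambda>i. v $ i)" for x
      using Sc[of x] c by (subst S.cscalar_prod_eq) (auto intro!: S.ip_cong simp: S.mult_mat_vec_eq simp del: index_mult_mat_vec)
    have "(\<integral>x. (cmod ((S.Sm {1..n} x *\<^sub>v w) \<bullet>c v))\<^sup>2 \<partial>M) \<le> (\<integral>x. (S.nv (S.ap (S.Sm {1..n} x) (\<lambda>i. w $ i)))\<^sup>2 \<partial>M)"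
    proof (rule integral_mono')
      show "integrable M (\<lambda>x. (S.nv (S.ap (S.Sm {1..n} x) (\<lambda>i. w $ i)))\<^sup>2)" by (rule S.nv_square_integrable(1)[OF S.Sm_all])
      show "(cmod ((S.Sm {1..n} x *\<^sub>v w) \<bullet>c v))\<^sup>2 \<le> (S.nv (S.ap (S.Sm {1..n} x) (\<lambda>i. w $ i)))\<^sup>2" for x
        unfolding e using S.cauchy_schwarz[of _ "\<lambda>i. v $ i"] S.unit_vecs_nv[OF vw(1)] by (intro power_mono) auto
    qed simp
    also have "\<dots> \<le> S.sg" using S.sum_square_bound(1)[of "\<lambda>i. w $ i"] S.unit_vecs_nv[OF vw(2)] by simp
    finally show ?thesis by (simp add: centered_rand_sum)
  qed
  have "0 \<le> ?f (u, u)" by simp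
  also have "\<dots> \<le> sigma_star d M (rand_sum d n Z0 Z)" unfolding sigma_star_def
    by (rule cSUP_upper) (use u b in \<open>auto intro!: bdd_aboveI[of _ "sqrt S.sg"]\<close>)
  finally show ?thesis .
qed

context
  fixes N :: "'b measure" and G :: "'b \<Rightarrow> complex mat"
  assumes gm: "gaussian_model d M (rand_sum d n Z0 Z) N G"
begin

lemma gaussian_matrix_model: "gaussian_matrix d N G"
  using gm d by (auto simp: gaussian_model_def gaussian_matrix_def gaussian_matrix_axioms_def dim.mm_measurable)

interpretation H: gaussian_matrix d N G by (rule gaussian_matrix_model)

lemma comparison_model: "comparison d M n Z N G Z0"
proof -
  have "(\<integral>g. H.Gt g $$ (i, j) * cnj (H.Gt g $$ (k, l)) \<partial>N) = (\<integral>x. S.Sm {1..n} x $$ (i, j) * cnj (S.Sm {1..n} x $$ (k, l)) \<partial>M)"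
    if "i < d" "j < d" "k < d" "l < d" for i j k l
    using gm that by (simp add: gaussian_model_def mat_cov_def centered_rand_sum H.Gt_def)
  then show ?thesis
    using model random_sum_model gaussian_matrix_model by (simp add: comparison_def comparison_axioms_def summand_model_def)
qed

lemma gaussian_eq: "g \<in> space N \<Longrightarrow> G g = S.lin Z0 1 (H.Gt g)"
proof -
  assume g: "g \<in> space N"
  have "mat_expectation d N G = Z0" using gm rand_sum_mean by (simp add: gaussian_model_def)
  moreover have "G g \<in> carrier_mat d d" by (rule S.self_adjoint_carrier[OF H.G_sa[OF g]])
  ultimately show ?thesis
    using H.mean_carrier unfolding S.lin_def H.Gt_def centered_def by (intro eq_matI) auto
qed

end

end

theorem universality_bounds_absolute: "universality_bounds TYPE('a) TYPE('b) K 4224"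
  unfolding universality_bounds_def Let_def
proof (intro allI impI conjI ballI)
  fix d n :: nat and M :: "'a measure" and Z0 Z and N :: "'b measure" and G
  assume d: "2 \<le> d" and m: "summand_model d n M Z0 Z" and gm: "gaussian_model d M (rand_sum d n Z0 Z) N G"
  interpret comparison d M n Z N G Z0 by (rule comparison_model[OF d m gm])
  have eN: "mat_expectation d N (\<lambda>g. F (G g)) = mat_expectation d N (\<lambda>g. F (lin Z0 1 (W g)))" for F
    unfolding mat_expectation_def
    by (intro cong_mat refl Bochner_Integration.integral_cong) (auto simp: gaussian_eq[OF d m gm])
  let ?\<epsilon> = "sigma_star d M (rand_sum d n Z0 Z) + R_bar n M Z powr (1/10) * sigma_std d M (rand_sum d n Z0 Z) powr (9/10)"
  have \<epsilon>: "\<epsilon>\<^sub>0 \<le> ?\<epsilon>" using sigma_star_nonneg[OF d m] by (simp add: sigma_std_rand_sum[OF d m] S.r_def)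
  note sum = rand_sum_eq[OF d m]
  show "op_norm (mat_expectation d M (\<lambda>x. resolvent d z (rand_sum d n Z0 Z x)) - mat_expectation d N (\<lambda>g. resolvent d z (G g))) \<le> 4224 * (?\<epsilon> / (Im z)\<^sup>2)"
    if z: "0 < Im z" for z
  proof -
    \<comment> \<open>The larger constant 4224 serves both bounds.\<close>
    have "96 * \<epsilon>\<^sub>0 / (Im z)\<^sup>2 \<le> 4224 * ?\<epsilon> / (Im z)\<^sup>2" using \<epsilon> by (intro divide_right_mono mult_mono) auto
    then show ?thesis using resolvent_bound[OF z] unfolding sum eN by simp
  qed
  show "op_norm (mat_expectation d M (\<lambda>x. fun_calc d \<phi> (rand_sum d n Z0 Z x)) - mat_expectation d N (\<lambda>g. fun_calc d \<phi> (G g))) \<le> 4224 * ?\<epsilon> * sobolev_norm 3 \<phi>"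
    if "\<phi> \<in> sobolev_W1 3" "continuous_on UNIV \<phi>" for \<phi>
  proof -
    have "4224 * \<epsilon>\<^sub>0 * sobolev_norm 3 \<phi> \<le> 4224 * ?\<epsilon> * sobolev_norm 3 \<phi>"
      using \<epsilon> by (intro mult_right_mono mult_left_mono) (auto simp: sobolev_norm_def intro!: sum_nonneg)
    then show ?thesis using fun_calc_bound[OF that] unfolding sum eN by linarith
  qed
qed

section \<open>Canonical sample spaces\<close>

lemma (in dim) mm_mult: assumes "mm M X" "mm M Y" shows "mm M (\<lambda>w. X w * Y w)"
proof -
  have "(\<lambda>w. (X w * Y w) $$ (i, j)) \<in> borel_measurable M" if "i < d" "j < d" for i j
  proof -
    have "(\<lambda>w. \<Sum>k<d. X w $$ (i, k) * Y w $$ (k, j)) \<in> borel_measurable M"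
      using that by (intro borel_measurable_sum borel_measurable_times mm_entry[OF assms(1)] mm_entry[OF assms(2)]) auto
    moreover have "(X w * Y w) $$ (i, j) = (\<Sum>k<d. X w $$ (i, k) * Y w $$ (k, j))" if "w \<in> space M" for w
      using mm_carrier[OF assms(1) that] mm_carrier[OF assms(2) that] \<open>i < d\<close> \<open>j < d\<close> by (auto simp: scalar_prod_def lessThan_atLeast0 intro!: sum.cong)
    ultimately show ?thesis by (simp cong: measurable_cong)
  qed
  moreover have "X w * Y w \<in> carrier_mat d d" if "w \<in> space M" for w
    by (rule mult_carrier_mat[OF mm_carrier[OF assms(1) that] mm_carrier[OF assms(2) that]])
  ultimately show ?thesis by (simp add: mm_def)
qed

lemma mat_expectation_distr:
  assumes T: "T \<in> M \<rightarrow>\<^sub>M S" and F: "\<And>i j. i < d \<Longrightarrow> j < d \<Longrightarrow> (\<lambda>s. F' s $$ (i, j)) \<in> borel_measurable S"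
    and e: "\<And>w. w \<in> space M \<Longrightarrow> F' (T w) = F w"
  shows "mat_expectation d (distr M S T) F' = mat_expectation d M F"
  unfolding mat_expectation_def
proof (intro cong_mat refl)
  fix i j assume ij: "i < d" "j < d"
  show "(\<integral>s. F' s $$ (i, j) \<partial>distr M S T) = (\<integral>w. F w $$ (i, j) \<partial>M)"
    unfolding integral_distr[OF T F[OF ij]] by (intro Bochner_Integration.integral_cong) (auto simp: e)
qed

context dim
begin

context
  fixes M :: "'a measure" and S :: "'s measure" and T X X'
  assumes T: "T \<in> M \<rightarrow>\<^sub>M S" and X': "mm S X'" and e: "\<And>w. w \<in> space M \<Longrightarrow> X' (T w) = X w"
begin

lemma mean_distr: "mat_expectation d (distr M S T) X' = mat_expectation d M X"
  by (rule mat_expectation_distr[OF T mm_entry[OF X']]) (simp_all add: e)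

lemma centered_distr: "w \<in> space M \<Longrightarrow> centered d (distr M S T) X' (T w) = centered d M X w"
  by (simp add: centered_def mean_distr e)

lemma centered_mm: "mm S (centered d (distr M S T) X')"
  unfolding centered_def[abs_def] by (intro mm_diff X' mm_const) (simp add: mat_expectation_def)

lemma mat_cov_distr:
  assumes "i < d" "j < d" "k < d" "l < d" shows "mat_cov d (distr M S T) X' (i, j) (k, l) = mat_cov d M X (i, j) (k, l)"
proof -
  have "(\<lambda>s. centered d (distr M S T) X' s $$ (i, j) * cnj (centered d (distr M S T) X' s $$ (k, l))) \<in> borel_measurable S"
    using assms by (intro borel_measurable_times cnj_measurable mm_entry[OF centered_mm])
  from integral_distr[OF T this] show ?thesis
    unfolding mat_cov_def by (simp add: centered_distr cong: Bochner_Integration.integral_cong)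
qed

lemma sigma_std_distr: "sigma_std d (distr M S T) X' = sigma_std d M X"
proof -
  have "mat_expectation d (distr M S T) (\<lambda>s. centered d (distr M S T) X' s * centered d (distr M S T) X' s) = mat_expectation d M (\<lambda>w. centered d M X w * centered d M X w)"
    by (rule mat_expectation_distr[OF T mm_entry[OF mm_mult[OF centered_mm centered_mm]]]) (simp_all add: centered_distr)
  then show ?thesis by (simp add: sigma_std_def)
qed

lemma sigma_star_distr: "sigma_star d (distr M S T) X' = sigma_star d M X"
proof -
  have "(\<integral>s. (cmod ((centered d (distr M S T) X' s *\<^sub>v w) \<bullet>c v))\<^sup>2 \<partial>distr M S T) = (\<integral>x. (cmod ((centered d M X x *\<^sub>v w) \<bullet>c v))\<^sup>2 \<partial>M)"
    if vw: "v \<in> unit_vecs d" "w \<in> unit_vecs d" for v w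
  proof -
    have c: "v \<in> carrier_vec d" "w \<in> carrier_vec d" using vw by (auto simp: unit_vecs_def)
    have e: "(centered d (distr M S T) X' s *\<^sub>v w) \<bullet>c v = ip (ap (centered d (distr M S T) X' s) (\<lambda>i. w $ i)) (\<lambda>i. v $ i)" if "s \<in> space S" for s
      using mm_carrier[OF centered_mm that] c
      by (subst cscalar_prod_eq) (auto intro!: ip_cong simp: mult_mat_vec_eq simp del: index_mult_mat_vec)
    have "(\<lambda>s. ip (ap (centered d (distr M S T) X' s) (\<lambda>i. w $ i)) (\<lambda>i. v $ i)) \<in> borel_measurable S"
      by (intro ip_measurable mv_ap centered_mm mv_const)
    then have "(\<lambda>s. (centered d (distr M S T) X' s *\<^sub>v w) \<bullet>c v) \<in> borel_measurable S" by (simp add: e cong: measurable_cong)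
    then have "(\<lambda>s. (cmod ((centered d (distr M S T) X' s *\<^sub>v w) \<bullet>c v))\<^sup>2) \<in> borel_measurable S" by measurable
    from integral_distr[OF T this] show ?thesis by (simp add: centered_distr cong: Bochner_Integration.integral_cong)
  qed
  then show ?thesis unfolding sigma_star_def by (intro SUP_cong refl) auto
qed

end

end

lemma gaussian_rv_distr:
  assumes T: "T \<in> N \<rightarrow>\<^sub>M S" and Y: "Y \<in> borel_measurable S" and g: "gaussian_rv N (\<lambda>w. Y (T w))"
  shows "gaussian_rv (distr N S T) Y"
proof -
  have d: "distr (distr N S T) lborel Y = distr N lborel (\<lambda>w. Y (T w))"
    using Y T by (subst distr_distr) (auto simp: comp_def)
  have a: "(AE s in distr N S T. Y s = \<mu>) \<longleftrightarrow> (AE w in N. Y (T w) = \<mu>)" for \<mu>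
    using Y by (intro AE_distr_iff T) measurable
  show ?thesis using g Y unfolding gaussian_rv_def distributed_def d a by auto
qed

text \<open>A model demands self-adjointness at every sample point, so a canonical sample space may
  contain only self-adjoint matrices.\<close>

definition sa_borel :: "nat \<Rightarrow> complex mat measure" where
  "sa_borel d = restrict_space (mat_borel d) {A. self_adjoint d A}"

lemma space_sa_borel: "space (sa_borel d) = {A. self_adjoint d A}"
  by (auto simp: sa_borel_def space_restrict_space mat_borel_def self_adjoint_def)

lemma sa_borel_ident: "(\<lambda>A. A) \<in> sa_borel d \<rightarrow>\<^sub>M mat_borel d"
  unfolding sa_borel_def by (intro measurable_restrict_space1) simp

lemma measurable_sa_borel: "X \<in> M \<rightarrow>\<^sub>M mat_borel d \<Longrightarrow> (\<And>w. w \<in> space M \<Longrightarrow> self_adjoint d (X w)) \<Longrightarrow> X \<in> M \<rightarrow>\<^sub>M sa_borel d"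
  unfolding sa_borel_def by (intro measurable_restrict_space2) auto

context
  fixes d n :: nat and M :: "'a measure" and Z0 :: "complex mat" and Z :: "nat \<Rightarrow> 'a \<Rightarrow> complex mat"
    and N :: "'b measure" and G :: "'b \<Rightarrow> complex mat"
  assumes d: "2 \<le> d" and model: "summand_model d n M Z0 Z" and gm: "gaussian_model d M (rand_sum d n Z0 Z) N G"
begin

text \<open>The joint law of the summands on families of matrices, and the law of \<open>G\<close>
  on matrices, form a model in their own right, with coordinate maps as random variables. Its
  parameters and expectations are those of the given model, but its sample spaces have fixed
  types.\<close>

definition "Sc = (\<Pi>\<^sub>M i\<in>{1..n}. sa_borel d)"
definition "Tc = (\<lambda>w. \<lambda>i\<in>{1..n}. Z i w)"
definition "Mc = distr M Sc Tc"
definition Zc :: "nat \<Rightarrow> (nat \<Rightarrow> complex mat) \<Rightarrow> complex mat" where "Zc i f = f i"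
definition "Nc = distr N (sa_borel d) G"

interpretation comparison d M n Z N G Z0 by (rule comparison_model[OF d model gm])

lemma prob_Mc: "prob_space Mc" and Tc: "Tc \<in> M \<rightarrow>\<^sub>M Sc"
proof -
  show 1: "Tc \<in> M \<rightarrow>\<^sub>M Sc" unfolding Tc_def Sc_def
    by (intro measurable_restrict measurable_sa_borel S.Z_rv S.sa)
  then show "prob_space Mc" unfolding Mc_def by (rule S.prob_space_distr)
qed

lemma Gc: "G \<in> N \<rightarrow>\<^sub>M sa_borel d"
  using gm by (intro measurable_sa_borel) (auto simp: gaussian_model_def)

lemma Zc_measurable: "i \<in> {1..n} \<Longrightarrow> Zc i \<in> Sc \<rightarrow>\<^sub>M mat_borel d"
  unfolding Zc_def[abs_def] Sc_def by (rule measurable_compose[OF measurable_component_singleton[where M = "\<lambda>_. sa_borel d"] sa_borel_ident])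

lemma Zc_sa: "i \<in> {1..n} \<Longrightarrow> f \<in> space Sc \<Longrightarrow> self_adjoint d (Zc i f)"
  by (auto simp: Zc_def Sc_def space_PiM space_sa_borel dest!: PiE_mem[where x = i])

lemma Zc_Tc: "i \<in> {1..n} \<Longrightarrow> Zc i (Tc w) = Z i w" by (simp add: Zc_def Tc_def)

abbreviation "Xc \<equiv> rand_sum d n Z0 Zc"

lemma Xc_Tc: "w \<in> space M \<Longrightarrow> Xc (Tc w) = rand_sum d n Z0 Z w"
  unfolding rand_sum_def by (intro cong_mat refl arg_cong2[where f = "(+)"] sum.cong) (simp add: Zc_Tc)

lemma Xc_mm: "mm Sc Xc"
  unfolding rand_sum_def[abs_def]
  by (intro mm_mat borel_measurable_add borel_measurable_const borel_measurable_sum mm_entry[OF mm_measurable[OF Zc_measurable]])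

lemma summand_model_c: "summand_model d n Mc Z0 Zc"
  unfolding summand_model_def
proof (intro conjI ballI allI impI)
  show "prob_space Mc" by (rule prob_Mc)
  interpret Mc: prob_space Mc by (rule prob_Mc)
  show "self_adjoint d Z0" by (rule Z0)
  show "prob_space.indep_vars Mc (\<lambda>_. mat_borel d) Zc {1..n}"
  proof (cases "n = 0")
    \<comment> \<open>The description of independence by a product law is for a nonempty index
      set.\<close>
    case True
    then show ?thesis unfolding Mc.indep_vars_def Mc.indep_sets_def by auto
  next
    case False
    then have ne: "{1..n} \<noteq> {}" by simp
    have rv: "Zc i \<in> Mc \<rightarrow>\<^sub>M mat_borel d" if "i \<in> {1..n}" for i using Zc_measurable[OF that] by (simp add: Mc_def)
    have "distr Mc (\<Pi>\<^sub>M i\<in>{1..n}. mat_borel d) (\<lambda>f. \<lambda>i\<in>{1..n}. Zc i f) = distr M (\<Pi>\<^sub>M i\<in>{1..n}. mat_borel d) (\<lambda>w. \<lambda>i\<in>{1..n}. Z i w)"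
      unfolding Mc_def by (subst distr_distr[OF _ Tc]) (auto intro!: measurable_restrict Zc_measurable simp: comp_def Zc_Tc cong: restrict_cong)
    also have "\<dots> = (\<Pi>\<^sub>M i\<in>{1..n}. distr M (mat_borel d) (Z i))"
      using S.indep_vars_iff_distr_eq_PiM'[where X = Z and M' = "\<lambda>_. mat_borel d", OF ne S.Z_rv] S.indep by blast
    also have "\<dots> = (\<Pi>\<^sub>M i\<in>{1..n}. distr Mc (mat_borel d) (Zc i))"
    proof (rule PiM_cong[OF refl])
      fix i assume i: "i \<in> {1..n}"
      show "distr M (mat_borel d) (Z i) = distr Mc (mat_borel d) (Zc i)"
        unfolding Mc_def by (subst distr_distr[OF Zc_measurable[OF i] Tc]) (simp add: comp_def Zc_Tc[OF i])
    qed
    finally show ?thesis using Mc.indep_vars_iff_distr_eq_PiM'[where X = Zc and M' = "\<lambda>_. mat_borel d", OF ne rv] by blast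
  qed
  fix i assume i: "i \<in> {1..n}"
  note m = mm_entry[OF mm_measurable[OF Zc_measurable[OF i]]]
  show "self_adjoint d (Zc i f)" if "f \<in> space Mc" for f using Zc_sa[OF i] that by (simp add: Mc_def)
  show "integrable Mc (\<lambda>f. (cmod (Zc i f $$ (j, k)))\<^sup>2)" if "j < d" "k < d" for j k
    unfolding Mc_def using m[OF that] S.sq[OF i that] by (subst integrable_distr_eq[OF Tc]) (auto simp: Zc_Tc[OF i])
  have "mat_expectation d Mc (Zc i) = mat_expectation d M (Z i)"
    unfolding Mc_def by (rule mat_expectation_distr[OF Tc m]) (simp_all add: Zc_Tc[OF i])
  then show "mat_expectation d Mc (Zc i) = 0\<^sub>m d d" using model i by (simp add: summand_model_def)
qed

lemma Gc_mm: "mm (sa_borel d) (\<lambda>A. A)"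
  by (rule mm_measurable[OF sa_borel_ident])

lemma gaussian_model_c: "gaussian_model d Mc Xc Nc (\<lambda>A. A)"
proof -
  have e: "mat_expectation d Mc Xc = mat_expectation d M (rand_sum d n Z0 Z)"
    unfolding Mc_def by (rule mat_expectation_distr[OF Tc mm_entry[OF Xc_mm]]) (simp_all add: Xc_Tc)
  have e': "mat_expectation d Nc (\<lambda>A. A) = mat_expectation d N G"
    unfolding Nc_def by (rule mat_expectation_distr[OF Gc mm_entry[OF Gc_mm]]) simp_all
  have "jointly_gaussian_entries d Nc (\<lambda>A. A)"
    unfolding jointly_gaussian_entries_def Nc_def
  proof (intro allI gaussian_rv_distr[OF Gc])
    fix a b :: "nat \<Rightarrow> nat \<Rightarrow> real"
    have [measurable]: "(\<lambda>A. A $$ (j, k)) \<in> borel_measurable (sa_borel d)" if "j < d" "k < d" for j k by (rule mm_entry[OF Gc_mm that])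
    show "(\<lambda>A. \<Sum>j<d. \<Sum>k<d. a j k * Re (A $$ (j, k)) + b j k * Im (A $$ (j, k))) \<in> borel_measurable (sa_borel d)"
      by (intro borel_measurable_sum) auto
    show "gaussian_rv N (\<lambda>w. \<Sum>j<d. \<Sum>k<d. a j k * Re (G w $$ (j, k)) + b j k * Im (G w $$ (j, k)))"
      using gm by (auto simp: gaussian_model_def jointly_gaussian_entries_def)
  qed
  moreover have "(\<lambda>A. A) \<in> Nc \<rightarrow>\<^sub>M mat_borel d" using sa_borel_ident by (simp add: Nc_def)
  moreover have "prob_space Nc" unfolding Nc_def by (rule H.prob_space_distr[OF Gc])
  moreover have "mat_cov d Nc (\<lambda>A. A) (i, j) (k, l) = mat_cov d Mc Xc (i, j) (k, l)" if ij: "i < d" "j < d" "k < d" "l < d" for i j k l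
  proof -
    have "mat_cov d Mc Xc (i, j) (k, l) = mat_cov d M (rand_sum d n Z0 Z) (i, j) (k, l)"
      unfolding Mc_def by (rule mat_cov_distr[OF Tc Xc_mm _ ij]) (rule Xc_Tc)
    moreover have "mat_cov d Nc (\<lambda>A. A) (i, j) (k, l) = mat_cov d N G (i, j) (k, l)"
      unfolding Nc_def by (rule mat_cov_distr[OF Gc Gc_mm _ ij]) simp
    ultimately show ?thesis using gm ij by (simp add: gaussian_model_def)
  qed
  moreover have "self_adjoint d A" if "A \<in> space Nc" for A using that by (simp add: Nc_def space_sa_borel)
  ultimately show ?thesis using gm e e' by (simp add: gaussian_model_def)
qed

interpretation C: comparison d Mc n Zc Nc "\<lambda>A. A" Z0
  by (rule comparison_model[OF d summand_model_c gaussian_model_c])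

lemma R_bar_c: "R_bar n Mc Zc = R_bar n M Z"
proof -
  have mx: "C.S.Mx (Tc w) = S.Mx w" for w
  proof -
    have "(\<lambda>i. op_norm (Zc i (Tc w))) ` {1..n} = (\<lambda>i. op_norm (Z i w)) ` {1..n}" by (intro image_cong refl) (simp add: Zc_Tc)
    then show ?thesis by (simp add: C.S.Mx_def S.Mx_def)
  qed
  have "(\<lambda>f. (C.S.Mx f)\<^sup>2) \<in> borel_measurable Sc" using C.S.Mx_measurable by (simp add: Mc_def)
  from integral_distr[OF Tc this] have "(\<integral>f. (C.S.Mx f)\<^sup>2 \<partial>Mc) = (\<integral>w. (S.Mx w)\<^sup>2 \<partial>M)" by (simp add: Mc_def mx)
  then show ?thesis by (simp add: R_bar_def C.S.Mx_def S.Mx_def)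
qed

lemma sigma_c: "sigma_std d Mc Xc = sigma_std d M (rand_sum d n Z0 Z)" "sigma_star d Mc Xc = sigma_star d M (rand_sum d n Z0 Z)"
  unfolding Mc_def by (rule sigma_std_distr[OF Tc Xc_mm], rule Xc_Tc, assumption) (rule sigma_star_distr[OF Tc Xc_mm], rule Xc_Tc)

lemma Xc_sa: "f \<in> space Sc \<Longrightarrow> self_adjoint d (Xc f)"
proof -
  assume "f \<in> space Sc"
  then have "f \<in> space Mc" by (simp add: Mc_def)
  then show ?thesis unfolding rand_sum_eq[OF d summand_model_c] by (intro lin_sa Z0 C.Y)
qed

lemma resolvent_c:
  assumes z: "0 < Im z"
  shows "mat_expectation d Mc (\<lambda>f. resolvent d z (Xc f)) = mat_expectation d M (\<lambda>w. resolvent d z (rand_sum d n Z0 Z w))"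
    "mat_expectation d Nc (\<lambda>A. resolvent d z A) = mat_expectation d N (\<lambda>g. resolvent d z (G g))"
proof -
  have "mm Sc (\<lambda>f. resolvent d z (Xc f))" by (rule mm_resolvent[OF Xc_mm Xc_sa]) (use z in auto)
  from mm_entry[OF this] show "mat_expectation d Mc (\<lambda>f. resolvent d z (Xc f)) = mat_expectation d M (\<lambda>w. resolvent d z (rand_sum d n Z0 Z w))"
    unfolding Mc_def by (intro mat_expectation_distr[OF Tc]) (auto simp: Xc_Tc)
  have "mm (sa_borel d) (\<lambda>A. resolvent d z A)" by (rule mm_resolvent[OF Gc_mm]) (use z in \<open>auto simp: space_sa_borel\<close>)
  from mm_entry[OF this] show "mat_expectation d Nc (\<lambda>A. resolvent d z A) = mat_expectation d N (\<lambda>g. resolvent d z (G g))"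
    unfolding Nc_def by (intro mat_expectation_distr[OF Gc]) auto
qed

text \<open>The formula for image measures wants measurability on the canonical spaces. It is read
  off from integrability in the canonical model, since an image measure keeps the sigma-algebra of
  its target.\<close>

lemma fun_calc_c:
  assumes \<phi>: "\<phi> \<in> sobolev_W1 3" "continuous_on UNIV \<phi>"
  shows "mat_expectation d Mc (\<lambda>f. fun_calc d \<phi> (Xc f)) = mat_expectation d M (\<lambda>w. fun_calc d \<phi> (rand_sum d n Z0 Z w))"
    "mat_expectation d Nc (\<lambda>A. fun_calc d \<phi> A) = mat_expectation d N (\<lambda>g. fun_calc d \<phi> (G g))"
proof -
  have "(\<lambda>f. fun_calc d \<phi> (Xc f) $$ (i, j)) \<in> borel_measurable Sc" if "i < d" "j < d" for i j
  proof -
    have "(\<lambda>f. fun_calc d \<phi> (Xc f) $$ (i, j)) \<in> borel_measurable Mc"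
      unfolding rand_sum_eq[OF d summand_model_c] entry_as_form[OF that]
      by (rule borel_measurable_integrable[OF C.fun_calc_integrable(1)[OF \<phi>]]) (intro nv_delta that)+
    then show ?thesis by (simp add: Mc_def)
  qed
  then show "mat_expectation d Mc (\<lambda>f. fun_calc d \<phi> (Xc f)) = mat_expectation d M (\<lambda>w. fun_calc d \<phi> (rand_sum d n Z0 Z w))"
    unfolding Mc_def by (intro mat_expectation_distr[OF Tc]) (auto simp: Xc_Tc)
  have "(\<lambda>A. fun_calc d \<phi> A $$ (i, j)) \<in> borel_measurable (sa_borel d)" if "i < d" "j < d" for i j
  proof -
    have "(\<lambda>A. fun_calc d \<phi> (lin Z0 1 (C.H.Gt A)) $$ (i, j)) \<in> borel_measurable Nc"
      unfolding entry_as_form[OF that]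
      by (rule borel_measurable_integrable[OF C.fun_calc_integrable(2)[OF \<phi>]]) (intro nv_delta that)+
    then have "(\<lambda>A. fun_calc d \<phi> A $$ (i, j)) \<in> borel_measurable Nc"
      by (rule measurable_cong[THEN iffD1, rotated]) (simp add: gaussian_eq[OF d summand_model_c gaussian_model_c, symmetric])
    then show ?thesis by (simp add: Nc_def)
  qed
  then show "mat_expectation d Nc (\<lambda>A. fun_calc d \<phi> A) = mat_expectation d N (\<lambda>g. fun_calc d \<phi> (G g))"
    unfolding Nc_def by (intro mat_expectation_distr[OF Gc]) auto
qed

end

text \<open>All quantities in the hypotheses and the bounds depend on laws only, so the canonical
  model can stand in for the given one.\<close>

lemma universality_bounds_transfer:
  assumes b: "universality_bounds TYPE(nat \<Rightarrow> complex mat) TYPE(complex mat) K C"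
  shows "universality_bounds TYPE('a) TYPE('b) K C"
  unfolding universality_bounds_def Let_def
proof (intro allI impI)
  fix d n :: nat and M :: "'a measure" and Z0 Z and N :: "'b measure" and G
  assume d: "2 \<le> d" and m: "summand_model d n M Z0 Z" and g: "gaussian_model d M (rand_sum d n Z0 Z) N G"
    and R: "R_bar n M Z * ln (real d) powr (5/3) \<le> K * sigma_std d M (rand_sum d n Z0 Z)"
  note c = summand_model_c[OF d m g] gaussian_model_c[OF d m g]
  note eqs = R_bar_c[OF d m g] sigma_c[OF d m g]
  have R': "R_bar n (Mc d n M Z) Zc * ln (real d) powr (5/3) \<le> K * sigma_std d (Mc d n M Z) (rand_sum d n Z0 Zc)"
    using R by (simp only: eqs)
  note B = b[unfolded universality_bounds_def Let_def, rule_format, OF d c R', unfolded eqs]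
  let ?\<epsilon> = "sigma_star d M (rand_sum d n Z0 Z) + R_bar n M Z powr (1/10) * sigma_std d M (rand_sum d n Z0 Z) powr (9/10)"
  show "(\<forall>z. 0 < Im z \<longrightarrow> op_norm (mat_expectation d M (\<lambda>x. resolvent d z (rand_sum d n Z0 Z x)) - mat_expectation d N (\<lambda>g. resolvent d z (G g))) \<le> C * (?\<epsilon> / (Im z)\<^sup>2))
    \<and> (\<forall>\<phi>\<in>sobolev_W1 3. continuous_on UNIV \<phi> \<longrightarrow> op_norm (mat_expectation d M (\<lambda>x. fun_calc d \<phi> (rand_sum d n Z0 Z x)) - mat_expectation d N (\<lambda>g. fun_calc d \<phi> (G g))) \<le> C * ?\<epsilon> * sobolev_norm 3 \<phi>)"
    using B by (simp add: resolvent_c[OF d m g] fun_calc_c[OF d m g])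
qed

text \<open>The constant must not depend on the sample spaces, but a quantifier cannot range over
  their types. Independence is therefore expressed by choosing the constant on the canonical types
  alone and letting every such constant pass to arbitrary types.\<close>

theorem theorem2p11:
  fixes K :: real
  assumes "K > 0"
  shows "(\<exists>C>0. universality_bounds TYPE(nat \<Rightarrow> complex mat) TYPE(complex mat) K C)
    \<and> (\<forall>C>0. universality_bounds TYPE(nat \<Rightarrow> complex mat) TYPE(complex mat) K C
          \<longrightarrow> universality_bounds TYPE('a) TYPE('b) K C)"
proof (intro conjI exI[of _ 4224] allI impI)
  show "universality_bounds TYPE(nat \<Rightarrow> complex mat) TYPE(complex mat) K 4224"
    by (rule universality_bounds_absolute)
qed (simp, rule universality_bounds_transfer)

end
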